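(* Let $p$ be a prime, let $G=SL(2,p)$, and let $k$ be a field of characteristic $p$. Every module in $\mathsf{stmod}(kG)$ is a direct sum of suspensions of simple modules. In particular, the simple generating hypothesis holds for $kG$.
   Context: $\mathsf{StMod}(kG)$ is the stable module category: objects are $kG$-modules, and $\underline{\mathrm{Hom}}(M,N)$ is $\mathrm{Hom}_{kG}(M,N)$ modulo maps factoring through a projective. It is triangulated; $\Omega M$ (the kernel of a surjection from a projective onto $M$) is the desuspension of $M$, and $\Omega^i$ is defined for all $i\in\mathbb{Z}$; "suspensions" of $S$ means the modules $\Omega^iS$ with $i\in\mathbb{Z}$. $\mathsf{stmod}(kG)$ is the full subcategory of modules stably isomorphic to finitely generated ones; the direct sum decomposition is up to isomorphism in $\mathsf{stmod}(kG)$ (i.e., up to projective summands). The simple generating hypothesis holds for $kG$ if every map $f$ in $\mathsf{stmod}(kG)$ with $\underline{\mathrm{Hom}}(\Omega^iS,f)=0$ for every simple $kG$-module $S$ and every $i\in\mathbb{Z}$ is stably zero. *)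

theory Defs
  imports "HOL-Analysis.Determinants" "HOL-Number_Theory.Cong" "HOL-Algebra.Module"
begin

text \<open>
  The elements of SL(2,p) are the 2x2 matrices over the residues 0, ..., p - 1 whose determinant
  is 1 modulo p; they are multiplied as integer matrices and then reduced entrywise modulo p.
\<close>

definition SL2 :: "nat \<Rightarrow> (int^2^2) monoid" where
  "SL2 p = \<lparr>
     carrier = {A. (\<forall>i j. A $ i $ j \<in> {0..<int p}) \<and> [det A = 1] (mod int p)},
     monoid.mult = (\<lambda>A B. \<chi> i j. (A ** B) $ i $ j mod int p),
     one = mat 1\<rparr>"

text \<open>Finitely supported functions on the group, with convolution as product.\<close>

definition group_algebra :: "('g, 'x) monoid_scheme \<Rightarrow> ('g \<Rightarrow> 'k :: comm_ring_1) ring" where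
  "group_algebra G = \<lparr>
     carrier = {a. finite {g. a g \<noteq> 0} \<and> {g. a g \<noteq> 0} \<subseteq> carrier G},
     monoid.mult = (\<lambda>a b g. if g \<in> carrier G
                            then \<Sum>h | a h \<noteq> 0. a h * b (inv\<^bsub>G\<^esub> h \<otimes>\<^bsub>G\<^esub> g) else 0),
     one = (\<lambda>g. if g = \<one>\<^bsub>G\<^esub> then 1 else 0),
     zero = (\<lambda>g. 0),
     add = (\<lambda>a b g. a g + b g)\<rparr>"

text \<open>
  The library locale \<open>module\<close> requires a commutative ring of scalars, which a group algebra
  usually is not, so the same axioms are restated over an arbitrary ring.  The library notion
  \<open>submodule\<close> does not assume commutativity and is used unchanged.
\<close>

locale left_module = R?: ring R + M?: abelian_group M
  for R (structure) and M :: "('a, 'm, 'x) module_scheme" (structure) +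
  assumes smult_closed:
      "\<lbrakk>a \<in> carrier R; x \<in> carrier M\<rbrakk> \<Longrightarrow> a \<odot>\<^bsub>M\<^esub> x \<in> carrier M"
    and smult_l_distr:
      "\<lbrakk>a \<in> carrier R; b \<in> carrier R; x \<in> carrier M\<rbrakk> \<Longrightarrow>
       (a \<oplus> b) \<odot>\<^bsub>M\<^esub> x = a \<odot>\<^bsub>M\<^esub> x \<oplus>\<^bsub>M\<^esub> b \<odot>\<^bsub>M\<^esub> x"
    and smult_r_distr:
      "\<lbrakk>a \<in> carrier R; x \<in> carrier M; y \<in> carrier M\<rbrakk> \<Longrightarrow>
       a \<odot>\<^bsub>M\<^esub> (x \<oplus>\<^bsub>M\<^esub> y) = a \<odot>\<^bsub>M\<^esub> x \<oplus>\<^bsub>M\<^esub> a \<odot>\<^bsub>M\<^esub> y"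
    and smult_assoc1:
      "\<lbrakk>a \<in> carrier R; b \<in> carrier R; x \<in> carrier M\<rbrakk> \<Longrightarrow>
       (a \<otimes> b) \<odot>\<^bsub>M\<^esub> x = a \<odot>\<^bsub>M\<^esub> (b \<odot>\<^bsub>M\<^esub> x)"
    and smult_one:
      "x \<in> carrier M \<Longrightarrow> \<one> \<odot>\<^bsub>M\<^esub> x = x"

text \<open>
  Below, all modules under consideration have their elements in one type \<open>'u\<close>, which plays the
  role of a universe; definitions that quantify over modules (projectivity, factoring through a
  projective, syzygies, ...) quantify over the modules in that type.  If \<open>'u\<close> is infinite and at
  least as large as the ring R, then every R-module in \<open>'u\<close> is a quotient of a free R-module in
  \<open>'u\<close>, so these notions are the usual ones.
\<close>

definition module_hom :: "('a, 'x) ring_scheme \<Rightarrow> ('a, 'm) module \<Rightarrow> ('a, 'n) module \<Rightarrow> ('m \<Rightarrow> 'n) set"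
  where
  "module_hom R M N = {f \<in> carrier M \<rightarrow> carrier N.
     (\<forall>x\<in>carrier M. \<forall>y\<in>carrier M. f (x \<oplus>\<^bsub>M\<^esub> y) = f x \<oplus>\<^bsub>N\<^esub> f y) \<and>
     (\<forall>a\<in>carrier R. \<forall>x\<in>carrier M. f (a \<odot>\<^bsub>M\<^esub> x) = a \<odot>\<^bsub>N\<^esub> f x)}"

definition simple_module :: "('a, 'x) ring_scheme \<Rightarrow> ('a, 'm) module \<Rightarrow> bool" where
  "simple_module R S \<longleftrightarrow> left_module R S \<and> carrier S \<noteq> {\<zero>\<^bsub>S\<^esub>} \<and>
     (\<forall>H. submodule H R S \<longrightarrow> H = {\<zero>\<^bsub>S\<^esub>} \<or> H = carrier S)"

definition finitely_generated :: "('a, 'x) ring_scheme \<Rightarrow> ('a, 'm) module \<Rightarrow> bool" where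
  "finitely_generated R M \<longleftrightarrow> left_module R M \<and>
     (\<exists>A. finite A \<and> A \<subseteq> carrier M \<and> (\<forall>H. submodule H R M \<and> A \<subseteq> H \<longrightarrow> H = carrier M))"

definition projective :: "('a, 'x) ring_scheme \<Rightarrow> ('a, 'u) module \<Rightarrow> bool" where
  "projective R P \<longleftrightarrow> left_module R P \<and>
     (\<forall>(A :: ('a, 'u) module) (B :: ('a, 'u) module) e f.
        left_module R A \<and> left_module R B \<and>
        e \<in> module_hom R A B \<and> e ` carrier A = carrier B \<and> f \<in> module_hom R P B \<longrightarrow>
        (\<exists>h\<in>module_hom R P A. \<forall>x\<in>carrier P. e (h x) = f x))"

text \<open>
  The morphisms of the stable category are module homomorphisms modulo those that are
  \<open>stably_zero\<close>; two homomorphisms are \<open>stably_equal\<close> if they have the same class.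
\<close>

definition stably_zero ::
  "('a, 'x) ring_scheme \<Rightarrow> ('a, 'u) module \<Rightarrow> ('a, 'u) module \<Rightarrow> ('u \<Rightarrow> 'u) \<Rightarrow> bool" where
  "stably_zero R M N f \<longleftrightarrow> f \<in> module_hom R M N \<and>
     (\<exists>P :: ('a, 'u) module. projective R P \<and>
        (\<exists>a\<in>module_hom R M P. \<exists>b\<in>module_hom R P N. \<forall>x\<in>carrier M. f x = b (a x)))"

definition stably_equal ::
  "('a, 'x) ring_scheme \<Rightarrow> ('a, 'u) module \<Rightarrow> ('a, 'u) module \<Rightarrow> ('u \<Rightarrow> 'u) \<Rightarrow> ('u \<Rightarrow> 'u) \<Rightarrow> bool"
  where
  "stably_equal R M N f g \<longleftrightarrow> f \<in> module_hom R M N \<and> g \<in> module_hom R M N \<and>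
     stably_zero R M N (\<lambda>x. f x \<ominus>\<^bsub>N\<^esub> g x)"

definition stably_isomorphic ::
  "('a, 'x) ring_scheme \<Rightarrow> ('a, 'u) module \<Rightarrow> ('a, 'u) module \<Rightarrow> bool" where
  "stably_isomorphic R M N \<longleftrightarrow> left_module R M \<and> left_module R N \<and>
     (\<exists>f\<in>module_hom R M N. \<exists>g\<in>module_hom R N M.
        stably_equal R M M (g \<circ> f) id \<and> stably_equal R N N (f \<circ> g) id)"

definition in_stmod :: "('a, 'x) ring_scheme \<Rightarrow> ('a, 'u) module \<Rightarrow> bool" where
  "in_stmod R M \<longleftrightarrow> (\<exists>M' :: ('a, 'u) module. finitely_generated R M' \<and> stably_isomorphic R M M')"

definition syzygy :: "('a, 'x) ring_scheme \<Rightarrow> ('a, 'u) module \<Rightarrow> ('a, 'u) module \<Rightarrow> bool" where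
  "syzygy R M L \<longleftrightarrow> left_module R M \<and>
     (\<exists>(P :: ('a, 'u) module) f. projective R P \<and> f \<in> module_hom R P M \<and>
        f ` carrier P = carrier M \<and>
        L = P\<lparr>carrier := {x \<in> carrier P. f x = \<zero>\<^bsub>M\<^esub>}\<rparr>)"

text \<open>
  \<open>Omega R i M N\<close> says that N is an \<open>i\<close>-th syzygy of M in the stable category.  Since syzygies
  depend on choices and are only well defined up to stable isomorphism, this is a relation, closed
  under stable isomorphism of N.  As negative powers of \<open>\<Omega>\<close> are powers of the inverse of the
  autoequivalence \<open>\<Omega>\<close> (over a group algebra of a finite group), \<open>N = \<Omega>\<^sup>-\<^sup>n M\<close> means
  \<open>M = \<Omega>\<^sup>n N\<close>.
\<close>

fun Omega_nat ::
  "('a, 'x) ring_scheme \<Rightarrow> nat \<Rightarrow> ('a, 'u) module \<Rightarrow> ('a, 'u) module \<Rightarrow> bool" where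
  "Omega_nat R 0 M N \<longleftrightarrow> stably_isomorphic R M N"
| "Omega_nat R (Suc n) M N \<longleftrightarrow> (\<exists>L. syzygy R M L \<and> Omega_nat R n L N)"

definition Omega ::
  "('a, 'x) ring_scheme \<Rightarrow> int \<Rightarrow> ('a, 'u) module \<Rightarrow> ('a, 'u) module \<Rightarrow> bool" where
  "Omega R i M N \<longleftrightarrow>
     (if i \<ge> 0 then Omega_nat R (nat i) M N else Omega_nat R (nat (- i)) N M)"

text \<open>D is a direct sum of the finite family X, via suitable coprojections.\<close>

definition direct_sum ::
  "('a, 'x) ring_scheme \<Rightarrow> 'i set \<Rightarrow> ('i \<Rightarrow> ('a, 'u) module) \<Rightarrow> ('a, 'u) module \<Rightarrow> bool" where
  "direct_sum R I X D \<longleftrightarrow> finite I \<and> left_module R D \<and> (\<forall>i\<in>I. left_module R (X i)) \<and>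
     (\<exists>\<iota>. (\<forall>i\<in>I. \<iota> i \<in> module_hom R (X i) D) \<and>
        bij_betw (\<lambda>x. \<Oplus>\<^bsub>D\<^esub>i\<in>I. \<iota> i (x i)) (\<Pi>\<^sub>E i\<in>I. carrier (X i)) (carrier D))"

text \<open>
  A finite direct sum suffices for objects of stmod: they are compact in the stable category.
\<close>

definition sum_of_suspensions_of_simples ::
  "('a, 'x) ring_scheme \<Rightarrow> ('a, 'u) module \<Rightarrow> bool" where
  "sum_of_suspensions_of_simples R M \<longleftrightarrow>
     (\<exists>(n :: nat) (S :: nat \<Rightarrow> ('a, 'u) module) (d :: nat \<Rightarrow> int)
        (X :: nat \<Rightarrow> ('a, 'u) module) (D :: ('a, 'u) module).
        (\<forall>j<n. simple_module R (S j) \<and> Omega R (d j) (S j) (X j)) \<and>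
        direct_sum R {..<n} X D \<and> stably_isomorphic R M D)"

text \<open>
  The condition on f says that composition with f induces the zero map on the stable Hom groups
  out of every suspension X of a simple module S.
\<close>

definition simple_generating_hypothesis ::
  "('a, 'x) ring_scheme \<Rightarrow> 'u itself \<Rightarrow> bool" where
  "simple_generating_hypothesis R _ \<longleftrightarrow>
     (\<forall>(M :: ('a, 'u) module) (N :: ('a, 'u) module) f.
        in_stmod R M \<and> in_stmod R N \<and> f \<in> module_hom R M N \<and>
        (\<forall>(S :: ('a, 'u) module) (i :: int) (X :: ('a, 'u) module).
           simple_module R S \<and> Omega R i S X \<longrightarrow>
           (\<forall>g\<in>module_hom R X M. stably_zero R X N (f \<circ> g))) \<longrightarrow>
        stably_zero R M N f)"

end

theory Submission
  imports Defs "HOL-Library.Function_Algebras" "HOL-Number_Theory.Residues"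
begin

text \<open>
  A Sylow \<open>p\<close>-subgroup of \<open>SL(2,p)\<close> meets its other conjugates trivially, so restriction to the Borel
  subgroup reflects stable isomorphism. Over the Borel subgroup every finite-dimensional module is a
  direct sum of the uniserial modules \<open>(l, w)\<close> of length \<open>l \<le> p\<close> and weight \<open>w\<close> modulo \<open>p - 1\<close>, which
  are projective for \<open>l = p\<close>, and \<open>\<Omega>\<close> sends \<open>(l, w)\<close> to \<open>(p - l, w + 2l - 2)\<close>. The homogeneous
  polynomials of degree \<open>l - 1\<close> form a simple module of \<open>SL(2,p)\<close> that restricts to
  \<open>(l, (p - 2)(l - 1))\<close>. Every \<open>(l, w)\<close> with \<open>l < p\<close> is therefore the restriction of a suspension of
  such a module, and replacing the summands of the restriction of \<open>M\<close> by these suspensions gives a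
  module stably isomorphic to \<open>M\<close>. A map that vanishes on all suspensions of simple modules then
  vanishes on each summand of its domain.
\<close>

section \<open>Representations and the trace\<close>

text \<open>Stable triviality is expressed as being the trace of a linear map, so that restriction,
  transfer and syzygies become computations with finite sums. Projective modules enter only when a
  trace is finally factored through an explicit free module. Two units of \<open>k\<close> carry the
  argument: the index \<open>p + 1\<close> of the Borel subgroup, which is 1 in \<open>k\<close>,
  and the order \<open>p - 1\<close> of its torus, which is -1. The latter is the source of every
  minus sign in the auxiliary maps. All characters of the torus take values in the prime field,
  which is why \<open>k\<close> may be any field of characteristic \<open>p\<close> and no extension
  of scalars occurs. Weights matter modulo \<open>p - 1\<close> only, so nonnegative powers of the
  syzygy operator suffice to reach every summand. The linear algebra is done in spaces of functions
  on index sets; it is carried over to the universe \<open>'u\<close> by encoding the spaces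
  \<open>k^I\<close> with finite \<open>I\<close>, which fit because \<open>'u\<close> is infinite
  and contains a copy of \<open>k\<close>.\<close>

definition sc :: "'k::field \<Rightarrow> ('i \<Rightarrow> 'k) \<Rightarrow> 'i \<Rightarrow> 'k" where
  "sc c f = (\<lambda>i. c * f i)"

lemma sc_apply [simp]: "sc c f i = c * f i"
  by (simp add: sc_def)

interpretation fs: vector_space sc
  by standard (auto simp: fun_eq_iff algebra_simps)

lemma fun_sum_apply: "(\<Sum>i\<in>A. f i) x = (\<Sum>i\<in>A. f i x :: 'a::comm_monoid_add)"
  by (induction A rule: infinite_finite_induct) auto

text \<open>Linearity is demanded on the subspace alone: the actions, lifts and inverses below are
  given by formulas or choices whose values elsewhere are uncontrolled.\<close>

definition lin_on :: "('i \<Rightarrow> 'k::field) set \<Rightarrow> ('j \<Rightarrow> 'k) set \<Rightarrow> (('i \<Rightarrow> 'k) \<Rightarrow> ('j \<Rightarrow> 'k)) \<Rightarrow> bool" where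
  "lin_on V W f \<longleftrightarrow> (\<forall>x\<in>V. f x \<in> W) \<and> (\<forall>x\<in>V. \<forall>y\<in>V. f (x + y) = f x + f y) \<and>
     (\<forall>c. \<forall>x\<in>V. f (sc c x) = sc c (f x))"

lemma lin_onI:
  assumes "\<And>x. x \<in> V \<Longrightarrow> f x \<in> W" "\<And>x y. x \<in> V \<Longrightarrow> y \<in> V \<Longrightarrow> f (x + y) = f x + f y"
    "\<And>c x. x \<in> V \<Longrightarrow> f (sc c x) = sc c (f x)"
  shows "lin_on V W f"
  using assms unfolding lin_on_def by blast+

lemma lin_onD:
  assumes "lin_on V W f"
  shows "x \<in> V \<Longrightarrow> f x \<in> W" "x \<in> V \<Longrightarrow> y \<in> V \<Longrightarrow> f (x + y) = f x + f y"
    "x \<in> V \<Longrightarrow> f (sc c x) = sc c (f x)"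
  using assms unfolding lin_on_def by blast+

lemma lin_on_comp: "lin_on V W f \<Longrightarrow> lin_on W Z g \<Longrightarrow> lin_on V Z (\<lambda>x. g (f x))"
  by (simp add: lin_on_def)

lemma lin_on_subset: "lin_on V W f \<Longrightarrow> V' \<subseteq> V \<Longrightarrow> W \<subseteq> W' \<Longrightarrow> lin_on V' W' f"
  unfolding lin_on_def by blast

lemma lin_on_id: "lin_on V V (\<lambda>x. x)"
  by (auto simp: lin_on_def)

lemma lin_on_0:
  assumes "lin_on V W f" "fs.subspace V"
  shows "f 0 = 0"
proof -
  have "f (sc 0 0) = sc 0 (f 0)"
    by (rule lin_onD(3)[OF assms(1)]) (rule fs.subspace_0[OF assms(2)])
  then show ?thesis by simp
qed

lemma lin_on_minus:
  assumes "lin_on V W f" "fs.subspace V" "x \<in> V"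
  shows "f (- x) = - f x"
  using lin_onD(3)[OF assms(1,3), of "-1"] by (simp only: fs.scale_minus_left fs.scale_one)

lemma lin_on_diff:
  assumes "lin_on V W f" "fs.subspace V" "x \<in> V" "y \<in> V"
  shows "f (x - y) = f x - f y"
proof -
  have "f (x + - y) = f x + f (- y)"
    by (rule lin_onD(2)[OF assms(1,3)]) (rule fs.subspace_neg[OF assms(2,4)])
  then show ?thesis using lin_on_minus[OF assms(1,2,4)] by simp
qed

lemma lin_on_sum:
  assumes "lin_on V W f" "fs.subspace V" "\<And>i. i \<in> A \<Longrightarrow> x i \<in> V"
  shows "f (\<Sum>i\<in>A. x i) = (\<Sum>i\<in>A. f (x i))"
  using assms(3)
proof (induction A rule: infinite_finite_induct)
  case (insert a A)
  have "x a \<in> V" "(\<Sum>i\<in>A. x i) \<in> V"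
    using insert(4) by (auto intro: fs.subspace_sum[OF assms(2)])
  from lin_onD(2)[OF assms(1) this] show ?case
    by (simp only: sum.insert[OF insert(1,2)] insert(3)[OF insert(4)] insertI2)
qed (auto simp: lin_on_0[OF assms(1,2)])

lemma lin_on_add_fun:
  assumes "lin_on V W f" "lin_on V W g" "fs.subspace W"
  shows "lin_on V W (\<lambda>x. f x + g x)"
proof (rule lin_onI)
  fix x y assume "x \<in> V" "y \<in> V"
  then show "f (x + y) + g (x + y) = f x + g x + (f y + g y)"
    by (simp only: lin_onD(2)[OF assms(1)] lin_onD(2)[OF assms(2)] ac_simps)
next
  fix c x assume "x \<in> V"
  then show "f (sc c x) + g (sc c x) = sc c (f x + g x)"
    by (simp only: lin_onD(3)[OF assms(1)] lin_onD(3)[OF assms(2)] fs.scale_right_distrib)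
qed (intro fs.subspace_add[OF assms(3)] lin_onD(1)[OF assms(1)] lin_onD(1)[OF assms(2)])

lemma lin_on_sum_fun:
  assumes "\<And>i. i \<in> A \<Longrightarrow> lin_on V W (f i)" "fs.subspace W"
  shows "lin_on V W (\<lambda>x. \<Sum>i\<in>A. f i x)"
proof (intro lin_onI)
  fix x y assume "x \<in> V" "y \<in> V"
  then have "(\<Sum>i\<in>A. f i (x + y)) = (\<Sum>i\<in>A. f i x + f i y)"
    by (intro sum.cong refl lin_onD(2)[OF assms(1)])
  then show "(\<Sum>i\<in>A. f i (x + y)) = (\<Sum>i\<in>A. f i x) + (\<Sum>i\<in>A. f i y)"
    by (simp add: sum.distrib)
next
  fix c x assume "x \<in> V"
  then have "(\<Sum>i\<in>A. f i (sc c x)) = (\<Sum>i\<in>A. sc c (f i x))"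
    by (intro sum.cong refl lin_onD(3)[OF assms(1)])
  then show "(\<Sum>i\<in>A. f i (sc c x)) = sc c (\<Sum>i\<in>A. f i x)"
    by (simp add: fs.scale_sum_right)
qed (blast intro: fs.subspace_sum[OF assms(2)] lin_onD(1)[OF assms(1)])

lemma lin_on_sc_fun:
  assumes "lin_on V W f" "fs.subspace W"
  shows "lin_on V W (\<lambda>x. sc c (f x))"
proof (rule lin_onI)
  fix x y assume "x \<in> V" "y \<in> V"
  then show "sc c (f (x + y)) = sc c (f x) + sc c (f y)"
    by (simp only: lin_onD(2)[OF assms(1)] fs.scale_right_distrib)
next
  fix d x assume "x \<in> V"
  then show "sc c (f (sc d x)) = sc d (sc c (f x))"
    by (simp only: lin_onD(3)[OF assms(1)] fs.scale_left_commute)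
qed (intro fs.subspace_scale[OF assms(2)] lin_onD(1)[OF assms(1)])

lemma lin_on_diff_fun:
  assumes "lin_on V W f" "lin_on V W g" "fs.subspace W"
  shows "lin_on V W (\<lambda>x. f x - g x)"
  using lin_on_add_fun[OF assms(1) lin_on_sc_fun[OF assms(2,3), of "-1"] assms(3)]
  by (simp only: fs.scale_minus_left fs.scale_one add_uminus_conv_diff)

section \<open>Group representations and their stable maps\<close>

definition rep :: "('g, 'x) monoid_scheme \<Rightarrow> ('i \<Rightarrow> 'k::field) set \<Rightarrow> ('g \<Rightarrow> ('i \<Rightarrow> 'k) \<Rightarrow> ('i \<Rightarrow> 'k)) \<Rightarrow> bool"
  where
  "rep G V \<rho> \<longleftrightarrow> fs.subspace V \<and> (\<forall>g\<in>carrier G. lin_on V V (\<rho> g)) \<and>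
     (\<forall>x\<in>V. \<rho> \<one>\<^bsub>G\<^esub> x = x) \<and>
     (\<forall>g\<in>carrier G. \<forall>h\<in>carrier G. \<forall>x\<in>V. \<rho> (g \<otimes>\<^bsub>G\<^esub> h) x = \<rho> g (\<rho> h x))"

definition ghom where
  "ghom G V \<rho> W \<sigma> f \<longleftrightarrow> lin_on V W f \<and> (\<forall>g\<in>carrier G. \<forall>x\<in>V. f (\<rho> g x) = \<sigma> g (f x))"

text \<open>The norm of \<open>\<phi>\<close> for the conjugation action of the group on linear
  maps, the standard device for making a linear map equivariant.\<close>

definition tr where
  "tr G \<rho> \<sigma> \<phi> x = (\<Sum>g\<in>carrier G. \<sigma> g (\<phi> (\<rho> (inv\<^bsub>G\<^esub> g) x)))"

text \<open>By Higman's criterion, the maps \<open>null\<close> singles out are those factoring through a projective, so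
  that \<open>steq\<close> is stable isomorphism.\<close>

definition null where
  "null G V \<rho> W \<sigma> f \<longleftrightarrow> (\<exists>\<phi>. lin_on V W \<phi> \<and> (\<forall>x\<in>V. f x = tr G \<rho> \<sigma> \<phi> x))"

definition steq where
  "steq G V \<rho> W \<sigma> \<longleftrightarrow> (\<exists>a b. ghom G V \<rho> W \<sigma> a \<and> ghom G W \<sigma> V \<rho> b \<and>
     null G V \<rho> V \<rho> (\<lambda>x. b (a x) - x) \<and> null G W \<sigma> W \<sigma> (\<lambda>x. a (b x) - x))"

lemma repD:
  assumes "rep G V \<rho>"
  shows "fs.subspace V" "g \<in> carrier G \<Longrightarrow> lin_on V V (\<rho> g)"
    "x \<in> V \<Longrightarrow> \<rho> \<one>\<^bsub>G\<^esub> x = x"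
    "g \<in> carrier G \<Longrightarrow> h \<in> carrier G \<Longrightarrow> x \<in> V \<Longrightarrow> \<rho> (g \<otimes>\<^bsub>G\<^esub> h) x = \<rho> g (\<rho> h x)"
    "g \<in> carrier G \<Longrightarrow> x \<in> V \<Longrightarrow> \<rho> g x \<in> V"
  using assms unfolding rep_def lin_on_def by blast+

lemma ghomD:
  assumes "ghom G V \<rho> W \<sigma> f"
  shows "lin_on V W f" "x \<in> V \<Longrightarrow> f x \<in> W"
    "g \<in> carrier G \<Longrightarrow> x \<in> V \<Longrightarrow> f (\<rho> g x) = \<sigma> g (f x)"
  using assms unfolding ghom_def lin_on_def by blast+

lemma ghom_comp:
  assumes "ghom G V \<rho> W \<sigma> f" "ghom G W \<sigma> Z \<tau> g"
  shows "ghom G V \<rho> Z \<tau> (\<lambda>x. g (f x))"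
  using lin_on_comp[OF ghomD(1)[OF assms(1)] ghomD(1)[OF assms(2)]]
  by (simp add: ghom_def ghomD(2,3)[OF assms(1)] ghomD(3)[OF assms(2)])

lemma ghom_id: "ghom G V \<rho> V \<rho> (\<lambda>x. x)"
  by (simp add: ghom_def lin_on_id)

lemma ghom_diff:
  assumes "rep G V \<rho>" "rep G W \<sigma>" "ghom G V \<rho> W \<sigma> f" "ghom G V \<rho> W \<sigma> g"
  shows "ghom G V \<rho> W \<sigma> (\<lambda>x. f x - g x)"
  unfolding ghom_def
proof (intro conjI ballI)
  show "lin_on V W (\<lambda>x. f x - g x)"
    by (rule lin_on_diff_fun[OF ghomD(1)[OF assms(3)] ghomD(1)[OF assms(4)] repD(1)[OF assms(2)]])
  fix h x assume "h \<in> carrier G" "x \<in> V"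
  then show "f (\<rho> h x) - g (\<rho> h x) = \<sigma> h (f x - g x)"
    using lin_on_diff[OF repD(2)[OF assms(2), of h] repD(1)[OF assms(2)], of "f x" "g x"]
    by (simp only: ghomD[OF assms(3)] ghomD[OF assms(4)])
qed

lemma ghom_sum:
  assumes "rep G V \<rho>" "rep G W \<sigma>" "\<And>i. i \<in> I \<Longrightarrow> ghom G V \<rho> W \<sigma> (f i)"
  shows "ghom G V \<rho> W \<sigma> (\<lambda>x. \<Sum>i\<in>I. f i x)"
  unfolding ghom_def
proof (intro conjI ballI)
  show "lin_on V W (\<lambda>x. \<Sum>i\<in>I. f i x)"
    by (rule lin_on_sum_fun[OF ghomD(1)[OF assms(3)] repD(1)[OF assms(2)]])
  fix h x assume h: "h \<in> carrier G" and x: "x \<in> V"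
  then show "(\<Sum>i\<in>I. f i (\<rho> h x)) = \<sigma> h (\<Sum>i\<in>I. f i x)"
    by (subst lin_on_sum[OF repD(2)[OF assms(2) h] repD(1)[OF assms(2)]])
      (auto intro!: sum.cong simp: ghomD(2)[OF assms(3)] ghomD(3)[OF assms(3)])
qed

section \<open>Calculus of traces over a finite group\<close>

locale finite_group = group G for G (structure) +
  assumes fin [simp]: "finite (carrier G)"
begin

lemma rep_inv:
  assumes "rep G V \<rho>" "g \<in> carrier G" "x \<in> V"
  shows "\<rho> (inv g) (\<rho> g x) = x" "\<rho> g (\<rho> (inv g) x) = x"
  using repD(4)[OF assms(1), of "inv g" g x] repD(4)[OF assms(1), of g "inv g" x] repD(3)[OF assms(1)]
    assms by auto

lemma sum_left_translate:
  assumes "h \<in> carrier G"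
  shows "(\<Sum>g\<in>carrier G. f (h \<otimes> g)) = (\<Sum>g\<in>carrier G. f g)"
proof -
  have "bij_betw (\<lambda>g. h \<otimes> g) (carrier G) (carrier G)"
    by (rule bij_betwI[where g="\<lambda>g. inv h \<otimes> g"]) (use assms in \<open>auto simp: m_assoc[symmetric]\<close>)
  then show ?thesis by (rule sum.reindex_bij_betw)
qed

lemma tr_lin:
  assumes "rep G V \<rho>" "rep G W \<sigma>" "lin_on V W \<phi>"
  shows "lin_on V W (tr G \<rho> \<sigma> \<phi>)"
proof -
  have "lin_on V W (\<lambda>x. \<Sum>g\<in>carrier G. \<sigma> g (\<phi> (\<rho> (inv g) x)))"
    by (intro lin_on_sum_fun repD(1)[OF assms(2)] lin_on_comp[OF repD(2)[OF assms(1)]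
      lin_on_comp[OF assms(3) repD(2)[OF assms(2)]]]) auto
  then show ?thesis by (simp add: tr_def[abs_def])
qed

text \<open>Together with \<open>tr_comp_right\<close>: composing a trace with an equivariant map
  gives the trace of the composite. Hence null maps form a two-sided ideal.\<close>

lemma tr_comp_left:
  assumes "rep G V \<rho>" "rep G W \<sigma>" "lin_on V W \<phi>" "ghom G W \<sigma> Z \<tau> b" "x \<in> V"
  shows "b (tr G \<rho> \<sigma> \<phi> x) = tr G \<rho> \<tau> (\<lambda>x. b (\<phi> x)) x"
proof -
  have m: "\<phi> (\<rho> (inv g) x) \<in> W" if "g \<in> carrier G" for g
    using that assms(5) by (intro lin_onD(1)[OF assms(3)] repD(5)[OF assms(1)]) auto
  have "b (tr G \<rho> \<sigma> \<phi> x) = (\<Sum>g\<in>carrier G. b (\<sigma> g (\<phi> (\<rho> (inv g) x))))"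
    unfolding tr_def
    by (intro lin_on_sum[OF ghomD(1)[OF assms(4)] repD(1)[OF assms(2)]] repD(5)[OF assms(2)] m)
  also have "\<dots> = tr G \<rho> \<tau> (\<lambda>x. b (\<phi> x)) x"
    unfolding tr_def using m by (intro sum.cong) (auto simp: ghomD(3)[OF assms(4)])
  finally show ?thesis .
qed

lemma tr_comp_right:
  assumes "ghom G U \<mu> V \<rho> a" "x \<in> U"
  shows "tr G \<rho> \<sigma> \<phi> (a x) = tr G \<mu> \<sigma> (\<lambda>x. \<phi> (a x)) x"
  unfolding tr_def by (intro sum.cong refl) (simp only: ghomD(3)[OF assms(1) inv_closed assms(2)])

lemma tr_cong:
  assumes "rep G V \<rho>" "x \<in> V" "\<And>y. y \<in> V \<Longrightarrow> \<phi> y = \<psi> y"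
  shows "tr G \<rho> \<sigma> \<phi> x = tr G \<rho> \<sigma> \<psi> x"
  unfolding tr_def
  by (intro sum.cong refl) (simp only: assms(3)[OF repD(5)[OF assms(1) inv_closed assms(2)]])

lemma tr_ghom:
  assumes "rep G V \<rho>" "rep G W \<sigma>" "lin_on V W \<phi>"
  shows "ghom G V \<rho> W \<sigma> (tr G \<rho> \<sigma> \<phi>)"
  unfolding ghom_def
proof (intro conjI ballI)
  show "lin_on V W (tr G \<rho> \<sigma> \<phi>)" by (rule tr_lin[OF assms])
  fix h x assume h: "h \<in> carrier G" and x: "x \<in> V"
  have m: "\<phi> (\<rho> g y) \<in> W" if "g \<in> carrier G" "y \<in> V" for g y
    using that by (intro lin_onD(1)[OF assms(3)] repD(5)[OF assms(1)])
  have "tr G \<rho> \<sigma> \<phi> (\<rho> h x) = (\<Sum>g\<in>carrier G. \<sigma> (h \<otimes> g) (\<phi> (\<rho> (inv (h \<otimes> g)) (\<rho> h x))))"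
    unfolding tr_def by (rule sum_left_translate[OF h, symmetric])
  also have "\<dots> = (\<Sum>g\<in>carrier G. \<sigma> h (\<sigma> g (\<phi> (\<rho> (inv g) x))))"
  proof (intro sum.cong refl)
    fix g assume g: "g \<in> carrier G"
    have "\<rho> (inv (h \<otimes> g)) (\<rho> h x) = \<rho> (inv (h \<otimes> g) \<otimes> h) x"
      using repD(4)[OF assms(1), of "inv (h \<otimes> g)" h x] g h x by auto
    also have "inv (h \<otimes> g) \<otimes> h = inv g"
      using g h by (simp add: inv_mult_group m_assoc)
    finally show "\<sigma> (h \<otimes> g) (\<phi> (\<rho> (inv (h \<otimes> g)) (\<rho> h x))) = \<sigma> h (\<sigma> g (\<phi> (\<rho> (inv g) x)))"
      using repD(4)[OF assms(2) h g] m g x by simp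
  qed
  also have "\<dots> = \<sigma> h (tr G \<rho> \<sigma> \<phi> x)"
    unfolding tr_def using m x repD(5)[OF assms(2)]
    by (intro lin_on_sum[OF repD(2)[OF assms(2) h] repD(1)[OF assms(2)], symmetric]) auto
  finally show "tr G \<rho> \<sigma> \<phi> (\<rho> h x) = \<sigma> h (tr G \<rho> \<sigma> \<phi> x)" .
qed

lemma null_sum:
  assumes "rep G V \<rho>" "rep G W \<sigma>" "\<And>i. i \<in> I \<Longrightarrow> null G V \<rho> W \<sigma> (f i)"
  shows "null G V \<rho> W \<sigma> (\<lambda>x. \<Sum>i\<in>I. f i x)"
proof -
  obtain \<phi> where \<phi>: "\<And>i. i \<in> I \<Longrightarrow> lin_on V W (\<phi> i)"
    "\<And>i x. i \<in> I \<Longrightarrow> x \<in> V \<Longrightarrow> f i x = tr G \<rho> \<sigma> (\<phi> i) x"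
    using assms(3) unfolding null_def by metis
  show ?thesis
    unfolding null_def
  proof (intro exI conjI ballI)
    show "lin_on V W (\<lambda>x. \<Sum>i\<in>I. \<phi> i x)"
      by (intro lin_on_sum_fun \<phi> repD[OF assms(2)])
    fix x assume x: "x \<in> V"
    have "(\<Sum>i\<in>I. f i x) = (\<Sum>i\<in>I. \<Sum>g\<in>carrier G. \<sigma> g (\<phi> i (\<rho> (inv g) x)))"
      using \<phi>(2) x by (simp add: tr_def)
    also have "\<dots> = (\<Sum>g\<in>carrier G. \<Sum>i\<in>I. \<sigma> g (\<phi> i (\<rho> (inv g) x)))"
      by (rule sum.swap)
    also have "\<dots> = tr G \<rho> \<sigma> (\<lambda>x. \<Sum>i\<in>I. \<phi> i x) x"
      unfolding tr_def using repD[OF assms(1)] x \<phi>(1)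
      by (intro sum.cong refl lin_on_sum[OF repD(2)[OF assms(2)] repD(1)[OF assms(2)], symmetric]
        lin_onD(1)[OF \<phi>(1)]) auto
    finally show "(\<Sum>i\<in>I. f i x) = tr G \<rho> \<sigma> (\<lambda>x. \<Sum>i\<in>I. \<phi> i x) x" .
  qed
qed

lemma null_add:
  assumes "rep G V \<rho>" "rep G W \<sigma>" "null G V \<rho> W \<sigma> f" "null G V \<rho> W \<sigma> g"
  shows "null G V \<rho> W \<sigma> (\<lambda>x. f x + g x)"
proof -
  have "null G V \<rho> W \<sigma> (\<lambda>x. \<Sum>b\<in>{True, False}. (if b then f else g) x)"
    by (rule null_sum[OF assms(1,2)]) (use assms(3,4) in auto)
  then show ?thesis by simp
qed

lemma null_comp_left:
  assumes "rep G V \<rho>" "rep G W \<sigma>" "null G V \<rho> W \<sigma> f" "ghom G W \<sigma> Z \<tau> b"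
  shows "null G V \<rho> Z \<tau> (\<lambda>x. b (f x))"
proof -
  obtain \<phi> where "lin_on V W \<phi>" "\<And>x. x \<in> V \<Longrightarrow> f x = tr G \<rho> \<sigma> \<phi> x"
    using assms(3) unfolding null_def by auto
  then show ?thesis
    unfolding null_def
    by (intro exI[of _ "\<lambda>x. b (\<phi> x)"] conjI ballI lin_on_comp[OF _ ghomD(1)[OF assms(4)]])
      (auto simp: tr_comp_left[OF assms(1,2) _ assms(4)])
qed

lemma null_comp_right:
  assumes "null G V \<rho> W \<sigma> f" "ghom G U \<mu> V \<rho> a"
  shows "null G U \<mu> W \<sigma> (\<lambda>x. f (a x))"
proof -
  obtain \<phi> where "lin_on V W \<phi>" "\<And>x. x \<in> V \<Longrightarrow> f x = tr G \<rho> \<sigma> \<phi> x"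
    using assms(1) unfolding null_def by auto
  then show ?thesis
    unfolding null_def
    by (intro exI[of _ "\<lambda>x. \<phi> (a x)"] conjI ballI lin_on_comp[OF ghomD(1)[OF assms(2)]])
      (auto simp: tr_comp_right[OF assms(2)] ghomD(2)[OF assms(2)])
qed

lemma null_cong:
  assumes "null G V \<rho> W \<sigma> f" "\<And>x. x \<in> V \<Longrightarrow> f x = g x"
  shows "null G V \<rho> W \<sigma> g"
proof -
  obtain \<phi> where "lin_on V W \<phi>" "\<forall>x\<in>V. f x = tr G \<rho> \<sigma> \<phi> x"
    using assms(1) unfolding null_def by blast
  with assms(2) show ?thesis unfolding null_def by (intro exI[of _ \<phi>]) simp
qed

lemma null_zero:
  assumes "rep G V \<rho>" "rep G W \<sigma>"
  shows "null G V \<rho> W \<sigma> (\<lambda>x. 0)"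
proof -
  have "null G V \<rho> W \<sigma> (\<lambda>x. \<Sum>i\<in>{}. undefined x)"
    by (rule null_sum[OF assms]) simp
  then show ?thesis by simp
qed

lemma null_minus:
  assumes "rep G V \<rho>" "rep G W \<sigma>" "null G V \<rho> W \<sigma> f"
  shows "null G V \<rho> W \<sigma> (\<lambda>x. - f x)"
proof -
  have "ghom G W \<sigma> W \<sigma> (\<lambda>x. 0 - x)"
  proof (rule ghom_diff[OF assms(2,2)])
    show "ghom G W \<sigma> W \<sigma> (\<lambda>x. 0)"
      unfolding ghom_def using repD(1)[OF assms(2)]
      by (auto simp: lin_on_def lin_on_0[OF repD(2)[OF assms(2)] repD(1)[OF assms(2)]] fs.subspace_0)
  qed (rule ghom_id)
  from null_comp_left[OF assms this] show ?thesis by simp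
qed

text \<open>The composite differs from the identity by \<open>b (d c - 1) a + (b a - 1)\<close>, and
  null maps form an ideal.\<close>

lemma null_round_trip:
  assumes "rep G V \<rho>" "rep G W \<sigma>"
    and a: "ghom G V \<rho> W \<sigma> a" and b: "ghom G W \<sigma> V \<rho> b"
    and c: "ghom G W \<sigma> Z \<tau> c" and d: "ghom G Z \<tau> W \<sigma> d"
    and n1: "null G V \<rho> V \<rho> (\<lambda>x. b (a x) - x)" and n2: "null G W \<sigma> W \<sigma> (\<lambda>x. d (c x) - x)"
  shows "null G V \<rho> V \<rho> (\<lambda>x. b (d (c (a x))) - x)"
proof (rule null_cong[OF null_add[OF assms(1,1)]])
  show "null G V \<rho> V \<rho> (\<lambda>x. b (d (c (a x)) - a x))"
    by (rule null_comp_right[OF null_comp_left[OF assms(2,2) n2 b] a])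
  show "null G V \<rho> V \<rho> (\<lambda>x. b (a x) - x)" by (rule n1)
  fix x assume x: "x \<in> V"
  show "b (d (c (a x)) - a x) + (b (a x) - x) = b (d (c (a x))) - x"
    using x by (subst lin_on_diff[OF ghomD(1)[OF b] repD(1)[OF assms(2)]])
      (auto intro!: ghomD(2)[OF a] ghomD(2)[OF d] ghomD(2)[OF c])
qed

lemma steq_trans:
  assumes "rep G V \<rho>" "rep G W \<sigma>" "rep G Z \<tau>" "steq G V \<rho> W \<sigma>" "steq G W \<sigma> Z \<tau>"
  shows "steq G V \<rho> Z \<tau>"
proof -
  obtain a b where ab: "ghom G V \<rho> W \<sigma> a" "ghom G W \<sigma> V \<rho> b"
    "null G V \<rho> V \<rho> (\<lambda>x. b (a x) - x)" "null G W \<sigma> W \<sigma> (\<lambda>x. a (b x) - x)"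
    using assms(4) unfolding steq_def by auto
  obtain c d where cd: "ghom G W \<sigma> Z \<tau> c" "ghom G Z \<tau> W \<sigma> d"
    "null G W \<sigma> W \<sigma> (\<lambda>x. d (c x) - x)" "null G Z \<tau> Z \<tau> (\<lambda>x. c (d x) - x)"
    using assms(5) unfolding steq_def by auto
  show ?thesis
    unfolding steq_def
  proof (intro exI conjI)
    show "ghom G V \<rho> Z \<tau> (\<lambda>x. c (a x))" "ghom G Z \<tau> V \<rho> (\<lambda>x. b (d x))"
      by (rule ghom_comp[OF ab(1) cd(1)], rule ghom_comp[OF cd(2) ab(2)])
    show "null G V \<rho> V \<rho> (\<lambda>x. b (d (c (a x))) - x)"
      by (rule null_round_trip[OF assms(1,2) ab(1,2) cd(1,2) ab(3) cd(3)])
    show "null G Z \<tau> Z \<tau> (\<lambda>x. c (a (b (d x))) - x)"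
      by (rule null_round_trip[OF assms(3,2) cd(2,1) ab(2,1) cd(4) ab(4)])
  qed
qed

lemma steq_iso:
  assumes "rep G V \<rho>" "rep G W \<sigma>" "ghom G V \<rho> W \<sigma> a" "bij_betw a V W"
  shows "steq G V \<rho> W \<sigma>"
proof -
  define b where "b = inv_into V a"
  have b: "\<And>x. x \<in> V \<Longrightarrow> b (a x) = x" "\<And>y. y \<in> W \<Longrightarrow> a (b y) = y" "\<And>y. y \<in> W \<Longrightarrow> b y \<in> V"
    using assms(4) unfolding b_def
    by (auto simp: bij_betw_inv_into_left bij_betw_inv_into_right bij_betw_def inv_into_into)
  have inj: "a x = a y \<Longrightarrow> x \<in> V \<Longrightarrow> y \<in> V \<Longrightarrow> x = y" for x y
    using b(1) by metis
  note sV = repD(1)[OF assms(1)] and sW = repD(1)[OF assms(2)]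
  have "ghom G W \<sigma> V \<rho> b"
    unfolding ghom_def
  proof (intro conjI ballI lin_onI)
    fix x y assume xy: "x \<in> W" "y \<in> W"
    show "b (x + y) = b x + b y"
      by (rule inj) (use xy b sV sW in \<open>auto simp: lin_onD(2)[OF ghomD(1)[OF assms(3)]] fs.subspace_add\<close>)
  next
    fix c x assume x: "x \<in> W"
    show "b (sc c x) = sc c (b x)"
      by (rule inj) (use x b sV sW in \<open>auto simp: lin_onD(3)[OF ghomD(1)[OF assms(3)]] fs.subspace_scale\<close>)
  next
    fix g x assume x: "x \<in> W" and g: "g \<in> carrier G"
    show "b (\<sigma> g x) = \<rho> g (b x)"
      by (rule inj) (use x g b repD(5)[OF assms(1)] repD(5)[OF assms(2)] in \<open>auto simp: ghomD(3)[OF assms(3)]\<close>)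
  qed (use b in auto)
  then show ?thesis
    unfolding steq_def using assms b
    by (intro exI[of _ a] exI[of _ b] conjI null_cong[OF null_zero]) auto
qed

section \<open>Kernels of covers: syzygies up to stable isomorphism\<close>

lemma rep_kernel:
  assumes "rep G V \<rho>" "rep G W \<sigma>" "ghom G V \<rho> W \<sigma> f"
  shows "rep G {x \<in> V. f x = 0} \<rho>"
  unfolding rep_def
proof (intro conjI ballI)
  note lf = ghomD(1)[OF assms(3)]
  show "fs.subspace {x \<in> V. f x = 0}"
    using repD(1)[OF assms(1)] lin_onD[OF lf] lin_on_0[OF lf repD(1)[OF assms(1)]]
    by (auto simp: fs.subspace_def)
  fix g assume g: "g \<in> carrier G"
  show "lin_on {x \<in> V. f x = 0} {x \<in> V. f x = 0} (\<rho> g)"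
    using repD(2)[OF assms(1) g] ghomD(3)[OF assms(3) g] lin_on_0[OF repD(2)[OF assms(2) g] repD(1)[OF assms(2)]]
    by (auto simp: lin_on_def)
qed (use repD[OF assms(1)] in auto)

text \<open>One half of Schanuel's lemma in the stable category: \<open>A\<close> and \<open>B\<close> lift the maps \<open>a\<close> and
  \<open>b\<close> between the covered modules to the covers.\<close>

lemma null_on_kernels:
  assumes P: "rep G P \<rho>" and P': "rep G P' \<rho>'" and X: "rep G X \<sigma>"
    and \<pi>: "ghom G P \<rho> X \<sigma> \<pi>" and s: "lin_on X P s" "\<And>x. x \<in> X \<Longrightarrow> \<pi> (s x) = x"
    and \<epsilon>: "lin_on P P \<epsilon>" "\<And>x. x \<in> P \<Longrightarrow> tr G \<rho> \<rho> \<epsilon> x = x"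
    and A: "ghom G P \<rho> P' \<rho>' A" and B: "ghom G P' \<rho>' P \<rho> B"
    and ab: "\<And>x. x \<in> P \<Longrightarrow> \<pi> (B (A x)) = c (\<pi> x)"
    and n: "null G X \<sigma> X \<sigma> (\<lambda>x. c x - x)"
  shows "null G {x \<in> P. \<pi> x = 0} \<rho> {x \<in> P. \<pi> x = 0} \<rho> (\<lambda>x. B (A x) - x)"
proof -
  obtain \<phi> where \<phi>: "lin_on X X \<phi>" "\<And>x. x \<in> X \<Longrightarrow> c x - x = tr G \<sigma> \<sigma> \<phi> x"
    using n unfolding null_def by auto
  define \<kappa> where "\<kappa> = tr G \<sigma> \<rho> (\<lambda>x. s (\<phi> x))"
  have s\<phi>: "lin_on X P (\<lambda>x. s (\<phi> x))" by (rule lin_on_comp[OF \<phi>(1) s(1)])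
  have \<kappa>: "ghom G X \<sigma> P \<rho> \<kappa>" unfolding \<kappa>_def by (rule tr_ghom[OF X P s\<phi>])
  have \<pi>\<kappa>: "\<pi> (\<kappa> x) = c x - x" if "x \<in> X" for x
  proof -
    have "\<pi> (\<kappa> x) = tr G \<sigma> \<sigma> (\<lambda>x. \<pi> (s (\<phi> x))) x"
      unfolding \<kappa>_def by (rule tr_comp_left[OF X P s\<phi> \<pi> that])
    also have "\<dots> = tr G \<sigma> \<sigma> \<phi> x"
      by (rule tr_cong[OF X that]) (rule s(2)[OF lin_onD(1)[OF \<phi>(1)]])
    finally show ?thesis using \<phi>(2)[OF that] by simp
  qed
  \<comment> \<open>\<open>\<kappa>\<close> is an equivariant lift of \<open>c - 1\<close> through
    \<open>\<pi>\<close>. Subtracting \<open>\<kappa> \<circ> \<pi>\<close> pushes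
    \<open>B A - 1\<close> into the kernel on all of \<open>P\<close> while leaving it unchanged on
    the kernel; therefore \<open>h \<circ> \<epsilon>\<close> is a linear endomorphism of the kernel
    and can serve as the witness.\<close>
  define h where "h = (\<lambda>x. B (A x) - x - \<kappa> (\<pi> x))"
  have h: "ghom G P \<rho> P \<rho> h"
    unfolding h_def by (intro ghom_diff[OF P P] ghom_id ghom_comp[OF A B] ghom_comp[OF \<pi> \<kappa>])
  have \<pi>h: "\<pi> (h x) = 0" if "x \<in> P" for x
  proof -
    have m: "A x \<in> P'" "B (A x) \<in> P" "\<pi> x \<in> X" "\<kappa> (\<pi> x) \<in> P"
      using that by (intro ghomD(2)[OF A] ghomD(2)[OF B] ghomD(2)[OF \<pi>] ghomD(2)[OF \<kappa>]; assumption)+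
    from m(2) have m2: "B (A x) - x \<in> P" by (rule fs.subspace_diff[OF repD(1)[OF P] _ that])
    note d = lin_on_diff[OF ghomD(1)[OF \<pi>] repD(1)[OF P]]
    show ?thesis
      unfolding h_def using d[OF m2 m(4)] d[OF m(2) that] ab[OF that] \<pi>\<kappa>[OF m(3)] by simp
  qed
  let ?K = "{x \<in> P. \<pi> x = 0}"
  show ?thesis
    unfolding null_def
  proof (intro exI conjI ballI)
    show "lin_on ?K ?K (\<lambda>x. h (\<epsilon> x))"
      using \<epsilon>(1) ghomD(1)[OF h] \<pi>h by (auto simp: lin_on_def)
    fix x assume x: "x \<in> ?K"
    have "\<kappa> 0 = 0" by (rule lin_on_0[OF ghomD(1)[OF \<kappa>] repD(1)[OF X]])
    then have "B (A x) - x = h x" using x by (simp add: h_def)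
    also have "\<dots> = h (tr G \<rho> \<rho> \<epsilon> x)" using x \<epsilon>(2) by simp
    also have "\<dots> = tr G \<rho> \<rho> (\<lambda>x. h (\<epsilon> x)) x"
      by (rule tr_comp_left[OF P P \<epsilon>(1) h]) (use x in auto)
    finally show "B (A x) - x = tr G \<rho> \<rho> (\<lambda>x. h (\<epsilon> x)) x" .
  qed
qed

text \<open>Projectivity of \<open>P\<close> is the existence of \<open>\<epsilon>\<close> with
  trace the identity. The linear lift \<open>s' \<circ> a \<circ> \<pi>\<close>, precomposed with
  \<open>\<epsilon>\<close>, has a trace that is an equivariant lift.\<close>

lemma lift_through_cover:
  assumes P: "rep G P \<rho>" and P': "rep G P' \<rho>'" and X: "rep G X \<sigma>" and X': "rep G X' \<sigma>'"
    and \<pi>: "ghom G P \<rho> X \<sigma> \<pi>" and \<epsilon>: "lin_on P P \<epsilon>" "\<And>x. x \<in> P \<Longrightarrow> tr G \<rho> \<rho> \<epsilon> x = x"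
    and \<pi>': "ghom G P' \<rho>' X' \<sigma>' \<pi>'" and s': "lin_on X' P' s'" "\<And>x. x \<in> X' \<Longrightarrow> \<pi>' (s' x) = x"
    and a: "ghom G X \<sigma> X' \<sigma>' a"
  obtains A where "ghom G P \<rho> P' \<rho>' A" "\<And>x. x \<in> P \<Longrightarrow> \<pi>' (A x) = a (\<pi> x)"
proof -
  define A where "A = tr G \<rho> \<rho>' (\<lambda>x. s' (a (\<pi> (\<epsilon> x))))"
  have l: "lin_on P P' (\<lambda>x. s' (a (\<pi> (\<epsilon> x))))"
    by (intro lin_on_comp[OF \<epsilon>(1) lin_on_comp[OF ghomD(1)[OF \<pi>] lin_on_comp[OF ghomD(1)[OF a] s'(1)]]])
  show thesis
  proof
    show "ghom G P \<rho> P' \<rho>' A" unfolding A_def by (rule tr_ghom[OF P P' l])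
    fix x assume x: "x \<in> P"
    have "\<pi>' (A x) = tr G \<rho> \<sigma>' (\<lambda>x. \<pi>' (s' (a (\<pi> (\<epsilon> x))))) x"
      unfolding A_def by (rule tr_comp_left[OF P P' l \<pi>' x])
    also have "\<dots> = tr G \<rho> \<sigma>' (\<lambda>x. a (\<pi> (\<epsilon> x))) x"
      by (rule tr_cong[OF P x], intro s'(2) ghomD(2)[OF a] ghomD(2)[OF \<pi>] lin_onD(1)[OF \<epsilon>(1)])
    also have "\<dots> = a (\<pi> (tr G \<rho> \<rho> \<epsilon> x))"
      by (rule tr_comp_left[OF P P \<epsilon>(1) ghom_comp[OF \<pi> a] x, symmetric])
    finally show "\<pi>' (A x) = a (\<pi> x)" using \<epsilon>(2)[OF x] by simp
  qed
qed

text \<open>Schanuel's lemma: the stable class of the covered module determines that of the kernel.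
  A cover is recorded by a linear section and a linear endomorphism with trace the identity, so the
  two covers may live on different index types and one may be a restriction from a larger
  group.\<close>

lemma steq_kernels:
  assumes P: "rep G P \<rho>" and P': "rep G P' \<rho>'" and X: "rep G X \<sigma>" and X': "rep G X' \<sigma>'"
    and \<pi>: "ghom G P \<rho> X \<sigma> \<pi>" and s: "lin_on X P s" "\<And>x. x \<in> X \<Longrightarrow> \<pi> (s x) = x"
    and \<epsilon>: "lin_on P P \<epsilon>" "\<And>x. x \<in> P \<Longrightarrow> tr G \<rho> \<rho> \<epsilon> x = x"
    and \<pi>': "ghom G P' \<rho>' X' \<sigma>' \<pi>'" and s': "lin_on X' P' s'" "\<And>x. x \<in> X' \<Longrightarrow> \<pi>' (s' x) = x"
    and \<epsilon>': "lin_on P' P' \<epsilon>'" "\<And>x. x \<in> P' \<Longrightarrow> tr G \<rho>' \<rho>' \<epsilon>' x = x"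
    and st: "steq G X \<sigma> X' \<sigma>'"
  shows "steq G {x \<in> P. \<pi> x = 0} \<rho> {x \<in> P'. \<pi>' x = 0} \<rho>'"
proof -
  obtain a b where ab: "ghom G X \<sigma> X' \<sigma>' a" "ghom G X' \<sigma>' X \<sigma> b"
    "null G X \<sigma> X \<sigma> (\<lambda>x. b (a x) - x)" "null G X' \<sigma>' X' \<sigma>' (\<lambda>x. a (b x) - x)"
    using st unfolding steq_def by auto
  obtain A where A: "ghom G P \<rho> P' \<rho>' A" "\<And>x. x \<in> P \<Longrightarrow> \<pi>' (A x) = a (\<pi> x)"
    using lift_through_cover[OF P P' X X' \<pi> \<epsilon> \<pi>' s' ab(1)] by blast
  obtain B where B: "ghom G P' \<rho>' P \<rho> B" "\<And>x. x \<in> P' \<Longrightarrow> \<pi> (B x) = b (\<pi>' x)"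
    using lift_through_cover[OF P' P X' X \<pi>' \<epsilon>' \<pi> s ab(2)] by blast
  have a0: "a 0 = 0" "b 0 = 0"
    using lin_on_0[OF ghomD(1)[OF ab(1)] repD(1)[OF X]] lin_on_0[OF ghomD(1)[OF ab(2)] repD(1)[OF X']]
    by auto
  have BA: "\<pi> (B (A x)) = b (a (\<pi> x))" if "x \<in> P" for x
    using B(2)[OF ghomD(2)[OF A(1) that]] A(2)[OF that] by simp
  have AB: "\<pi>' (A (B x)) = a (b (\<pi>' x))" if "x \<in> P'" for x
    using A(2)[OF ghomD(2)[OF B(1) that]] B(2)[OF that] by simp
  show ?thesis
    unfolding steq_def
  proof (intro exI conjI)
    show "ghom G {x \<in> P. \<pi> x = 0} \<rho> {x \<in> P'. \<pi>' x = 0} \<rho>' A"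
      using A a0 by (auto simp: ghom_def lin_on_def)
    show "ghom G {x \<in> P'. \<pi>' x = 0} \<rho>' {x \<in> P. \<pi> x = 0} \<rho> B"
      using B a0 by (auto simp: ghom_def lin_on_def)
    show "null G {x \<in> P. \<pi> x = 0} \<rho> {x \<in> P. \<pi> x = 0} \<rho> (\<lambda>x. B (A x) - x)"
      by (rule null_on_kernels[OF P P' X \<pi> s \<epsilon> A(1) B(1) _ ab(3)])
        (simp_all only: BA)
    show "null G {x \<in> P'. \<pi>' x = 0} \<rho>' {x \<in> P'. \<pi>' x = 0} \<rho>' (\<lambda>x. A (B x) - x)"
      by (rule null_on_kernels[OF P' P X' \<pi>' s' \<epsilon>' B(1) A(1) _ ab(4)])
        (simp_all only: AB)
  qed
qed

end

section \<open>Restriction to a subgroup\<close>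

text \<open>The transfer from a subgroup with left coset representatives \<open>R\<close>. If
  \<open>\<phi>\<close> is equivariant under the subgroup, each summand depends only on the coset of
  \<open>r\<close>.\<close>

definition rel_tr where
  "rel_tr G R \<rho> \<sigma> \<phi> x = (\<Sum>r\<in>R. \<sigma> r (\<phi> (\<rho> (inv\<^bsub>G\<^esub> r) x)))"

locale transversal = finite_group +
  fixes H R
  assumes sub: "subgroup H G" and R: "R \<subseteq> carrier G"
    and bij: "bij_betw (\<lambda>(r, h). r \<otimes> h) (R \<times> H) (carrier G)"
begin

abbreviation "GH \<equiv> G\<lparr>carrier := H\<rparr>"

lemma H_carrier: "h \<in> H \<Longrightarrow> h \<in> carrier G"
  using sub by (rule subgroup.mem_carrier)

lemma R_carrier: "r \<in> R \<Longrightarrow> r \<in> carrier G"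
  using R by auto

lemma finite_R: "finite R" and finite_H: "finite H"
  using R fin H_carrier by (auto intro: finite_subset[OF _ fin])

lemma inv_GH: "h \<in> H \<Longrightarrow> inv\<^bsub>GH\<^esub> h = inv h"
  by (rule m_inv_consistent[OF sub])

lemma finite_group_GH: "finite_group GH"
proof -
  interpret GH: group GH by (rule subgroup_imp_group[OF sub])
  show ?thesis by standard (simp add: finite_H)
qed

sublocale GH: finite_group GH by (rule finite_group_GH)

lemma rep_restrict: "rep G V \<rho> \<Longrightarrow> rep GH V \<rho>"
  by (simp add: rep_def H_carrier)

lemma ghom_restrict: "ghom G V \<rho> W \<sigma> f \<Longrightarrow> ghom GH V \<rho> W \<sigma> f"
  by (simp add: ghom_def H_carrier)

lemma tr_GH: "tr GH \<rho> \<sigma> \<phi> x = (\<Sum>h\<in>H. \<sigma> h (\<phi> (\<rho> (inv h) x)))"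
  by (simp add: tr_def inv_GH)

lemma sum_carrier: "(\<Sum>g\<in>carrier G. F g) = (\<Sum>r\<in>R. \<Sum>h\<in>H. F (r \<otimes> h))"
proof -
  have "(\<Sum>g\<in>carrier G. F g) = (\<Sum>z\<in>R \<times> H. F ((\<lambda>(r, h). r \<otimes> h) z))"
    by (rule sum.reindex_bij_betw[OF bij, symmetric])
  also have "\<dots> = (\<Sum>r\<in>R. \<Sum>h\<in>H. F (r \<otimes> h))"
    by (subst sum.cartesian_product) (simp add: case_prod_beta)
  finally show ?thesis .
qed

text \<open>An equivariant \<open>f\<close> is fixed by conjugation, so the sum of its conjugates
  over \<open>R\<close> is \<open>card R\<close> times \<open>f\<close>, that is \<open>f\<close>.
  Conjugating a trace over the subgroup by the representatives and adding gives the full trace of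
  the same \<open>\<phi>\<close>.\<close>

lemma null_of_restrict:
  fixes W :: "('i \<Rightarrow> 'k::field) set"
  assumes V: "rep G V \<rho>" and W: "rep G W \<sigma>" and f: "ghom G V \<rho> W \<sigma> f" and n: "null GH V \<rho> W \<sigma> f"
    and card: "of_nat (card R) = (1 :: 'k)"
  shows "null G V \<rho> W \<sigma> f"
proof -
  obtain \<phi> where \<phi>: "lin_on V W \<phi>" "\<And>x. x \<in> V \<Longrightarrow> f x = tr GH \<rho> \<sigma> \<phi> x"
    using n unfolding null_def by blast
  have m: "\<phi> (\<rho> g x) \<in> W" if "g \<in> carrier G" "x \<in> V" for g x
    using that by (intro lin_onD(1)[OF \<phi>(1)] repD(5)[OF V])
  have "f x = tr G \<rho> \<sigma> \<phi> x" if x: "x \<in> V" for x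
  proof -
    have "f x = (\<Sum>r\<in>R. f x)"
    proof
      fix i
      have "(\<Sum>r\<in>R. f x) i = of_nat (card R) * f x i" by (simp add: fun_sum_apply)
      then show "f x i = (\<Sum>r\<in>R. f x) i" using card by simp
    qed
    also have "\<dots> = (\<Sum>r\<in>R. \<Sum>h\<in>H. \<sigma> (r \<otimes> h) (\<phi> (\<rho> (inv (r \<otimes> h)) x)))"
    proof (intro sum.cong refl)
      fix r assume r: "r \<in> R"
      then have rG: "r \<in> carrier G" by (rule R_carrier)
      have y: "\<rho> (inv r) x \<in> V" using rG x by (intro repD(5)[OF V]) auto
      have "f x = f (\<rho> r (\<rho> (inv r) x))" by (simp only: rep_inv(2)[OF V rG x])
      also have "\<dots> = \<sigma> r (f (\<rho> (inv r) x))" by (rule ghomD(3)[OF f rG y])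
      also have "f (\<rho> (inv r) x) = (\<Sum>h\<in>H. \<sigma> h (\<phi> (\<rho> (inv h) (\<rho> (inv r) x))))"
        by (simp only: \<phi>(2)[OF y] tr_GH)
      also have "\<sigma> r \<dots> = (\<Sum>h\<in>H. \<sigma> r (\<sigma> h (\<phi> (\<rho> (inv h) (\<rho> (inv r) x)))))"
        by (intro lin_on_sum[OF repD(2)[OF W rG] repD(1)[OF W]] repD(5)[OF W] m y inv_closed H_carrier)
      also have "\<dots> = (\<Sum>h\<in>H. \<sigma> (r \<otimes> h) (\<phi> (\<rho> (inv (r \<otimes> h)) x)))"
      proof (intro sum.cong refl)
        fix h assume h: "h \<in> H"
        then have hG: "h \<in> carrier G" by (rule H_carrier)
        have e: "\<rho> (inv (r \<otimes> h)) x = \<rho> (inv h) (\<rho> (inv r) x)"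
          using repD(4)[OF V, of "inv h" "inv r" x] hG rG x by (simp add: inv_mult_group)
        show "\<sigma> r (\<sigma> h (\<phi> (\<rho> (inv h) (\<rho> (inv r) x)))) = \<sigma> (r \<otimes> h) (\<phi> (\<rho> (inv (r \<otimes> h)) x))"
          unfolding e by (rule repD(4)[OF W rG hG m[OF inv_closed[OF hG] y], symmetric])
      qed
      finally show "f x = (\<Sum>h\<in>H. \<sigma> (r \<otimes> h) (\<phi> (\<rho> (inv (r \<otimes> h)) x)))" .
    qed
    also have "\<dots> = tr G \<rho> \<sigma> \<phi> x"
      unfolding tr_def by (rule sum_carrier[symmetric])
    finally show ?thesis .
  qed
  with \<phi>(1) show ?thesis unfolding null_def by blast
qed

text \<open>Grouping the full trace by right cosets of the subgroup collects the conjugates of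
  \<open>\<phi>\<close> by the inverse representatives into one linear map \<open>\<psi>\<close>,
  and what remains is the trace of \<open>\<psi>\<close> over the subgroup.\<close>

lemma null_restrict:
  assumes V: "rep G V \<rho>" and W: "rep G W \<sigma>" and n: "null G V \<rho> W \<sigma> f"
  shows "null GH V \<rho> W \<sigma> f"
proof -
  obtain \<phi> where \<phi>: "lin_on V W \<phi>" "\<And>x. x \<in> V \<Longrightarrow> f x = tr G \<rho> \<sigma> \<phi> x"
    using n unfolding null_def by blast
  have m: "\<phi> (\<rho> g x) \<in> W" if "g \<in> carrier G" "x \<in> V" for g x
    using that by (intro lin_onD(1)[OF \<phi>(1)] repD(5)[OF V])
  define \<psi> where "\<psi> = (\<lambda>x. \<Sum>r\<in>R. \<sigma> (inv r) (\<phi> (\<rho> r x)))"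
  have "lin_on V W \<psi>"
    unfolding \<psi>_def
    by (intro lin_on_sum_fun repD(1)[OF W] lin_on_comp[OF repD(2)[OF V] lin_on_comp[OF \<phi>(1) repD(2)[OF W]]]
      inv_closed R_carrier)
  moreover have "f x = tr GH \<rho> \<sigma> \<psi> x" if x: "x \<in> V" for x
  proof -
    let ?F = "\<lambda>g. \<sigma> g (\<phi> (\<rho> (inv g) x))"
    have "f x = (\<Sum>g\<in>carrier G. ?F g)" using \<phi>(2)[OF x] by (simp add: tr_def)
    \<comment> \<open>The bijection of the locale describes left cosets; inverting the summation
      variable produces the right cosets that a trace over \<open>H\<close> requires.\<close>
    also have "\<dots> = (\<Sum>g\<in>carrier G. ?F (inv g))"
      by (rule sum.reindex_bij_witness[of _ "\<lambda>g. inv g" "\<lambda>g. inv g"]) auto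
    also have "\<dots> = (\<Sum>r\<in>R. \<Sum>h\<in>H. ?F (inv (r \<otimes> h)))" by (rule sum_carrier)
    also have "\<dots> = (\<Sum>h\<in>H. \<Sum>r\<in>R. ?F (inv (r \<otimes> h)))" by (rule sum.swap)
    also have "\<dots> = (\<Sum>h\<in>H. \<Sum>r\<in>R. ?F (inv (r \<otimes> inv h)))"
      by (rule sum.reindex_bij_witness[of _ "\<lambda>g. inv g" "\<lambda>g. inv g"])
        (auto simp: subgroup.m_inv_closed[OF sub] H_carrier)
    also have "\<dots> = (\<Sum>h\<in>H. \<sigma> h (\<psi> (\<rho> (inv h) x)))"
    proof (intro sum.cong refl)
      fix h assume "h \<in> H"
      then have hG: "h \<in> carrier G" by (rule H_carrier)
      have y: "\<rho> (inv h) x \<in> V" by (rule repD(5)[OF V inv_closed[OF hG] x])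
      have "(\<Sum>r\<in>R. ?F (inv (r \<otimes> inv h))) = (\<Sum>r\<in>R. \<sigma> h (\<sigma> (inv r) (\<phi> (\<rho> r (\<rho> (inv h) x)))))"
      proof (intro sum.cong refl)
        fix r assume "r \<in> R"
        then have rG: "r \<in> carrier G" by (rule R_carrier)
        have "inv (r \<otimes> inv h) = h \<otimes> inv r" "inv (inv (r \<otimes> inv h)) = r \<otimes> inv h"
          using rG hG by (auto simp: inv_mult_group)
        then show "?F (inv (r \<otimes> inv h)) = \<sigma> h (\<sigma> (inv r) (\<phi> (\<rho> r (\<rho> (inv h) x))))"
          by (simp only: repD(4)[OF V rG inv_closed[OF hG] x]
            repD(4)[OF W hG inv_closed[OF rG] m[OF rG y]])
      qed
      also have "\<dots> = \<sigma> h (\<psi> (\<rho> (inv h) x))"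
        unfolding \<psi>_def
        by (intro lin_on_sum[OF repD(2)[OF W hG] repD(1)[OF W], symmetric] repD(5)[OF W] inv_closed
          R_carrier m y)
      finally show "(\<Sum>r\<in>R. ?F (inv (r \<otimes> inv h))) = \<sigma> h (\<psi> (\<rho> (inv h) x))" .
    qed
    finally show ?thesis by (simp only: tr_GH)
  qed
  ultimately show ?thesis unfolding null_def by blast
qed

lemma steq_restrict:
  assumes "rep G V \<rho>" "rep G W \<sigma>" "steq G V \<rho> W \<sigma>"
  shows "steq GH V \<rho> W \<sigma>"
  using assms(3) unfolding steq_def
  by (blast intro: ghom_restrict null_restrict[OF assms(1,1)] null_restrict[OF assms(2,2)])

text \<open>Left multiplication by \<open>g\<close> permutes the left cosets:
  \<open>g \<otimes> r\<close> is \<open>r' \<otimes> h\<close> with \<open>r'\<close> again in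
  \<open>R\<close>, and \<open>h\<close> is absorbed by the equivariance of \<open>\<alpha>\<close>
  under the subgroup.\<close>

lemma rel_tr_ghom:
  assumes V: "rep G V \<rho>" and W: "rep G W \<sigma>" and \<alpha>: "ghom GH V \<rho> W \<sigma> \<alpha>"
  shows "ghom G V \<rho> W \<sigma> (rel_tr G R \<rho> \<sigma> \<alpha>)"
  unfolding ghom_def
proof (intro conjI ballI)
  have "lin_on V W (\<lambda>x. \<Sum>r\<in>R. \<sigma> r (\<alpha> (\<rho> (inv r) x)))"
    by (intro lin_on_sum_fun repD(1)[OF W] inv_closed R_carrier
      lin_on_comp[OF repD(2)[OF V] lin_on_comp[OF ghomD(1)[OF \<alpha>] repD(2)[OF W]]])
  then show "lin_on V W (rel_tr G R \<rho> \<sigma> \<alpha>)" by (simp add: rel_tr_def[abs_def])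
  fix g x assume g: "g \<in> carrier G" and x: "x \<in> V"
  have m: "\<alpha> (\<rho> k y) \<in> W" if "k \<in> carrier G" "y \<in> V" for k y
    using that by (intro ghomD(2)[OF \<alpha>] repD(5)[OF V])
  have "\<exists>r'\<in>R. \<exists>h\<in>H. k = r' \<otimes> h" if "k \<in> carrier G" for k
    using bij that unfolding bij_betw_def by force
  then obtain \<pi> \<eta> where \<pi>: "\<And>k. k \<in> carrier G \<Longrightarrow> \<pi> k \<in> R" "\<And>k. k \<in> carrier G \<Longrightarrow> \<eta> k \<in> H"
    "\<And>k. k \<in> carrier G \<Longrightarrow> k = \<pi> k \<otimes> \<eta> k"
    by metis
  have uniq: "r = r'" if "r \<in> R" "r' \<in> R" "h \<in> H" "h' \<in> H" "r \<otimes> h = r' \<otimes> h'" for r r' h h'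
    using bij that unfolding bij_betw_def inj_on_def by force
  have gr: "g \<otimes> r \<in> carrier G" if "r \<in> R" for r using g R_carrier that by simp
  have inj: "inj_on (\<lambda>r. \<pi> (g \<otimes> r)) R"
  proof (rule inj_onI)
    fix r r' assume r: "r \<in> R" "r' \<in> R" and e: "\<pi> (g \<otimes> r) = \<pi> (g \<otimes> r')"
    let ?h = "\<eta> (g \<otimes> r)" and ?h' = "\<eta> (g \<otimes> r')"
    have hh: "?h \<in> H" "?h' \<in> H" using r gr \<pi> by auto
    note hG = hh[THEN H_carrier]
    have c: "\<pi> (g \<otimes> r) \<in> carrier G" using r gr \<pi> R_carrier by blast
    have 1: "g \<otimes> r = \<pi> (g \<otimes> r) \<otimes> ?h" "g \<otimes> r' = \<pi> (g \<otimes> r) \<otimes> ?h'"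
      using \<pi>(3)[OF gr[OF r(1)]] \<pi>(3)[OF gr[OF r(2)]] e by auto
    have "g \<otimes> (r \<otimes> inv ?h) = \<pi> (g \<otimes> r)"
      using 1(1) hG c g r R_carrier by (metis inv_solve_right m_assoc m_closed inv_closed)
    moreover have "g \<otimes> (r' \<otimes> inv ?h') = \<pi> (g \<otimes> r)"
      using 1(2) hG c g r R_carrier by (metis inv_solve_right m_assoc m_closed inv_closed)
    ultimately have "r \<otimes> inv ?h = r' \<otimes> inv ?h'"
      using g r R_carrier hG inv_closed m_closed by (metis Units_eq Units_l_cancel)
    then show "r = r'" using uniq r hh subgroup.m_inv_closed[OF sub] by blast
  qed
  then have "(\<lambda>r. \<pi> (g \<otimes> r)) ` R = R"
    using gr \<pi>(1) by (intro card_subset_eq finite_R) (auto simp: card_image)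
  with inj have bR: "bij_betw (\<lambda>r. \<pi> (g \<otimes> r)) R R" by (simp add: bij_betw_def)
  have gx: "\<rho> g x \<in> V" by (rule repD(5)[OF V g x])
  have "rel_tr G R \<rho> \<sigma> \<alpha> (\<rho> g x) = (\<Sum>r\<in>R. \<sigma> (\<pi> (g \<otimes> r)) (\<alpha> (\<rho> (inv (\<pi> (g \<otimes> r))) (\<rho> g x))))"
    unfolding rel_tr_def by (rule sum.reindex_bij_betw[OF bR, symmetric])
  also have "\<dots> = (\<Sum>r\<in>R. \<sigma> g (\<sigma> r (\<alpha> (\<rho> (inv r) x))))"
  proof (intro sum.cong refl)
    fix r assume r: "r \<in> R"
    let ?s = "\<pi> (g \<otimes> r)" and ?h = "\<eta> (g \<otimes> r)"
    have rG: "r \<in> carrier G" and sG: "?s \<in> carrier G" and hH: "?h \<in> H"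
      using r gr \<pi> R_carrier by auto
    note hG = H_carrier[OF hH]
    have e: "g \<otimes> r = ?s \<otimes> ?h" by (rule \<pi>(3)[OF gr[OF r]])
    have e2: "inv ?s \<otimes> g = ?h \<otimes> inv r"
    proof -
      have "inv ?s \<otimes> g = inv ?s \<otimes> (g \<otimes> r) \<otimes> inv r" using g rG sG by (simp add: m_assoc)
      also have "inv ?s \<otimes> (g \<otimes> r) = inv ?s \<otimes> (?s \<otimes> ?h)" using e by (rule arg_cong)
      also have "\<dots> = ?h" using sG hG by (simp add: m_assoc[symmetric])
      finally show ?thesis .
    qed
    have y: "\<rho> (inv r) x \<in> V" by (rule repD(5)[OF V inv_closed[OF rG] x])
    have "\<rho> (inv ?s) (\<rho> g x) = \<rho> (inv ?s \<otimes> g) x"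
      by (rule repD(4)[OF V inv_closed[OF sG] g x, symmetric])
    also have "\<dots> = \<rho> ?h (\<rho> (inv r) x)"
      unfolding e2 by (rule repD(4)[OF V hG inv_closed[OF rG] x])
    finally have "\<alpha> (\<rho> (inv ?s) (\<rho> g x)) = \<sigma> ?h (\<alpha> (\<rho> (inv r) x))"
      using ghomD(3)[OF \<alpha> _ y, of ?h] hH by simp
    then have "\<sigma> ?s (\<alpha> (\<rho> (inv ?s) (\<rho> g x))) = \<sigma> (?s \<otimes> ?h) (\<alpha> (\<rho> (inv r) x))"
      using repD(4)[OF W sG hG m[OF inv_closed[OF rG] x]] by simp
    also have "\<dots> = \<sigma> g (\<sigma> r (\<alpha> (\<rho> (inv r) x)))"
      unfolding e[symmetric] by (rule repD(4)[OF W g rG m[OF inv_closed[OF rG] x]])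
    finally show "\<sigma> ?s (\<alpha> (\<rho> (inv ?s) (\<rho> g x))) = \<sigma> g (\<sigma> r (\<alpha> (\<rho> (inv r) x)))" .
  qed
  also have "\<dots> = \<sigma> g (rel_tr G R \<rho> \<sigma> \<alpha> x)"
    unfolding rel_tr_def
    by (intro lin_on_sum[OF repD(2)[OF W g] repD(1)[OF W], symmetric] repD(5)[OF W] m x inv_closed R_carrier)
  finally show "rel_tr G R \<rho> \<sigma> \<alpha> (\<rho> g x) = \<sigma> g (rel_tr G R \<rho> \<sigma> \<alpha> x)" .
qed

text \<open>Strong embedding of the subgroup is what gives the hypothesis on \<open>rel_tr\<close>.\<close>

lemma steq_of_restrict:
  fixes V :: "('i \<Rightarrow> 'k::field) set" and W :: "('j \<Rightarrow> 'k) set"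
  assumes V: "rep G V \<rho>" and W: "rep G W \<sigma>" and st: "steq GH V \<rho> W \<sigma>"
    and card: "of_nat (card R) = (1 :: 'k)"
    and VW: "\<And>\<alpha>. ghom GH V \<rho> W \<sigma> \<alpha> \<Longrightarrow> null GH V \<rho> W \<sigma> (\<lambda>x. rel_tr G R \<rho> \<sigma> \<alpha> x - \<alpha> x)"
    and WV: "\<And>\<alpha>. ghom GH W \<sigma> V \<rho> \<alpha> \<Longrightarrow> null GH W \<sigma> V \<rho> (\<lambda>x. rel_tr G R \<sigma> \<rho> \<alpha> x - \<alpha> x)"
  shows "steq G V \<rho> W \<sigma>"
proof -
  have V': "rep GH V \<rho>" and W': "rep GH W \<sigma>" using V W by (auto intro: rep_restrict)
  obtain a b where ab: "ghom GH V \<rho> W \<sigma> a" "ghom GH W \<sigma> V \<rho> b"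
    "null GH V \<rho> V \<rho> (\<lambda>x. b (a x) - x)" "null GH W \<sigma> W \<sigma> (\<lambda>x. a (b x) - x)"
    using st unfolding steq_def by auto
  \<comment> \<open>Stated for arbitrary modules because it serves both round trips, with the roles
    exchanged. Over the subgroup the transfers may be replaced by the original maps; the resulting
    null map is equivariant for the whole group, so \<open>null_of_restrict\<close> applies.\<close>
  have main: "null G V \<rho> V \<rho> (\<lambda>x. rel_tr G R \<sigma> \<rho> b (rel_tr G R \<rho> \<sigma> a x) - x)"
    if V: "rep G V \<rho>" and W: "rep G W \<sigma>" and V': "rep GH V \<rho>" and W': "rep GH W \<sigma>"
      and a: "ghom GH V \<rho> W \<sigma> a" and b: "ghom GH W \<sigma> V \<rho> b"
      and n: "null GH V \<rho> V \<rho> (\<lambda>x. b (a x) - x)"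
      and na: "null GH V \<rho> W \<sigma> (\<lambda>x. rel_tr G R \<rho> \<sigma> a x - a x)"
      and nb: "null GH W \<sigma> V \<rho> (\<lambda>x. rel_tr G R \<sigma> \<rho> b x - b x)"
    for V :: "('m \<Rightarrow> 'k) set" and W :: "('n \<Rightarrow> 'k) set" and \<rho> \<sigma> a b
  proof -
    let ?A = "rel_tr G R \<rho> \<sigma> a" and ?B = "rel_tr G R \<sigma> \<rho> b"
    have A: "ghom G V \<rho> W \<sigma> ?A" and B: "ghom G W \<sigma> V \<rho> ?B"
      by (rule rel_tr_ghom[OF V W a], rule rel_tr_ghom[OF W V b])
    note A' = ghom_restrict[OF A] and B' = ghom_restrict[OF B]
    have "null GH V \<rho> V \<rho> (\<lambda>x. (?B (?A x) - b (?A x)) + (b (?A x - a x) + (b (a x) - x)))"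
      by (intro GH.null_add[OF V' V'] n GH.null_comp_right[OF nb A'] GH.null_comp_left[OF V' W' na b])
    then have "null GH V \<rho> V \<rho> (\<lambda>x. ?B (?A x) - x)"
    proof (rule GH.null_cong)
      fix x assume x: "x \<in> V"
      show "(?B (?A x) - b (?A x)) + (b (?A x - a x) + (b (a x) - x)) = ?B (?A x) - x"
        using lin_on_diff[OF ghomD(1)[OF b] repD(1)[OF W] ghomD(2)[OF A x] ghomD(2)[OF a x]] by simp
    qed
    moreover have "ghom G V \<rho> V \<rho> (\<lambda>x. ?B (?A x) - x)"
      by (intro ghom_diff[OF V V] ghom_comp[OF A B] ghom_id)
    ultimately show ?thesis using null_of_restrict[OF V V] card by blast
  qed
  show ?thesis
    unfolding steq_def
    using rel_tr_ghom[OF V W ab(1)] rel_tr_ghom[OF W V ab(2)]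
      main[OF V W V' W' ab(1,2,3) VW[OF ab(1)] WV[OF ab(2)]]
      main[OF W V W' V' ab(2,1,4) WV[OF ab(2)] VW[OF ab(1)]]
    by blast
qed

end

section \<open>Polynomial functions modulo \<open>p\<close>\<close>

lemmas fun_pw = plus_fun_apply zero_fun_apply minus_apply uminus_apply sc_apply

declare fun_pw [simp del]

section \<open>Finite differences and Newton expansions\<close>

text \<open>When a unipotent element acts on functions by the unit translation, this is that element
  minus 1, the generator of the radical of the group algebra of the unipotent subgroup.\<close>

definition fdiff :: "(int \<Rightarrow> 'k::field) \<Rightarrow> int \<Rightarrow> 'k" where
  "fdiff f = (\<lambda>x. f (x + 1) - f x)"

lemma fdiff_apply: "fdiff f x = f (x + 1) - f x"
  by (simp add: fdiff_def)

lemma fdiff_simps: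
  "fdiff (f + g) = fdiff f + fdiff g" "fdiff (f - g) = fdiff f - fdiff g" "fdiff (sc c f) = sc c (fdiff f)"
  "fdiff 0 = 0" "fdiff (\<Sum>i\<in>A. h i) = (\<Sum>i\<in>A. fdiff (h i))"
  by (auto simp: fun_eq_iff fun_pw fdiff_apply algebra_simps fun_sum_apply sum_subtractf)

lemma fdiff_pow_simps:
  "(fdiff ^^ n) (f + g) = (fdiff ^^ n) f + (fdiff ^^ n) g"
  "(fdiff ^^ n) (f - g) = (fdiff ^^ n) f - (fdiff ^^ n) g"
  "(fdiff ^^ n) (sc c f) = sc c ((fdiff ^^ n) f)"
  "(fdiff ^^ n) 0 = 0"
  "(fdiff ^^ n) (\<Sum>i\<in>A. h i) = (\<Sum>i\<in>A. (fdiff ^^ n) (h i))"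
  by (induction n) (auto simp: fdiff_simps)

lemma fdiff_pow_add: "(fdiff ^^ (m + n)) f = (fdiff ^^ m) ((fdiff ^^ n) f)"
  by (simp add: funpow_add)

lemma fdiff_pow_vanish_mono:
  assumes "(fdiff ^^ m) f = 0" "m \<le> n"
  shows "(fdiff ^^ n) f = 0"
  using fdiff_pow_add[of "n - m" m f] assms by (simp add: fdiff_pow_simps)

lemma fdiff_pow_shift: "(fdiff ^^ n) (\<lambda>x. f (x + e)) = (\<lambda>x. (fdiff ^^ n) f (x + e))"
  by (induction n) (auto simp: fdiff_def algebra_simps)

lemma fdiff_eq_0_const:
  assumes "fdiff f = 0"
  shows "f = (\<lambda>x. f 0)"
proof
  fix x
  have s: "f (x + 1) = f x" for x
    using fun_cong[OF assms, of x] by (simp add: fdiff_apply fun_pw)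
  show "f x = f 0"
  proof (induction x rule: int_induct[where k=0])
    case (step2 i)
    then show ?case using s[of "i - 1"] by simp
  qed (auto simp: s)
qed

text \<open>A difference with step \<open>s\<close> is a sum of \<open>s\<close> translates of
  \<open>fdiff f\<close>, so it lowers the degree as well.\<close>

lemma fdiff_pow_step:
  assumes "(fdiff ^^ Suc n) f = 0"
  shows "(fdiff ^^ n) (\<lambda>x. f (x + int s) - f x) = 0"
proof (induction s)
  case 0
  have "(\<lambda>x. f (x + int 0) - f x) = 0" by (simp add: fun_eq_iff fun_pw)
  then show ?case by (simp only: fdiff_pow_simps)
next
  case (Suc s)
  have e: "(\<lambda>x. f (x + int (Suc s)) - f x) = (\<lambda>x. f (x + int s) - f x) + (\<lambda>x. fdiff f (x + int s))"
    by (simp add: fun_eq_iff fun_pw fdiff_apply algebra_simps)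
  have "(fdiff ^^ n) (fdiff f) = 0" using assms by (simp add: funpow_swap1)
  then show ?case
    unfolding e fdiff_pow_simps(1) Suc fdiff_pow_shift by (simp add: fun_eq_iff fun_pw)
qed

text \<open>The unit difference of the rescaled function is the difference of \<open>f\<close> with
  step \<open>s\<close>, again rescaled. That difference has smaller degree, which drives the
  induction over all \<open>f\<close>.\<close>

lemma fdiff_pow_affine:
  assumes "(fdiff ^^ n) f = 0"
  shows "(fdiff ^^ n) (\<lambda>x. f (int s * x + e)) = 0"
  using assms
proof (induction n arbitrary: f)
  case 0
  then show ?case by (simp add: fun_eq_iff fun_pw)
next
  case (Suc n)
  have "fdiff (\<lambda>x. f (int s * x + e)) = (\<lambda>x. (\<lambda>x. f (x + int s) - f x) (int s * x + e))"
    by (simp add: fun_eq_iff fun_pw fdiff_apply algebra_simps)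
  then have "(fdiff ^^ Suc n) (\<lambda>x. f (int s * x + e)) =
      (fdiff ^^ n) (\<lambda>x. (\<lambda>x. f (x + int s) - f x) (int s * x + e))"
    by (simp add: funpow_swap1)
  also have "\<dots> = 0" by (rule Suc.IH[OF fdiff_pow_step[OF Suc.prems]])
  finally show ?case .
qed

text \<open>A function \<open>q\<close> of exact degree \<open>m\<close> generates everything of
  degree at most \<open>m\<close> under differences: a multiple of \<open>q\<close> removes the top
  difference of \<open>f\<close>, and \<open>fdiff q\<close> takes over in degree
  \<open>m - 1\<close>. This is the uniseriality of the spaces \<open>pol\<close>, in the form used
  whenever a generator is chosen.\<close>

lemma newton_span:
  fixes q f :: "int \<Rightarrow> 'k::field"
  assumes "(fdiff ^^ m) q = (\<lambda>x. c)" "c \<noteq> 0" "(fdiff ^^ Suc m) f = 0"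
  shows "\<exists>a. f = (\<Sum>i<Suc m. sc (a i) ((fdiff ^^ i) q))"
  using assms(1,3)
proof (induction m arbitrary: q f)
  case 0
  from 0(2) have "fdiff f = 0" by simp
  then have "f = (\<lambda>x. f 0)" by (rule fdiff_eq_0_const)
  then have "f = sc (f 0 / c) q"
    using 0(1) \<open>c \<noteq> 0\<close> by (auto simp: fun_eq_iff fun_pw)
  then show ?case by (intro exI[of _ "\<lambda>_. f 0 / c"]) simp
next
  case (Suc m)
  let ?d = "(fdiff ^^ Suc m) f 0 / c"
  have "(fdiff ^^ Suc m) f = (\<lambda>x. (fdiff ^^ Suc m) f 0)"
    using Suc.prems(2) by (intro fdiff_eq_0_const) simp
  then have "(fdiff ^^ Suc m) (f - sc ?d q) = 0"
    using \<open>c \<noteq> 0\<close> Suc.prems(1) unfolding fdiff_pow_simps by (auto simp: fun_eq_iff fun_pw)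
  moreover have "(fdiff ^^ m) (fdiff q) = (\<lambda>x. c)"
    using Suc.prems(1) by (simp add: funpow_swap1)
  ultimately obtain a where a: "f - sc ?d q = (\<Sum>i<Suc m. sc (a i) ((fdiff ^^ i) (fdiff q)))"
    using Suc.IH by blast
  let ?b = "\<lambda>i. case i of 0 \<Rightarrow> ?d | Suc j \<Rightarrow> a j"
  have "(\<Sum>i<Suc (Suc m). sc (?b i) ((fdiff ^^ i) q)) =
      sc ?d q + (\<Sum>i<Suc m. sc (a i) ((fdiff ^^ i) (fdiff q)))"
    by (subst sum.lessThan_Suc_shift) (simp add: funpow_swap1)
  also have "\<dots> = f" unfolding a[symmetric] by (simp only: add_diff_eq add_diff_cancel_left')
  finally show ?case by metis
qed

text \<open>The operator \<open>fdiff ^^ m\<close> annihilates every term except the one at index 0,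
  where it gives the nonzero constant; the induction then passes to \<open>fdiff q\<close>.\<close>

lemma newton_independent:
  fixes q :: "int \<Rightarrow> 'k::field"
  assumes "(fdiff ^^ m) q = (\<lambda>x. c)" "c \<noteq> 0" "(\<Sum>i<Suc m. sc (a i) ((fdiff ^^ i) q)) = 0" "i \<le> m"
  shows "a i = 0"
  using assms(1,3,4)
proof (induction m arbitrary: q a i)
  case 0
  then have "sc (a 0) q = 0" by simp
  then have "a 0 * c = 0" using 0(1) by (auto simp: fun_eq_iff fun_pw)
  then show ?case using \<open>c \<noteq> 0\<close> 0(3) by simp
next
  case (Suc m)
  have z: "fdiff (\<lambda>x. c) = 0" by (simp add: fun_eq_iff fun_pw fdiff_apply)
  have k: "(fdiff ^^ Suc m) ((fdiff ^^ Suc j) q) = 0" for j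
  proof -
    have "(fdiff ^^ Suc m) ((fdiff ^^ Suc j) q) = (fdiff ^^ Suc j) ((fdiff ^^ Suc m) q)"
      by (simp add: fdiff_pow_add[symmetric] add.commute del: funpow.simps)
    also have "\<dots> = (fdiff ^^ j) (fdiff (\<lambda>x. c))" using Suc.prems(1) by (simp add: funpow_swap1)
    finally show ?thesis by (simp add: z fdiff_pow_simps)
  qed
  have sp: "(\<Sum>i<Suc (Suc m). sc (a i) ((fdiff ^^ i) q)) =
      sc (a 0) q + (\<Sum>i<Suc m. sc (a (Suc i)) ((fdiff ^^ Suc i) q))"
    by (subst sum.lessThan_Suc_shift) simp
  have "(fdiff ^^ Suc m) (\<Sum>i<Suc (Suc m). sc (a i) ((fdiff ^^ i) q)) = sc (a 0) ((fdiff ^^ Suc m) q)"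
    unfolding sp fdiff_pow_simps k by simp
  then have "sc (a 0) ((fdiff ^^ Suc m) q) = 0"
    unfolding Suc.prems(2) fdiff_pow_simps by (rule sym)
  then have a0: "a 0 = 0" using \<open>c \<noteq> 0\<close> unfolding Suc.prems(1) by (auto simp: fun_eq_iff fun_pw)
  have "(\<Sum>i<Suc m. sc (a (Suc i)) ((fdiff ^^ i) (fdiff q))) = 0"
    using Suc.prems(2) unfolding sp a0 by (simp add: funpow_swap1)
  moreover have "(fdiff ^^ m) (fdiff q) = (\<lambda>x. c)"
    using Suc.prems(1) by (simp add: funpow_swap1)
  ultimately have "j \<le> m \<Longrightarrow> a (Suc j) = 0" for j
    using Suc.IH[of "fdiff q" "\<lambda>j. a (Suc j)"] by blast
  then show ?case using a0 Suc.prems(3) by (cases i) auto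
qed

lemma fdiff_monomial:
  "fdiff (\<lambda>x. of_int x ^ n) = (\<Sum>i<n. sc (of_nat (n choose i)) (\<lambda>x. of_int x ^ i))"
proof
  fix x :: int
  have "(of_int x + 1 :: 'a) ^ n = (\<Sum>i\<le>n. of_nat (n choose i) * of_int x ^ i)"
    by (simp add: binomial_ring)
  also have "\<dots> = (\<Sum>i<n. of_nat (n choose i) * of_int x ^ i) + of_int x ^ n"
    by (simp add: lessThan_Suc_atMost[symmetric])
  finally show "fdiff (\<lambda>x. of_int x ^ n :: 'a) x =
      (\<Sum>i<n. sc (of_nat (n choose i)) (\<lambda>x. of_int x ^ i)) x"
    by (simp add: fdiff_apply fun_sum_apply sc_apply algebra_simps)
qed

lemma fdiff_pow_monomial_0: "n < m \<Longrightarrow> (fdiff ^^ m) (\<lambda>x. of_int x ^ n :: 'k::field) = 0"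
proof (induction n arbitrary: m rule: less_induct)
  case (less n)
  then obtain k where m: "m = Suc k" "n \<le> k" by (cases m) auto
  have "(fdiff ^^ m) (\<lambda>x. of_int x ^ n) = (fdiff ^^ k) (fdiff (\<lambda>x. of_int x ^ n :: 'k))"
    by (simp add: m(1) funpow_swap1)
  also have "\<dots> = (\<Sum>i<n. sc (of_nat (n choose i)) ((fdiff ^^ k) (\<lambda>x. of_int x ^ i)))"
    by (simp only: fdiff_monomial fdiff_pow_simps)
  also have "\<dots> = 0" using less m by (intro sum.neutral) simp
  finally show ?case .
qed

lemma fdiff_pow_monomial: "(fdiff ^^ n) (\<lambda>x. of_int x ^ n) = (\<lambda>x. of_nat (fact n) :: 'k::field)"
proof (induction n)
  case (Suc n)
  have "(fdiff ^^ Suc n) (\<lambda>x. of_int x ^ Suc n) = (fdiff ^^ n) (fdiff (\<lambda>x. of_int x ^ Suc n :: 'k))"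
    by (simp add: funpow_swap1)
  also have "\<dots> = (\<Sum>i<Suc n. sc (of_nat (Suc n choose i)) ((fdiff ^^ n) (\<lambda>x. of_int x ^ i)))"
    by (simp only: fdiff_monomial fdiff_pow_simps)
  also have "\<dots> = sc (of_nat (Suc n)) ((fdiff ^^ n) (\<lambda>x. of_int x ^ n))"
    by (simp add: fdiff_pow_monomial_0)
  finally show ?case unfolding Suc by (simp add: fun_eq_iff fun_pw algebra_simps del: funpow.simps)
qed simp

lemma fdiff_pow_binomial:
  "(fdiff ^^ n) f x = (\<Sum>k\<le>n. (-1) ^ (n - k) * of_nat (n choose k) * f (x + int k))"
proof (induction n arbitrary: x)
  case (Suc n)
  let ?t = "\<lambda>n k. (-1) ^ (n - k) * of_nat (n choose k) * f (x + int k)"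
  have "(fdiff ^^ Suc n) f x = (\<Sum>k\<le>n. (-1) ^ (n - k) * of_nat (n choose k) * f (x + 1 + int k)) -
      (\<Sum>k\<le>n. ?t n k)"
    by (simp add: fdiff_apply Suc)
  also have "(\<Sum>k\<le>n. ?t n k) = (\<Sum>k\<le>Suc n. ?t n k)" by (simp add: binomial_eq_0)
  also have "\<dots> = ?t n 0 + (\<Sum>k\<le>n. ?t n (Suc k))" by (rule sum.atMost_Suc_shift)
  also have "(\<Sum>k\<le>n. (-1) ^ (n - k) * of_nat (n choose k) * f (x + 1 + int k)) -
      (?t n 0 + (\<Sum>k\<le>n. ?t n (Suc k))) = - ?t n 0 +
      (\<Sum>k\<le>n. (-1) ^ (n - k) * of_nat (n choose k) * f (x + 1 + int k) - ?t n (Suc k))"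
    by (simp add: sum_subtractf)
  also have "(\<Sum>k\<le>n. (-1) ^ (n - k) * of_nat (n choose k) * f (x + 1 + int k) - ?t n (Suc k)) =
      (\<Sum>k\<le>n. ?t (Suc n) (Suc k))"
  proof (intro sum.cong refl)
    fix k assume "k \<in> {..n}"
    then consider "k = n" | "k < n" by force
    then show "(-1) ^ (n - k) * of_nat (n choose k) * f (x + 1 + int k) - ?t n (Suc k) = ?t (Suc n) (Suc k)"
    proof cases
      case 2
      then have "n - k = Suc (n - Suc k)" by simp
      then show ?thesis by (simp add: algebra_simps)
    qed (simp add: binomial_eq_0 algebra_simps)
  qed
  also have "- ?t n 0 + \<dots> = (\<Sum>k\<le>Suc n. ?t (Suc n) k)"
    by (subst sum.atMost_Suc_shift) simp
  finally show ?case .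
qed simp

section \<open>Arithmetic in characteristic p and functions modulo p\<close>

locale char_p =
  fixes p :: nat and ty :: "'k::field itself"
  assumes prime_p: "prime p" and char_p: "CHAR('k) = p"
begin

lemma p_ge_2: "p \<ge> 2"
  using prime_p by (rule prime_ge_2_nat)

lemma of_nat_0_iff: "of_nat n = (0::'k) \<longleftrightarrow> p dvd n"
  using of_nat_eq_0_iff_char_dvd[where 'a='k, of n] char_p by simp

lemma of_int_0_iff: "of_int n = (0::'k) \<longleftrightarrow> int p dvd n"
  using of_int_eq_0_iff_char_dvd[where 'a='k, of n] char_p by simp

lemma of_int_cong: "[a = b] (mod int p) \<Longrightarrow> of_int a = (of_int b :: 'k)"
  using of_int_0_iff[of "a - b"] by (simp add: cong_iff_dvd_diff)

lemma of_int_mod [simp]: "of_int (a mod int p) = (of_int a :: 'k)"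
  by (rule of_int_cong) (simp add: cong_def)

lemma of_nat_p [simp]: "of_nat p = (0::'k)"
  by (simp add: of_nat_0_iff)

lemma of_nat_p_minus_1: "of_nat (p - 1) = (-1::'k)"
proof -
  have "of_nat (p - 1) + 1 = (of_nat (p - 1 + 1) :: 'k)" by (simp only: of_nat_add of_nat_1)
  also have "\<dots> = 0" using p_ge_2 by simp
  finally show ?thesis by (simp add: eq_neg_iff_add_eq_0)
qed

text \<open>The top difference of a monomial is a factorial, so this makes monomials of degree below
  \<open>p\<close> admissible generators in \<open>newton_span\<close>.\<close>

lemma fact_neq_0: "n < p \<Longrightarrow> of_nat (fact n) \<noteq> (0::'k)"
  by (simp add: of_nat_0_iff prime_dvd_fact_iff[OF prime_p] del: of_nat_fact)

lemma fermat:
  assumes "\<not> int p dvd d"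
  shows "(of_int d :: 'k) ^ (p - 1) = 1"
proof -
  have "[nat (d mod int p) ^ (p - 1) = 1] (mod p)"
  proof (rule fermat_theorem[OF prime_p])
    show "\<not> p dvd nat (d mod int p)"
      using assms p_ge_2 by (metis dvd_mod_iff dvd_refl int_dvd_int_iff int_nat_eq of_nat_0_less_iff
        pos_mod_sign prime_gt_0_nat prime_p)
  qed
  then have "[int (nat (d mod int p)) ^ (p - 1) = 1] (mod int p)"
    by (metis cong_int_iff of_nat_1 of_nat_power)
  then have "of_int ((d mod int p) ^ (p - 1)) = (of_int 1 :: 'k)"
    using p_ge_2 by (intro of_int_cong) simp
  then show ?thesis by simp
qed

lemma fermat_power_cong:
  assumes "\<not> int p dvd d" "[m = n] (mod (p - 1))"
  shows "(of_int d :: 'k) ^ m = of_int d ^ n"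
proof -
  have "(of_int d :: 'k) ^ m = of_int d ^ (m mod (p - 1))" for m
  proof -
    have "(of_int d :: 'k) ^ m = of_int d ^ ((p - 1) * (m div (p - 1)) + m mod (p - 1))" by simp
    also have "\<dots> = of_int d ^ (m mod (p - 1))"
      by (simp only: power_add power_mult fermat[OF assms(1)] power_one mult_1)
    finally show ?thesis .
  qed
  then show ?thesis using assms(2) unfolding cong_def by metis
qed

text \<open>Functions on \<open>\<int>/p\<close> are \<open>p\<close>-periodic functions on \<open>int\<close>; among them \<open>pol l\<close> consists of the
  polynomial functions of degree less than \<open>l\<close>.\<close>

definition per :: "(int \<Rightarrow> 'k) set" where
  "per = {f. \<forall>x. f (x + int p) = f x}"

definition pol :: "nat \<Rightarrow> (int \<Rightarrow> 'k) set" where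
  "pol l = {f \<in> per. (fdiff ^^ l) f = 0}"

lemma per_cong:
  assumes "f \<in> per" "[x = y] (mod int p)"
  shows "f x = f y"
proof -
  have s: "f (x + int p) = f x" for x using assms(1) by (simp add: per_def)
  have "f (x + int p * k) = f x" for k x
  proof (induction k rule: int_induct[where k=0])
    case (step1 i)
    then show ?case using s[of "x + int p * i"] by (simp add: algebra_simps)
  next
    case (step2 i)
    then show ?case using s[of "x + int p * (i - 1)"] by (simp add: algebra_simps)
  qed simp
  moreover obtain k where "x = y + int p * k"
    using assms(2) by (metis cong_iff_lin cong_sym)
  ultimately show ?thesis by simp
qed

lemma perI:
  assumes "\<And>x y. [x = y] (mod int p) \<Longrightarrow> f x = f y"
  shows "f \<in> per"
proof -
  have "f (x + int p) = f x" for x by (rule assms) (simp add: cong_def)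
  then show ?thesis unfolding per_def by blast
qed

lemma subspace_per: "fs.subspace per"
  by (auto simp: fs.subspace_def per_def fun_pw)

lemma subspace_pol: "fs.subspace (pol l)"
  using subspace_per by (auto simp: fs.subspace_def pol_def fdiff_pow_simps)

lemma fdiff_per:
  assumes "f \<in> per"
  shows "fdiff f \<in> per"
  unfolding fdiff_def
  by (rule perI, intro arg_cong2[where f="(-)"] per_cong[OF assms]) (auto intro: cong_add)

lemma fdiff_pow_per: "f \<in> per \<Longrightarrow> (fdiff ^^ n) f \<in> per"
  by (induction n) (auto intro: fdiff_per)

lemma per_affine:
  assumes "f \<in> per"
  shows "(\<lambda>x. f (s * x + e)) \<in> per"
  by (rule perI, rule per_cong[OF assms]) (auto intro: cong_add cong_scalar_left)

lemma pol_affine: "f \<in> pol l \<Longrightarrow> (\<lambda>x. f (int s * x + e)) \<in> pol l"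
  by (auto simp: pol_def per_affine fdiff_pow_affine)

text \<open>This is \<open>(u - 1)^p = u^p - 1\<close> in characteristic \<open>p\<close>, for the
  translation \<open>u\<close> by 1: the inner binomial coefficients vanish, and periodicity
  identifies the two outer terms.\<close>

lemma fdiff_pow_p:
  assumes "f \<in> per"
  shows "(fdiff ^^ p) f = 0"
proof -
  have e: "(fdiff ^^ p) f x = f x * (1 + (-1) ^ p)" if "f \<in> per" for f :: "int \<Rightarrow> 'k" and x
  proof -
    obtain m where m: "p = Suc m" using p_ge_2 by (cases p) auto
    let ?t = "\<lambda>k. (-1) ^ (p - k) * of_nat (p choose k) * f (x + int k)"
    have "(fdiff ^^ p) f x = (\<Sum>k\<le>p. ?t k)" by (rule fdiff_pow_binomial)
    also have "\<dots> = (\<Sum>k\<in>{0, p}. ?t k)"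
    proof (rule sum.mono_neutral_right)
      show "\<forall>k\<in>{..p} - {0, p}. ?t k = 0"
      proof
        fix k assume "k \<in> {..p} - {0, p}"
        then have "0 < k" "k < p" by auto
        then have "p dvd (p choose k)" using prime_p by (intro dvd_choose_prime) auto
        then have "of_nat (p choose k) = (0::'k)" by (simp only: of_nat_0_iff)
        then show "?t k = 0" by simp
      qed
    qed auto
    also have "\<dots> = f x * (1 + (-1) ^ p)"
      using p_ge_2 per_cong[OF that, of "x + int p" x] by (simp add: cong_def algebra_simps)
    finally show ?thesis .
  qed
  \<comment> \<open>The constant function 1 has vanishing differences, so the formula forces
    \<open>1 + (-1) ^ p = 0\<close> for even and odd \<open>p\<close> alike.\<close>
  have 1: "(\<lambda>x. 1) \<in> per" by (simp add: per_def)
  have "fdiff (\<lambda>x. 1 :: 'k) = 0" by (simp add: fdiff_def fun_eq_iff fun_pw)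
  then have "(fdiff ^^ 1) (\<lambda>x. 1 :: 'k) = 0" by simp
  then have "(fdiff ^^ p) (\<lambda>x. 1 :: 'k) = 0"
    by (rule fdiff_pow_vanish_mono) (use p_ge_2 in simp)
  then have "1 + (-1) ^ p = (0::'k)" using e[OF 1, of 0] by (simp add: fun_pw)
  then show ?thesis using e[OF assms] by (simp add: fun_eq_iff fun_pw)
qed

lemma pol_p: "pol p = per"
  by (auto simp: pol_def fdiff_pow_p)

lemma monomial_per: "(\<lambda>x. of_int x ^ n :: 'k) \<in> per"
  by (rule perI) (metis of_int_cong)

lemma monomial_pol: "n < l \<Longrightarrow> (\<lambda>x. of_int x ^ n :: 'k) \<in> pol l"
  by (simp add: pol_def monomial_per fdiff_pow_monomial_0)

lemma sum_per_shift:
  assumes "f \<in> per"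
  shows "(\<Sum>b\<in>{0..<int p}. f (b + e)) = (\<Sum>b\<in>{0..<int p}. f b)"
proof -
  have p0: "int p > 0" using p_ge_2 by simp
  have "(\<Sum>b\<in>{0..<int p}. f (b + e)) = (\<Sum>b\<in>{0..<int p}. f ((b + e) mod int p))"
    by (intro sum.cong refl per_cong[OF assms]) (simp add: cong_def)
  also have "\<dots> = (\<Sum>b\<in>{0..<int p}. f b)"
    by (rule sum.reindex_bij_witness[of _ "\<lambda>b. (b - e) mod int p" "\<lambda>b. (b + e) mod int p"])
      (use p0 in \<open>auto simp: mod_simps\<close>)
  finally show ?thesis .
qed

section \<open>Convolution modulo p and the covers of the modules \<open>pol\<close>\<close>

definition conv :: "(int \<Rightarrow> 'k) \<Rightarrow> (int \<Rightarrow> 'k) \<Rightarrow> int \<Rightarrow> 'k" where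
  "conv g f = (\<lambda>x. \<Sum>b\<in>{0..<int p}. g b * f (x - b))"

lemma conv_simps:
  "conv g (f + f') = conv g f + conv g f'" "conv g (sc c f) = sc c (conv g f)" "conv g 0 = 0"
  "conv g (\<Sum>i\<in>A. h i) = (\<Sum>i\<in>A. conv g (h i))"
proof -
  show add: "conv g (f + f') = conv g f + conv g f'" for f f'
    by (simp add: fun_eq_iff fun_pw conv_def algebra_simps sum.distrib)
  show "conv g (sc c f) = sc c (conv g f)"
    by (simp add: fun_eq_iff fun_pw conv_def algebra_simps sum_distrib_left)
  show "conv g 0 = 0" by (simp add: fun_eq_iff fun_pw conv_def)
  then show "conv g (\<Sum>i\<in>A. h i) = (\<Sum>i\<in>A. conv g (h i))"
    by (induction A rule: infinite_finite_induct) (auto simp: add)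
qed

lemma conv_per:
  assumes "f \<in> per"
  shows "conv g f \<in> per"
  unfolding conv_def
  by (rule perI, intro sum.cong refl arg_cong2[where f="(*)"] per_cong[OF assms])
    (auto intro: cong_diff)

lemma fdiff_conv: "fdiff (conv g f) = conv g (fdiff f)"
  by (simp add: fun_eq_iff fun_pw conv_def fdiff_apply sum_subtractf algebra_simps)

lemma fdiff_pow_conv: "(fdiff ^^ n) (conv g f) = conv g ((fdiff ^^ n) f)"
  by (induction n) (auto simp: fdiff_conv)

lemma fdiff_conv_left:
  assumes "g \<in> per" "f \<in> per"
  shows "fdiff (conv g f) = conv (fdiff g) f"
proof
  fix x
  have "(\<lambda>b. g b * f (x + 1 - b)) \<in> per"
    by (rule perI, intro arg_cong2[where f="(*)"] per_cong[OF assms(1)] per_cong[OF assms(2)])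
      (auto intro: cong_diff)
  from sum_per_shift[OF this, of 1]
  have "(\<Sum>b\<in>{0..<int p}. g b * f (x + 1 - b)) = (\<Sum>b\<in>{0..<int p}. g (b + 1) * f (x - b))" by simp
  then show "fdiff (conv g f) x = conv (fdiff g) f x"
    by (simp add: fdiff_apply conv_def sum_subtractf algebra_simps)
qed

lemma fdiff_pow_conv_left:
  assumes "g \<in> per" "f \<in> per"
  shows "(fdiff ^^ n) (conv g f) = conv ((fdiff ^^ n) g) f"
  by (induction n) (auto simp: fdiff_conv_left fdiff_pow_per assms)

lemma sum_top_monomial: "(\<Sum>b\<in>{0..<int p}. of_int b ^ (p - 1)) = (-1 :: 'k)"
proof -
  \<comment> \<open>The residue 0 contributes nothing, as the exponent \<open>p - 1\<close> is
    positive; each of the other \<open>p - 1\<close> residues contributes 1.\<close>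
  have s: "{0..<int p} = insert 0 {1..<int p}" using p_ge_2 by auto
  have "(\<Sum>b\<in>{1..<int p}. of_int b ^ (p - 1)) = (\<Sum>b\<in>{1..<int p}. 1 :: 'k)"
    by (intro sum.cong refl fermat) (auto dest: zdvd_imp_le)
  also have "\<dots> = of_nat (p - 1)" using p_ge_2 by (simp add: nat_diff_distrib)
  finally show ?thesis unfolding s using p_ge_2 of_nat_p_minus_1 by simp
qed

text \<open>Convolution commutes with translations; for \<open>1 \<le> l\<close> and
  \<open>l < p\<close> this one is a unit times \<open>fdiff ^^ l\<close>. The monomial kernel is
  chosen because rescaling the variable multiplies it by a character, which makes the map
  equivariant for the torus, unlike \<open>fdiff ^^ l\<close> itself. It projects the projective
  module \<open>per\<close> onto \<open>pol (p - l)\<close> with kernel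
  \<open>pol l\<close>.\<close>

definition twist :: "nat \<Rightarrow> (int \<Rightarrow> 'k) \<Rightarrow> int \<Rightarrow> 'k" where
  "twist l f = conv (\<lambda>x. of_int x ^ (p - 1 - l)) f"

text \<open>The differences of a function \<open>q\<close> of degree \<open>p - 1\<close> form a
  basis of \<open>per\<close>, and \<open>twist l\<close> sends them to the corresponding
  differences of \<open>r = twist l q\<close>. As \<open>r\<close> has exact degree
  \<open>p - 1 - l\<close>, the first \<open>p - l\<close> images form a basis of
  \<open>pol (p - l)\<close> and the others vanish, so kernel and image can be read off.\<close>

lemma twist_props:
  assumes l: "1 \<le> l" "l < p"
  shows twist_pol: "f \<in> per \<Longrightarrow> twist l f \<in> pol (p - l)"
    and twist_kernel: "{f \<in> per. twist l f = 0} = pol l"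
    and twist_surj: "h \<in> pol (p - l) \<Longrightarrow> \<exists>f\<in>per. h = twist l f"
proof -
  define D where "D = p - 1 - l"
  have D: "Suc D = p - l" "p = Suc (p - 1)" "D < p" using l by (auto simp: D_def)
  let ?m = "\<lambda>x. of_int x ^ D :: 'k"
  have tw: "twist l f = conv ?m f" for f by (simp add: twist_def D_def)
  have 0: "(fdiff ^^ Suc D) (conv ?m f) = 0" if "f \<in> per" for f
    using fdiff_pow_conv_left[OF monomial_per that, where n="Suc D"]
    by (simp add: fdiff_pow_monomial_0 conv_def fun_eq_iff fun_pw del: funpow.simps)
  show 1: "twist l f \<in> pol (p - l)" if "f \<in> per" for f
    using that 0 D by (simp add: tw pol_def conv_per del: funpow.simps)
  define q where "q = (\<lambda>x. of_int x ^ (p - 1) :: 'k)"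
  have q: "q \<in> per" by (simp add: q_def monomial_per)
  have qt: "(fdiff ^^ (p - 1)) q = (\<lambda>x. of_nat (fact (p - 1)))"
    by (simp add: q_def fdiff_pow_monomial)
  have qc: "of_nat (fact (p - 1)) \<noteq> (0::'k)" by (rule fact_neq_0) (use p_ge_2 in simp)
  have sq: "(\<Sum>b\<in>{0..<int p}. q (x - b)) = -1" for x
  proof -
    have "(\<Sum>b\<in>{0..<int p}. q (x - b)) = (\<Sum>b\<in>{0..<int p}. q ((x - b) mod int p))"
      by (intro sum.cong refl per_cong[OF q]) (simp add: cong_def)
    also have "\<dots> = (\<Sum>b\<in>{0..<int p}. q b)"
      by (rule sum.reindex_bij_witness[of _ "\<lambda>b. (x - b) mod int p" "\<lambda>b. (x - b) mod int p"])
        (use p_ge_2 in \<open>auto simp: mod_simps\<close>)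
    also have "\<dots> = -1" unfolding q_def by (rule sum_top_monomial)
    finally show ?thesis .
  qed
  define r where "r = twist l q"
  \<comment> \<open>The differences fall on the monomial and leave the constant
    \<open>fact D\<close>; convolving a constant with \<open>q\<close> multiplies it by the sum of
    \<open>q\<close> over a period, which is -1.\<close>
  have rt: "(fdiff ^^ D) r = (\<lambda>x. - of_nat (fact D))"
  proof -
    have "(fdiff ^^ D) r = conv ((fdiff ^^ D) ?m) q"
      unfolding r_def tw by (rule fdiff_pow_conv_left[OF monomial_per q])
    then show ?thesis
      by (simp add: fdiff_pow_monomial conv_def sum_distrib_left[symmetric] sq del: of_nat_fact)
  qed
  have rc: "- of_nat (fact D) \<noteq> (0::'k)" using fact_neq_0[OF D(3)] by simp
  have tw_pow: "twist l ((fdiff ^^ i) q) = (fdiff ^^ i) r" for i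
    by (simp add: tw r_def fdiff_pow_conv)
  have r0: "(fdiff ^^ i) r = 0" if "Suc D \<le> i" for i
    by (rule fdiff_pow_vanish_mono[OF _ that]) (simp add: r_def tw 0[OF q] del: funpow.simps)
  have expand: "twist l (\<Sum>i<p. sc (a i) ((fdiff ^^ i) q)) = (\<Sum>i<Suc D. sc (a i) ((fdiff ^^ i) r))" for a
  proof -
    have "twist l (\<Sum>i<p. sc (a i) ((fdiff ^^ i) q)) = (\<Sum>i<p. sc (a i) ((fdiff ^^ i) r))"
      by (simp only: tw conv_simps) (simp only: tw[symmetric] tw_pow)
    also have "\<dots> = (\<Sum>i<Suc D. sc (a i) ((fdiff ^^ i) r))"
      by (rule sum.mono_neutral_right) (use D r0 in auto)
    finally show ?thesis .
  qed
  have qspan: "\<exists>a. f = (\<Sum>i<p. sc (a i) ((fdiff ^^ i) q))" if "f \<in> per" for f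
    using newton_span[OF qt qc, of f] that fdiff_pow_p D(2) by simp
  show "{f \<in> per. twist l f = 0} = pol l"
  proof (intro equalityI subsetI)
    fix f assume f: "f \<in> {f \<in> per. twist l f = 0}"
    then obtain a where a: "f = (\<Sum>i<p. sc (a i) ((fdiff ^^ i) q))" using qspan by blast
    have "(\<Sum>i<Suc D. sc (a i) ((fdiff ^^ i) r)) = 0" using f expand a by simp
    then have z: "a i = 0" if "i \<le> D" for i using newton_independent[OF rt rc] that by blast
    have "(fdiff ^^ l) f = (\<Sum>i<p. sc (a i) ((fdiff ^^ (l + i)) q))"
      by (simp only: a fdiff_pow_simps fdiff_pow_add)
    also have "\<dots> = 0"
    proof (intro sum.neutral ballI)
      fix i
      show "sc (a i) ((fdiff ^^ (l + i)) q) = 0"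
      proof (cases "i \<le> D")
        case False
        then have "(fdiff ^^ (l + i)) q = 0"
          using D by (intro fdiff_pow_vanish_mono[OF fdiff_pow_p[OF q]]) linarith
        then show ?thesis by simp
      qed (simp add: z)
    qed
    finally show "f \<in> pol l" using f by (simp add: pol_def)
  next
    fix f assume f: "f \<in> pol l"
    \<comment> \<open>A generator of \<open>pol l\<close>: the difference of order
      \<open>p - l\<close> of \<open>q\<close> has exact degree \<open>l - 1\<close>. All its
      differences go to differences of \<open>r\<close> of order at least \<open>p - l\<close>,
      which are zero.\<close>
    let ?q = "(fdiff ^^ (Suc D)) q"
    have lD: "Suc D + (l - 1) = p - 1" "l = Suc (l - 1)" using D l by auto
    have t: "(fdiff ^^ (l - 1)) ?q = (\<lambda>x. of_nat (fact (p - 1)))"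
      using fdiff_pow_add[of "l - 1" "Suc D" q] qt lD by (simp add: add.commute del: funpow.simps)
    have "(fdiff ^^ Suc (l - 1)) f = 0" using f lD(2) by (simp add: pol_def)
    from newton_span[OF t qc this]
    obtain a where a: "f = (\<Sum>i<Suc (l - 1). sc (a i) ((fdiff ^^ i) ?q))" by blast
    have "twist l f = (\<Sum>i<Suc (l - 1). sc (a i) ((fdiff ^^ (i + Suc D)) r))"
      by (simp only: a tw conv_simps fdiff_pow_add[symmetric]) (simp only: tw[symmetric] tw_pow)
    also have "\<dots> = 0" by (intro sum.neutral ballI) (simp add: r0 del: funpow.simps)
    finally show "f \<in> {f \<in> per. twist l f = 0}" using f by (simp add: pol_def)
  qed
  show "\<exists>f\<in>per. h = twist l f" if h: "h \<in> pol (p - l)"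
  proof -
    have "(fdiff ^^ Suc D) h = 0" using h D by (simp add: pol_def)
    from newton_span[OF rt rc this]
    obtain a where a: "h = (\<Sum>i<Suc D. sc (a i) ((fdiff ^^ i) r))" by blast
    let ?f = "\<Sum>i<p. sc (a i) ((fdiff ^^ i) q)"
    have "?f \<in> per"
      by (intro fs.subspace_sum[OF subspace_per] fs.subspace_scale[OF subspace_per] fdiff_pow_per q)
    with a expand show ?thesis by metis
  qed
qed

end

section \<open>The Borel subgroup of \<open>SL(2,p)\<close>\<close>

context char_p
begin

abbreviation "SL \<equiv> SL2 p"

section \<open>Matrices modulo p as a finite group\<close>

text \<open>The arguments may be any integers and are reduced on construction, so that identities
  between group elements become congruences.\<close>

definition sl :: "int \<Rightarrow> int \<Rightarrow> int \<Rightarrow> int \<Rightarrow> int^2^2" where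
  "sl a b c d = (\<chi> i j. (if i = 1 then if j = 1 then a else b else if j = 1 then c else d) mod int p)"

lemma sl_entries [simp]:
  "sl a b c d $ 1 $ 1 = a mod int p" "sl a b c d $ 1 $ 2 = b mod int p"
  "sl a b c d $ 2 $ 1 = c mod int p" "sl a b c d $ 2 $ 2 = d mod int p"
  by (simp_all add: sl_def)

lemma sl_eq_iff:
  "sl a b c d = sl a' b' c' d' \<longleftrightarrow>
     [a = a'] (mod int p) \<and> [b = b'] (mod int p) \<and> [c = c'] (mod int p) \<and> [d = d'] (mod int p)"
  by (auto simp: vec_eq_iff forall_2 cong_def)

lemma sl_cong:
  "[a = a'] (mod int p) \<Longrightarrow> [b = b'] (mod int p) \<Longrightarrow> [c = c'] (mod int p) \<Longrightarrow> [d = d'] (mod int p) \<Longrightarrow>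
     sl a b c d = sl a' b' c' d'"
  by (simp add: sl_eq_iff)

lemma sl_carrier_iff [simp]: "sl a b c d \<in> carrier SL \<longleftrightarrow> [a * d - b * c = 1] (mod int p)"
proof -
  have "[a mod int p * (d mod int p) - b mod int p * (c mod int p) = a * d - b * c] (mod int p)"
    by (intro cong_diff cong_mult) (auto simp: cong_def)
  then have "[a mod int p * (d mod int p) - b mod int p * (c mod int p) = 1] (mod int p) \<longleftrightarrow>
      [a * d - b * c = 1] (mod int p)"
    by (simp add: cong_def)
  then show ?thesis using p_ge_2 by (simp add: SL2_def det_2 forall_2)
qed

lemma SL_cases:
  assumes "A \<in> carrier SL"
  obtains a b c d where "A = sl a b c d" "[a * d - b * c = 1] (mod int p)"
proof
  have e: "A $ i $ j mod int p = A $ i $ j" for i j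
    using assms by (simp add: SL2_def)
  show "A = sl (A $ 1 $ 1) (A $ 1 $ 2) (A $ 2 $ 1) (A $ 2 $ 2)"
    by (simp add: vec_eq_iff forall_2 e)
  show "[A $ 1 $ 1 * A $ 2 $ 2 - A $ 1 $ 2 * A $ 2 $ 1 = 1] (mod int p)"
    using assms by (simp add: SL2_def det_2)
qed

lemma sl_mult [simp]:
  "sl a b c d \<otimes>\<^bsub>SL\<^esub> sl a' b' c' d' = sl (a * a' + b * c') (a * b' + b * d') (c * a' + d * c') (c * b' + d * d')"
proof -
  have "[x mod int p * (y mod int p) + z mod int p * (w mod int p) = x * y + z * w] (mod int p)" for x y z w
    by (intro cong_add cong_mult) (auto simp: cong_def)
  then show ?thesis
    by (simp add: SL2_def vec_eq_iff forall_2 matrix_matrix_mult_def sum_2 cong_def)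
qed

lemma sl_one: "\<one>\<^bsub>SL\<^esub> = sl 1 0 0 1"
  using p_ge_2 by (simp add: SL2_def vec_eq_iff forall_2 mat_def)

lemma group_SL: "group SL"
proof (rule groupI)
  fix x y assume "x \<in> carrier SL" "y \<in> carrier SL"
  then obtain a b c d a' b' c' d' where x: "x = sl a b c d" "[a * d - b * c = 1] (mod int p)"
    and y: "y = sl a' b' c' d'" "[a' * d' - b' * c' = 1] (mod int p)"
    by (metis SL_cases)
  have "[(a * d - b * c) * (a' * d' - b' * c') = 1 * 1] (mod int p)"
    by (rule cong_mult) (rule x y)+
  moreover have "(a * d - b * c) * (a' * d' - b' * c') =
      (a * a' + b * c') * (c * b' + d * d') - (a * b' + b * d') * (c * a' + d * c')"
    by (simp add: algebra_simps)
  ultimately show "x \<otimes>\<^bsub>SL\<^esub> y \<in> carrier SL" using x y by simp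
next
  show "\<one>\<^bsub>SL\<^esub> \<in> carrier SL" by (simp add: sl_one)
next
  fix x y z assume "x \<in> carrier SL" "y \<in> carrier SL" "z \<in> carrier SL"
  then show "x \<otimes>\<^bsub>SL\<^esub> y \<otimes>\<^bsub>SL\<^esub> z = x \<otimes>\<^bsub>SL\<^esub> (y \<otimes>\<^bsub>SL\<^esub> z)"
    by (elim SL_cases) (auto simp: algebra_simps)
next
  fix x assume "x \<in> carrier SL"
  then show "\<one>\<^bsub>SL\<^esub> \<otimes>\<^bsub>SL\<^esub> x = x"
    by (elim SL_cases) (simp add: sl_one)
next
  fix x assume "x \<in> carrier SL"
  then obtain a b c d where x: "x = sl a b c d" "[a * d - b * c = 1] (mod int p)" by (rule SL_cases)
  show "\<exists>y\<in>carrier SL. y \<otimes>\<^bsub>SL\<^esub> x = \<one>\<^bsub>SL\<^esub>"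
  proof
    show "sl d (- b) (- c) a \<in> carrier SL" using x(2) by (simp add: mult.commute)
    show "sl d (- b) (- c) a \<otimes>\<^bsub>SL\<^esub> x = \<one>\<^bsub>SL\<^esub>"
      using x by (auto simp: sl_one sl_eq_iff algebra_simps)
  qed
qed

lemma finite_SL: "finite (carrier SL)"
proof (rule finite_subset)
  let ?S = "{0..<int p}"
  show "carrier SL \<subseteq> (\<lambda>(a, b, c, d). sl a b c d) ` (?S \<times> ?S \<times> ?S \<times> ?S)"
  proof
    fix A assume "A \<in> carrier SL"
    then obtain a b c d where A: "A = sl a b c d" by (rule SL_cases)
    have "A = (\<lambda>(a, b, c, d). sl a b c d) (a mod int p, b mod int p, c mod int p, d mod int p)"
      unfolding A by (simp add: sl_eq_iff cong_def)
    then show "A \<in> (\<lambda>(a, b, c, d). sl a b c d) ` (?S \<times> ?S \<times> ?S \<times> ?S)"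
      using p_ge_2
      by (intro image_eqI[where x="(a mod int p, b mod int p, c mod int p, d mod int p)"]) auto
  qed
qed auto

sublocale SL: finite_group SL
  by (intro finite_group.intro group_SL finite_group_axioms.intro finite_SL)

lemma sl_inv:
  assumes "[a * d - b * c = 1] (mod int p)"
  shows "inv\<^bsub>SL\<^esub> (sl a b c d) = sl d (- b) (- c) a"
proof (rule SL.inv_equality)
  show "sl d (- b) (- c) a \<otimes>\<^bsub>SL\<^esub> sl a b c d = \<one>\<^bsub>SL\<^esub>"
    using assms by (auto simp: sl_one sl_eq_iff algebra_simps)
qed (use assms in \<open>simp_all add: mult.commute\<close>)

section \<open>The Borel subgroup, its torus and the Weyl element\<close>

definition borel :: "(int^2^2) set" where
  "borel = {A \<in> carrier SL. A $ 2 $ 1 = 0}"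

abbreviation "BB \<equiv> SL\<lparr>carrier := borel\<rparr>"

definition ut :: "int \<Rightarrow> int^2^2" where "ut x = sl 1 x 0 1"

text \<open>Fermat's inverse of \<open>d\<close> modulo \<open>p\<close>. Being a power, it is
  multiplicative, respects congruences and is itself visible as a power of \<open>d\<close> in
  weights.\<close>

definition dinv :: "int \<Rightarrow> int" where "dinv d = d ^ (p - 2)"

definition tt :: "int \<Rightarrow> int^2^2" where "tt d = sl (dinv d) 0 0 d"

text \<open>\<open>ww x\<close> is \<open>ut x\<close> times the Weyl element \<open>ww 0\<close>;
  these matrices represent the cosets in the big Bruhat cell.\<close>

definition ww :: "int \<Rightarrow> int^2^2" where "ww x = sl x (- 1) 1 0"

lemma not_dvd_interval: "d \<in> {1..<int p} \<Longrightarrow> \<not> int p dvd d"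
  by (auto dest: zdvd_imp_le)

lemma int_fermat:
  assumes "\<not> int p dvd d"
  shows "[d ^ (p - 1) = 1] (mod int p)"
proof -
  have "of_int (d ^ (p - 1) - 1) = (0::'k)" using fermat[OF assms] by simp
  then show ?thesis by (simp only: of_int_0_iff cong_iff_dvd_diff)
qed

lemma dinv: "\<not> int p dvd d \<Longrightarrow> [dinv d * d = 1] (mod int p)" "\<not> int p dvd d \<Longrightarrow> [d * dinv d = 1] (mod int p)"
proof -
  have "dinv d * d = d ^ (p - 1)"
  proof -
    have "p - 1 = Suc (p - 2)" using p_ge_2 by simp
    then show ?thesis by (simp add: dinv_def)
  qed
  then show "\<not> int p dvd d \<Longrightarrow> [dinv d * d = 1] (mod int p)" "\<not> int p dvd d \<Longrightarrow> [d * dinv d = 1] (mod int p)"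
    using int_fermat by (simp_all add: mult.commute)
qed

lemma prime_int_p: "prime (int p)"
  using prime_p by simp

lemma unit_not_dvd:
  assumes "[a * d = 1] (mod int p)"
  shows "\<not> int p dvd d" "\<not> int p dvd a"
proof -
  have "\<not> int p dvd a * d"
    using cong_dvd_iff[OF assms] p_ge_2 by (auto simp: zdvd1_eq)
  then show "\<not> int p dvd d" "\<not> int p dvd a" by auto
qed

lemma dinv_unique:
  assumes "[a * d = 1] (mod int p)"
  shows "[a = dinv d] (mod int p)"
proof -
  note u = unit_not_dvd(1)[OF assms]
  have "[a * (d * dinv d) = a * 1] (mod int p)" by (intro cong_mult cong_refl dinv u)
  then have 1: "[a = a * d * dinv d] (mod int p)" by (simp add: mult.assoc cong_sym)
  have "[a * d * dinv d = 1 * dinv d] (mod int p)" by (intro cong_mult cong_refl assms)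
  with 1 show ?thesis by (metis cong_trans mult_1)
qed

lemma borel_iff: "sl a b c d \<in> borel \<longleftrightarrow> [c = 0] (mod int p) \<and> [a * d = 1] (mod int p)"
proof
  assume "sl a b c d \<in> borel"
  then have c: "[c = 0] (mod int p)" and "[a * d - b * c = 1] (mod int p)"
    by (auto simp: borel_def cong_def)
  moreover have "[a * d - b * c = a * d - b * 0] (mod int p)"
    by (intro cong_diff cong_mult cong_refl c)
  ultimately show "[c = 0] (mod int p) \<and> [a * d = 1] (mod int p)"
    by (metis cong_sym cong_trans diff_zero mult_zero_right)
next
  assume c: "[c = 0] (mod int p) \<and> [a * d = 1] (mod int p)"
  then have "[a * d - b * c = 1 - b * 0] (mod int p)"
    by (intro cong_diff cong_mult cong_refl) auto
  then show "sl a b c d \<in> borel" using c by (simp add: borel_def cong_def)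
qed

text \<open>The upper right entry is written \<open>x * d\<close> because the matrix is then the
  product of \<open>ut x\<close> and \<open>tt d\<close>.\<close>

lemma borel_cases:
  assumes "A \<in> borel"
  obtains x d where "A = sl (dinv d) (x * d) 0 d" "\<not> int p dvd d"
proof -
  have "A \<in> carrier SL" using assms by (simp add: borel_def)
  then obtain a b c d where A: "A = sl a b c d" by (rule SL_cases)
  then have c: "[c = 0] (mod int p)" "[a * d = 1] (mod int p)"
    using assms by (simp_all add: borel_iff)
  note u = unit_not_dvd(1)[OF c(2)]
  have "[b * (dinv d * d) = b * 1] (mod int p)" by (intro cong_mult cong_refl dinv u)
  then have "[b = b * dinv d * d] (mod int p)" by (simp add: mult.assoc cong_sym)
  then have "A = sl (dinv d) (b * dinv d * d) 0 d"
    unfolding A by (intro sl_cong dinv_unique c cong_refl)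
  then show thesis using u that by blast
qed

lemma borel_sl: "\<not> int p dvd d \<Longrightarrow> sl (dinv d) b 0 d \<in> borel"
  by (simp add: borel_iff dinv)

lemma subgroup_borel: "subgroup borel SL"
proof (rule SL.subgroupI)
  show "borel \<subseteq> carrier SL" by (auto simp: borel_def)
  have "\<one>\<^bsub>SL\<^esub> \<in> borel" by (simp add: sl_one borel_iff)
  then show "borel \<noteq> {}" by blast
  fix A assume "A \<in> borel"
  then obtain x d where A: "A = sl (dinv d) (x * d) 0 d" "\<not> int p dvd d" by (rule borel_cases)
  then have "inv\<^bsub>SL\<^esub> A = sl d (- (x * d)) (- 0) (dinv d)"
    unfolding A(1) by (intro sl_inv) (simp add: dinv)
  then show "inv\<^bsub>SL\<^esub> A \<in> borel" using A(2) by (simp add: borel_iff dinv)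
next
  fix A B assume "A \<in> borel" "B \<in> borel"
  then obtain x d y e where A: "A = sl (dinv d) (x * d) 0 d" "\<not> int p dvd d"
    and B: "B = sl (dinv e) (y * e) 0 e" "\<not> int p dvd e" by (metis borel_cases)
  have "[(dinv d * d) * (dinv e * e) = 1 * 1] (mod int p)" using A B by (intro cong_mult dinv)
  then have "[dinv d * dinv e * (d * e) = 1] (mod int p)" by (simp add: algebra_simps)
  then show "A \<otimes>\<^bsub>SL\<^esub> B \<in> borel" using A B by (simp add: borel_iff)
qed

lemma ut_borel: "ut x \<in> borel" and tt_borel: "\<not> int p dvd d \<Longrightarrow> tt d \<in> borel"
  by (simp_all add: ut_def tt_def borel_iff dinv)

lemma ww_carrier: "ww x \<in> carrier SL"
  by (simp add: ww_def)

lemma ut_mult: "ut x \<otimes>\<^bsub>SL\<^esub> ut y = ut (x + y)"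
  by (simp add: ut_def add.commute)

lemma ut_eq_iff: "ut x = ut y \<longleftrightarrow> [x = y] (mod int p)"
  by (simp add: ut_def sl_eq_iff)

lemma tt_mult_ut: "tt d \<otimes>\<^bsub>SL\<^esub> ut x = sl (dinv d) (dinv d * x) 0 d"
  by (simp add: ut_def tt_def)

text \<open>The cosets of the Borel subgroup are the \<open>p + 1\<close> points of the projective
  line over the prime field; the unit stands for the point at infinity.\<close>

definition bruhat :: "(int^2^2) set" where
  "bruhat = insert \<one>\<^bsub>SL\<^esub> (ww ` {0..<int p})"

lemma interval_inj: "x \<in> {0..<int p} \<Longrightarrow> y \<in> {0..<int p} \<Longrightarrow> [x = y] (mod int p) \<Longrightarrow> x = y"
  by (simp add: cong_def)

lemma ww_inj: "inj_on ww {0..<int p}"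
  by (rule inj_onI, rule interval_inj) (auto simp: ww_def sl_eq_iff)

lemma one_not_ww: "\<one>\<^bsub>SL\<^esub> \<notin> ww ` {0..<int p}"
proof -
  have "\<not> [0 = 1] (mod int p)" using p_ge_2 by (simp add: cong_def)
  then show ?thesis by (auto simp: ww_def sl_one sl_eq_iff)
qed

lemma card_bruhat: "card bruhat = p + 1"
  unfolding bruhat_def using one_not_ww by (simp add: card_image[OF ww_inj])

lemma transversal_borel: "transversal SL borel bruhat"
proof (intro transversal.intro transversal_axioms.intro SL.finite_group_axioms subgroup_borel)
  show R: "bruhat \<subseteq> carrier SL" by (auto simp: bruhat_def ww_carrier)
  have Bc: "h \<in> carrier SL" if "h \<in> borel" for h using that by (simp add: borel_def)
  have w_not: "ww x \<otimes>\<^bsub>SL\<^esub> h \<notin> borel" if hb: "h \<in> borel" for x h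
  proof -
    obtain y d where h: "h = sl (dinv d) (y * d) 0 d" "\<not> int p dvd d" using hb by (rule borel_cases)
    have "\<not> int p dvd dinv d" using unit_not_dvd dinv h(2) by blast
    then show ?thesis unfolding h ww_def by (simp add: borel_iff cong_0_iff)
  qed
  show "bij_betw (\<lambda>(r, h). r \<otimes>\<^bsub>SL\<^esub> h) (bruhat \<times> borel) (carrier SL)"
    unfolding bij_betw_def
  proof
    have "r = r'" if r: "r \<in> bruhat" "r' \<in> bruhat" and h: "h \<in> borel" "h' \<in> borel"
      and e: "r \<otimes>\<^bsub>SL\<^esub> h = r' \<otimes>\<^bsub>SL\<^esub> h'" for r r' h h'
    proof -
      have oneB: "\<one>\<^bsub>SL\<^esub> \<otimes>\<^bsub>SL\<^esub> h \<in> borel" if "h \<in> borel" for h using that Bc by simp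
      consider "r = \<one>\<^bsub>SL\<^esub>" "r' = \<one>\<^bsub>SL\<^esub>" | x where "r = \<one>\<^bsub>SL\<^esub>" "r' = ww x" | x where "r = ww x" "r' = \<one>\<^bsub>SL\<^esub>"
        | x y where "r = ww x" "r' = ww y" "x \<in> {0..<int p}" "y \<in> {0..<int p}"
        using r unfolding bruhat_def by blast
      then show ?thesis
      proof cases
        case 2
        then show ?thesis using w_not[OF h(2)] oneB[OF h(1)] e by metis
      next
        case 3
        then show ?thesis using w_not[OF h(1)] oneB[OF h(2)] e by metis
      next
        case 4
        obtain z d z' d' where h1: "h = sl (dinv d) (z * d) 0 d" "\<not> int p dvd d"
          and h2: "h' = sl (dinv d') (z' * d') 0 d'" "\<not> int p dvd d'" using h by (metis borel_cases)
        have c: "[x * dinv d = y * dinv d'] (mod int p)" "[dinv d = dinv d'] (mod int p)"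
          using e unfolding 4 h1 h2 ww_def by (auto simp: sl_eq_iff)
        have cp: "coprime (dinv d) (int p)"
          using unit_not_dvd(2)[OF dinv(1)[OF h1(2)]] prime_int_p
          by (metis coprime_commute prime_imp_coprime)
        have "[x * dinv d = y * dinv d] (mod int p)"
          using c by (metis cong_scalar_left cong_sym cong_trans)
        then have "[x = y] (mod int p)" using cong_mult_rcancel[OF cp] by blast
        then show ?thesis using 4 interval_inj by blast
      qed simp
    qed
    then have "r = r' \<and> h = h'" if r: "r \<in> bruhat" "r' \<in> bruhat" and h: "h \<in> borel" "h' \<in> borel"
      and e: "r \<otimes>\<^bsub>SL\<^esub> h = r' \<otimes>\<^bsub>SL\<^esub> h'" for r r' h h'
      using SL.Units_l_cancel[of r' h h'] that R Bc by (metis SL.Units_eq subsetD)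
    then show "inj_on (\<lambda>(r, h). r \<otimes>\<^bsub>SL\<^esub> h) (bruhat \<times> borel)"
      unfolding inj_on_def by auto
    show "(\<lambda>(r, h). r \<otimes>\<^bsub>SL\<^esub> h) ` (bruhat \<times> borel) = carrier SL"
    proof (intro equalityI subsetI)
      fix g assume "g \<in> (\<lambda>(r, h). r \<otimes>\<^bsub>SL\<^esub> h) ` (bruhat \<times> borel)"
      then show "g \<in> carrier SL" using R Bc by (auto intro!: SL.m_closed)
    next
      fix g assume "g \<in> carrier SL"
      then obtain a b c d where g: "g = sl a b c d" "[a * d - b * c = 1] (mod int p)" by (rule SL_cases)
      have gc: "g \<in> carrier SL" using g by simp
      show "g \<in> (\<lambda>(r, h). r \<otimes>\<^bsub>SL\<^esub> h) ` (bruhat \<times> borel)"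
      proof (cases "int p dvd c")
        case True
        then have "g \<in> borel" using gc g(1) by (simp add: borel_def dvd_imp_mod_0)
        then show ?thesis using gc
          by (intro image_eqI[where x="(\<one>\<^bsub>SL\<^esub>, g)"]) (auto simp: bruhat_def)
      next
        case False
        \<comment> \<open>A coset is determined by the first column up to a scalar. That column is
          \<open>(a, c)\<close> for \<open>g\<close> and \<open>(x, 1)\<close> for
          \<open>ww x\<close>, hence \<open>x\<close> is the quotient of \<open>a\<close> by
          \<open>c\<close>.\<close>
        define x where "x = (a * dinv c) mod int p"
        have x: "x \<in> {0..<int p}" "ww x = ww (a * dinv c)"
          using p_ge_2 by (auto simp: x_def ww_def sl_eq_iff cong_def)
        let ?h = "inv\<^bsub>SL\<^esub> (ww x) \<otimes>\<^bsub>SL\<^esub> g"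
        have "?h = sl 0 1 (-1) (a * dinv c) \<otimes>\<^bsub>SL\<^esub> sl a b c d"
          unfolding x(2) unfolding ww_def g(1) by (subst sl_inv) simp_all
        also have "\<dots> = sl c d (- a + a * (dinv c * c)) (- b + a * dinv c * d)"
          by (simp add: mult.assoc)
        also have "\<dots> = sl c d (- a + a * 1) (- b + a * dinv c * d)"
          by (intro sl_cong cong_refl cong_add cong_mult dinv False)
        finally have "?h $ 2 $ 1 = 0" by simp
        moreover have hc: "?h \<in> carrier SL" using gc ww_carrier by simp
        ultimately have "?h \<in> borel" by (simp add: borel_def)
        moreover have "g = ww x \<otimes>\<^bsub>SL\<^esub> ?h"
          using gc ww_carrier by (simp add: SL.m_assoc[symmetric])
        moreover have "ww x \<in> bruhat" using x(1) by (simp add: bruhat_def)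
        ultimately show ?thesis by (intro image_eqI[where x="(ww x, ?h)"]) auto
      qed
    qed
  qed
qed

sublocale B: transversal SL borel bruhat by (rule transversal_borel)

section \<open>The torus as a transversal of the unipotent subgroup\<close>

definition unip :: "(int^2^2) set" where "unip = range ut"

definition tor :: "(int^2^2) set" where "tor = tt ` {1..<int p}"

lemma tt_inj: "inj_on tt {1..<int p}"
  by (rule inj_onI, rule interval_inj) (auto simp: tt_def sl_eq_iff)

lemma not_dvd_mod: "\<not> int p dvd d \<Longrightarrow> d mod int p \<in> {1..<int p}"
  using p_ge_2 pos_mod_sign[of "int p" d] by (auto simp: dvd_eq_mod_eq_0 le_less)

lemma dinv_cong: "[d = e] (mod int p) \<Longrightarrow> [dinv d = dinv e] (mod int p)"
  unfolding dinv_def by (rule cong_pow)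

lemma tt_mod: "tt (d mod int p) = tt d"
  unfolding tt_def by (intro sl_cong cong_refl dinv_cong) (auto simp: cong_def)

lemma tt_tor: "\<not> int p dvd d \<Longrightarrow> tt d \<in> tor"
  using not_dvd_mod tt_mod unfolding tor_def by (metis image_eqI)

lemma ut_inv: "inv\<^bsub>SL\<^esub> (ut x) = ut (- x)"
  unfolding ut_def by (subst sl_inv) simp_all

text \<open>Allows averaging over the torus: the transfer turns a map equivariant under
  \<open>unip\<close> into one equivariant under the Borel subgroup, and the index
  \<open>p - 1\<close> is invertible in \<open>k\<close>.\<close>

lemma transversal_unip: "transversal BB unip tor"
proof (intro transversal.intro transversal_axioms.intro B.finite_group_GH)
  show "subgroup unip BB"
  proof (rule B.GH.subgroupI)
    show "unip \<subseteq> carrier BB" "unip \<noteq> {}" by (auto simp: unip_def ut_borel)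
    fix u assume "u \<in> unip"
    then show "inv\<^bsub>BB\<^esub> u \<in> unip" by (auto simp: unip_def ut_borel B.inv_GH ut_inv)
  qed (auto simp: unip_def ut_mult)
  show T: "tor \<subseteq> carrier BB" by (auto simp: tor_def intro!: tt_borel dest: not_dvd_interval)
  have inj: "t = t' \<and> u = u'" if tu: "t \<in> tor" "t' \<in> tor" "u \<in> unip" "u' \<in> unip" "t \<otimes>\<^bsub>SL\<^esub> u = t' \<otimes>\<^bsub>SL\<^esub> u'" for t t' u u'
  proof -
    obtain d d' x x' where 1: "t = tt d" "t' = tt d'" "u = ut x" "u' = ut x'" "d \<in> {1..<int p}" "d' \<in> {1..<int p}"
      using tu unfolding tor_def unip_def by blast
    have "[d = d'] (mod int p)" using tu(5) unfolding 1 tt_mult_ut by (simp add: sl_eq_iff)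
    then have "d = d'" using 1(5,6) by (intro interval_inj) auto
    then have "t = t'" using 1 by simp
    moreover have "t \<in> carrier SL" "u \<in> carrier SL" "u' \<in> carrier SL"
      using 1 tt_borel ut_borel not_dvd_interval by (auto simp: borel_def)
    ultimately show ?thesis using tu(5) by (metis SL.Units_eq SL.Units_l_cancel)
  qed
  show "bij_betw (\<lambda>(r, h). r \<otimes>\<^bsub>BB\<^esub> h) (tor \<times> unip) (carrier BB)"
    unfolding bij_betw_def
  proof
    show "inj_on (\<lambda>(r, h). r \<otimes>\<^bsub>BB\<^esub> h) (tor \<times> unip)"
      unfolding inj_on_def using inj by auto
    show "(\<lambda>(r, h). r \<otimes>\<^bsub>BB\<^esub> h) ` (tor \<times> unip) = carrier BB"
    proof (intro equalityI subsetI)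
      fix g assume "g \<in> (\<lambda>(r, h). r \<otimes>\<^bsub>BB\<^esub> h) ` (tor \<times> unip)"
      then obtain t u where "t \<in> tor" "u \<in> unip" "g = t \<otimes>\<^bsub>SL\<^esub> u" by auto
      then show "g \<in> carrier BB"
        using T subgroup.m_closed[OF subgroup_borel] ut_borel unfolding unip_def by auto
    next
      fix g assume "g \<in> carrier BB"
      then have "g \<in> borel" by simp
      then obtain x d where g: "g = sl (dinv d) (x * d) 0 d" "\<not> int p dvd d" by (rule borel_cases)
      \<comment> \<open>Moving \<open>ut x\<close> to the right of \<open>tt d\<close> multiplies
        its parameter by the square of \<open>d\<close>.\<close>
      have "tt d \<otimes>\<^bsub>SL\<^esub> ut (d * (x * d)) = sl (dinv d) (dinv d * d * (x * d)) 0 d"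
        by (simp add: tt_mult_ut mult.assoc)
      also have "\<dots> = sl (dinv d) (1 * (x * d)) 0 d"
        by (intro sl_cong cong_refl cong_mult dinv g)
      finally have "g = tt d \<otimes>\<^bsub>SL\<^esub> ut (d * (x * d))" using g by simp
      then show "g \<in> (\<lambda>(r, h). r \<otimes>\<^bsub>BB\<^esub> h) ` (tor \<times> unip)"
        using tt_tor[OF g(2)] unfolding unip_def
        by (intro image_eqI[where x="(tt d, ut (d * (x * d)))"]) auto
    qed
  qed
qed

text \<open>Traces over the Borel subgroup are evaluated through this parametrisation by products of
  \<open>ut x\<close> and \<open>tt d\<close>.\<close>

lemma sum_borel: "(\<Sum>A\<in>borel. F A) = (\<Sum>d\<in>{1..<int p}. \<Sum>x\<in>{0..<int p}. F (sl (dinv d) (x * d) 0 d))"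
proof -
  have "(\<Sum>A\<in>borel. F A) =
      (\<Sum>z\<in>{1..<int p} \<times> {0..<int p}. F (sl (dinv (fst z)) (snd z * fst z) 0 (fst z)))"
  proof (rule sum.reindex_bij_betw[symmetric])
    show "bij_betw (\<lambda>z. sl (dinv (fst z)) (snd z * fst z) 0 (fst z)) ({1..<int p} \<times> {0..<int p}) borel"
      unfolding bij_betw_def
    proof
      show "inj_on (\<lambda>z. sl (dinv (fst z)) (snd z * fst z) 0 (fst z)) ({1..<int p} \<times> {0..<int p})"
      proof (rule inj_onI)
        fix z z' assume z: "z \<in> {1..<int p} \<times> {0..<int p}" "z' \<in> {1..<int p} \<times> {0..<int p}"
          and e: "sl (dinv (fst z)) (snd z * fst z) 0 (fst z) = sl (dinv (fst z')) (snd z' * fst z') 0 (fst z')"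
        obtain d x d' x' where zz: "z = (d, x)" "z' = (d', x')" by (metis surj_pair)
        have "[d = d'] (mod int p)" using e unfolding zz by (simp add: sl_eq_iff)
        then have d: "d = d'" using z unfolding zz by (intro interval_inj) auto
        have cp: "coprime d (int p)"
          using not_dvd_interval[of d] z prime_int_p unfolding zz
          by (metis coprime_commute mem_Sigma_iff prime_imp_coprime)
        have "[x * d = x' * d] (mod int p)" using e d unfolding zz by (simp add: sl_eq_iff)
        then have "[x = x'] (mod int p)" using cong_mult_rcancel[OF cp] by blast
        then show "z = z'" using z d unfolding zz by (auto intro: interval_inj)
      qed
      show "(\<lambda>z. sl (dinv (fst z)) (snd z * fst z) 0 (fst z)) ` ({1..<int p} \<times> {0..<int p}) = borel"
      proof (intro equalityI subsetI)
        fix A assume "A \<in> borel"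
        then obtain x d where A: "A = sl (dinv d) (x * d) 0 d" "\<not> int p dvd d" by (rule borel_cases)
        have "A = sl (dinv (d mod int p)) (x mod int p * (d mod int p)) 0 (d mod int p)"
          unfolding A(1) by (intro sl_cong cong_mult dinv_cong) (auto simp: cong_def)
        then show "A \<in> (\<lambda>z. sl (dinv (fst z)) (snd z * fst z) 0 (fst z)) ` ({1..<int p} \<times> {0..<int p})"
          using not_dvd_mod[OF A(2)] p_ge_2
          by (intro image_eqI[where x="(d mod int p, x mod int p)"]) auto
      qed (auto intro!: borel_sl dest: not_dvd_interval)
    qed
  qed
  then show ?thesis by (simp add: sum.cartesian_product case_prod_beta)
qed

text \<open>The two double cosets of \<open>borel\<close> give \<open>rel_tr \<alpha> = \<alpha> + \<Sum>\<^sub>x (u\<^sub>x w) \<alpha> (u\<^sub>x w)\<^sup>-\<^sup>1\<close>, and the second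
  summand is a full trace because the torus normalised by \<open>w\<close> has order prime to \<open>p\<close>.\<close>

lemma rel_tr_borel:
  fixes V :: "('i \<Rightarrow> 'k) set" and W :: "('j \<Rightarrow> 'k) set"
  assumes V: "rep SL V \<rho>" and W: "rep SL W \<sigma>" and \<alpha>: "ghom BB V \<rho> W \<sigma> \<alpha>"
  shows "null BB V \<rho> W \<sigma> (\<lambda>x. rel_tr SL bruhat \<rho> \<sigma> \<alpha> x - \<alpha> x)"
proof -
  define F where "F = (\<lambda>g x. \<sigma> g (\<alpha> (\<rho> (inv\<^bsub>SL\<^esub> g) x)))"
  let ?w = "ww 0"
  have m: "\<alpha> (\<rho> k y) \<in> W" if "k \<in> carrier SL" "y \<in> V" for k y
    using that by (intro ghomD(2)[OF \<alpha>] repD(5)[OF V])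
  have FW: "F g x \<in> W" if "g \<in> carrier SL" "x \<in> V" for g x
    unfolding F_def using that by (intro repD(5)[OF W] m) auto
  have F_right: "F (g \<otimes>\<^bsub>SL\<^esub> h) x = F g x" if g: "g \<in> carrier SL" and h: "h \<in> borel" and x: "x \<in> V" for g h x
  proof -
    have hc: "h \<in> carrier SL" and ih: "inv\<^bsub>SL\<^esub> h \<in> borel"
      using h subgroup.m_inv_closed[OF subgroup_borel] by (auto simp: borel_def)
    let ?y = "\<rho> (inv\<^bsub>SL\<^esub> g) x"
    have y: "?y \<in> V" by (rule repD(5)[OF V SL.inv_closed[OF g] x])
    have "\<alpha> (\<rho> (inv\<^bsub>SL\<^esub> (g \<otimes>\<^bsub>SL\<^esub> h)) x) = \<alpha> (\<rho> (inv\<^bsub>SL\<^esub> h) ?y)"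
      using g hc by (simp add: SL.inv_mult_group repD(4)[OF V SL.inv_closed[OF hc] SL.inv_closed[OF g] x])
    also have "\<dots> = \<sigma> (inv\<^bsub>SL\<^esub> h) (\<alpha> ?y)" by (rule ghomD(3)[OF \<alpha> _ y]) (simp add: ih)
    finally have "F (g \<otimes>\<^bsub>SL\<^esub> h) x = \<sigma> g (\<sigma> h (\<sigma> (inv\<^bsub>SL\<^esub> h) (\<alpha> ?y)))"
      unfolding F_def using repD(4)[OF W g hc repD(5)[OF W SL.inv_closed[OF hc] ghomD(2)[OF \<alpha> y]]] by simp
    then show ?thesis unfolding F_def using SL.rep_inv(2)[OF W hc ghomD(2)[OF \<alpha> y]] by simp
  qed
  have F_left: "\<sigma> h (F ?w (\<rho> (inv\<^bsub>SL\<^esub> h) x)) = F (h \<otimes>\<^bsub>SL\<^esub> ?w) x" if h: "h \<in> carrier SL" and x: "x \<in> V" for h x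
  proof -
    note w = ww_carrier[of 0]
    have "F (h \<otimes>\<^bsub>SL\<^esub> ?w) x = \<sigma> (h \<otimes>\<^bsub>SL\<^esub> ?w) (\<alpha> (\<rho> (inv\<^bsub>SL\<^esub> ?w \<otimes>\<^bsub>SL\<^esub> inv\<^bsub>SL\<^esub> h) x))"
      unfolding F_def using h w by (simp add: SL.inv_mult_group)
    also have "\<dots> = \<sigma> h (\<sigma> ?w (\<alpha> (\<rho> (inv\<^bsub>SL\<^esub> ?w) (\<rho> (inv\<^bsub>SL\<^esub> h) x))))"
      using repD(4)[OF V SL.inv_closed[OF w] SL.inv_closed[OF h] x]
        repD(4)[OF W h w m[OF SL.inv_closed[OF w] repD(5)[OF V SL.inv_closed[OF h] x]]] by simp
    finally show ?thesis by (simp add: F_def)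
  qed
  \<comment> \<open>The sign offsets the number \<open>p - 1\<close> of torus elements, each of
    which contributes the same sum over the \<open>ww y\<close>.\<close>
  define \<phi> where "\<phi> = (\<lambda>x. sc (-1) (F ?w x))"
  have "lin_on V W \<phi>"
    unfolding \<phi>_def F_def
    by (intro lin_on_sc_fun repD(1)[OF W] lin_on_comp[OF repD(2)[OF V] lin_on_comp[OF ghomD(1)[OF \<alpha>] repD(2)[OF W]]]
      SL.inv_closed ww_carrier)
  moreover have "rel_tr SL bruhat \<rho> \<sigma> \<alpha> x - \<alpha> x = tr BB \<rho> \<sigma> \<phi> x" if x: "x \<in> V" for x
  proof -
    have F1: "F \<one>\<^bsub>SL\<^esub> x = \<alpha> x"
      unfolding F_def using repD(3)[OF V x] repD(3)[OF W ghomD(2)[OF \<alpha> x]] by simp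
    have "rel_tr SL bruhat \<rho> \<sigma> \<alpha> x = (\<Sum>r\<in>bruhat. F r x)" by (simp add: rel_tr_def F_def)
    also have "\<dots> = F \<one>\<^bsub>SL\<^esub> x + (\<Sum>r\<in>ww ` {0..<int p}. F r x)"
      unfolding bruhat_def using one_not_ww by simp
    finally have 1: "rel_tr SL bruhat \<rho> \<sigma> \<alpha> x - \<alpha> x = (\<Sum>y\<in>{0..<int p}. F (ww y) x)"
      by (simp add: F1 sum.reindex[OF ww_inj])
    have "tr BB \<rho> \<sigma> \<phi> x = (\<Sum>A\<in>borel. sc (-1) (F (A \<otimes>\<^bsub>SL\<^esub> ?w) x))"
      unfolding B.tr_GH \<phi>_def
    proof (intro sum.cong refl)
      fix A assume "A \<in> borel"
      then have A: "A \<in> carrier SL" by (simp add: borel_def)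
      show "\<sigma> A (sc (-1) (F ?w (\<rho> (inv\<^bsub>SL\<^esub> A) x))) = sc (-1) (F (A \<otimes>\<^bsub>SL\<^esub> ?w) x)"
        unfolding F_left[OF A x, symmetric]
        by (rule lin_onD(3)[OF repD(2)[OF W A]], rule FW[OF ww_carrier repD(5)[OF V SL.inv_closed[OF A] x]])
    qed
    also have "\<dots> = (\<Sum>d\<in>{1..<int p}. \<Sum>y\<in>{0..<int p}. sc (-1) (F (ww y) x))"
      unfolding sum_borel
    proof (intro sum.cong refl arg_cong[where f="sc (-1)"])
      fix d y assume "d \<in> {1..<int p}" "y \<in> {0..<int p}"
      then have d: "\<not> int p dvd d" by (intro not_dvd_interval)
      \<comment> \<open>The Weyl element inverts the torus, so the product of \<open>ut y\<close>,
        \<open>tt d\<close> and \<open>ww 0\<close> is \<open>ww y\<close> times an element of the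
        Borel subgroup, which \<open>F_right\<close> absorbs.\<close>
      have "sl (dinv d) (y * d) 0 d \<otimes>\<^bsub>SL\<^esub> ?w = ww y \<otimes>\<^bsub>SL\<^esub> sl d 0 0 (dinv d)"
        by (simp add: ww_def mult.commute)
      moreover have "sl d 0 0 (dinv d) \<in> borel" using d by (simp add: borel_iff dinv)
      ultimately show "F (sl (dinv d) (y * d) 0 d \<otimes>\<^bsub>SL\<^esub> ?w) x = F (ww y) x"
        using F_right[OF ww_carrier _ x] by metis
    qed
    also have "\<dots> = (\<Sum>y\<in>{0..<int p}. F (ww y) x)"
    proof
      fix j
      have "of_nat (nat (int p - 1)) = (-1::'k)" using of_nat_p_minus_1 p_ge_2 by (simp add: nat_diff_distrib)
      then show "(\<Sum>d\<in>{1..<int p}. \<Sum>y\<in>{0..<int p}. sc (-1) (F (ww y) x)) j = (\<Sum>y\<in>{0..<int p}. F (ww y) x) j"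
        by (simp only: fun_sum_apply sc_apply) (simp add: sum_negf)
    qed
    finally show ?thesis using 1 by simp
  qed
  ultimately show ?thesis unfolding null_def by blast
qed

text \<open>Transfer turns a stable isomorphism over the Borel subgroup into one over the group: it
  changes a map only by null maps, and the index \<open>p + 1\<close> is 1 in \<open>k\<close>. This
  takes the place of the Green correspondence.\<close>

lemma steq_SL_of_borel:
  fixes V :: "('i \<Rightarrow> 'k) set" and W :: "('j \<Rightarrow> 'k) set"
  assumes "rep SL V \<rho>" "rep SL W \<sigma>" "steq BB V \<rho> W \<sigma>"
  shows "steq SL V \<rho> W \<sigma>"
  by (rule B.steq_of_restrict[OF assms]) (auto intro: rel_tr_borel assms simp: card_bruhat)

end

section \<open>Modules over the Borel subgroup\<close>

context char_p
begin

text \<open>Every indecomposable module over the Borel subgroup is \<open>pol l\<close> with the action \<open>pact w\<close> for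
  some \<open>l \<in> {1..p}\<close> and some weight \<open>w\<close> modulo \<open>p - 1\<close>.\<close>

definition pact :: "nat \<Rightarrow> int^2^2 \<Rightarrow> (int \<Rightarrow> 'k) \<Rightarrow> int \<Rightarrow> 'k" where
  "pact w A f = (\<lambda>y. of_int (A $ 2 $ 2) ^ w * f ((A $ 2 $ 2)\<^sup>2 * y + A $ 2 $ 2 * A $ 1 $ 2))"

lemma pact_sl:
  assumes "f \<in> per"
  shows "pact w (sl a b c d) f y = of_int d ^ w * f (d\<^sup>2 * y + d * b)"
proof -
  have "f ((d mod int p)\<^sup>2 * y + d mod int p * (b mod int p)) = f (d\<^sup>2 * y + d * b)"
    by (rule per_cong[OF assms], intro cong_add cong_mult cong_pow) (auto simp: cong_def)
  then show ?thesis by (simp add: pact_def)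
qed

lemma pact_ut: "f \<in> per \<Longrightarrow> pact w (ut x) f y = f (y + x)"
  unfolding ut_def by (subst pact_sl) auto

lemma pol_per: "f \<in> pol l \<Longrightarrow> f \<in> per"
  by (simp add: pol_def)

lemma pact_pol:
  assumes "f \<in> pol l" "A \<in> borel"
  shows "pact w A f \<in> pol l"
proof -
  have "0 \<le> A $ 2 $ 2"
    using assms(2) by (simp add: borel_def SL2_def)
  then have e: "(A $ 2 $ 2)\<^sup>2 = int (nat ((A $ 2 $ 2)\<^sup>2))" by simp
  have "pact w A f = sc (of_int (A $ 2 $ 2) ^ w) (\<lambda>y. f ((A $ 2 $ 2)\<^sup>2 * y + A $ 2 $ 2 * A $ 1 $ 2))"
    by (simp add: fun_eq_iff fun_pw pact_def)
  moreover have "(\<lambda>y. f ((A $ 2 $ 2)\<^sup>2 * y + A $ 2 $ 2 * A $ 1 $ 2)) \<in> pol l"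
    by (subst e) (rule pol_affine[OF assms(1)])
  ultimately show ?thesis by (simp add: fs.subspace_scale[OF subspace_pol])
qed

lemma rep_pol: "rep BB (pol l) (pact w)"
  unfolding rep_def
proof (intro conjI ballI)
  show "fs.subspace (pol l)" by (rule subspace_pol)
  fix A assume "A \<in> carrier BB"
  then show "lin_on (pol l) (pol l) (pact w A)"
    using pact_pol by (auto simp: lin_on_def pact_def fun_eq_iff fun_pw algebra_simps)
next
  fix f assume "f \<in> pol l"
  then show "pact w \<one>\<^bsub>BB\<^esub> f = f" by (simp add: sl_one fun_eq_iff pact_sl pol_per)
next
  fix A B f assume "A \<in> carrier BB" "B \<in> carrier BB" and f: "f \<in> pol l"
  then have "A \<in> borel" and Bb: "B \<in> borel" by auto
  then obtain x d y e where A: "A = sl (dinv d) (x * d) 0 d" "\<not> int p dvd d"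
    and B: "B = sl (dinv e) (y * e) 0 e" "\<not> int p dvd e" by (metis borel_cases)
  note fp = pol_per[OF f]
  show "pact w (A \<otimes>\<^bsub>BB\<^esub> B) f = pact w A (pact w B f)"
  proof
    fix z
    have "pact w (A \<otimes>\<^bsub>BB\<^esub> B) f z =
        of_int (d * e) ^ w * f ((d * e)\<^sup>2 * z + d * e * (dinv d * (y * e) + x * d * e))"
      using A B by (simp add: pact_sl fp)
    also have "f ((d * e)\<^sup>2 * z + d * e * (dinv d * (y * e) + x * d * e)) =
        f (e\<^sup>2 * (d\<^sup>2 * z + d * (x * d)) + e * (y * e))"
    proof (rule per_cong[OF fp])
      have "(d * e)\<^sup>2 * z + d * e * (dinv d * (y * e) + x * d * e) =
          (d * dinv d) * (e * (y * e)) + e\<^sup>2 * (d\<^sup>2 * z + d * (x * d))"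
        by (simp add: algebra_simps power2_eq_square)
      also have "[\<dots> = 1 * (e * (y * e)) + e\<^sup>2 * (d\<^sup>2 * z + d * (x * d))] (mod int p)"
        by (intro cong_add cong_mult cong_refl dinv A)
      finally show "[(d * e)\<^sup>2 * z + d * e * (dinv d * (y * e) + x * d * e) =
          e\<^sup>2 * (d\<^sup>2 * z + d * (x * d)) + e * (y * e)] (mod int p)"
        by (simp add: add.commute)
    qed
    also have "of_int (d * e) ^ w * \<dots> = pact w A (pact w B f) z"
      using A B pol_per[OF pact_pol[OF f Bb]]
      by (simp add: pact_sl fp power_mult_distrib mult.assoc)
    finally show "pact w (A \<otimes>\<^bsub>BB\<^esub> B) f z = pact w A (pact w B f) z" .
  qed
qed

lemma carrier_BB: "carrier BB = borel"
  by simp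

text \<open>Minus the restriction of a function to the residue class 0. Its conjugates under the
  unipotent elements are minus the restrictions to all residue classes and add up to minus the
  identity; the torus repeats this \<open>p - 1\<close> times, which is another factor -1. The trace
  is therefore the identity, and \<open>per\<close> is projective.\<close>

definition pt :: "(int \<Rightarrow> 'k) \<Rightarrow> int \<Rightarrow> 'k" where
  "pt f = (\<lambda>y. if int p dvd y then - f y else 0)"

lemma pt_lin: "lin_on per per pt"
proof (rule lin_onI)
  fix f assume f: "f \<in> per"
  show "pt f \<in> per"
  proof (rule perI)
    fix x y assume "[x = y] (mod int p)"
    then show "pt f x = pt f y"
      unfolding pt_def using per_cong[OF f] cong_dvd_iff by metis
  qed
qed (auto simp: pt_def fun_eq_iff fun_pw)

lemma tr_pt:
  assumes f: "f \<in> per"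
  shows "tr BB (pact w) (pact w) pt f = f"
proof
  fix y
  have fp: "f \<in> pol p" using f by (simp add: pol_p)
  have t: "pact w (sl (dinv d) (x * d) 0 d) (pt (pact w (inv\<^bsub>BB\<^esub> (sl (dinv d) (x * d) 0 d)) f)) y =
      (if int p dvd y + x then - f y else 0)" if d: "\<not> int p dvd d" for d x
  proof -
    let ?A = "sl (dinv d) (x * d) 0 d"
    define h where "h = pact w (inv\<^bsub>BB\<^esub> ?A) f"
    have A: "?A \<in> carrier BB" using borel_sl[OF d] by simp
    have h: "h \<in> per" unfolding h_def
      using repD(5)[OF rep_pol B.GH.inv_closed[OF A] fp] by (rule pol_per)
    have pth: "pt h \<in> per" by (rule lin_onD(1)[OF pt_lin h])
    have fy: "of_int d ^ w * h (d\<^sup>2 * y + d * (x * d)) = f y"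
      using B.GH.rep_inv(2)[OF rep_pol A fp, of w] pact_sl[OF h, of w "dinv d" "x * d" 0 d y]
      by (simp add: h_def)
    have "d\<^sup>2 * y + d * (x * d) = d * (d * (y + x))" by (simp add: algebra_simps power2_eq_square)
    then have dv: "int p dvd d\<^sup>2 * y + d * (x * d) \<longleftrightarrow> int p dvd y + x"
      using d prime_dvd_mult_iff[OF prime_int_p] by simp
    have "pact w ?A (pt h) y = of_int d ^ w * pt h (d\<^sup>2 * y + d * (x * d))"
      by (rule pact_sl[OF pth])
    also have "\<dots> = (if int p dvd y + x then - f y else 0)"
      unfolding pt_def dv using fy by simp
    finally show ?thesis by (simp add: h_def)
  qed
  have one: "(\<Sum>x\<in>{0..<int p}. if int p dvd y + x then - f y else 0) = - f y"
  proof -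
    have "int p dvd y + x \<longleftrightarrow> (- y) mod int p = x" if "x \<in> {0..<int p}" for x
    proof -
      have "int p dvd y + x \<longleftrightarrow> [- y = x] (mod int p)"
        by (metis add.commute cong_iff_dvd_diff cong_sym_eq diff_minus_eq_add)
      then show ?thesis using that by (simp add: cong_def)
    qed
    then have "(\<Sum>x\<in>{0..<int p}. if int p dvd y + x then - f y else 0) =
        (\<Sum>x\<in>{0..<int p}. if (- y) mod int p = x then - f y else 0)"
      by (intro sum.cong refl if_cong) auto
    also have "\<dots> = - f y" using p_ge_2 by simp
    finally show ?thesis .
  qed
  have "tr BB (pact w) (pact w) pt f y =
      (\<Sum>d\<in>{1..<int p}. \<Sum>x\<in>{0..<int p}. if int p dvd y + x then - f y else 0)"
    unfolding tr_def fun_sum_apply carrier_BB sum_borel by (intro sum.cong refl t not_dvd_interval)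
  also have "\<dots> = of_nat (nat (int p - 1)) * (- f y)"
    by (simp only: one) simp
  also have "\<dots> = f y" using of_nat_p_minus_1 p_ge_2 by (simp add: nat_diff_distrib)
  finally show "tr BB (pact w) (pact w) pt f y = f y" .
qed

lemma null_per: "null BB per (pact w) per (pact w) (\<lambda>x. x)"
  unfolding null_def using pt_lin tr_pt by (intro exI[of _ pt]) auto

text \<open>Orthogonality of the characters of the multiplicative group modulo \<open>p\<close>,
  used to recover a functional from its weight components.\<close>

lemma sum_powers:
  assumes "\<not> int p dvd d"
  shows "(\<Sum>j\<in>{1..p - 1}. (of_int d :: 'k) ^ j) = (if [d = 1] (mod int p) then -1 else 0)"
proof (cases "[d = 1] (mod int p)")
  case True
  then have "(of_int d :: 'k) = 1" using of_int_cong by fastforce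
  then show ?thesis using True of_nat_p_minus_1 by simp
next
  case False
  let ?S = "\<Sum>j\<in>{1..p - 1}. (of_int d :: 'k) ^ j"
  have "of_int d * ?S = (\<Sum>j\<in>{1..p - 1}. of_int d ^ Suc j)" by (simp add: sum_distrib_left)
  also have "\<dots> = (\<Sum>j\<in>{Suc 1..Suc (p - 1)}. of_int d ^ j)" by (rule sum.shift_bounds_cl_Suc_ivl[symmetric])
  also have "{Suc 1..Suc (p - 1)} = insert p {2..p - 1}" using p_ge_2 by auto
  also have "(\<Sum>j\<in>insert p {2..p - 1}. (of_int d :: 'k) ^ j) = of_int d ^ p + (\<Sum>j\<in>{2..p - 1}. of_int d ^ j)"
    using p_ge_2 by (intro sum.insert) auto
  also have "(of_int d :: 'k) ^ p = of_int d ^ 1"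
  proof -
    have "(of_int d :: 'k) ^ p = of_int d ^ (p - 1) * of_int d"
      using p_ge_2 by (metis Suc_diff_1 power_Suc2 zero_less_numeral less_le_trans)
    then show ?thesis using fermat[OF assms] by simp
  qed
  also have "of_int d ^ 1 + (\<Sum>j\<in>{2..p - 1}. of_int d ^ j) = (\<Sum>j\<in>insert 1 {2..p - 1}. (of_int d :: 'k) ^ j)"
    by (subst sum.insert) auto
  also have "insert 1 {2..p - 1} = {1..p - 1}" using p_ge_2 by auto
  finally have "(of_int d - 1) * ?S = 0" by (simp add: algebra_simps)
  moreover have "of_int d - 1 \<noteq> (0::'k)"
    using False of_int_0_iff[of "d - 1"] by (simp add: cong_iff_dvd_diff)
  ultimately show ?thesis using False by simp
qed

text \<open>Carries \<open>ut y\<close> to the right past an element of the Borel subgroup. The new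
  parameter is the argument occurring in \<open>pact\<close>, which is thereby right translation on
  functions of the unipotent subgroup, twisted by a power of \<open>d\<close>.\<close>

lemma borel_ut:
  assumes "\<not> int p dvd d"
  shows "ut y \<otimes>\<^bsub>SL\<^esub> sl (dinv d) (x * d) 0 d = tt d \<otimes>\<^bsub>SL\<^esub> ut (d\<^sup>2 * y + d * (x * d))"
proof -
  have "tt d \<otimes>\<^bsub>SL\<^esub> ut (d\<^sup>2 * y + d * (x * d)) = sl (dinv d) (dinv d * d * (y * d + x * d)) 0 d"
    by (simp add: tt_mult_ut algebra_simps power2_eq_square)
  also have "\<dots> = sl (dinv d) (1 * (y * d + x * d)) 0 d"
    by (intro sl_cong cong_refl cong_mult dinv assms)
  finally show ?thesis by (simp add: ut_def add.commute)
qed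

interpretation U: transversal BB unip tor by (rule transversal_unip)

text \<open>Let \<open>l\<close> be the Loewy length over the unipotent subgroup and
  \<open>v\<close> a vector surviving the power \<open>l - 1\<close> of \<open>X\<close>. A
  functional on \<open>W\<close>, evaluated along the orbits of the elements \<open>ut a\<close>,
  gives a map \<open>\<alpha>\<close> into functions of \<open>a\<close>; it is equivariant for the
  Borel subgroup if the functional is a weight vector of the torus. If moreover the functional does
  not vanish on that power of \<open>X\<close> applied to \<open>v\<close>, then
  \<open>\<alpha> v\<close> has exact degree \<open>l - 1\<close> and generates
  \<open>pol l\<close>, so \<open>\<alpha>\<close> splits over \<open>unip\<close>. Averaging over
  the torus makes the splitting equivariant. By the choice of \<open>l\<close> the image stays
  inside \<open>pol l\<close>.\<close>

lemma borel_split: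
  fixes W :: "('i \<Rightarrow> 'k) set"
  assumes W: "rep BB W \<rho>" and ne: "W \<noteq> {0}"
  obtains l w \<alpha> \<beta> where "1 \<le> l" "l \<le> p" "ghom BB W \<rho> (pol l) (pact w) \<alpha>"
    "ghom BB (pol l) (pact w) W \<rho> \<beta>" "\<And>f. f \<in> pol l \<Longrightarrow> \<alpha> (\<beta> f) = f"
proof -
  note sW = repD(1)[OF W]
  have utc: "ut a \<in> carrier BB" for a by (simp add: ut_borel)
  define X where "X = (\<lambda>m. \<rho> (ut 1) m - m)"
  have XW: "lin_on W W X"
    unfolding X_def by (intro lin_on_diff_fun repD(2)[OF W utc] lin_on_id sW)
  have XnW: "(X ^^ n) m \<in> W" if "m \<in> W" for n m
    using that by (induction n) (auto intro: lin_onD(1)[OF XW])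
  have XnL: "lin_on W W (X ^^ n)" for n
  proof (induction n)
    case 0
    then show ?case by (simp add: lin_on_def)
  next
    case (Suc n)
    then show ?case using lin_on_comp[OF Suc XW] by (simp add: comp_def)
  qed
  define lf where "lf = (\<lambda>ph::('i \<Rightarrow> 'k) \<Rightarrow> 'k. (\<forall>x\<in>W. \<forall>y\<in>W. ph (x + y) = ph x + ph y) \<and> (\<forall>c. \<forall>x\<in>W. ph (sc c x) = c * ph x))"
  \<comment> \<open>Frobenius reciprocity: functionals on \<open>W\<close> correspond to maps into
    the functions on the unipotent subgroup. Under this map \<open>X\<close> becomes
    \<open>fdiff\<close>.\<close>
  define orb where "orb = (\<lambda>(ph::('i \<Rightarrow> 'k) \<Rightarrow> 'k) m a. ph (\<rho> (ut a) m))"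
  have lf_diff: "ph (x - y) = ph x - ph y" if "lf ph" "x \<in> W" "y \<in> W" for ph x y
  proof -
    have "ph (x + sc (-1) y) = ph x + ph (sc (-1) y)"
      using that fs.subspace_scale[OF sW] unfolding lf_def by blast
    also have "ph (sc (-1) y) = -1 * ph y" using that unfolding lf_def by blast
    finally show ?thesis by simp
  qed
  have orb_per: "orb ph m \<in> per" for ph m
    by (rule perI) (metis orb_def ut_eq_iff)
  have orb_lin: "lin_on W per (orb ph)" if "lf ph" for ph
    using that orb_per repD(5)[OF W utc]
    by (auto simp: lin_on_def orb_def fun_eq_iff fun_pw lin_onD[OF repD(2)[OF W utc]] lf_def)
  have fdiff_orb: "fdiff (orb ph m) = orb ph (X m)" if l: "lf ph" and m: "m \<in> W" for ph m
  proof
    fix a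
    have um: "\<rho> (ut b) m \<in> W" for b by (rule repD(5)[OF W utc m])
    have "\<rho> (ut a) (X m) = \<rho> (ut a) (\<rho> (ut 1) m) - \<rho> (ut a) m"
      unfolding X_def by (rule lin_on_diff[OF repD(2)[OF W utc] sW um m])
    also have "\<rho> (ut a) (\<rho> (ut 1) m) = \<rho> (ut (a + 1)) m"
      using repD(4)[OF W utc utc m, of a 1] by (simp add: ut_mult)
    finally show "fdiff (orb ph m) a = orb ph (X m) a"
      by (simp add: fdiff_apply orb_def lf_diff[OF l um um])
  qed
  have fdiff_pow_orb: "(fdiff ^^ n) (orb ph m) = orb ph ((X ^^ n) m)" if "lf ph" "m \<in> W" for n ph m
    by (induction n) (auto simp: fdiff_orb that XnW)
  have orb0: "orb ph m 0 = ph m" if "m \<in> W" for ph m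
    using repD(3)[OF W that] by (simp add: orb_def ut_def sl_one)
  have lf_coord: "lf (\<lambda>m. m i)" for i
    by (simp add: lf_def fun_pw)
  have Xp: "(X ^^ p) m = 0" if "m \<in> W" for m
  proof
    fix i
    have "(fdiff ^^ p) (orb (\<lambda>m. m i) m) = 0" by (rule fdiff_pow_p[OF orb_per])
    then have "orb (\<lambda>m. m i) ((X ^^ p) m) = 0" by (simp only: fdiff_pow_orb[OF lf_coord that])
    then have "orb (\<lambda>m. m i) ((X ^^ p) m) 0 = 0" by (simp add: fun_pw)
    then show "(X ^^ p) m i = 0 i" using orb0[OF XnW[OF that]] by (simp add: fun_pw)
  qed
  define l where "l = (LEAST n. \<forall>m\<in>W. (X ^^ n) m = 0)"
  have Xl: "(X ^^ l) m = 0" if "m \<in> W" for m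
    using LeastI[of "\<lambda>n. \<forall>m\<in>W. (X ^^ n) m = 0" p] Xp that unfolding l_def by blast
  have lp: "l \<le> p" unfolding l_def by (rule Least_le) (use Xp in blast)
  have "l \<noteq> 0"
  proof
    assume "l = 0"
    then have "W \<subseteq> {0}" using Xl by auto
    then show False using ne fs.subspace_0[OF sW] by blast
  qed
  then obtain l' where l': "l = Suc l'" by (cases l) auto
  have "\<not> (\<forall>m\<in>W. (X ^^ l') m = 0)"
    using not_less_Least[of l' "\<lambda>n. \<forall>m\<in>W. (X ^^ n) m = 0"] l' unfolding l_def by simp
  then obtain v where v: "v \<in> W" "(X ^^ l') v \<noteq> 0" by blast
  then obtain i0 where i0: "(X ^^ l') v i0 \<noteq> 0" by (auto simp: fun_eq_iff fun_pw)
  define y where "y = (X ^^ l') v"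
  have yW: "y \<in> W" using XnW v by (simp add: y_def)
  have ttc: "tt d \<in> carrier BB" if "\<not> int p dvd d" for d using tt_borel[OF that] by simp
  have ttc': "tt d \<in> carrier BB" if "d \<in> {1..<int p}" for d using ttc not_dvd_interval[OF that] by blast
  \<comment> \<open>A weight component, under the torus, of the coordinate functional at
    \<open>i0\<close>, which does not vanish on \<open>y\<close>.\<close>
  define \<mu> where "\<mu> = (\<lambda>j m. \<Sum>d\<in>{1..<int p}. (of_int d :: 'k) ^ j * \<rho> (tt d) m i0)"
  have lf_\<mu>: "lf (\<mu> j)" for j
    unfolding lf_def \<mu>_def
    by (auto simp: lin_onD[OF repD(2)[OF W ttc']] fun_pw algebra_simps sum.distrib sum_distrib_left
        simp del: atLeastLessThan_iff intro!: sum.cong)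
  have weight: "\<mu> j (\<rho> (tt e) m) = of_int e ^ (p - 1 - j) * \<mu> j m"
    if j: "j \<in> {1..p - 1}" and e: "\<not> int p dvd e" and m: "m \<in> W" for j e m
  proof -
    let ?g = "\<lambda>d. (of_int d :: 'k) ^ j * \<rho> (tt d) m i0"
    have *: "(of_int d :: 'k) ^ j * \<rho> (tt d) (\<rho> (tt e) m) i0 =
        of_int e ^ (p - 1 - j) * ?g ((d * e) mod int p)" if d: "d \<in> {1..<int p}" for d
    proof -
      have nd: "\<not> int p dvd d" by (rule not_dvd_interval[OF d])
      have "tt d \<otimes>\<^bsub>SL\<^esub> tt e = tt (d * e)" by (simp add: tt_def dinv_def power_mult_distrib)
      then have "\<rho> (tt d) (\<rho> (tt e) m) = \<rho> (tt (d * e)) m"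
        using repD(4)[OF W ttc[OF nd] ttc[OF e] m] by simp
      moreover have "(of_int d :: 'k) ^ j = of_int e ^ (p - 1 - j) * of_int (d * e) ^ j"
      proof -
        have "of_int e ^ (p - 1 - j) * of_int (d * e) ^ j = (of_int d :: 'k) ^ j * of_int e ^ (p - 1 - j + j)"
          by (simp add: power_mult_distrib power_add algebra_simps)
        also have "p - 1 - j + j = p - 1" using j by (intro le_add_diff_inverse2) simp
        finally show ?thesis using fermat[OF e] by simp
      qed
      ultimately show ?thesis by (simp add: tt_mod)
    qed
    have "\<mu> j (\<rho> (tt e) m) = (\<Sum>d\<in>{1..<int p}. of_int e ^ (p - 1 - j) * ?g ((d * e) mod int p))"
      unfolding \<mu>_def by (intro sum.cong refl *)
    also have "\<dots> = of_int e ^ (p - 1 - j) * (\<Sum>d\<in>{1..<int p}. ?g ((d * e) mod int p))"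
      by (rule sum_distrib_left[symmetric])
    also have "(\<Sum>d\<in>{1..<int p}. ?g ((d * e) mod int p)) = (\<Sum>d\<in>{1..<int p}. ?g d)"
    proof (rule sum.reindex_bij_witness[of _ "\<lambda>d. (d * dinv e) mod int p" "\<lambda>d. (d * e) mod int p"])
      have key: "(d * a mod int p) * b mod int p = d" if "d \<in> {1..<int p}" "[a * b = 1] (mod int p)" for d a b
      proof -
        have "(d * a mod int p) * b mod int p = d * (a * b) mod int p" by (simp add: mod_mult_left_eq mult.assoc)
        also have "\<dots> = d * 1 mod int p" using that(2) by (metis cong_def cong_scalar_left)
        finally show ?thesis using that(1) by simp
      qed
      have mem: "d * a mod int p \<in> {1..<int p}" if "d \<in> {1..<int p}" "\<not> int p dvd a" for d a
        using not_dvd_mod[of "d * a"] not_dvd_interval[OF that(1)] that(2) prime_dvd_mult_iff[OF prime_int_p]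
        by blast
      have ie: "\<not> int p dvd dinv e" using unit_not_dvd dinv e by blast
      fix d assume d: "d \<in> {1..<int p}"
      show "(d * e mod int p) * dinv e mod int p = d" by (rule key[OF d dinv(2)[OF e]])
      show "(d * dinv e mod int p) * e mod int p = d" by (rule key[OF d dinv(1)[OF e]])
      show "d * e mod int p \<in> {1..<int p}" by (rule mem[OF d e])
      show "d * dinv e mod int p \<in> {1..<int p}" by (rule mem[OF d ie])
    qed auto
    finally show ?thesis by (simp add: \<mu>_def)
  qed
  \<comment> \<open>By orthogonality of characters the components add up to minus the coordinate
    functional, so one of them is nonzero on \<open>y\<close>.\<close>
  have "(\<Sum>j\<in>{1..p - 1}. \<mu> j y) = - y i0"
  proof -
    have "(\<Sum>j\<in>{1..p - 1}. \<mu> j y) = (\<Sum>d\<in>{1..<int p}. (\<Sum>j\<in>{1..p - 1}. of_int d ^ j) * \<rho> (tt d) y i0)"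
      unfolding \<mu>_def by (subst sum.swap) (simp add: sum_distrib_right)
    also have "\<dots> = (\<Sum>d\<in>{1..<int p}. if 1 = d then - \<rho> (tt 1) y i0 else 0)"
    proof (intro sum.cong refl)
      fix d assume d: "d \<in> {1..<int p}"
      have "[d = 1] (mod int p) \<longleftrightarrow> 1 = d" using d p_ge_2 by (auto simp: cong_def)
      then show "(\<Sum>j\<in>{1..p - 1}. of_int d ^ j) * \<rho> (tt d) y i0 = (if 1 = d then - \<rho> (tt 1) y i0 else 0)"
        using sum_powers[OF not_dvd_interval[OF d]] by auto
    qed
    also have "\<dots> = - \<rho> (tt 1) y i0" using p_ge_2 by simp
    also have "tt 1 = \<one>\<^bsub>BB\<^esub>" by (simp add: tt_def dinv_def sl_one)
    finally show ?thesis using repD(3)[OF W yW] by simp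
  qed
  moreover have "- y i0 \<noteq> 0" using i0 by (simp add: y_def)
  ultimately obtain j where j: "j \<in> {1..p - 1}" "\<mu> j y \<noteq> 0"
    by (metis sum.neutral)
  \<comment> \<open>The component of index \<open>j\<close> transforms by the inverse of the
    \<open>j\<close>-th power; this is its exponent as a natural number, modulo
    \<open>p - 1\<close>.\<close>
  define w where "w = p - 1 - j"
  define \<alpha> where "\<alpha> = orb (\<mu> j)"
  note lj = lf_\<mu>[of j]
  have \<alpha>pol: "\<alpha> m \<in> pol l" if "m \<in> W" for m
  proof -
    have "(fdiff ^^ l) (\<alpha> m) = orb (\<mu> j) 0"
      unfolding \<alpha>_def by (simp only: fdiff_pow_orb[OF lj that] Xl[OF that])
    also have "\<dots> = 0" by (rule lin_on_0[OF orb_lin[OF lj] sW])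
    finally show ?thesis by (simp add: pol_def \<alpha>_def orb_per)
  qed
  have \<alpha>lin: "lin_on W (pol l) \<alpha>"
    using orb_lin[OF lj] \<alpha>pol by (auto simp: lin_on_def \<alpha>_def)
  have \<alpha>: "ghom BB W \<rho> (pol l) (pact w) \<alpha>"
    unfolding ghom_def
  proof (intro conjI ballI \<alpha>lin)
    fix A m assume A: "A \<in> carrier BB" and m: "m \<in> W"
    then have "A \<in> borel" by simp
    then obtain x d where Ad: "A = sl (dinv d) (x * d) 0 d" "\<not> int p dvd d" by (rule borel_cases)
    show "\<alpha> (\<rho> A m) = pact w A (\<alpha> m)"
    proof
      fix z
      let ?b = "d\<^sup>2 * z + d * (x * d)"
      have "\<alpha> (\<rho> A m) z = \<mu> j (\<rho> (ut z) (\<rho> A m))" by (simp add: \<alpha>_def orb_def)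
      also have "\<rho> (ut z) (\<rho> A m) = \<rho> (tt d) (\<rho> (ut ?b) m)"
        using repD(4)[OF W utc A m, of z] repD(4)[OF W ttc[OF Ad(2)] utc m, of ?b]
          borel_ut[OF Ad(2), of z x] Ad(1) by simp
      also have "\<mu> j \<dots> = of_int d ^ w * \<alpha> m ?b"
        unfolding w_def by (subst weight[OF j(1) Ad(2) repD(5)[OF W utc m]]) (simp add: \<alpha>_def orb_def)
      also have "\<dots> = pact w A (\<alpha> m) z"
        unfolding Ad(1) by (rule pact_sl[symmetric]) (use \<alpha>pol[OF m] pol_per in blast)
      finally show "\<alpha> (\<rho> A m) z = pact w A (\<alpha> m) z" .
    qed
  qed
  define q where "q = \<alpha> v"
  have \<alpha>X: "\<alpha> ((X ^^ i) m) = (fdiff ^^ i) (\<alpha> m)" if "m \<in> W" for i m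
    unfolding \<alpha>_def by (rule fdiff_pow_orb[OF lj that, symmetric])
  have qt: "(fdiff ^^ l') q = (\<lambda>x. \<mu> j y)"
  proof -
    have "(fdiff ^^ l') q = \<alpha> y" unfolding q_def y_def using \<alpha>X[OF v(1)] by simp
    moreover have "fdiff (\<alpha> y) = 0"
    proof -
      have "fdiff (\<alpha> y) = (fdiff ^^ l) (\<alpha> v)" using \<alpha>X[OF v(1), of l'] by (simp add: l' y_def)
      also have "\<dots> = 0" using \<alpha>pol[OF v(1)] by (simp add: pol_def)
      finally show ?thesis .
    qed
    moreover have "\<alpha> y 0 = \<mu> j y" unfolding \<alpha>_def by (rule orb0[OF yW])
    ultimately show ?thesis using fdiff_eq_0_const by metis
  qed
  define rp where "rp = (\<lambda>f a. f = (\<Sum>i<l. sc (a i) ((fdiff ^^ i) q)))"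
  have ex: "\<exists>a. rp f a" if "f \<in> pol l" for f
    using newton_span[OF qt j(2), of f] that unfolding rp_def l' by (simp add: pol_def del: funpow.simps)
  have uniq: "a i = b i" if "rp f a" "rp f b" "i < l" for f a b i
  proof -
    have "(\<Sum>i<l. sc (a i - b i) ((fdiff ^^ i) q)) = f - f"
      using that(1,2) unfolding rp_def by (simp add: fs.scale_left_diff_distrib sum_subtractf)
    then have "(\<Sum>i<Suc l'. sc (a i - b i) ((fdiff ^^ i) q)) = 0" unfolding l' by simp
    then have "a i - b i = 0"
      using newton_independent[OF qt j(2), where i=i and a="\<lambda>i. a i - b i"] that(3) unfolding l' by simp
    then show ?thesis by simp
  qed
  define coef where "coef = (\<lambda>f. SOME a. rp f a)"
  have coef: "rp f (coef f)" if "f \<in> pol l" for f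
    unfolding coef_def by (rule someI_ex[OF ex[OF that]])
  \<comment> \<open>A section of \<open>\<alpha>\<close> over \<open>unip\<close>, up to a
    deliberate minus sign: the transfer over the torus adds \<open>p - 1\<close> equal
    contributions, that is, multiplies by -1.\<close>
  define \<sigma> where "\<sigma> = (\<lambda>f. \<Sum>i<l. sc (- coef f i) ((X ^^ i) v))"
  have \<sigma>_rp: "\<sigma> f = (\<Sum>i<l. sc (- a i) ((X ^^ i) v))" if "f \<in> pol l" "rp f a" for f a
    unfolding \<sigma>_def using uniq[OF coef[OF that(1)] that(2)] by (intro sum.cong refl) simp
  have \<sigma>W: "\<sigma> f \<in> W" for f
    unfolding \<sigma>_def by (intro fs.subspace_sum[OF sW] fs.subspace_scale[OF sW] XnW v)
  have \<sigma>lin: "lin_on (pol l) W \<sigma>"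
  proof (rule lin_onI)
    fix f g assume fg: "f \<in> pol l" "g \<in> pol l"
    have "rp (f + g) (\<lambda>i. coef f i + coef g i)"
      using coef[OF fg(1)] coef[OF fg(2)] unfolding rp_def
      by (simp add: fs.scale_left_distrib sum.distrib)
    from \<sigma>_rp[OF fs.subspace_add[OF subspace_pol fg] this]
    show "\<sigma> (f + g) = \<sigma> f + \<sigma> g"
      unfolding \<sigma>_def by (simp add: fs.scale_left_diff_distrib sum.distrib[symmetric])
  next
    fix c f assume f: "f \<in> pol l"
    have "rp (sc c f) (\<lambda>i. c * coef f i)"
      using coef[OF f] unfolding rp_def by (metis (no_types, lifting) fs.scale_scale fs.scale_sum_right sum.cong)
    from \<sigma>_rp[OF fs.subspace_scale[OF subspace_pol f] this]
    show "\<sigma> (sc c f) = sc c (\<sigma> f)"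
      unfolding \<sigma>_def by (simp add: fs.scale_sum_right)
  qed (rule \<sigma>W)
  have \<alpha>\<sigma>: "\<alpha> (\<sigma> f) = - f" if "f \<in> pol l" for f
  proof -
    have "\<alpha> (\<sigma> f) = (\<Sum>i<l. \<alpha> (sc (- coef f i) ((X ^^ i) v)))"
      unfolding \<sigma>_def by (intro lin_on_sum[OF \<alpha>lin sW] fs.subspace_scale[OF sW] XnW v)
    also have "\<dots> = (\<Sum>i<l. sc (- coef f i) ((fdiff ^^ i) q))"
      by (intro sum.cong refl) (simp add: lin_onD(3)[OF \<alpha>lin XnW[OF v(1)]] \<alpha>X[OF v(1)] q_def
          del: fs.scale_minus_left)
    also have "\<dots> = - (\<Sum>i<l. sc (coef f i) ((fdiff ^^ i) q))" by (simp add: sum_negf)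
    also have "\<dots> = - f" using coef[OF that] unfolding rp_def by (rule arg_cong[OF sym])
    finally show ?thesis .
  qed
  have fdpol: "fdiff f \<in> pol l" if "f \<in> pol l" for f
    using that by (auto simp: pol_def fdiff_per funpow_swap1[symmetric] fdiff_simps)
  \<comment> \<open>On coefficients \<open>fdiff\<close> is a shift. The term shifted past the top
    is harmless on both sides, because the power \<open>l\<close> kills \<open>q\<close> as well as
    \<open>v\<close>.\<close>
  have \<sigma>fd: "\<sigma> (fdiff f) = X (\<sigma> f)" if f: "f \<in> pol l" for f
  proof -
    let ?a = "\<lambda>i. case i of 0 \<Rightarrow> 0 | Suc i \<Rightarrow> coef f i"
    have ql: "(fdiff ^^ l) q = 0" using \<alpha>pol[OF v(1)] by (simp add: q_def pol_def)
    have "fdiff f = fdiff (\<Sum>i<l. sc (coef f i) ((fdiff ^^ i) q))"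
      using coef[OF f] unfolding rp_def by (rule arg_cong)
    also have "\<dots> = (\<Sum>i<l. sc (coef f i) ((fdiff ^^ Suc i) q))" by (simp add: fdiff_simps)
    also have "\<dots> = (\<Sum>i<l'. sc (coef f i) ((fdiff ^^ Suc i) q))"
      unfolding l' sum.lessThan_Suc using ql unfolding l' by simp
    also have "\<dots> = (\<Sum>i<l. sc (?a i) ((fdiff ^^ i) q))"
      unfolding l' by (subst sum.lessThan_Suc_shift) simp
    finally have "rp (fdiff f) ?a" by (simp add: rp_def)
    from \<sigma>_rp[OF fdpol[OF f] this]
    have "\<sigma> (fdiff f) = (\<Sum>i<l'. sc (- coef f i) ((X ^^ Suc i) v))"
      unfolding l' by (subst (asm) sum.lessThan_Suc_shift) simp
    also have "\<dots> = (\<Sum>i<l. sc (- coef f i) ((X ^^ Suc i) v))"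
      unfolding l' sum.lessThan_Suc using Xl[OF v(1)] unfolding l' by simp
    also have "\<dots> = (\<Sum>i<l. X (sc (- coef f i) ((X ^^ i) v)))"
      by (intro sum.cong refl) (simp add: lin_onD(3)[OF XW XnW[OF v(1)]] del: fs.scale_minus_left)
    also have "\<dots> = X (\<sigma> f)"
      unfolding \<sigma>_def by (intro lin_on_sum[OF XW sW, symmetric] fs.subspace_scale[OF sW] XnW v)
    finally show ?thesis .
  qed
  \<comment> \<open>Commutation with \<open>fdiff\<close> and \<open>X\<close> is equivariance under
    \<open>ut 1\<close>, whose powers exhaust \<open>unip\<close>.\<close>
  have \<sigma>1: "\<sigma> (pact w (ut 1) f) = \<rho> (ut 1) (\<sigma> f)" if f: "f \<in> pol l" for f
  proof -
    have "pact w (ut 1) f = f + fdiff f"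
      by (simp add: fun_eq_iff fun_pw fdiff_apply pact_ut pol_per[OF f])
    then show ?thesis using lin_onD(2)[OF \<sigma>lin f fdpol[OF f]] \<sigma>fd[OF f] by (simp add: X_def)
  qed
  have \<sigma>n: "\<sigma> (pact w (ut (int n)) f) = \<rho> (ut (int n)) (\<sigma> f)" if f: "f \<in> pol l" for f n
  proof (induction n)
    case 0
    have "ut (int 0) = \<one>\<^bsub>BB\<^esub>" by (simp add: ut_def sl_one)
    then show ?case using repD(3)[OF W \<sigma>W] repD(3)[OF rep_pol f] by simp
  next
    case (Suc n)
    have u: "ut (int (Suc n)) = ut 1 \<otimes>\<^bsub>BB\<^esub> ut (int n)" by (simp add: ut_mult add.commute)
    have pf: "pact w (ut (int n)) f \<in> pol l" by (rule pact_pol[OF f ut_borel])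
    show ?case
      unfolding u repD(4)[OF rep_pol utc utc f] repD(4)[OF W utc utc \<sigma>W] \<sigma>1[OF pf] Suc ..
  qed
  have \<sigma>u: "\<sigma> (pact w (ut x) f) = \<rho> (ut x) (\<sigma> f)" if f: "f \<in> pol l" for f x
  proof -
    have "ut x = ut (int (nat (x mod int p)))" using p_ge_2 by (simp add: ut_eq_iff cong_def)
    then show ?thesis using \<sigma>n[OF f] by metis
  qed
  have \<sigma>: "ghom (BB\<lparr>carrier := unip\<rparr>) (pol l) (pact w) W \<rho> \<sigma>"
    unfolding ghom_def using \<sigma>lin \<sigma>u by (auto simp: unip_def)
  define \<beta> where "\<beta> = rel_tr BB tor (pact w) \<rho> \<sigma>"
  have \<beta>: "ghom BB (pol l) (pact w) W \<rho> \<beta>"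
    unfolding \<beta>_def by (rule U.rel_tr_ghom[OF rep_pol W \<sigma>])
  have "\<alpha> (\<beta> f) = f" if f: "f \<in> pol l" for f
  proof -
    have tc: "t \<in> carrier BB" if "t \<in> tor" for t using that U.R_carrier by blast
    have if': "pact w (inv\<^bsub>BB\<^esub> t) f \<in> pol l" if "t \<in> tor" for t
      by (rule repD(5)[OF rep_pol B.GH.inv_closed[OF tc[OF that]] f])
    have "\<alpha> (\<beta> f) = (\<Sum>t\<in>tor. \<alpha> (\<rho> t (\<sigma> (pact w (inv\<^bsub>BB\<^esub> t) f))))"
      unfolding \<beta>_def rel_tr_def
      by (intro lin_on_sum[OF \<alpha>lin sW] repD(5)[OF W tc] \<sigma>W)
    also have "\<dots> = (\<Sum>t\<in>tor. - f)"
    proof (intro sum.cong refl)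
      fix t assume t: "t \<in> tor"
      have "\<alpha> (\<rho> t (\<sigma> (pact w (inv\<^bsub>BB\<^esub> t) f))) = pact w t (- pact w (inv\<^bsub>BB\<^esub> t) f)"
        using ghomD(3)[OF \<alpha> tc[OF t] \<sigma>W] \<alpha>\<sigma>[OF if'[OF t]] by simp
      also have "\<dots> = - pact w t (pact w (inv\<^bsub>BB\<^esub> t) f)"
        by (rule lin_on_minus[OF repD(2)[OF rep_pol tc[OF t]] subspace_pol if'[OF t]])
      also have "\<dots> = - f" by (simp only: B.GH.rep_inv(2)[OF rep_pol tc[OF t] f])
      finally show "\<alpha> (\<rho> t (\<sigma> (pact w (inv\<^bsub>BB\<^esub> t) f))) = - f" .
    qed
    also have "\<dots> = f"
    proof
      fix z
      have "card tor = p - 1" unfolding tor_def using p_ge_2 by (simp add: card_image[OF tt_inj] nat_diff_distrib)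
      then show "(\<Sum>t\<in>tor. - f) z = f z"
        using of_nat_p_minus_1 by (simp only: fun_sum_apply) (simp add: fun_pw)
    qed
    finally show ?thesis .
  qed
  with \<alpha> \<beta> lp l' show thesis by (intro that[of l w \<alpha> \<beta>]) auto
qed

end

section \<open>Decomposition over the Borel subgroup\<close>

text \<open>A basis of \<open>W'\<close> stays independent when \<open>v\<close> is adjoined, and
  the finite spanning set keeps all cardinalities finite. This is the measure by which the splitting
  off of summands terminates.\<close>

lemma dim_less_of_proper:
  fixes W :: "('i \<Rightarrow> 'k::field) set"
  assumes "finite S" "W \<subseteq> fs.span S" "fs.subspace W'" "W' \<subseteq> W" "v \<in> W" "v \<notin> W'"
  shows "fs.dim W' < fs.dim W"
proof -
  obtain C where C: "C \<subseteq> W'" "fs.independent C" "W' \<subseteq> fs.span C" "card C = fs.dim W'"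
    by (rule fs.basis_exists)
  obtain D where D: "D \<subseteq> W" "fs.independent D" "W \<subseteq> fs.span D" "card D = fs.dim W"
    by (rule fs.basis_exists)
  have finD: "finite D" using fs.independent_span_bound[OF assms(1) D(2)] D(1) assms(2) by blast
  have finC: "finite C"
    using fs.independent_span_bound[OF assms(1) C(2)] C(1) assms(2,4) by blast
  have "fs.span C \<subseteq> W'" by (rule fs.span_minimal[OF C(1) assms(3)])
  then have v: "v \<notin> fs.span C" using assms(6) by blast
  then have "fs.independent (insert v C)" using C(2) by (simp add: fs.independent_insert)
  moreover have "insert v C \<subseteq> fs.span D" using C(1) assms(4,5) D(3) by blast
  ultimately have "card (insert v C) \<le> card D" using fs.independent_span_bound[OF finD] by blast
  moreover have "v \<notin> C" using v fs.span_base by blast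
  ultimately show ?thesis using C(4) D(4) finC by simp
qed

text \<open>The number of the summand becomes an extra coordinate, so that a sum of function spaces
  is again a function space; vanishing from \<open>N\<close> on makes a vector determined by its
  components.\<close>

definition dsum :: "nat \<Rightarrow> (nat \<Rightarrow> (nat \<Rightarrow> 'k::field) set) \<Rightarrow> (nat \<times> nat \<Rightarrow> 'k) set" where
  "dsum N V = {F. (\<forall>j<N. (\<lambda>i. F (j, i)) \<in> V j) \<and> (\<forall>j i. \<not> j < N \<longrightarrow> F (j, i) = 0)}"

definition dact :: "nat \<Rightarrow> (nat \<Rightarrow> 'g \<Rightarrow> (nat \<Rightarrow> 'k::field) \<Rightarrow> nat \<Rightarrow> 'k) \<Rightarrow> 'g \<Rightarrow> (nat \<times> nat \<Rightarrow> 'k) \<Rightarrow> nat \<times> nat \<Rightarrow> 'k" where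
  "dact N \<rho> g F = (\<lambda>(j, i). if j < N then \<rho> j g (\<lambda>i. F (j, i)) i else 0)"

definition inc :: "nat \<Rightarrow> (nat \<Rightarrow> 'k::field) \<Rightarrow> nat \<times> nat \<Rightarrow> 'k" where
  "inc j x = (\<lambda>(j', i). if j' = j then x i else 0)"

definition pr :: "nat \<Rightarrow> (nat \<times> nat \<Rightarrow> 'k::field) \<Rightarrow> nat \<Rightarrow> 'k" where
  "pr j F = (\<lambda>i. F (j, i))"

lemma pr_simps [simp]: "pr j (F + F') = pr j F + pr j F'" "pr j (sc c F) = sc c (pr j F)" "pr j 0 = 0"
  by (simp_all add: pr_def fun_eq_iff fun_pw)

lemma inc_simps: "inc j (x + x') = inc j x + inc j x'" "inc j (sc c x) = sc c (inc j x)" "inc j 0 = 0"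
  by (auto simp add: inc_def fun_eq_iff fun_pw)

lemma pr_inc: "pr i (inc j x) = (if i = j then x else 0)"
  by (auto simp: pr_def inc_def fun_eq_iff fun_pw)

lemma pr_sum: "pr j (\<Sum>i\<in>A. F i) = (\<Sum>i\<in>A. pr j (F i))"
  by (simp add: pr_def fun_eq_iff fun_sum_apply)

lemma pr_dact: "j < N \<Longrightarrow> pr j (dact N \<rho> g F) = \<rho> j g (pr j F)"
  by (simp add: pr_def dact_def)

lemma dsum_pr: "F \<in> dsum N V \<Longrightarrow> j < N \<Longrightarrow> pr j F \<in> V j"
  by (simp add: dsum_def pr_def)

lemma dsum_eqI:
  assumes "F \<in> dsum N V" "F' \<in> dsum N V" "\<And>j. j < N \<Longrightarrow> pr j F = pr j F'"
  shows "F = F'"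
proof
  fix z :: "nat \<times> nat"
  obtain j i where z: "z = (j, i)" by (cases z)
  show "F z = F' z"
  proof (cases "j < N")
    case True
    then have "pr j F i = pr j F' i" using assms(3) by simp
    then show ?thesis by (simp add: pr_def z)
  next
    case False
    then show ?thesis using assms(1,2) by (simp add: dsum_def z)
  qed
qed

lemma subspace_dsum:
  assumes "\<And>j. j < N \<Longrightarrow> fs.subspace (V j)"
  shows "fs.subspace (dsum N V)"
  unfolding fs.subspace_def
proof (intro conjI ballI allI)
  have *: "F \<in> dsum N V \<longleftrightarrow> (\<forall>j<N. pr j F \<in> V j) \<and> (\<forall>j i. \<not> j < N \<longrightarrow> F (j, i) = 0)" for F
    by (simp add: dsum_def pr_def)
  show "0 \<in> dsum N V" using assms by (simp add: * fs.subspace_0 fun_pw)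
  fix F F' assume "F \<in> dsum N V" "F' \<in> dsum N V"
  then show "F + F' \<in> dsum N V" using assms by (simp add: * fs.subspace_add fun_pw)
next
  fix c F assume F: "F \<in> dsum N V"
  have *: "F \<in> dsum N V \<longleftrightarrow> (\<forall>j<N. pr j F \<in> V j) \<and> (\<forall>j i. \<not> j < N \<longrightarrow> F (j, i) = 0)" for F
    by (simp add: dsum_def pr_def)
  show "sc c F \<in> dsum N V" using assms F by (simp add: * fs.subspace_scale fun_pw)
qed

lemma dact_dsum:
  assumes "\<And>j. j < N \<Longrightarrow> rep G (V j) (\<rho> j)" "g \<in> carrier G" "F \<in> dsum N V"
  shows "dact N \<rho> g F \<in> dsum N V"
proof -
  have "pr j (dact N \<rho> g F) \<in> V j" if "j < N" for j
    unfolding pr_dact[OF that] by (rule repD(5)[OF assms(1)[OF that] assms(2) dsum_pr[OF assms(3) that]])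
  then show ?thesis by (simp add: dsum_def pr_def dact_def)
qed

lemma rep_dsum:
  assumes r: "\<And>j. j < N \<Longrightarrow> rep G (V j) (\<rho> j)" and G: "group G"
  shows "rep G (dsum N V) (dact N \<rho>)"
proof -
  have s: "fs.subspace (dsum N V)" by (rule subspace_dsum) (rule repD(1)[OF r])
  note m = dact_dsum[where N=N and V=V and \<rho>=\<rho> and G=G, OF r]
  show ?thesis
    unfolding rep_def
  proof (intro conjI ballI s lin_onI)
    fix g F assume g: "g \<in> carrier G" and F: "F \<in> dsum N V"
    show "dact N \<rho> g F \<in> dsum N V" by (rule m[OF _ g F])
    fix c
    show "dact N \<rho> g (sc c F) = sc c (dact N \<rho> g F)"
      by (rule dsum_eqI[OF m[OF _ g fs.subspace_scale[OF s F]] fs.subspace_scale[OF s m[OF _ g F]]])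
        (simp_all add: pr_dact lin_onD(3)[OF repD(2)[OF r g] dsum_pr[OF F]])
    fix F' assume F': "F' \<in> dsum N V"
    show "dact N \<rho> g (F + F') = dact N \<rho> g F + dact N \<rho> g F'"
      by (rule dsum_eqI[OF m[OF _ g fs.subspace_add[OF s F F']] fs.subspace_add[OF s m[OF _ g F] m[OF _ g F']]])
        (simp_all add: pr_dact lin_onD(2)[OF repD(2)[OF r g] dsum_pr[OF F] dsum_pr[OF F']])
  next
    fix F assume F: "F \<in> dsum N V"
    show "dact N \<rho> \<one>\<^bsub>G\<^esub> F = F"
      by (rule dsum_eqI[OF m[OF _ monoid.one_closed[OF group.is_monoid[OF G]] F] F])
        (simp_all add: pr_dact repD(3)[OF r dsum_pr[OF F]])
  next
    fix g h F assume g: "g \<in> carrier G" and h: "h \<in> carrier G" and F: "F \<in> dsum N V"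
    show "dact N \<rho> (g \<otimes>\<^bsub>G\<^esub> h) F = dact N \<rho> g (dact N \<rho> h F)"
      by (rule dsum_eqI[OF m[OF _ monoid.m_closed[OF group.is_monoid[OF G] g h] F] m[OF _ g m[OF _ h F]]])
        (simp_all add: pr_dact repD(4)[OF r g h dsum_pr[OF F]])
  qed
qed

lemma inc_dsum:
  assumes "\<And>j. j < N \<Longrightarrow> fs.subspace (V j)" "j < N" "x \<in> V j"
  shows "inc j x \<in> dsum N V"
proof -
  have "pr i (inc j x) \<in> V i" if "i < N" for i
    using assms(3) fs.subspace_0[OF assms(1)[OF that]] by (simp add: pr_inc)
  then show ?thesis using assms(2) by (auto simp: dsum_def pr_def inc_def)
qed

lemma ghom_pr:
  assumes "j < N"
  shows "ghom G (dsum N V) (dact N \<rho>) (V j) (\<rho> j) (pr j)"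
  using assms by (auto simp: ghom_def lin_on_def pr_dact dsum_pr)

lemma ghom_inc:
  assumes r: "\<And>j. j < N \<Longrightarrow> rep G (V j) (\<rho> j)" and j: "j < N"
  shows "ghom G (V j) (\<rho> j) (dsum N V) (dact N \<rho>) (inc j)"
  unfolding ghom_def
proof (intro conjI ballI lin_onI)
  note i = inc_dsum[where N=N and V=V, OF repD(1)[OF r] j]
  fix x assume x: "x \<in> V j"
  show "inc j x \<in> dsum N V" by (rule i[OF _ x])
  fix g assume g: "g \<in> carrier G"
  show "inc j (\<rho> j g x) = dact N \<rho> g (inc j x)"
  proof (rule dsum_eqI[OF i[OF _ repD(5)[OF r[OF j] g x]] dact_dsum[where G=G, OF r g i[OF _ x]]])
    fix k assume k: "k < N"
    show "pr k (inc j (\<rho> j g x)) = pr k (dact N \<rho> g (inc j x))"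
      using k lin_on_0[OF repD(2)[OF r[OF k] g] repD(1)[OF r[OF k]]] by (simp add: pr_dact pr_inc)
  qed auto
qed (simp_all add: inc_simps)

lemma dsum_expand:
  assumes "\<And>j. j < N \<Longrightarrow> fs.subspace (V j)" "F \<in> dsum N V"
  shows "F = (\<Sum>j<N. inc j (pr j F))"
proof (rule dsum_eqI[OF assms(2)])
  show "(\<Sum>j<N. inc j (pr j F)) \<in> dsum N V"
    by (intro fs.subspace_sum subspace_dsum assms(1) inc_dsum dsum_pr[OF assms(2)]) auto
  fix j assume "j < N"
  then show "pr j F = pr j (\<Sum>j<N. inc j (pr j F))"
    by (simp add: pr_sum pr_inc)
qed

context finite_group
begin

text \<open>The \<open>Q j\<close> are summands of \<open>V\<close> with projective complement,
  while \<open>X j\<close> is only a stable substitute for \<open>Q j\<close>. The round trip on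
  \<open>V\<close> misses the identity by the errors of the substitutions and by the complement, all
  of them null.\<close>

lemma steq_dsum:
  fixes V :: "('i \<Rightarrow> 'k::field) set" and X :: "nat \<Rightarrow> (nat \<Rightarrow> 'k) set"
    and Q :: "nat \<Rightarrow> ('j \<Rightarrow> 'k) set"
  assumes V: "rep G V \<rho>" and X: "\<And>j. j < N \<Longrightarrow> rep G (X j) (\<tau> j)" and Q: "\<And>j. j < N \<Longrightarrow> rep G (Q j) (\<kappa> j)"
    and st: "\<And>j. j < N \<Longrightarrow> steq G (X j) (\<tau> j) (Q j) (\<kappa> j)"
    and \<alpha>: "\<And>j. j < N \<Longrightarrow> ghom G V \<rho> (Q j) (\<kappa> j) (\<alpha> j)"
    and \<beta>: "\<And>j. j < N \<Longrightarrow> ghom G (Q j) (\<kappa> j) V \<rho> (\<beta> j)"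
    and orth: "\<And>i j f. i < N \<Longrightarrow> j < N \<Longrightarrow> f \<in> Q j \<Longrightarrow> \<alpha> i (\<beta> j f) = (if i = j then f else 0)"
    and n: "null G V \<rho> V \<rho> (\<lambda>x. x - (\<Sum>j<N. \<beta> j (\<alpha> j x)))"
  shows "steq G V \<rho> (dsum N X) (dact N \<tau>)"
proof -
  have "\<forall>j. \<exists>a b. j < N \<longrightarrow> ghom G (X j) (\<tau> j) (Q j) (\<kappa> j) a \<and> ghom G (Q j) (\<kappa> j) (X j) (\<tau> j) b \<and>
     null G (X j) (\<tau> j) (X j) (\<tau> j) (\<lambda>x. b (a x) - x) \<and>
     null G (Q j) (\<kappa> j) (Q j) (\<kappa> j) (\<lambda>x. a (b x) - x)"
    using st unfolding steq_def by blast
  from choice[OF this] obtain a where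
    "\<forall>j. \<exists>b. j < N \<longrightarrow> ghom G (X j) (\<tau> j) (Q j) (\<kappa> j) (a j) \<and> ghom G (Q j) (\<kappa> j) (X j) (\<tau> j) b \<and>
     null G (X j) (\<tau> j) (X j) (\<tau> j) (\<lambda>x. b (a j x) - x) \<and>
     null G (Q j) (\<kappa> j) (Q j) (\<kappa> j) (\<lambda>x. a j (b x) - x)" by (rule exE)
  from choice[OF this] obtain b where
    ab: "\<forall>j. j < N \<longrightarrow> ghom G (X j) (\<tau> j) (Q j) (\<kappa> j) (a j) \<and> ghom G (Q j) (\<kappa> j) (X j) (\<tau> j) (b j) \<and>
     null G (X j) (\<tau> j) (X j) (\<tau> j) (\<lambda>x. b j (a j x) - x) \<and>
     null G (Q j) (\<kappa> j) (Q j) (\<kappa> j) (\<lambda>x. a j (b j x) - x)" by (rule exE)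
  have a: "ghom G (X j) (\<tau> j) (Q j) (\<kappa> j) (a j)"
    and b: "ghom G (Q j) (\<kappa> j) (X j) (\<tau> j) (b j)"
    and n1: "null G (X j) (\<tau> j) (X j) (\<tau> j) (\<lambda>x. b j (a j x) - x)"
    and n2: "null G (Q j) (\<kappa> j) (Q j) (\<kappa> j) (\<lambda>x. a j (b j x) - x)" if "j < N" for j
    using ab[rule_format, OF that] by simp_all
  let ?D = "dsum N X" and ?\<delta> = "dact N \<tau>"
  have D: "rep G ?D ?\<delta>" by (rule rep_dsum[OF X is_group])
  have gi: "ghom G (X j) (\<tau> j) ?D ?\<delta> (inc j)" if "j < N" for j
    by (rule ghom_inc[OF X that])
  have gp: "ghom G ?D ?\<delta> (X j) (\<tau> j) (pr j)" if "j < N" for j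
    by (rule ghom_pr[OF that])
  define A where "A = (\<lambda>x. \<Sum>j<N. inc j (b j (\<alpha> j x)))"
  define B where "B = (\<lambda>F. \<Sum>j<N. \<beta> j (a j (pr j F)))"
  have A: "ghom G V \<rho> ?D ?\<delta> A"
    unfolding A_def
    by (rule ghom_sum[OF V D], rule ghom_comp[OF ghom_comp[OF \<alpha> b] gi]) auto
  have B: "ghom G ?D ?\<delta> V \<rho> B"
    unfolding B_def
    by (rule ghom_sum[OF D V], rule ghom_comp[OF ghom_comp[OF gp a] \<beta>]) auto
  have prA: "pr j (A x) = b j (\<alpha> j x)" if "j < N" for j x
    using that by (simp add: A_def pr_sum pr_inc)
  have N1: "null G V \<rho> V \<rho> (\<lambda>x. B (A x) - x)"
  proof -
    have "null G V \<rho> V \<rho> (\<lambda>x. (\<Sum>j<N. \<beta> j (a j (b j (\<alpha> j x)) - \<alpha> j x)) + - (x - (\<Sum>j<N. \<beta> j (\<alpha> j x))))"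
    proof (intro null_add[OF V V] null_sum[OF V V] null_minus[OF V V n])
      fix j assume "j \<in> {..<N}"
      then have j: "j < N" by simp
      show "null G V \<rho> V \<rho> (\<lambda>x. \<beta> j (a j (b j (\<alpha> j x)) - \<alpha> j x))"
        by (rule null_comp_right[OF null_comp_left[OF Q[OF j] Q[OF j] n2[OF j] \<beta>[OF j]] \<alpha>[OF j]])
    qed
    then show ?thesis
    proof (rule null_cong)
      fix x assume x: "x \<in> V"
      have "B (A x) = (\<Sum>j<N. \<beta> j (a j (b j (\<alpha> j x))))"
        unfolding B_def by (intro sum.cong refl) (simp add: prA)
      moreover have "\<beta> j (a j (b j (\<alpha> j x)) - \<alpha> j x) = \<beta> j (a j (b j (\<alpha> j x))) - \<beta> j (\<alpha> j x)" if j: "j < N" for j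
        by (rule lin_on_diff[OF ghomD(1)[OF \<beta>[OF j]] repD(1)[OF Q[OF j]]
          ghomD(2)[OF a[OF j] ghomD(2)[OF b[OF j] ghomD(2)[OF \<alpha>[OF j] x]]] ghomD(2)[OF \<alpha>[OF j] x]])
      ultimately show "(\<Sum>j<N. \<beta> j (a j (b j (\<alpha> j x)) - \<alpha> j x)) + - (x - (\<Sum>j<N. \<beta> j (\<alpha> j x))) = B (A x) - x"
        by (simp add: sum_subtractf)
    qed
  qed
  have N2: "null G ?D ?\<delta> ?D ?\<delta> (\<lambda>F. A (B F) - F)"
  proof -
    have "null G ?D ?\<delta> ?D ?\<delta> (\<lambda>F. \<Sum>j<N. inc j (b j (a j (pr j F)) - pr j F))"
    proof (intro null_sum[OF D D])
      fix j assume "j \<in> {..<N}"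
      then have j: "j < N" by simp
      show "null G ?D ?\<delta> ?D ?\<delta> (\<lambda>F. inc j (b j (a j (pr j F)) - pr j F))"
        by (rule null_comp_right[OF null_comp_left[OF X[OF j] X[OF j] n1[OF j] gi[OF j]] gp[OF j]])
    qed
    then show ?thesis
    proof (rule null_cong)
      fix F assume F: "F \<in> ?D"
      have pF: "pr j F \<in> X j" if "j < N" for j by (rule dsum_pr[OF F that])
      have "\<alpha> i (B F) = a i (pr i F)" if i: "i < N" for i
      proof -
        have "\<alpha> i (B F) = (\<Sum>j<N. \<alpha> i (\<beta> j (a j (pr j F))))"
          unfolding B_def
          by (intro lin_on_sum[OF ghomD(1)[OF \<alpha>[OF i]] repD(1)[OF V]] ghomD(2)[OF \<beta>] ghomD(2)[OF a] pF) auto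
        also have "\<dots> = (\<Sum>j<N. if i = j then a j (pr j F) else 0)"
          by (intro sum.cong refl orth i ghomD(2)[OF a] pF) auto
        also have "\<dots> = a i (pr i F)" using i by simp
        finally show ?thesis .
      qed
      then have "A (B F) = (\<Sum>j<N. inc j (b j (a j (pr j F))))"
        unfolding A_def by (intro sum.cong refl) simp
      moreover have "F = (\<Sum>j<N. inc j (pr j F))"
        by (rule dsum_expand[OF repD(1)[OF X] F])
      ultimately have "A (B F) - F = (\<Sum>j<N. inc j (b j (a j (pr j F))) - inc j (pr j F))"
        by (simp add: sum_subtractf)
      also have "\<dots> = (\<Sum>j<N. inc j (b j (a j (pr j F)) - pr j F))"
        by (intro sum.cong refl) (auto simp: inc_def fun_eq_iff fun_pw)
      finally show "(\<Sum>j<N. inc j (b j (a j (pr j F)) - pr j F)) = A (B F) - F" by simp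
    qed
  qed
  show ?thesis unfolding steq_def using A B N1 N2 by blast
qed

end

context char_p
begin

text \<open>A decomposition up to projective summands: those of length \<open>p\<close> are left
  out, and the last clause places them in the null part.\<close>

definition borel_decomp where
  "borel_decomp W \<rho> (N::nat) l w \<alpha> \<beta> \<longleftrightarrow>
     (\<forall>j<N. 1 \<le> l j \<and> l j < p \<and> ghom BB W \<rho> (pol (l j)) (pact (w j)) (\<alpha> j) \<and>
       ghom BB (pol (l j)) (pact (w j)) W \<rho> (\<beta> j)) \<and>
     (\<forall>i<N. \<forall>j<N. \<forall>f\<in>pol (l j). \<alpha> i (\<beta> j f) = (if i = j then f else 0)) \<and>
     null BB W \<rho> W \<rho> (\<lambda>x. x - (\<Sum>j<N. \<beta> j (\<alpha> j x)))"

text \<open>Split off one \<open>pol l\<close> and continue with the kernel of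
  \<open>\<alpha>\<close>, onto which \<open>1 - \<beta> \<alpha>\<close> projects. The spanning set
  stays fixed while the dimension drops.\<close>

lemma borel_decomposition:
  fixes W :: "('i \<Rightarrow> 'k) set"
  assumes "rep BB W \<rho>" "finite S" "W \<subseteq> fs.span S"
  shows "\<exists>N l w \<alpha> \<beta>. borel_decomp W \<rho> N l w \<alpha> \<beta>"
  using assms(1,3)
proof (induction "fs.dim W" arbitrary: W rule: less_induct)
  case less
  note W = less.prems(1)
  show ?case
  proof (cases "W = {0}")
    case True
    have "null BB W \<rho> W \<rho> (\<lambda>x. x)"
      by (rule B.GH.null_cong[OF B.GH.null_zero[OF W W]]) (simp add: True)
    then have "borel_decomp W \<rho> 0 l w \<alpha> \<beta>" for l w \<alpha> \<beta> by (simp add: borel_decomp_def)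
    then show ?thesis by blast
  next
    case False
    then obtain l w \<alpha> \<beta> where l: "1 \<le> l" "l \<le> p" and \<alpha>: "ghom BB W \<rho> (pol l) (pact w) \<alpha>"
      and \<beta>: "ghom BB (pol l) (pact w) W \<rho> \<beta>" and ab: "\<And>f. f \<in> pol l \<Longrightarrow> \<alpha> (\<beta> f) = f"
      by (rule borel_split[OF W]) blast
    let ?K = "{m \<in> W. \<alpha> m = 0}"
    have K: "rep BB ?K \<rho>" by (rule B.GH.rep_kernel[OF W rep_pol \<alpha>])
    \<comment> \<open>The constant function shows that the summand is nonzero, hence that the kernel
      is proper.\<close>
    have one: "(\<lambda>x. 1) \<in> pol l"
      using monomial_pol[of 0 l] l by simp
    have "\<beta> (\<lambda>x. 1) \<in> W" by (rule ghomD(2)[OF \<beta> one])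
    moreover have "\<beta> (\<lambda>x. 1) \<notin> ?K" using ab[OF one] by (auto simp: fun_eq_iff fun_pw)
    ultimately have "fs.dim ?K < fs.dim W"
      by (intro dim_less_of_proper[OF assms(2) less.prems(2) repD(1)[OF K]]) auto
    from less.hyps[OF this K] less.prems(2)
    obtain N :: nat and L w' \<alpha>' \<beta>' where ih: "borel_decomp ?K \<rho> N L w' \<alpha>' \<beta>'" by blast
    have ih1: "1 \<le> L j \<and> L j < p"
      and \<alpha>': "ghom BB ?K \<rho> (pol (L j)) (pact (w' j)) (\<alpha>' j)"
      and \<beta>': "ghom BB (pol (L j)) (pact (w' j)) ?K \<rho> (\<beta>' j)" if "j < N" for j
      using ih that unfolding borel_decomp_def by simp_all
    have ih2: "\<alpha>' i (\<beta>' j f) = (if i = j then f else 0)" if "i < N" "j < N" "f \<in> pol (L j)" for i j f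
      using ih that unfolding borel_decomp_def by simp
    have ih3: "null BB ?K \<rho> ?K \<rho> (\<lambda>x. x - (\<Sum>j<N. \<beta>' j (\<alpha>' j x)))"
      using ih unfolding borel_decomp_def by blast
    define \<pi> where "\<pi> = (\<lambda>x. x - \<beta> (\<alpha> x))"
    have \<pi>W: "ghom BB W \<rho> W \<rho> \<pi>"
      unfolding \<pi>_def by (intro ghom_diff[OF W W] ghom_id ghom_comp[OF \<alpha> \<beta>])
    have \<pi>K: "\<pi> x \<in> ?K" if "x \<in> W" for x
    proof -
      have "\<alpha> (\<pi> x) = \<alpha> x - \<alpha> (\<beta> (\<alpha> x))"
        unfolding \<pi>_def
        by (rule lin_on_diff[OF ghomD(1)[OF \<alpha>] repD(1)[OF W] that ghomD(2)[OF \<beta> ghomD(2)[OF \<alpha> that]]])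
      then show ?thesis using ghomD(2)[OF \<pi>W that] ab[OF ghomD(2)[OF \<alpha> that]] by simp
    qed
    have \<pi>: "ghom BB W \<rho> ?K \<rho> \<pi>"
      using \<pi>W \<pi>K by (auto simp: ghom_def lin_on_def)
    have incl: "ghom BB ?K \<rho> W \<rho> (\<lambda>x. x)" by (auto simp: ghom_def lin_on_def)
    have \<pi>id: "\<pi> x = x" if "x \<in> ?K" for x
    proof -
      have "\<beta> 0 = 0" by (rule lin_on_0[OF ghomD(1)[OF \<beta>] subspace_pol])
      then show ?thesis using that by (simp add: \<pi>_def)
    qed
    have \<pi>\<beta>: "\<pi> (\<beta> f) = 0" if "f \<in> pol l" for f using ab[OF that] by (simp add: \<pi>_def)
    have \<alpha>'0: "\<alpha>' j 0 = 0" if "j < N" for j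
      by (rule lin_on_0[OF ghomD(1)[OF \<alpha>'[OF that]] repD(1)[OF K]])
    have \<alpha>\<pi>: "ghom BB W \<rho> (pol (L j)) (pact (w' j)) (\<lambda>x. \<alpha>' j (\<pi> x))" if "j < N" for j
      by (rule ghom_comp[OF \<pi> \<alpha>'[OF that]])
    have \<beta>W: "ghom BB (pol (L j)) (pact (w' j)) W \<rho> (\<beta>' j)" if "j < N" for j
      using ghom_comp[OF \<beta>'[OF that] incl] by simp
    have \<alpha>\<pi>\<beta>: "\<alpha>' i (\<pi> (\<beta>' j f)) = (if i = j then f else 0)" if "i < N" "j < N" "f \<in> pol (L j)" for i j f
      using \<pi>id[OF ghomD(2)[OF \<beta>'[OF that(2)] that(3)]] ih2[OF that] by simp
    have nK: "null BB W \<rho> W \<rho> (\<lambda>x. \<pi> x - (\<Sum>j<N. \<beta>' j (\<alpha>' j (\<pi> x))))"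
      by (rule B.GH.null_comp_right[OF B.GH.null_comp_left[OF K K ih3 incl] \<pi>])
    show ?thesis
    \<comment> \<open>A summand of length \<open>p\<close> is the projective module
      \<open>per\<close> and joins the null part; any other length is appended as a new summand with
      index \<open>N\<close>.\<close>
    proof (cases "l = p")
      case True
      have "null BB per (pact w) per (pact w) (\<lambda>x. x)" by (rule null_per)
      then have n0: "null BB W \<rho> W \<rho> (\<lambda>x. \<beta> (\<alpha> x))"
        using B.GH.null_comp_right[OF B.GH.null_comp_left[OF rep_pol rep_pol _ \<beta>] \<alpha>] True pol_p by simp
      have n1: "null BB W \<rho> W \<rho> (\<lambda>x. x - (\<Sum>j<N. \<beta>' j (\<alpha>' j (\<pi> x))))"
        by (rule B.GH.null_cong[OF B.GH.null_add[OF W W nK n0]]) (simp add: \<pi>_def)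
      have "borel_decomp W \<rho> N L w' (\<lambda>j x. \<alpha>' j (\<pi> x)) \<beta>'"
        unfolding borel_decomp_def using ih1 by (intro conjI allI impI ballI \<alpha>\<pi> \<beta>W \<alpha>\<pi>\<beta> n1) auto
      then show ?thesis by blast
    next
      case False
      let ?L = "\<lambda>j. if j < N then L j else l" and ?w = "\<lambda>j. if j < N then w' j else w"
      let ?a = "\<lambda>j. if j < N then (\<lambda>x. \<alpha>' j (\<pi> x)) else \<alpha>" and ?b = "\<lambda>j. if j < N then \<beta>' j else \<beta>"
      have 1: "?a i (?b j f) = (if i = j then f else 0)" if ij: "i < Suc N" "j < Suc N" "f \<in> pol (?L j)" for i j f
      proof -
        have "\<alpha> (\<beta>' j f) = 0" if "j < N" "f \<in> pol (L j)"
          using ghomD(2)[OF \<beta>'[OF that(1)] that(2)] by simp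
        then show ?thesis using ij \<alpha>\<pi>\<beta> \<pi>\<beta> \<alpha>'0 ab
          by (cases "i < N"; cases "j < N") auto
      qed
      have 2: "null BB W \<rho> W \<rho> (\<lambda>x. x - (\<Sum>j<Suc N. ?b j (?a j x)))"
        by (rule B.GH.null_cong[OF nK]) (simp add: \<pi>_def algebra_simps)
      have 3: "1 \<le> ?L j \<and> ?L j < p \<and> ghom BB W \<rho> (pol (?L j)) (pact (?w j)) (?a j) \<and>
          ghom BB (pol (?L j)) (pact (?w j)) W \<rho> (?b j)" if "j < Suc N" for j
        using ih1[of j] \<alpha>\<pi>[of j] \<beta>W[of j] \<alpha> \<beta> l False by simp
      have "borel_decomp W \<rho> (Suc N) ?L ?w ?a ?b"
        unfolding borel_decomp_def by (intro conjI[OF _ conjI[OF _ 2]] allI impI ballI 1 3)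
      then show ?thesis by blast
    qed
  qed
qed

end

section \<open>Free modules and syzygies\<close>

definition slice :: "('g \<times> 'i \<Rightarrow> 'k) \<Rightarrow> 'g \<Rightarrow> 'i \<Rightarrow> 'k" where
  "slice F g = (\<lambda>i. F (g, i))"

lemma slice_simps [simp]: "slice (F + F') g = slice F g + slice F' g" "slice (sc c F) g = sc c (slice F g)"
  "slice 0 g = 0"
  by (simp_all add: slice_def fun_eq_iff fun_pw)

lemma slice_ext: "(\<And>g. slice F g = slice F' g) \<Longrightarrow> F = F'"
  by (auto simp: slice_def fun_eq_iff)

text \<open>The group algebra tensored with the underlying space of \<open>V\<close>, as families of
  vectors indexed by the group. The action on \<open>V\<close> plays its part only in
  \<open>cover\<close>.\<close>

definition free :: "('g, 'x) monoid_scheme \<Rightarrow> ('i \<Rightarrow> 'k::field) set \<Rightarrow> ('g \<times> 'i \<Rightarrow> 'k) set" where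
  "free G V = {F. (\<forall>g\<in>carrier G. slice F g \<in> V) \<and> (\<forall>g. g \<notin> carrier G \<longrightarrow> slice F g = 0)}"

definition free_act :: "('g, 'x) monoid_scheme \<Rightarrow> 'g \<Rightarrow> ('g \<times> 'i \<Rightarrow> 'k::field) \<Rightarrow> 'g \<times> 'i \<Rightarrow> 'k" where
  "free_act G h F = (\<lambda>(g, i). if g \<in> carrier G then F (inv\<^bsub>G\<^esub> h \<otimes>\<^bsub>G\<^esub> g, i) else 0)"

text \<open>The canonical surjection from the free module: the vector \<open>x\<close> at position
  \<open>g\<close> goes to \<open>\<rho> g x\<close>. Placing a vector at the unit gives a linear
  section.\<close>

definition cover :: "('g, 'x) monoid_scheme \<Rightarrow> ('g \<Rightarrow> ('i \<Rightarrow> 'k::field) \<Rightarrow> ('i \<Rightarrow> 'k)) \<Rightarrow> ('g \<times> 'i \<Rightarrow> 'k) \<Rightarrow> 'i \<Rightarrow> 'k"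
  where "cover G \<rho> F = (\<Sum>g\<in>carrier G. \<rho> g (slice F g))"

definition single :: "'g \<Rightarrow> ('i \<Rightarrow> 'k::field) \<Rightarrow> 'g \<times> 'i \<Rightarrow> 'k" where
  "single h x = (\<lambda>(g, i). if g = h then x i else 0)"

lemma slice_free_act: "slice (free_act G h F) g = (if g \<in> carrier G then slice F (inv\<^bsub>G\<^esub> h \<otimes>\<^bsub>G\<^esub> g) else 0)"
  by (auto simp: slice_def free_act_def fun_eq_iff fun_pw)

lemma slice_single: "slice (single h x) g = (if g = h then x else 0)"
  by (auto simp: slice_def single_def fun_eq_iff fun_pw)

lemma slice_sum: "slice (\<Sum>i\<in>A. F i) g = (\<Sum>i\<in>A. slice (F i) g)"
  by (simp add: slice_def fun_eq_iff fun_sum_apply)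

context finite_group
begin

lemma subspace_free: "fs.subspace V \<Longrightarrow> fs.subspace (free G V)"
  unfolding fs.subspace_def free_def by auto

lemma free_act_free: "h \<in> carrier G \<Longrightarrow> F \<in> free G V \<Longrightarrow> free_act G h F \<in> free G V"
  by (auto simp: free_def slice_free_act)

lemma rep_free:
  assumes "fs.subspace V"
  shows "rep G (free G V) (free_act G)"
  unfolding rep_def
proof (intro conjI ballI lin_onI)
  fix F assume F: "F \<in> free G V"
  show "free_act G \<one> F = F"
    using F by (intro slice_ext) (auto simp: slice_free_act free_def)
  fix g h assume "g \<in> carrier G" "h \<in> carrier G"
  then show "free_act G (g \<otimes> h) F = free_act G g (free_act G h F)"
    by (intro slice_ext) (auto simp: slice_free_act inv_mult_group m_assoc)
qed (auto intro!: subspace_free assms free_act_free slice_ext simp: slice_free_act)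

lemma ghom_cover:
  assumes V: "rep G V \<rho>"
  shows "ghom G (free G V) (free_act G) V \<rho> (cover G \<rho>)"
  unfolding ghom_def
proof (intro conjI ballI)
  have sl: "lin_on (free G V) V (\<lambda>F. slice F g)" if "g \<in> carrier G" for g
    using that by (auto simp: lin_on_def free_def)
  have "lin_on (free G V) V (\<lambda>F. \<Sum>g\<in>carrier G. \<rho> g (slice F g))"
    by (intro lin_on_sum_fun repD(1)[OF V] lin_on_comp[OF sl repD(2)[OF V]])
  then show "lin_on (free G V) V (cover G \<rho>)" by (simp add: cover_def[abs_def])
  fix h F assume h: "h \<in> carrier G" and F: "F \<in> free G V"
  have m: "slice F g \<in> V" if "g \<in> carrier G" for g using F that by (simp add: free_def)
  have "cover G \<rho> (free_act G h F) = (\<Sum>g\<in>carrier G. \<rho> g (slice F (inv h \<otimes> g)))"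
    unfolding cover_def by (intro sum.cong refl) (simp add: slice_free_act)
  also have "\<dots> = (\<Sum>g\<in>carrier G. \<rho> (h \<otimes> g) (slice F (inv h \<otimes> (h \<otimes> g))))"
    by (rule sum_left_translate[OF h, symmetric])
  also have "\<dots> = (\<Sum>g\<in>carrier G. \<rho> h (\<rho> g (slice F g)))"
  proof (intro sum.cong refl)
    fix g assume g: "g \<in> carrier G"
    have "inv h \<otimes> (h \<otimes> g) = g" using g h by (simp add: m_assoc[symmetric])
    then show "\<rho> (h \<otimes> g) (slice F (inv h \<otimes> (h \<otimes> g))) = \<rho> h (\<rho> g (slice F g))"
      using repD(4)[OF V h g m[OF g]] by simp
  qed
  also have "\<dots> = \<rho> h (cover G \<rho> F)"
    unfolding cover_def
    by (intro lin_on_sum[OF repD(2)[OF V h] repD(1)[OF V], symmetric] repD(5)[OF V] m)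
  finally show "cover G \<rho> (free_act G h F) = \<rho> h (cover G \<rho> F)" .
qed

lemma single_lin: "fs.subspace V \<Longrightarrow> g \<in> carrier G \<Longrightarrow> lin_on V (free G V) (single g)"
  by (intro lin_onI) (auto intro: slice_ext simp: slice_single free_def fs.subspace_0)

lemma cover_single:
  assumes V: "rep G V \<rho>" and x: "x \<in> V"
  shows "cover G \<rho> (single \<one> x) = x"
proof -
  have "\<rho> g (slice (single \<one> x) g) = (if g = \<one> then x else 0)" if "g \<in> carrier G" for g
    using repD(3)[OF V x] lin_on_0[OF repD(2)[OF V that] repD(1)[OF V]] by (simp add: slice_single)
  then have "cover G \<rho> (single \<one> x) = (\<Sum>g\<in>carrier G. if g = \<one> then x else 0)"
    unfolding cover_def by (intro sum.cong refl) auto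
  then show ?thesis by simp
qed

text \<open>The conjugates of the projection to the component at the unit are the projections to all
  components, and these add up to the identity.\<close>

lemma null_free:
  assumes "fs.subspace V"
  shows "null G (free G V) (free_act G) (free G V) (free_act G) (\<lambda>F. F)"
  unfolding null_def
proof (intro exI conjI ballI)
  let ?\<epsilon> = "\<lambda>F. single \<one> (slice F \<one>)"
  show "lin_on (free G V) (free G V) ?\<epsilon>"
    by (rule lin_on_comp[OF _ single_lin[OF assms one_closed]]) (auto simp: lin_on_def free_def)
  fix F assume F: "F \<in> free G V"
  show "F = tr G (free_act G) (free_act G) ?\<epsilon> F"
  proof (rule slice_ext)
    fix g
    show "slice F g = slice (tr G (free_act G) (free_act G) ?\<epsilon> F) g"
    proof (cases "g \<in> carrier G")
      case True
      have "slice (tr G (free_act G) (free_act G) ?\<epsilon> F) g = (\<Sum>h\<in>carrier G. if g = h then slice F g else 0)"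
        unfolding tr_def slice_sum
      proof (intro sum.cong refl)
        fix h assume h: "h \<in> carrier G"
        have "inv h \<otimes> g = \<one> \<longleftrightarrow> g = h"
          using h True by (metis inv_equality inv_inv inv_closed l_inv)
        then show "slice (free_act G h (?\<epsilon> (free_act G (inv h) F))) g = (if g = h then slice F g else 0)"
          using True h by (auto simp: slice_free_act slice_single)
      qed
      then show ?thesis using True by simp
    next
      case False
      then show ?thesis using F by (simp add: tr_def slice_sum slice_free_act free_def)
    qed
  qed
qed

end

context char_p
begin

lemma sum_per_scale:
  assumes f: "f \<in> per" and c: "\<not> int p dvd c"
  shows "(\<Sum>b\<in>{0..<int p}. f (c * b)) = (\<Sum>b\<in>{0..<int p}. f b)"
proof -
  have "(\<Sum>b\<in>{0..<int p}. f (c * b)) = (\<Sum>b\<in>{0..<int p}. f (c * b mod int p))"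
    by (intro sum.cong refl per_cong[OF f]) (simp add: cong_def)
  also have "\<dots> = (\<Sum>b\<in>{0..<int p}. f b)"
  proof (rule sum.reindex_bij_witness[of _ "\<lambda>b. (dinv c * b) mod int p" "\<lambda>b. (c * b) mod int p"])
    have key: "a * (b * x mod int p) mod int p = x" if "x \<in> {0..<int p}" "[a * b = 1] (mod int p)" for a b x
    proof -
      have "a * (b * x mod int p) mod int p = a * b * x mod int p" by (simp add: mod_mult_right_eq mult.assoc)
      also have "\<dots> = 1 * x mod int p" using that(2) by (metis cong_def cong_scalar_right)
      finally show ?thesis using that(1) by simp
    qed
    fix b assume b: "b \<in> {0..<int p}"
    show "dinv c * (c * b mod int p) mod int p = b" by (rule key[OF b dinv(1)[OF c]])
    show "c * (dinv c * b mod int p) mod int p = b" by (rule key[OF b dinv(2)[OF c]])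
  qed (use p_ge_2 in auto)
  finally show ?thesis .
qed

lemma pact_weight_cong:
  assumes "[w = w'] (mod (p - 1))" "A \<in> borel"
  shows "pact w A f = pact w' A f"
proof -
  obtain x d where A: "A = sl (dinv d) (x * d) 0 d" "\<not> int p dvd d" using assms(2) by (rule borel_cases)
  have "(of_int (A $ 2 $ 2) :: 'k) ^ w = of_int (A $ 2 $ 2) ^ w'"
    using fermat_power_cong[OF A(2) assms(1)] A(1) by simp
  then show ?thesis by (simp add: pact_def fun_eq_iff)
qed

lemma twist_linear: "Vector_Spaces.linear sc sc (twist m)"
  by (intro Vector_Spaces.linear.intro module_hom.intro module_hom_axioms.intro fs.module_axioms
      fs.vector_space_axioms module_pair.intro)
    (auto simp: twist_def conv_simps)

text \<open>Rescaling the convolution variable by the square of \<open>d\<close> produces the factor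
  \<open>d ^ (2 * D)\<close>. As \<open>D + m = p - 1\<close>, the exponent \<open>2 * D\<close> is
  minus \<open>2 * m\<close> modulo \<open>p - 1\<close>, which is the origin of the weight
  shift.\<close>

lemma ghom_twist:
  assumes m: "1 \<le> m" "m < p" and w: "[w' = w + 2 * m] (mod (p - 1))"
  shows "ghom BB per (pact w) (pol (p - m)) (pact w') (twist m)"
  unfolding ghom_def
proof (intro conjI ballI lin_onI)
  fix f A assume f: "f \<in> per" and "A \<in> carrier BB"
  then have "A \<in> borel" by simp
  then obtain x d where A: "A = sl (dinv d) (x * d) 0 d" "\<not> int p dvd d" by (rule borel_cases)
  have cf: "twist m f \<in> per" using twist_pol[OF m f] by (rule pol_per)
  define D where "D = p - 1 - m"
  show "twist m (pact w A f) = pact w' A (twist m f)"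
  proof
    fix y
    let ?z = "d\<^sup>2 * y + d * (x * d)"
    have d2: "\<not> int p dvd d\<^sup>2" using A(2) prime_dvd_power_iff[OF prime_int_p] by simp
    have per: "(\<lambda>b. of_int b ^ D * f (?z - b)) \<in> per"
      by (rule perI, intro arg_cong2[where f="(*)"] per_cong[OF f] per_cong[OF monomial_per])
        (auto intro: cong_diff)
    have "pact w' A (twist m f) y = of_int d ^ w' * (\<Sum>b\<in>{0..<int p}. of_int b ^ D * f (?z - b))"
      unfolding A(1) by (subst pact_sl[OF cf]) (simp add: twist_def conv_def D_def)
    also have "(\<Sum>b\<in>{0..<int p}. of_int b ^ D * f (?z - b)) =
        (\<Sum>b\<in>{0..<int p}. of_int (d\<^sup>2 * b) ^ D * f (?z - d\<^sup>2 * b))"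
      by (rule sum_per_scale[OF per d2, symmetric])
    also have "of_int d ^ w' * \<dots> = (\<Sum>b\<in>{0..<int p}. of_int b ^ D * (of_int d ^ w * f (d\<^sup>2 * (y - b) + d * (x * d))))"
      unfolding sum_distrib_left
    proof (intro sum.cong refl)
      fix b :: int
      have s: "w + 2 * m + 2 * D = w + 2 * (p - 1)" using m by (simp add: D_def)
      have "[w + 2 * m + 2 * D = w] (mod (p - 1))" unfolding s by (simp add: cong_def)
      then have "[w' + 2 * D = w] (mod (p - 1))"
        using w by (metis cong_add_rcancel_nat cong_trans)
      then have e: "(of_int d :: 'k) ^ (w' + 2 * D) = of_int d ^ w" by (rule fermat_power_cong[OF A(2)])
      have "of_int d ^ w' * (of_int (d\<^sup>2 * b) ^ D * f (?z - d\<^sup>2 * b)) =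
          of_int b ^ D * (of_int d ^ (w' + 2 * D) * f (?z - d\<^sup>2 * b))"
      proof -
        have "((of_int d :: 'k)\<^sup>2) ^ D = of_int d ^ (2 * D)" by (rule power_mult[symmetric])
        then show ?thesis by (simp add: power_mult_distrib power_add algebra_simps)
      qed
      then show "of_int d ^ w' * (of_int (d\<^sup>2 * b) ^ D * f (?z - d\<^sup>2 * b)) =
          of_int b ^ D * (of_int d ^ w * f (d\<^sup>2 * (y - b) + d * (x * d)))"
        unfolding e by (simp add: algebra_simps)
    qed
    also have "\<dots> = twist m (pact w A f) y"
      unfolding A(1) twist_def conv_def D_def by (simp add: pact_sl[OF f])
    finally show "twist m (pact w A f) y = pact w' A (twist m f) y" by simp
  qed
qed (rule twist_pol[OF m], assumption, simp_all add: twist_def conv_simps)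

text \<open>Over the Borel subgroup, \<open>free SL V\<close> and \<open>per\<close> are projective
  covers of stably isomorphic modules, and Schanuel's lemma compares their kernels. The first cover
  is free over the whole group so that its kernel is a module for \<open>SL2 p\<close>; after
  restriction its identity is still a trace.\<close>

lemma steq_syzygy:
  fixes V :: "('i \<Rightarrow> 'k) set"
  assumes V: "rep SL V \<rho>" and st: "steq BB V \<rho> (pol l) (pact w)" and l: "1 \<le> l" "l < p"
  shows "steq BB {F \<in> free SL V. cover SL \<rho> F = 0} (free_act SL) (pol (p - l)) (pact (w + 2 * (l - 1)))"
proof -
  let ?w = "w + 2 * (l - 1)"
  note sV = repD(1)[OF V]
  have F: "rep SL (free SL V) (free_act SL)" by (rule SL.rep_free[OF sV])
  have "null BB (free SL V) (free_act SL) (free SL V) (free_act SL) (\<lambda>F. F)"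
    by (rule B.null_restrict[OF F F SL.null_free[OF sV]])
  then obtain \<epsilon> where \<epsilon>: "lin_on (free SL V) (free SL V) \<epsilon>"
    "\<And>x. x \<in> free SL V \<Longrightarrow> tr BB (free_act SL) (free_act SL) \<epsilon> x = x"
    unfolding null_def by metis
  have m: "1 \<le> p - l" "p - l < p" "p - (p - l) = l" using l by auto
  \<comment> \<open>Modulo \<open>p - 1\<close> the shifts \<open>2 * (l - 1)\<close> and
    \<open>2 * (p - l)\<close> cancel, so \<open>twist (p - l)\<close> leads from weight
    \<open>?w\<close> back to weight \<open>w\<close>.\<close>
  have e: "?w + 2 * (p - l) = w + 2 * (p - 1)" using l by simp
  have wc: "[w = ?w + 2 * (p - l)] (mod (p - 1))" unfolding e by (simp add: cong_def)
  have tw: "ghom BB per (pact ?w) (pol l) (pact w) (twist (p - l))"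
    using ghom_twist[OF m(1,2) wc] m(3) by simp
  interpret vp: vector_space_pair "sc :: 'k \<Rightarrow> (int \<Rightarrow> 'k) \<Rightarrow> int \<Rightarrow> 'k" "sc :: 'k \<Rightarrow> (int \<Rightarrow> 'k) \<Rightarrow> int \<Rightarrow> 'k"
    by unfold_locales
  \<comment> \<open>Schanuel's lemma asks for a section that is merely linear, and linear algebra
    supplies one.\<close>
  obtain s where s: "s ` UNIV \<subseteq> per" "Vector_Spaces.linear sc sc s" "\<forall>h\<in>twist (p - l) ` per. twist (p - l) (s h) = h"
    using vp.linear_exists_right_inverse_on[OF twist_linear subspace_per] by blast
  have s1: "lin_on (pol l) per s"
    using s(1) module_hom.add[OF Vector_Spaces.linear.axioms(3)[OF s(2)]]
      module_hom.scale[OF Vector_Spaces.linear.axioms(3)[OF s(2)]]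
    by (auto simp: lin_on_def)
  have s2: "twist (p - l) (s h) = h" if "h \<in> pol l" for h
    using twist_surj[OF m(1,2), of h] that s(3) m(3) by auto
  have "steq BB {F \<in> free SL V. cover SL \<rho> F = 0} (free_act SL) {f \<in> per. twist (p - l) f = 0} (pact ?w)"
  proof (rule B.GH.steq_kernels[where X=V and X'="pol l" and \<sigma>=\<rho> and \<sigma>'="pact w" and s="single \<one>\<^bsub>SL\<^esub>" and \<epsilon>=\<epsilon>
        and s'=s and \<epsilon>'=pt])
    show "rep BB (free SL V) (free_act SL)" by (rule B.rep_restrict[OF F])
    show "rep BB per (pact ?w)" using rep_pol[of p] by (simp add: pol_p)
    show "rep BB V \<rho>" by (rule B.rep_restrict[OF V])
    show "ghom BB (free SL V) (free_act SL) V \<rho> (cover SL \<rho>)" by (rule B.ghom_restrict[OF SL.ghom_cover[OF V]])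
    show "lin_on V (free SL V) (single \<one>\<^bsub>SL\<^esub>)" by (rule SL.single_lin[OF sV SL.one_closed])
    show "cover SL \<rho> (single \<one>\<^bsub>SL\<^esub> x) = x" if "x \<in> V" for x by (rule SL.cover_single[OF V that])
  qed (use rep_pol \<epsilon> tw s1 s2 pt_lin tr_pt st in auto)
  also have "{f \<in> per. twist (p - l) f = 0} = pol (p - l)" by (rule twist_kernel[OF m(1,2)])
  finally show ?thesis .
qed

end

section \<open>Homogeneous polynomials in two variables\<close>

lemma span_family:
  assumes "F \<in> fs.span (f ` {..<n::nat})"
  shows "\<exists>c. F = (\<Sum>i<n. sc (c i) (f i))"
  using assms
proof (rule fs.span_induct)
  show "fs.subspace {F. \<exists>c. F = (\<Sum>i<n. sc (c i) (f i))}"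
    unfolding fs.subspace_def
  proof (intro conjI ballI allI)
    have "(0::'a \<Rightarrow> 'b) = (\<Sum>i<n. sc 0 (f i))" by simp
    then show "0 \<in> {F. \<exists>c. F = (\<Sum>i<n. sc (c i) (f i))}" by (intro CollectI exI[of _ "\<lambda>_. 0"])
    fix F F' assume "F \<in> {F. \<exists>c. F = (\<Sum>i<n. sc (c i) (f i))}" "F' \<in> {F. \<exists>c. F = (\<Sum>i<n. sc (c i) (f i))}"
    then obtain c c' where "F = (\<Sum>i<n. sc (c i) (f i))" "F' = (\<Sum>i<n. sc (c' i) (f i))" by blast
    then have "F + F' = (\<Sum>i<n. sc (c i + c' i) (f i))" by (simp add: fs.scale_left_distrib sum.distrib)
    then show "F + F' \<in> {F. \<exists>c. F = (\<Sum>i<n. sc (c i) (f i))}" by (intro CollectI exI[of _ "\<lambda>i. c i + c' i"])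
  next
    fix a F assume "F \<in> {F. \<exists>c. F = (\<Sum>i<n. sc (c i) (f i))}"
    then obtain c where "F = (\<Sum>i<n. sc (c i) (f i))" by blast
    then have "sc a F = (\<Sum>i<n. sc (a * c i) (f i))" by (simp add: fs.scale_sum_right)
    then show "sc a F \<in> {F. \<exists>c. F = (\<Sum>i<n. sc (c i) (f i))}" by (intro CollectI exI[of _ "\<lambda>i. a * c i"])
  qed
  fix F assume "F \<in> f ` {..<n}"
  then obtain j where j: "j < n" "F = f j" by blast
  have "(\<Sum>i<n. sc (if i = j then 1 else 0) (f i)) = (\<Sum>i<n. if i = j then f i else 0)"
    by (intro sum.cong refl) simp
  also have "\<dots> = F" using j by simp
  finally show "\<exists>c. F = (\<Sum>i<n. sc (c i) (f i))" by (intro exI[of _ "\<lambda>i. if i = j then 1 else 0"]) simp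
qed

context char_p
begin

definition mono :: "nat \<Rightarrow> nat \<Rightarrow> int \<times> int \<Rightarrow> 'k" where
  "mono j i = (\<lambda>(x, y). of_int x ^ j * of_int y ^ i)"

text \<open>Polynomial functions on pairs of integers stand in for formal polynomials, so that
  substituting a matrix is composition. For \<open>n < p\<close> the monomials remain independent as
  functions, even on the line \<open>x = 1\<close>.\<close>

definition homog :: "nat \<Rightarrow> (int \<times> int \<Rightarrow> 'k) set" where
  "homog n = fs.span ((\<lambda>i. mono (n - i) i) ` {..<Suc n})"

text \<open>Substitution of the row vector \<open>(x, y)\<close> times \<open>A\<close>; multiplying
  the argument on the right yields a left action.\<close>

definition lact :: "int^2^2 \<Rightarrow> (int \<times> int \<Rightarrow> 'k) \<Rightarrow> int \<times> int \<Rightarrow> 'k" where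
  "lact A F = (\<lambda>(x, y). F (x * A $ 1 $ 1 + y * A $ 2 $ 1, x * A $ 1 $ 2 + y * A $ 2 $ 2))"

lemma mono_apply: "mono j i (x, y) = of_int x ^ j * of_int y ^ i"
  by (simp add: mono_def)

lemma subspace_homog: "fs.subspace (homog n)"
  unfolding homog_def by (rule fs.subspace_span)

lemma mono_homog: "mono j i \<in> homog (j + i)"
  unfolding homog_def by (rule fs.span_base) (auto intro!: image_eqI[where x=i])

lemma homog_induct:
  assumes "F \<in> homog n" "fs.subspace {F. P F}" "\<And>j i. j + i = n \<Longrightarrow> P (mono j i)"
  shows "P F"
  using assms(1,2) unfolding homog_def
proof (rule fs.span_induct)
  fix F assume "F \<in> (\<lambda>i. mono (n - i) i) ` {..<Suc n}"
  then show "P F" using assms(3) by auto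
qed

lemma homog_cong:
  assumes "F \<in> homog n" "[x = x'] (mod int p)" "[y = y'] (mod int p)"
  shows "F (x, y) = F (x', y')"
  using assms(1)
proof (rule homog_induct)
  show "fs.subspace {F. F (x, y) = F (x', y')}"
    by (auto simp: fs.subspace_def fun_pw)
  show "mono j i (x, y) = mono j i (x', y')" for j i
    using of_int_cong[OF assms(2)] of_int_cong[OF assms(3)] by (simp add: mono_apply)
qed

lemma homog_scale:
  assumes "F \<in> homog n"
  shows "F (c * x, c * y) = of_int c ^ n * F (x, y)"
  using assms
proof (rule homog_induct)
  show "fs.subspace {F. F (c * x, c * y) = of_int c ^ n * F (x, y)}"
    by (auto simp: fs.subspace_def fun_pw algebra_simps)
  show "mono j i (c * x, c * y) = of_int c ^ n * mono j i (x, y)" if "j + i = n" for j i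
    using that by (auto simp: mono_apply power_mult_distrib power_add)
qed

lemma lact_sl:
  assumes "F \<in> homog n"
  shows "lact (sl a b c d) F (x, y) = F (x * a + y * c, x * b + y * d)"
proof -
  have "[x * (u mod int p) + y * (v mod int p) = x * u + y * v] (mod int p)" for u v
    by (intro cong_add cong_mult cong_refl) (auto simp: cong_def)
  then show ?thesis unfolding lact_def by (simp add: homog_cong[OF assms])
qed

lemma homog_mult_linear:
  assumes "F \<in> homog n"
  shows "(\<lambda>(x, y). (of_int x * a + of_int y * b) * F (x, y)) \<in> homog (Suc n)"
  using assms
proof (rule homog_induct)
  let ?P = "\<lambda>F. (\<lambda>(x, y). (of_int x * a + of_int y * b) * F (x, y)) \<in> homog (Suc n)"
  show "fs.subspace {F. ?P F}"
    unfolding fs.subspace_def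
  proof (intro conjI ballI allI)
    have "(\<lambda>(x, y). (of_int x * a + of_int y * b) * (0 :: int \<times> int \<Rightarrow> 'k) (x, y)) = 0"
      by (simp add: fun_eq_iff fun_pw)
    then show "0 \<in> {F. ?P F}" using fs.subspace_0[OF subspace_homog] by simp
  next
    fix F G assume "F \<in> {F. ?P F}" "G \<in> {F. ?P F}"
    then have "?P F" "?P G" by simp_all
    moreover have "(\<lambda>(x, y). (of_int x * a + of_int y * b) * (F + G) (x, y)) =
        (\<lambda>(x, y). (of_int x * a + of_int y * b) * F (x, y)) + (\<lambda>(x, y). (of_int x * a + of_int y * b) * G (x, y))"
      by (simp add: fun_eq_iff fun_pw algebra_simps)
    ultimately show "F + G \<in> {F. ?P F}" using fs.subspace_add[OF subspace_homog] by simp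
  next
    fix c F assume "F \<in> {F. ?P F}"
    then have "?P F" by simp
    moreover have "(\<lambda>(x, y). (of_int x * a + of_int y * b) * (sc c F) (x, y)) =
        sc c (\<lambda>(x, y). (of_int x * a + of_int y * b) * F (x, y))"
      by (simp add: fun_eq_iff fun_pw algebra_simps)
    ultimately show "sc c F \<in> {F. ?P F}" using fs.subspace_scale[OF subspace_homog] by simp
  qed
  show "?P (mono j i)" if "j + i = n" for j i
  proof -
    have "(\<lambda>(x, y). (of_int x * a + of_int y * b) * mono j i (x, y)) =
        sc a (mono (Suc j) i) + sc b (mono j (Suc i))"
      by (simp add: fun_eq_iff fun_pw mono_apply algebra_simps)
    moreover have "mono (Suc j) i \<in> homog (Suc n)" "mono j (Suc i) \<in> homog (Suc n)"
      using mono_homog[of "Suc j" i] mono_homog[of j "Suc i"] that by simp_all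
    ultimately show ?thesis
      by (simp add: fs.subspace_add[OF subspace_homog] fs.subspace_scale[OF subspace_homog])
  qed
qed

text \<open>A linear substitution turns a monomial into such a product of powers of linear
  forms.\<close>

lemma homog_powers:
  "(\<lambda>(x, y). (of_int x * a + of_int y * b) ^ j * (of_int x * a' + of_int y * b') ^ i) \<in> homog (j + i)"
proof (induction j)
  case 0
  show ?case
  proof (induction i)
    case 0
    have "(\<lambda>(x, y). 1) = mono 0 0" by (simp add: fun_eq_iff mono_apply)
    then show ?case using mono_homog[of 0 0] by simp
  next
    case (Suc i)
    have "(\<lambda>(x, y). (of_int x * a + of_int y * b) ^ 0 * (of_int x * a' + of_int y * b') ^ Suc i) =
        (\<lambda>(x, y). (of_int x * a' + of_int y * b') *
          (\<lambda>(x, y). (of_int x * a + of_int y * b) ^ 0 * (of_int x * a' + of_int y * b') ^ i) (x, y))"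
      by (simp add: fun_eq_iff)
    then show ?case using homog_mult_linear[OF Suc, of a' b'] by simp
  qed
next
  case (Suc j)
  have "(\<lambda>(x, y). (of_int x * a + of_int y * b) ^ Suc j * (of_int x * a' + of_int y * b') ^ i) =
      (\<lambda>(x, y). (of_int x * a + of_int y * b) *
        (\<lambda>(x, y). (of_int x * a + of_int y * b) ^ j * (of_int x * a' + of_int y * b') ^ i) (x, y))"
    by (simp add: fun_eq_iff mult.assoc)
  then show ?case using homog_mult_linear[OF Suc, of a b] by simp
qed

lemma lact_linear: "lact A (F + F') = lact A F + lact A F'" "lact A (sc c F) = sc c (lact A F)" "lact A 0 = 0"
  by (simp_all add: lact_def fun_eq_iff fun_pw)

lemma lact_homog:
  assumes "F \<in> homog n"
  shows "lact A F \<in> homog n"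
  using assms
proof (rule homog_induct)
  show "fs.subspace {F. lact A F \<in> homog n}"
    using subspace_homog by (auto simp: fs.subspace_def lact_linear)
  show "lact A (mono j i) \<in> homog n" if "j + i = n" for j i
    using homog_powers[of "of_int (A $ 1 $ 1)" "of_int (A $ 2 $ 1)" j "of_int (A $ 1 $ 2)" "of_int (A $ 2 $ 2)" i] that
    by (simp add: lact_def mono_def)
qed

lemma rep_homog: "rep SL (homog n) lact"
  unfolding rep_def
proof (intro conjI ballI subspace_homog lin_onI lact_homog lact_linear)
  fix F assume F: "F \<in> homog n"
  show "lact \<one>\<^bsub>SL\<^esub> F = F" by (auto simp: fun_eq_iff sl_one lact_sl[OF F])
  fix A B assume "A \<in> carrier SL" "B \<in> carrier SL"
  then obtain a b c d a' b' c' d' where A: "A = sl a b c d" and B: "B = sl a' b' c' d'"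
    by (metis SL_cases)
  have "lact (A \<otimes>\<^bsub>SL\<^esub> B) F (x, y) = lact A (lact B F) (x, y)" for x y
    unfolding A B lact_sl[OF lact_homog[OF F]] sl_mult lact_sl[OF F] by (simp add: algebra_simps)
  then show "lact (A \<otimes>\<^bsub>SL\<^esub> B) F = lact A (lact B F)" by (auto simp: fun_eq_iff)
qed

text \<open>Dehomogenisation, the restriction to the line \<open>x = 1\<close>. An element of the
  Borel subgroup moves this line to a multiple of itself, and homogeneity absorbs the
  multiple.\<close>

definition rs :: "(int \<times> int \<Rightarrow> 'k) \<Rightarrow> int \<Rightarrow> 'k" where "rs F = (\<lambda>y. F (1, y))"

lemma rs_linear: "rs (F + F') = rs F + rs F'" "rs (F - F') = rs F - rs F'" "rs (sc c F) = sc c (rs F)" "rs 0 = 0"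
  "rs (\<Sum>i\<in>I. H i) = (\<Sum>i\<in>I. rs (H i))"
  by (simp_all add: rs_def fun_eq_iff fun_pw fun_sum_apply)

lemma rs_mono: "rs (mono j i) = (\<lambda>y. of_int y ^ i)"
  by (simp add: rs_def mono_apply)

lemma rs_pol:
  assumes "F \<in> homog n"
  shows "rs F \<in> pol (Suc n)"
  using assms
proof (rule homog_induct)
  show "fs.subspace {F. rs F \<in> pol (Suc n)}"
    using subspace_pol by (auto simp: fs.subspace_def rs_linear)
qed (auto simp: rs_mono intro: monomial_pol)

text \<open>The highest difference isolates the leading coefficient times a factorial, which is a
  unit below \<open>p\<close>.\<close>

lemma monomials_independent:
  assumes "(\<Sum>i<l. sc (c i) (\<lambda>x. of_int x ^ i)) = (0 :: int \<Rightarrow> 'k)" "l \<le> p" "i < l"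
  shows "c i = 0"
  using assms
proof (induction l)
  case (Suc l)
  have "(fdiff ^^ l) (\<Sum>i<Suc l. sc (c i) (\<lambda>x. of_int x ^ i :: 'k)) = (\<lambda>x. c l * of_nat (fact l))"
    by (simp add: fdiff_pow_simps fdiff_pow_monomial_0 fdiff_pow_monomial) (simp add: fun_eq_iff fun_pw)
  then have "(\<lambda>x::int. c l * of_nat (fact l)) = 0" unfolding Suc.prems(1) fdiff_pow_simps by (rule sym)
  then have "c l * of_nat (fact l) = 0" by (simp add: fun_eq_iff fun_pw)
  then have cl: "c l = 0" using fact_neq_0[of l] Suc.prems(2) by simp
  then have "(\<Sum>i<l. sc (c i) (\<lambda>x. of_int x ^ i)) = (0 :: int \<Rightarrow> 'k)" using Suc.prems(1) by simp
  then show ?case using Suc.IH cl Suc.prems(2,3) by (cases "i = l") auto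
qed simp

lemma rs_inj:
  assumes "F \<in> homog n" "n < p" "rs F = 0"
  shows "F = 0"
proof -
  obtain c where c: "F = (\<Sum>i<Suc n. sc (c i) (mono (n - i) i))"
    using span_family[OF assms(1)[unfolded homog_def]] by blast
  have "rs F = (\<Sum>i<Suc n. sc (c i) (\<lambda>x. of_int x ^ i))"
    by (simp only: c rs_linear rs_mono)
  then have "c i = 0" if "i < Suc n" for i
    using monomials_independent[of c "Suc n" i] that assms(2,3) by simp
  then show ?thesis unfolding c by simp
qed

lemma fdiff_rs:
  assumes "F \<in> homog n"
  shows "fdiff (rs F) = rs (lact (ut 1) F - F)"
  unfolding ut_def by (simp add: fun_eq_iff fun_pw fdiff_apply rs_def lact_sl[OF assms] add.commute)

lemma top_mono: "(fdiff ^^ n) (rs (mono 0 n)) = (\<lambda>x. of_nat (fact n))"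
  by (simp only: rs_mono fdiff_pow_monomial)

text \<open>The monomial \<open>y ^ n\<close> generates \<open>pol (Suc n)\<close> under
  differences, and differences are realised inside \<open>H\<close> by \<open>lact (ut 1)\<close>
  minus the identity. For \<open>H = homog n\<close> this is the surjectivity of \<open>rs\<close>;
  for a submodule it is the last step of the proof of simplicity.\<close>

lemma pol_subset_rs:
  assumes H: "fs.subspace H" "H \<subseteq> homog n" "mono 0 n \<in> H"
    and inv: "\<And>F. F \<in> H \<Longrightarrow> lact (ut 1) F \<in> H" and n: "n < p" and f: "f \<in> pol (Suc n)"
  shows "\<exists>F\<in>H. f = rs F"
proof -
  have pow: "\<exists>F\<in>H. (fdiff ^^ i) (rs (mono 0 n)) = rs F" for i
  proof (induction i)
    case (Suc i)
    then obtain F where F: "F \<in> H" "(fdiff ^^ i) (rs (mono 0 n)) = rs F" by blast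
    then have "(fdiff ^^ Suc i) (rs (mono 0 n)) = rs (lact (ut 1) F - F)"
      using fdiff_rs[of F n] H(2) by auto
    moreover have "lact (ut 1) F - F \<in> H" by (intro fs.subspace_diff[OF H(1)] inv F)
    ultimately show ?case by blast
  qed (use H(3) in auto)
  then obtain F where F: "\<And>i. F i \<in> H" "\<And>i. (fdiff ^^ i) (rs (mono 0 n)) = rs (F i)" by metis
  have "(fdiff ^^ Suc n) f = 0" using f by (simp add: pol_def)
  from newton_span[OF top_mono fact_neq_0[OF n] this]
  obtain a where "f = (\<Sum>i<Suc n. sc (a i) ((fdiff ^^ i) (rs (mono 0 n))))" by blast
  also have "\<dots> = rs (\<Sum>i<Suc n. sc (a i) (F i))" by (simp only: F(2) rs_linear)
  finally have "f = rs (\<Sum>i<Suc n. sc (a i) (F i))" .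
  moreover have "(\<Sum>i<Suc n. sc (a i) (F i)) \<in> H"
    by (intro fs.subspace_sum[OF H(1)] fs.subspace_scale[OF H(1)] F(1))
  ultimately show ?thesis by blast
qed

lemma mono0_homog: "mono 0 n \<in> homog n"
  using mono_homog[of 0 n] by simp

text \<open>The row vector \<open>(1, y)\<close> times a Borel matrix has first entry
  \<open>dinv d\<close>. Pulling it out by homogeneity leaves the factor \<open>dinv d ^ n\<close>,
  which as a power of \<open>d\<close> has exponent \<open>(p - 2) * n\<close>.\<close>

lemma steq_homog:
  assumes n: "n < p"
  shows "steq BB (homog n) lact (pol (Suc n)) (pact ((p - 2) * n))"
proof (rule B.GH.steq_iso[OF B.rep_restrict[OF rep_homog] rep_pol])
  show "ghom BB (homog n) lact (pol (Suc n)) (pact ((p - 2) * n)) rs"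
    unfolding ghom_def
  proof (intro conjI ballI lin_onI rs_pol rs_linear)
    fix A F assume "A \<in> carrier BB" and F: "F \<in> homog n"
    then have "A \<in> borel" by simp
    then obtain x d where A: "A = sl (dinv d) (x * d) 0 d" "\<not> int p dvd d" by (rule borel_cases)
    show "rs (lact A F) = pact ((p - 2) * n) A (rs F)"
    proof
      fix y
      have "rs (lact A F) y = F (dinv d, x * d + y * d)"
        by (simp add: rs_def A(1) lact_sl[OF F])
      also have "\<dots> = F (dinv d * 1, dinv d * (d * (x * d + y * d)))"
      proof (rule homog_cong[OF F])
        have "[1 * (x * d + y * d) = dinv d * d * (x * d + y * d)] (mod int p)"
          by (intro cong_mult cong_refl cong_sym[OF dinv(1)] A)
        then show "[x * d + y * d = dinv d * (d * (x * d + y * d))] (mod int p)" by (simp add: mult.assoc)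
      qed simp
      also have "\<dots> = of_int (dinv d) ^ n * F (1, d * (x * d + y * d))" by (rule homog_scale[OF F])
      also have "\<dots> = pact ((p - 2) * n) A (rs F) y"
      proof -
        have "(of_int (dinv d) :: 'k) ^ n = of_int d ^ ((p - 2) * n)"
          by (simp add: dinv_def power_mult)
        moreover have "d * (x * d + y * d) = d\<^sup>2 * y + d * (x * d)"
          by (simp add: algebra_simps power2_eq_square)
        ultimately show ?thesis
          unfolding A(1) by (subst pact_sl[OF pol_per[OF rs_pol[OF F]]]) (simp only: rs_def)
      qed
      finally show "rs (lact A F) y = pact ((p - 2) * n) A (rs F) y" .
    qed
  qed
  show "bij_betw rs (homog n) (pol (Suc n))"
    unfolding bij_betw_def
  proof
    show "inj_on rs (homog n)"
    proof (rule inj_onI)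
      fix F F' assume F: "F \<in> homog n" "F' \<in> homog n" "rs F = rs F'"
      then have "F - F' = 0" by (intro rs_inj[OF _ n] fs.subspace_diff[OF subspace_homog]) (auto simp: rs_linear)
      then show "F = F'" by simp
    qed
    show "rs ` homog n = pol (Suc n)"
      using rs_pol pol_subset_rs[OF subspace_homog order.refl mono0_homog lact_homog n] by blast
  qed
qed

text \<open>The last nonzero difference of an element of \<open>H\<close> is constant, hence a
  multiple of \<open>x ^ n\<close>, the vector fixed by the unipotent subgroup. The Weyl element
  sends \<open>x ^ n\<close> to \<open>y ^ n\<close>, and the latter generates everything.\<close>

lemma homog_simple:
  assumes H: "fs.subspace H" "H \<subseteq> homog n" "\<And>A F. A \<in> carrier SL \<Longrightarrow> F \<in> H \<Longrightarrow> lact A F \<in> H"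
    and n: "n < p" and F: "F \<in> H" "F \<noteq> 0"
  shows "H = homog n"
proof -
  have utc: "ut 1 \<in> carrier SL" using ut_borel by (simp add: borel_def)
  have pow: "\<exists>E\<in>H. (fdiff ^^ i) (rs F) = rs E" for i
  proof (induction i)
    case (Suc i)
    then obtain E where E: "E \<in> H" "(fdiff ^^ i) (rs F) = rs E" by blast
    then have "(fdiff ^^ Suc i) (rs F) = rs (lact (ut 1) E - E)"
      using fdiff_rs[of E n] H(2) by auto
    moreover have "lact (ut 1) E - E \<in> H" by (intro fs.subspace_diff[OF H(1)] H(3) E utc)
    ultimately show ?case by blast
  qed (use F in auto)
  define i where "i = (LEAST i. (fdiff ^^ i) (rs F) = 0)"
  have "(fdiff ^^ Suc n) (rs F) = 0" using rs_pol[of F n] F(1) H(2) by (auto simp: pol_def)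
  then have z: "(fdiff ^^ i) (rs F) = 0" unfolding i_def by (rule LeastI)
  have "i \<noteq> 0"
  proof
    assume "i = 0"
    then have "rs F = 0" using z by simp
    then show False using rs_inj[of F n] F H(2) n by blast
  qed
  then obtain j where j: "i = Suc j" by (cases i) auto
  have nz: "(fdiff ^^ j) (rs F) \<noteq> 0"
    using not_less_Least[of j "\<lambda>i. (fdiff ^^ i) (rs F) = 0"] j unfolding i_def by simp
  obtain E where E: "E \<in> H" "(fdiff ^^ j) (rs F) = rs E" using pow by blast
  have "fdiff (rs E) = 0" using z E(2) by (simp add: j)
  then obtain c where c: "rs E = (\<lambda>x. c)" using fdiff_eq_0_const by blast
  have c0: "c \<noteq> 0" using c nz E(2) by (auto simp: fun_eq_iff fun_pw)
  have mn: "mono n 0 \<in> homog n" using mono_homog[of n 0] by simp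
  have "E - sc c (mono n 0) = 0"
  proof (rule rs_inj[OF _ n])
    show "E - sc c (mono n 0) \<in> homog n"
      using E(1) H(2) mn by (intro fs.subspace_diff fs.subspace_scale subspace_homog) auto
    show "rs (E - sc c (mono n 0)) = 0"
      by (simp add: rs_linear rs_mono c fun_eq_iff fun_pw)
  qed
  then have "E = sc c (mono n 0)" by simp
  then have "mono n 0 = sc (inverse c) E" using c0 by simp
  then have mH: "mono n 0 \<in> H" using fs.subspace_scale[OF H(1) E(1)] by simp
  have "lact (sl 0 (-1) 1 0) (mono n 0) = mono 0 n"
    by (auto simp: fun_eq_iff lact_sl[OF mn] mono_apply)
  then have m0: "mono 0 n \<in> H" using H(3)[OF _ mH, of "sl 0 (-1) 1 0"] by simp
  show ?thesis
  proof (intro equalityI H(2) subsetI)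
    fix E assume E: "E \<in> homog n"
    obtain E' where E': "E' \<in> H" "rs E = rs E'"
      using pol_subset_rs[OF H(1,2) m0 H(3)[OF utc] n rs_pol[OF E]] by blast
    have "E - E' = 0"
      using E E' H(2) by (intro rs_inj[OF _ n] fs.subspace_diff[OF subspace_homog]) (auto simp: rs_linear)
    then show "E \<in> H" using E' by simp
  qed
qed

end

section \<open>Modules over a ring\<close>

lemma mhomI:
  assumes "\<And>x. x \<in> carrier M \<Longrightarrow> f x \<in> carrier N"
    "\<And>x y. x \<in> carrier M \<Longrightarrow> y \<in> carrier M \<Longrightarrow> f (x \<oplus>\<^bsub>M\<^esub> y) = f x \<oplus>\<^bsub>N\<^esub> f y"
    "\<And>a x. a \<in> carrier R \<Longrightarrow> x \<in> carrier M \<Longrightarrow> f (a \<odot>\<^bsub>M\<^esub> x) = a \<odot>\<^bsub>N\<^esub> f x"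
  shows "f \<in> module_hom R M N"
  using assms by (auto simp: Defs.module_hom_def)

lemma mhomD:
  assumes "f \<in> module_hom R M N"
  shows "x \<in> carrier M \<Longrightarrow> f x \<in> carrier N"
    "x \<in> carrier M \<Longrightarrow> y \<in> carrier M \<Longrightarrow> f (x \<oplus>\<^bsub>M\<^esub> y) = f x \<oplus>\<^bsub>N\<^esub> f y"
    "a \<in> carrier R \<Longrightarrow> x \<in> carrier M \<Longrightarrow> f (a \<odot>\<^bsub>M\<^esub> x) = a \<odot>\<^bsub>N\<^esub> f x"
  using assms by (auto simp: Defs.module_hom_def)

lemma mhom_cong:
  assumes "f \<in> module_hom R M N" "left_module R M" "\<And>x. x \<in> carrier M \<Longrightarrow> g x = f x"
  shows "g \<in> module_hom R M N"
proof -
  interpret M: left_module R M by fact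
  show ?thesis
    by (rule mhomI) (simp_all add: assms(3) mhomD[OF assms(1)] M.smult_closed)
qed

lemma mhom_comp: "f \<in> module_hom R M N \<Longrightarrow> g \<in> module_hom R N L \<Longrightarrow> (\<lambda>x. g (f x)) \<in> module_hom R M L"
  by (intro mhomI) (simp_all add: mhomD)

lemma mhom_id: "(\<lambda>x. x) \<in> module_hom R M M"
  by (simp add: Defs.module_hom_def)

context left_module
begin

lemma smult_zero: "a \<in> carrier R \<Longrightarrow> a \<odot>\<^bsub>M\<^esub> \<zero>\<^bsub>M\<^esub> = \<zero>\<^bsub>M\<^esub>"
proof -
  assume a: "a \<in> carrier R"
  have "a \<odot>\<^bsub>M\<^esub> \<zero>\<^bsub>M\<^esub> \<oplus>\<^bsub>M\<^esub> a \<odot>\<^bsub>M\<^esub> \<zero>\<^bsub>M\<^esub> = a \<odot>\<^bsub>M\<^esub> \<zero>\<^bsub>M\<^esub>"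
    using smult_r_distr[OF a M.zero_closed M.zero_closed] by simp
  then show ?thesis using M.add.l_cancel_one smult_closed[OF a M.zero_closed] by blast
qed

lemma smult_minus: "a \<in> carrier R \<Longrightarrow> x \<in> carrier M \<Longrightarrow> a \<odot>\<^bsub>M\<^esub> (\<ominus>\<^bsub>M\<^esub> x) = \<ominus>\<^bsub>M\<^esub> (a \<odot>\<^bsub>M\<^esub> x)"
  using smult_r_distr[of a "\<ominus>\<^bsub>M\<^esub> x" x] smult_zero[of a] smult_closed[of a x] smult_closed[of a "\<ominus>\<^bsub>M\<^esub> x"]
  by (simp add: M.l_neg M.minus_equality)

lemma smult_finsum:
  assumes "finite I" "a \<in> carrier R" "\<And>i. i \<in> I \<Longrightarrow> x i \<in> carrier M"
  shows "a \<odot>\<^bsub>M\<^esub> (\<Oplus>\<^bsub>M\<^esub>i\<in>I. x i) = (\<Oplus>\<^bsub>M\<^esub>i\<in>I. a \<odot>\<^bsub>M\<^esub> x i)"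
  using assms
proof (induction I)
  case (insert i I)
  then show ?case by (simp add: M.finsum_insert Pi_def smult_r_distr smult_closed)
qed (simp add: smult_zero)

end

lemma mhom_zero:
  assumes "left_module R M" "left_module R N" "f \<in> module_hom R M N"
  shows "f \<zero>\<^bsub>M\<^esub> = \<zero>\<^bsub>N\<^esub>"
proof -
  interpret M: left_module R M by fact
  interpret N: left_module R N by fact
  have c: "f \<zero>\<^bsub>M\<^esub> \<in> carrier N" by (rule mhomD(1)[OF assms(3)]) simp
  have "f \<zero>\<^bsub>M\<^esub> \<oplus>\<^bsub>N\<^esub> f \<zero>\<^bsub>M\<^esub> = f \<zero>\<^bsub>M\<^esub>"
    using mhomD(2)[OF assms(3), of "\<zero>\<^bsub>M\<^esub>" "\<zero>\<^bsub>M\<^esub>"] by simp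
  then show ?thesis using N.M.add.l_cancel_one[OF c c] by blast
qed

lemma mhom_minus:
  assumes "left_module R M" "left_module R N" "f \<in> module_hom R M N" "x \<in> carrier M"
  shows "f (\<ominus>\<^bsub>M\<^esub> x) = \<ominus>\<^bsub>N\<^esub> f x"
proof -
  interpret M: left_module R M by fact
  interpret N: left_module R N by fact
  have "f (\<ominus>\<^bsub>M\<^esub> x) \<oplus>\<^bsub>N\<^esub> f x = \<zero>\<^bsub>N\<^esub>"
    using mhomD(2)[OF assms(3), of "\<ominus>\<^bsub>M\<^esub> x" x] assms(4) mhom_zero[OF assms(1-3)] by (simp add: M.M.l_neg)
  then show ?thesis using mhomD(1)[OF assms(3)] assms(4) by (simp add: N.M.minus_equality)
qed

lemma mhom_diff:
  assumes "left_module R M" "left_module R N" "f \<in> module_hom R M N" "x \<in> carrier M" "y \<in> carrier M"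
  shows "f (x \<ominus>\<^bsub>M\<^esub> y) = f x \<ominus>\<^bsub>N\<^esub> f y"
proof -
  interpret M: left_module R M by fact
  show ?thesis
    using assms(4,5) by (simp add: a_minus_def mhomD(2)[OF assms(3)] mhom_minus[OF assms(1-3)])
qed

lemma mhom_finsum:
  assumes "left_module R M" "left_module R N" "f \<in> module_hom R M N" "finite I" "\<And>i. i \<in> I \<Longrightarrow> x i \<in> carrier M"
  shows "f (\<Oplus>\<^bsub>M\<^esub>i\<in>I. x i) = (\<Oplus>\<^bsub>N\<^esub>i\<in>I. f (x i))"
proof -
  interpret M: left_module R M by fact
  interpret N: left_module R N by fact
  show ?thesis using assms(4,5)
  proof (induction I)
    case (insert i I)
    then show ?case
      by (simp add: M.M.finsum_insert N.M.finsum_insert Pi_def mhomD[OF assms(3)])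
  qed (simp add: mhom_zero[OF assms(1-3)])
qed

lemma mhom_add:
  assumes "left_module R M" "left_module R N" "f \<in> module_hom R M N" "g \<in> module_hom R M N"
  shows "(\<lambda>x. f x \<oplus>\<^bsub>N\<^esub> g x) \<in> module_hom R M N"
proof -
  interpret M: left_module R M by fact
  interpret N: left_module R N by fact
  note f = mhomD[OF assms(3)] and g = mhomD[OF assms(4)]
  show ?thesis
    by (rule mhomI) (simp_all add: f g N.smult_r_distr N.M.a_ac)
qed

lemma mhom_neg:
  assumes "left_module R M" "left_module R N" "f \<in> module_hom R M N"
  shows "(\<lambda>x. \<ominus>\<^bsub>N\<^esub> f x) \<in> module_hom R M N"
proof -
  interpret M: left_module R M by fact
  interpret N: left_module R N by fact
  note f = mhomD[OF assms(3)]
  show ?thesis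
    by (rule mhomI) (simp_all add: f N.smult_minus N.M.minus_add)
qed

text \<open>A direct sum of two modules inside the universe \<open>'u\<close>; an injective \<open>\<pi>\<close> exists as \<open>'u\<close> is
  infinite.\<close>

definition prod_module :: "('u \<times> 'u \<Rightarrow> 'u) \<Rightarrow> ('a, 'u) module \<Rightarrow> ('a, 'u) module \<Rightarrow> ('a, 'u) module" where
  "prod_module \<pi> P Q = \<lparr>carrier = \<pi> ` (carrier P \<times> carrier Q), monoid.mult = (\<lambda>x y. x), one = \<pi> (\<zero>\<^bsub>P\<^esub>, \<zero>\<^bsub>Q\<^esub>),
     zero = \<pi> (\<zero>\<^bsub>P\<^esub>, \<zero>\<^bsub>Q\<^esub>),
     add = (\<lambda>x y. \<pi> (fst (inv_into UNIV \<pi> x) \<oplus>\<^bsub>P\<^esub> fst (inv_into UNIV \<pi> y), snd (inv_into UNIV \<pi> x) \<oplus>\<^bsub>Q\<^esub> snd (inv_into UNIV \<pi> y))),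
     smult = (\<lambda>a x. \<pi> (a \<odot>\<^bsub>P\<^esub> fst (inv_into UNIV \<pi> x), a \<odot>\<^bsub>Q\<^esub> snd (inv_into UNIV \<pi> x)))\<rparr>"

lemma left_module_prod:
  assumes "left_module R P" "left_module R Q" "inj \<pi>"
  shows "left_module R (prod_module \<pi> P Q)"
proof -
  interpret P: left_module R P by fact
  interpret Q: left_module R Q by fact
  note [simp] = prod_module_def inv_f_f[OF assms(3)] inj_eq[OF assms(3)]
  have "abelian_group (prod_module \<pi> P Q)"
  proof (rule abelian_groupI)
    fix x assume "x \<in> carrier (prod_module \<pi> P Q)"
    then obtain u v where "x = \<pi> (u, v)" "u \<in> carrier P" "v \<in> carrier Q" by auto
    then show "\<exists>y\<in>carrier (prod_module \<pi> P Q). y \<oplus>\<^bsub>prod_module \<pi> P Q\<^esub> x = \<zero>\<^bsub>prod_module \<pi> P Q\<^esub>"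
      by (intro bexI[of _ "\<pi> (\<ominus>\<^bsub>P\<^esub> u, \<ominus>\<^bsub>Q\<^esub> v)"]) (simp_all add: P.M.l_neg Q.M.l_neg)
  qed (auto simp: P.M.a_ac Q.M.a_ac)
  then show ?thesis
    by (intro left_module.intro left_module_axioms.intro P.R.ring_axioms)
      (auto simp: P.smult_closed Q.smult_closed P.smult_l_distr Q.smult_l_distr P.smult_r_distr Q.smult_r_distr
        P.smult_assoc1 Q.smult_assoc1 P.smult_one Q.smult_one)
qed

lemma projective_prod:
  fixes P Q :: "('a, 'u) module"
  assumes P: "projective R P" and Q: "projective R Q" and \<pi>: "inj \<pi>"
  shows "projective R (prod_module \<pi> P Q)"
proof -
  have lP: "left_module R P" and lQ: "left_module R Q" using P Q by (auto simp: projective_def)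
  interpret P: left_module R P by fact
  interpret Q: left_module R Q by fact
  note [simp] = prod_module_def inv_f_f[OF \<pi>] inj_eq[OF \<pi>]
  show ?thesis
    unfolding projective_def
  proof (intro conjI allI impI left_module_prod[OF lP lQ \<pi>])
    fix A B :: "('a, 'u) module" and e f
    assume a: "left_module R A \<and> left_module R B \<and> e \<in> module_hom R A B \<and> e ` carrier A = carrier B \<and>
      f \<in> module_hom R (prod_module \<pi> P Q) B"
    then have lA: "left_module R A" and lB: "left_module R B" and e: "e \<in> module_hom R A B"
      and es: "e ` carrier A = carrier B" and f: "f \<in> module_hom R (prod_module \<pi> P Q) B" by auto
    interpret A: left_module R A by fact
    have f1: "(\<lambda>x. f (\<pi> (x, \<zero>\<^bsub>Q\<^esub>))) \<in> module_hom R P B"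
      by (rule mhom_comp[OF _ f], rule mhomI) (auto simp: Q.smult_zero)
    have f2: "(\<lambda>x. f (\<pi> (\<zero>\<^bsub>P\<^esub>, x))) \<in> module_hom R Q B"
      by (rule mhom_comp[OF _ f], rule mhomI) (auto simp: P.smult_zero)
    obtain h1 where h1: "h1 \<in> module_hom R P A" "\<And>x. x \<in> carrier P \<Longrightarrow> e (h1 x) = f (\<pi> (x, \<zero>\<^bsub>Q\<^esub>))"
      using P lA lB e es f1 unfolding projective_def by blast
    obtain h2 where h2: "h2 \<in> module_hom R Q A" "\<And>x. x \<in> carrier Q \<Longrightarrow> e (h2 x) = f (\<pi> (\<zero>\<^bsub>P\<^esub>, x))"
      using Q lA lB e es f2 unfolding projective_def by blast
    have g1: "(\<lambda>z. h1 (fst (inv_into UNIV \<pi> z))) \<in> module_hom R (prod_module \<pi> P Q) A"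
      by (rule mhom_comp[OF _ h1(1)], rule mhomI) auto
    have g2: "(\<lambda>z. h2 (snd (inv_into UNIV \<pi> z))) \<in> module_hom R (prod_module \<pi> P Q) A"
      by (rule mhom_comp[OF _ h2(1)], rule mhomI) auto
    show "\<exists>h\<in>module_hom R (prod_module \<pi> P Q) A. \<forall>x\<in>carrier (prod_module \<pi> P Q). e (h x) = f x"
    proof (intro bexI ballI)
      show "(\<lambda>z. h1 (fst (inv_into UNIV \<pi> z)) \<oplus>\<^bsub>A\<^esub> h2 (snd (inv_into UNIV \<pi> z))) \<in> module_hom R (prod_module \<pi> P Q) A"
        by (rule mhom_add[OF left_module_prod[OF lP lQ \<pi>] lA g1 g2])
      fix z assume "z \<in> carrier (prod_module \<pi> P Q)"
      then obtain u v where z: "z = \<pi> (u, v)" "u \<in> carrier P" "v \<in> carrier Q" by auto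
      have "e (h1 u \<oplus>\<^bsub>A\<^esub> h2 v) = f (\<pi> (u, \<zero>\<^bsub>Q\<^esub>)) \<oplus>\<^bsub>B\<^esub> f (\<pi> (\<zero>\<^bsub>P\<^esub>, v))"
        using mhomD(2)[OF e mhomD(1)[OF h1(1) z(2)] mhomD(1)[OF h2(1) z(3)]] h1(2)[OF z(2)] h2(2)[OF z(3)] by simp
      also have "\<dots> = f (\<pi> (u, \<zero>\<^bsub>Q\<^esub>) \<oplus>\<^bsub>prod_module \<pi> P Q\<^esub> \<pi> (\<zero>\<^bsub>P\<^esub>, v))"
        by (rule mhomD(2)[OF f, symmetric]) (use z in auto)
      also have "\<dots> = f z" using z by simp
      finally show "e (h1 (fst (inv_into UNIV \<pi> z)) \<oplus>\<^bsub>A\<^esub> h2 (snd (inv_into UNIV \<pi> z))) = f z" using z by simp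
    qed
  qed
qed

lemma inj_prod_exists:
  assumes "infinite (UNIV :: 'u set)"
  shows "\<exists>\<pi> :: 'u \<times> 'u \<Rightarrow> 'u. inj \<pi>"
proof -
  obtain f :: "'u \<times> 'u \<Rightarrow> 'u" where "bij_betw f (UNIV \<times> UNIV) UNIV"
    using card_of_Times_same_infinite[OF assms] card_of_ordIso[of "UNIV \<times> UNIV" UNIV] by blast
  then show ?thesis by (auto simp: bij_betw_def)
qed

section \<open>The ideal of stably zero maps\<close>

lemma stably_zero_mhom: "stably_zero R M N f \<Longrightarrow> f \<in> module_hom R M N"
  by (simp add: stably_zero_def)

lemma stably_zeroI:
  fixes M N P :: "('a, 'u) module"
  assumes "f \<in> module_hom R M N" "projective R P" "a \<in> module_hom R M P" "b \<in> module_hom R P N"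
    "\<And>x. x \<in> carrier M \<Longrightarrow> f x = b (a x)"
  shows "stably_zero R M N f"
  unfolding stably_zero_def using assms
  by (intro conjI exI[of _ P] bexI[of _ a] bexI[of _ b]) auto

lemma stably_zero_cong:
  fixes M N :: "('a, 'u) module"
  assumes "stably_zero R M N f" "left_module R M" "\<And>x. x \<in> carrier M \<Longrightarrow> g x = f x"
  shows "stably_zero R M N g"
  using mhom_cong[OF stably_zero_mhom[OF assms(1)] assms(2,3)] assms(1,3) unfolding stably_zero_def by auto

lemma stably_zero_comp_left:
  fixes M N L :: "('a, 'u) module"
  assumes "stably_zero R M N f" "g \<in> module_hom R N L"
  shows "stably_zero R M L (\<lambda>x. g (f x))"
proof -
  obtain P :: "('a, 'u) module" and a b where P: "projective R P" "a \<in> module_hom R M P" "b \<in> module_hom R P N"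
    "\<forall>x\<in>carrier M. f x = b (a x)"
    using assms(1) unfolding stably_zero_def by blast
  show ?thesis
    by (rule stably_zeroI[OF mhom_comp[OF stably_zero_mhom[OF assms(1)] assms(2)] P(1,2) mhom_comp[OF P(3) assms(2)]])
      (simp add: P(4))
qed

lemma stably_zero_comp_right:
  fixes M N L :: "('a, 'u) module"
  assumes "stably_zero R M N f" "g \<in> module_hom R L M"
  shows "stably_zero R L N (\<lambda>x. f (g x))"
proof -
  obtain P :: "('a, 'u) module" and a b where P: "projective R P" "a \<in> module_hom R M P" "b \<in> module_hom R P N"
    "\<forall>x\<in>carrier M. f x = b (a x)"
    using assms(1) unfolding stably_zero_def by blast
  show ?thesis
    by (rule stably_zeroI[OF mhom_comp[OF assms(2) stably_zero_mhom[OF assms(1)]] P(1) mhom_comp[OF assms(2) P(2)] P(3)])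
      (simp add: P(4) mhomD(1)[OF assms(2)])
qed

text \<open>The sum of maps factoring through \<open>P\<close> and through \<open>Q\<close> factors
  through their product, for which an infinite universe has room.\<close>

lemma stably_zero_add:
  fixes M N :: "('a, 'u) module"
  assumes inf: "infinite (UNIV :: 'u set)" and M: "left_module R M" and N: "left_module R N"
    and f: "stably_zero R M N f" and g: "stably_zero R M N g"
  shows "stably_zero R M N (\<lambda>x. f x \<oplus>\<^bsub>N\<^esub> g x)"
proof -
  obtain \<pi> :: "'u \<times> 'u \<Rightarrow> 'u" where \<pi>: "inj \<pi>" using inj_prod_exists[OF inf] by blast
  obtain P :: "('a, 'u) module" and a b where P: "projective R P" "a \<in> module_hom R M P" "b \<in> module_hom R P N"
    "\<forall>x\<in>carrier M. f x = b (a x)"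
    using f unfolding stably_zero_def by blast
  obtain Q :: "('a, 'u) module" and c d where Q: "projective R Q" "c \<in> module_hom R M Q" "d \<in> module_hom R Q N"
    "\<forall>x\<in>carrier M. g x = d (c x)"
    using g unfolding stably_zero_def by blast
  have lP: "left_module R P" and lQ: "left_module R Q" using P Q by (auto simp: projective_def)
  note [simp] = prod_module_def inv_f_f[OF \<pi>] inj_eq[OF \<pi>]
  let ?D = "prod_module \<pi> P Q"
  have lD: "left_module R ?D" by (rule left_module_prod[OF lP lQ \<pi>])
  have 1: "(\<lambda>x. \<pi> (a x, c x)) \<in> module_hom R M ?D"
    by (rule mhomI) (simp_all add: mhomD[OF P(2)] mhomD[OF Q(2)])
  have b1: "(\<lambda>z. b (fst (inv_into UNIV \<pi> z))) \<in> module_hom R ?D N"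
    by (rule mhom_comp[OF _ P(3)], rule mhomI) auto
  have d1: "(\<lambda>z. d (snd (inv_into UNIV \<pi> z))) \<in> module_hom R ?D N"
    by (rule mhom_comp[OF _ Q(3)], rule mhomI) auto
  have 2: "(\<lambda>z. b (fst (inv_into UNIV \<pi> z)) \<oplus>\<^bsub>N\<^esub> d (snd (inv_into UNIV \<pi> z))) \<in> module_hom R ?D N"
    by (rule mhom_add[OF lD N b1 d1])
  show ?thesis
    unfolding stably_zero_def
  proof (intro conjI exI[of _ ?D] bexI[OF _ 1] bexI[OF _ 2] ballI)
    show "(\<lambda>x. f x \<oplus>\<^bsub>N\<^esub> g x) \<in> module_hom R M N"
      by (rule mhom_add[OF M N stably_zero_mhom[OF f] stably_zero_mhom[OF g]])
    show "projective R ?D" by (rule projective_prod[OF P(1) Q(1) \<pi>])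
    show "f x \<oplus>\<^bsub>N\<^esub> g x = b (fst (inv_into UNIV \<pi> (\<pi> (a x, c x)))) \<oplus>\<^bsub>N\<^esub> d (snd (inv_into UNIV \<pi> (\<pi> (a x, c x))))"
      if "x \<in> carrier M" for x
      using that P(4) Q(4) by simp
  qed
qed

lemma stably_zero_neg:
  assumes "left_module R M" "left_module R N" "stably_zero R M N f"
  shows "stably_zero R M N (\<lambda>x. \<ominus>\<^bsub>N\<^esub> f x)"
  using stably_zero_comp_left[OF assms(3) mhom_neg[OF assms(2,2) mhom_id]] .

text \<open>A zero module is cut out of \<open>N\<close> itself by shrinking its carrier, which
  keeps it in the universe.\<close>

lemma stably_zero_0:
  fixes M N :: "('a, 'u) module"
  assumes M: "left_module R M" and N: "left_module R N"
  shows "stably_zero R M N (\<lambda>x. \<zero>\<^bsub>N\<^esub>)"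
proof -
  interpret M: left_module R M by fact
  interpret N: left_module R N by fact
  let ?Z = "N\<lparr>carrier := {\<zero>\<^bsub>N\<^esub>}\<rparr>"
  have ag: "abelian_group ?Z" by (rule abelian_groupI) auto
  have lZ: "left_module R ?Z"
    by (intro left_module.intro left_module_axioms.intro M.R.ring_axioms ag) (auto simp: N.smult_zero N.smult_one)
  have "projective R ?Z"
    unfolding projective_def
  proof (intro conjI allI impI lZ)
    fix A B :: "('a, 'u) module" and e f
    assume "left_module R A \<and> left_module R B \<and> e \<in> module_hom R A B \<and> e ` carrier A = carrier B \<and> f \<in> module_hom R ?Z B"
    then have lA: "left_module R A" and lB: "left_module R B" and e: "e \<in> module_hom R A B"
      and f: "f \<in> module_hom R ?Z B" by auto
    interpret A: left_module R A by fact
    show "\<exists>h\<in>module_hom R ?Z A. \<forall>x\<in>carrier ?Z. e (h x) = f x"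
      using mhom_zero[OF lA lB e] mhom_zero[OF lZ lB f]
      by (intro bexI[of _ "\<lambda>_. \<zero>\<^bsub>A\<^esub>"] mhomI) (auto simp: A.smult_zero)
  qed
  moreover have "(\<lambda>x. \<zero>\<^bsub>N\<^esub>) \<in> module_hom R M ?Z" by (rule mhomI) (auto simp: N.smult_zero)
  moreover have "(\<lambda>x. x) \<in> module_hom R ?Z N" by (rule mhomI) auto
  moreover have "(\<lambda>x. \<zero>\<^bsub>N\<^esub>) \<in> module_hom R M N" by (rule mhomI) (auto simp: N.smult_zero)
  ultimately show ?thesis using stably_zeroI[where P="?Z" and a="\<lambda>x. \<zero>\<^bsub>N\<^esub>" and b="\<lambda>x. x"] by blast
qed

lemma stably_zero_finsum:
  fixes M N :: "('a, 'u) module"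
  assumes inf: "infinite (UNIV :: 'u set)" and M: "left_module R M" and N: "left_module R N"
    and "finite I" "\<And>i. i \<in> I \<Longrightarrow> stably_zero R M N (f i)"
  shows "stably_zero R M N (\<lambda>x. \<Oplus>\<^bsub>N\<^esub>i\<in>I. f i x)"
proof -
  interpret N: left_module R N by fact
  show ?thesis using assms(4,5)
  proof (induction I)
    case empty
    then show ?case using stably_zero_0[OF M N] by simp
  next
    case (insert i I)
    have "stably_zero R M N (\<lambda>x. f i x \<oplus>\<^bsub>N\<^esub> (\<Oplus>\<^bsub>N\<^esub>i\<in>I. f i x))"
      using insert by (intro stably_zero_add[OF inf M N]) auto
    then show ?case
    proof (rule stably_zero_cong[OF _ M])
      fix x assume "x \<in> carrier M"
      then have "f j x \<in> carrier N" if "j \<in> insert i I" for j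
        using mhomD(1)[OF stably_zero_mhom[OF insert.prems[OF that]]] by blast
      then show "(\<Oplus>\<^bsub>N\<^esub>j\<in>insert i I. f j x) = f i x \<oplus>\<^bsub>N\<^esub> (\<Oplus>\<^bsub>N\<^esub>j\<in>I. f j x)"
        using insert.hyps by (intro N.M.finsum_insert) auto
    qed
  qed
qed

section \<open>Stable isomorphism of modules\<close>

lemma stably_isomorphic_refl:
  assumes M: "left_module R M"
  shows "stably_isomorphic R M M"
proof -
  interpret M: left_module R M by fact
  have "stably_equal R M M (id \<circ> id) id"
    unfolding stably_equal_def
    using mhom_id[of R M] stably_zero_cong[OF stably_zero_0[OF M M] M, of "\<lambda>x. x \<ominus>\<^bsub>M\<^esub> x"]
    by (simp add: id_def comp_def M.M.r_neg a_minus_def)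
  then show ?thesis
    unfolding stably_isomorphic_def using M mhom_id[of R M]
    by (intro conjI bexI[of _ id]) (auto simp: id_def)
qed

lemma stably_zero_round_trip:
  fixes M N L :: "('a, 'u) module"
  assumes inf: "infinite (UNIV :: 'u set)" and M: "left_module R M" and N: "left_module R N"
    and f: "f \<in> module_hom R M N" and g: "g \<in> module_hom R N M"
    and f': "f' \<in> module_hom R N L" and g': "g' \<in> module_hom R L N"
    and 1: "stably_zero R M M (\<lambda>x. g (f x) \<ominus>\<^bsub>M\<^esub> x)" and 2: "stably_zero R N N (\<lambda>x. g' (f' x) \<ominus>\<^bsub>N\<^esub> x)"
  shows "stably_zero R M M (\<lambda>x. g (g' (f' (f x))) \<ominus>\<^bsub>M\<^esub> x)"
proof -
  interpret M: left_module R M by fact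
  interpret N: left_module R N by fact
  have "stably_zero R M M (\<lambda>x. g (g' (f' (f x)) \<ominus>\<^bsub>N\<^esub> f x) \<oplus>\<^bsub>M\<^esub> (g (f x) \<ominus>\<^bsub>M\<^esub> x))"
    by (rule stably_zero_add[OF inf M M stably_zero_comp_left[OF stably_zero_comp_right[OF 2 f] g] 1])
  then show ?thesis
  proof (rule stably_zero_cong[OF _ M])
    fix x assume x: "x \<in> carrier M"
    then have c: "f x \<in> carrier N" "g' (f' (f x)) \<in> carrier N"
      by (simp_all add: mhomD(1)[OF f] mhomD(1)[OF f'] mhomD(1)[OF g'])
    then have d: "g (f x) \<in> carrier M" "g (g' (f' (f x))) \<in> carrier M" by (simp_all add: mhomD(1)[OF g])
    have "(g (g' (f' (f x))) \<ominus>\<^bsub>M\<^esub> g (f x)) \<oplus>\<^bsub>M\<^esub> (g (f x) \<ominus>\<^bsub>M\<^esub> x) = g (g' (f' (f x))) \<ominus>\<^bsub>M\<^esub> x"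
      using x d by (simp add: a_minus_def M.M.a_assoc M.M.r_neg2 M.M.r_neg1)
    then show "g (g' (f' (f x))) \<ominus>\<^bsub>M\<^esub> x = g (g' (f' (f x)) \<ominus>\<^bsub>N\<^esub> f x) \<oplus>\<^bsub>M\<^esub> (g (f x) \<ominus>\<^bsub>M\<^esub> x)"
      by (simp add: mhom_diff[OF N M g c(2,1)])
  qed
qed

lemma stably_isomorphicI:
  assumes "left_module R M" "left_module R N" "f \<in> module_hom R M N" "g \<in> module_hom R N M"
    "stably_zero R M M (\<lambda>x. g (f x) \<ominus>\<^bsub>M\<^esub> x)" "stably_zero R N N (\<lambda>x. f (g x) \<ominus>\<^bsub>N\<^esub> x)"
  shows "stably_isomorphic R M N"
  using assms mhom_id[of R M] mhom_id[of R N] mhom_comp[OF assms(3,4)] mhom_comp[OF assms(4,3)]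
  unfolding stably_isomorphic_def stably_equal_def id_def comp_def by blast

lemma stably_isomorphicE:
  assumes "stably_isomorphic R M N"
  obtains f g where "left_module R M" "left_module R N" "f \<in> module_hom R M N" "g \<in> module_hom R N M"
    "stably_zero R M M (\<lambda>x. g (f x) \<ominus>\<^bsub>M\<^esub> x)" "stably_zero R N N (\<lambda>x. f (g x) \<ominus>\<^bsub>N\<^esub> x)"
  using assms unfolding stably_isomorphic_def stably_equal_def id_def comp_def by blast

lemma stably_isomorphic_trans:
  fixes M N L :: "('a, 'u) module"
  assumes inf: "infinite (UNIV :: 'u set)" and "stably_isomorphic R M N" "stably_isomorphic R N L"
  shows "stably_isomorphic R M L"
proof -
  obtain f g where 1: "left_module R M" "left_module R N" "f \<in> module_hom R M N" "g \<in> module_hom R N M"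
    "stably_zero R M M (\<lambda>x. g (f x) \<ominus>\<^bsub>M\<^esub> x)" "stably_zero R N N (\<lambda>x. f (g x) \<ominus>\<^bsub>N\<^esub> x)"
    using assms(2) by (rule stably_isomorphicE)
  obtain f' g' where 2: "left_module R N" "left_module R L" "f' \<in> module_hom R N L" "g' \<in> module_hom R L N"
    "stably_zero R N N (\<lambda>x. g' (f' x) \<ominus>\<^bsub>N\<^esub> x)" "stably_zero R L L (\<lambda>x. f' (g' x) \<ominus>\<^bsub>L\<^esub> x)"
    using assms(3) by (rule stably_isomorphicE)
  show ?thesis
    by (rule stably_isomorphicI[OF 1(1) 2(2) mhom_comp[OF 1(3) 2(3)] mhom_comp[OF 2(4) 1(4)]
      stably_zero_round_trip[OF inf 1(1,2,3,4) 2(3,4) 1(5) 2(5)]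
      stably_zero_round_trip[OF inf 2(2,1,4,3) 1(4,3) 2(6) 1(6)]])
qed

section \<open>From decompositions to the generating hypothesis\<close>

text \<open>Inverting the bijection built from the coprojections gives coordinates
  \<open>\<theta>\<close>, which are homomorphisms because decompositions are unique; then
  \<open>h\<close> is the sum of the composites of \<open>\<theta>\<close>, a coprojection and
  \<open>h\<close>. The assumption covers all maps from a summand, since the coprojections are known
  only to exist.\<close>

lemma stably_zero_on_direct_sum:
  fixes D N :: "('a, 'u) module"
  assumes inf: "infinite (UNIV :: 'u set)" and D: "direct_sum R I X D" and N: "left_module R N"
    and h: "h \<in> module_hom R D N"
    and z: "\<And>j \<iota>. j \<in> I \<Longrightarrow> \<iota> \<in> module_hom R (X j) D \<Longrightarrow> stably_zero R (X j) N (\<lambda>x. h (\<iota> x))"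
  shows "stably_zero R D N h"
proof -
  have I: "finite I" and lD: "left_module R D" and lX: "\<And>i. i \<in> I \<Longrightarrow> left_module R (X i)"
    using D by (auto simp: direct_sum_def)
  obtain \<iota> where \<iota>: "\<And>i. i \<in> I \<Longrightarrow> \<iota> i \<in> module_hom R (X i) D"
    and bij: "bij_betw (\<lambda>x. \<Oplus>\<^bsub>D\<^esub>i\<in>I. \<iota> i (x i)) (\<Pi>\<^sub>E i\<in>I. carrier (X i)) (carrier D)"
    using D unfolding direct_sum_def by blast
  interpret D: left_module R D by fact
  let ?S = "\<lambda>x. \<Oplus>\<^bsub>D\<^esub>i\<in>I. \<iota> i (x i)" and ?E = "\<Pi>\<^sub>E i\<in>I. carrier (X i)"
  define S where "S = ?S"
  have bS: "bij_betw S ?E (carrier D)" using bij by (simp add: S_def)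
  define \<theta> where "\<theta> = inv_into ?E S"
  have \<theta>E: "\<theta> d \<in> ?E" and S\<theta>: "?S (\<theta> d) = d" if "d \<in> carrier D" for d
  proof -
    show "\<theta> d \<in> ?E" unfolding \<theta>_def using bS that by (simp add: bij_betw_def inv_into_into)
    have "S (\<theta> d) = d" unfolding \<theta>_def by (rule bij_betw_inv_into_right[OF bS that])
    then show "?S (\<theta> d) = d" by (simp add: S_def)
  qed
  have \<theta>S: "\<theta> (?S x) = x" if "x \<in> ?E" for x
  proof -
    have "\<theta> (S x) = x" unfolding \<theta>_def by (rule bij_betw_inv_into_left[OF bS that])
    then show ?thesis by (simp add: S_def)
  qed
  have \<theta>X: "\<theta> d i \<in> carrier (X i)" if "d \<in> carrier D" "i \<in> I" for d i
    using \<theta>E[OF that(1)] that(2) by auto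
  have \<iota>D: "\<iota> i y \<in> carrier D" if "i \<in> I" "y \<in> carrier (X i)" for i y
    using mhomD(1)[OF \<iota>[OF that(1)] that(2)] .
  have \<theta>hom: "(\<lambda>d. \<theta> d i) \<in> module_hom R D (X i)" if i: "i \<in> I" for i
  proof (rule mhomI)
    fix d d' assume d: "d \<in> carrier D" "d' \<in> carrier D"
    let ?x = "\<lambda>j\<in>I. \<theta> d j \<oplus>\<^bsub>X j\<^esub> \<theta> d' j"
    have xE: "?x \<in> ?E"
    proof (intro restrict_PiE_iff[THEN iffD2] ballI)
      fix j assume j: "j \<in> I"
      interpret Xj: left_module R "X j" by (rule lX[OF j])
      show "\<theta> d j \<oplus>\<^bsub>X j\<^esub> \<theta> d' j \<in> carrier (X j)" using \<theta>X d j by simp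
    qed
    have "?S ?x = (\<Oplus>\<^bsub>D\<^esub>j\<in>I. \<iota> j (\<theta> d j) \<oplus>\<^bsub>D\<^esub> \<iota> j (\<theta> d' j))"
      using d by (intro D.M.finsum_cong' refl) (auto simp: mhomD(2)[OF \<iota>] \<theta>X \<iota>D)
    also have "\<dots> = ?S (\<theta> d) \<oplus>\<^bsub>D\<^esub> ?S (\<theta> d')"
      using d by (intro D.M.finsum_addf) (auto simp: \<theta>X \<iota>D)
    also have "\<dots> = d \<oplus>\<^bsub>D\<^esub> d'" using S\<theta> d by simp
    finally have "\<theta> (d \<oplus>\<^bsub>D\<^esub> d') = ?x" using \<theta>S[OF xE] by simp
    then show "\<theta> (d \<oplus>\<^bsub>D\<^esub> d') i = \<theta> d i \<oplus>\<^bsub>X i\<^esub> \<theta> d' i" using i by simp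
  next
    fix a d assume a: "a \<in> carrier R" and d: "d \<in> carrier D"
    let ?x = "\<lambda>j\<in>I. a \<odot>\<^bsub>X j\<^esub> \<theta> d j"
    have xE: "?x \<in> ?E"
    proof (intro restrict_PiE_iff[THEN iffD2] ballI)
      fix j assume j: "j \<in> I"
      interpret Xj: left_module R "X j" by (rule lX[OF j])
      show "a \<odot>\<^bsub>X j\<^esub> \<theta> d j \<in> carrier (X j)" using \<theta>X d j a by (simp add: Xj.smult_closed)
    qed
    have "?S ?x = (\<Oplus>\<^bsub>D\<^esub>j\<in>I. a \<odot>\<^bsub>D\<^esub> \<iota> j (\<theta> d j))"
      using d a by (intro D.M.finsum_cong' refl) (auto simp: mhomD(3)[OF \<iota>] \<theta>X \<iota>D D.smult_closed)
    also have "\<dots> = a \<odot>\<^bsub>D\<^esub> ?S (\<theta> d)"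
      using d a by (intro D.smult_finsum[symmetric] I) (auto simp: \<theta>X \<iota>D)
    also have "\<dots> = a \<odot>\<^bsub>D\<^esub> d" using S\<theta> d by simp
    finally have "\<theta> (a \<odot>\<^bsub>D\<^esub> d) = ?x" using \<theta>S[OF xE] by simp
    then show "\<theta> (a \<odot>\<^bsub>D\<^esub> d) i = a \<odot>\<^bsub>X i\<^esub> \<theta> d i" using i by simp
  qed (use \<theta>X i in auto)
  have "stably_zero R D N (\<lambda>d. \<Oplus>\<^bsub>N\<^esub>i\<in>I. h (\<iota> i (\<theta> d i)))"
    by (intro stably_zero_finsum[OF inf lD N I] stably_zero_comp_right[OF z[OF _ \<iota>] \<theta>hom])
  then show ?thesis
  proof (rule stably_zero_cong[OF _ lD])
    fix d assume d: "d \<in> carrier D"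
    have "h d = h (?S (\<theta> d))" using S\<theta>[OF d] by simp
    also have "\<dots> = (\<Oplus>\<^bsub>N\<^esub>i\<in>I. h (\<iota> i (\<theta> d i)))"
      by (intro mhom_finsum[OF lD N h I] \<iota>D \<theta>X d)
    finally show "h d = (\<Oplus>\<^bsub>N\<^esub>i\<in>I. h (\<iota> i (\<theta> d i)))" .
  qed
qed

text \<open>With \<open>M\<close> stably a sum \<open>D\<close> of suspensions through
  \<open>u\<close> and \<open>v\<close>, each map from a summand to \<open>D\<close> followed by
  \<open>v\<close> is one of the test maps, so \<open>f \<circ> v\<close> is stably zero. Finally
  \<open>f\<close> is \<open>f v u - f (v u - 1)\<close>.\<close>

lemma simple_generating_hypothesis_if_sums:
  assumes inf: "infinite (UNIV :: 'u set)"
    and sums: "\<And>M :: ('a, 'u) module. in_stmod R M \<Longrightarrow> sum_of_suspensions_of_simples R M"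
  shows "simple_generating_hypothesis R TYPE('u)"
  unfolding simple_generating_hypothesis_def
proof (intro allI impI)
  fix M N :: "('a, 'u) module" and f
  assume a: "in_stmod R M \<and> in_stmod R N \<and> f \<in> module_hom R M N \<and>
    (\<forall>(S :: ('a, 'u) module) (i :: int) (X :: ('a, 'u) module). simple_module R S \<and> Omega R i S X \<longrightarrow>
      (\<forall>g\<in>module_hom R X M. stably_zero R X N (f \<circ> g)))"
  then have f: "f \<in> module_hom R M N"
    and z: "\<And>(S :: ('a, 'u) module) i (X :: ('a, 'u) module) g. simple_module R S \<Longrightarrow> Omega R i S X \<Longrightarrow>
      g \<in> module_hom R X M \<Longrightarrow> stably_zero R X N (\<lambda>x. f (g x))"
    by (auto simp: comp_def)
  have N: "left_module R N" using a by (auto simp: in_stmod_def stably_isomorphic_def)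
  obtain n S d X and D :: "('a, 'u) module" where
    SX: "\<forall>j<(n::nat). simple_module R (S j) \<and> Omega R (d j) (S j) (X j)"
    and D: "direct_sum R {..<n} X D" and MD: "stably_isomorphic R M D"
    using sums[of M] a unfolding sum_of_suspensions_of_simples_def by blast
  obtain u v where uv: "left_module R M" "left_module R D" "u \<in> module_hom R M D" "v \<in> module_hom R D M"
    "stably_zero R M M (\<lambda>x. v (u x) \<ominus>\<^bsub>M\<^esub> x)"
    using MD by (rule stably_isomorphicE)
  interpret M: left_module R M by fact
  interpret N: left_module R N by fact
  have "stably_zero R D N (\<lambda>x. f (v x))"
  proof (rule stably_zero_on_direct_sum[OF inf D N mhom_comp[OF uv(4) f]])
    fix j \<iota> assume j: "j \<in> {..<n}" and \<iota>: "\<iota> \<in> module_hom R (X j) D"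
    then show "stably_zero R (X j) N (\<lambda>x. f (v (\<iota> x)))"
      using SX z[OF _ _ mhom_comp[OF \<iota> uv(4)]] by blast
  qed
  then have 1: "stably_zero R M N (\<lambda>x. f (v (u x)))" by (rule stably_zero_comp_right[OF _ uv(3)])
  have 2: "stably_zero R M N (\<lambda>x. f (v (u x) \<ominus>\<^bsub>M\<^esub> x))"
    by (rule stably_zero_comp_left[OF uv(5) f])
  have "stably_zero R M N (\<lambda>x. f (v (u x)) \<oplus>\<^bsub>N\<^esub> \<ominus>\<^bsub>N\<^esub> f (v (u x) \<ominus>\<^bsub>M\<^esub> x))"
    by (rule stably_zero_add[OF inf uv(1) N 1 stably_zero_neg[OF uv(1) N 2]])
  then show "stably_zero R M N f"
  proof (rule stably_zero_cong[OF _ uv(1)])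
    fix x assume x: "x \<in> carrier M"
    then have c: "v (u x) \<in> carrier M" using mhomD(1)[OF uv(3)] mhomD(1)[OF uv(4)] by blast
    have "f (v (u x) \<ominus>\<^bsub>M\<^esub> x) = f (v (u x)) \<ominus>\<^bsub>N\<^esub> f x" by (rule mhom_diff[OF uv(1) N f c x])
    then show "f x = f (v (u x)) \<oplus>\<^bsub>N\<^esub> \<ominus>\<^bsub>N\<^esub> f (v (u x) \<ominus>\<^bsub>M\<^esub> x)"
      using mhomD(1)[OF f x] mhomD(1)[OF f c]
      by (simp add: a_minus_def N.M.minus_add N.M.a_assoc[symmetric] N.M.r_neg)
  qed
qed

section \<open>Modules over a group algebra\<close>

definition coord :: "'i set \<Rightarrow> ('i \<Rightarrow> 'k::field) set" where
  "coord I = {f. \<forall>i. i \<notin> I \<longrightarrow> f i = 0}"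

lemma subspace_coord: "fs.subspace (coord I)"
  by (auto simp: fs.subspace_def coord_def fun_pw)

text \<open>Take \<open>I\<close> minimal such that \<open>coord I\<close> still has the full image:
  a relation between two vectors differing at \<open>i\<close> would allow \<open>i\<close> to be
  discarded. The target may be the carrier of a module, so linearity of \<open>\<Phi>\<close> is
  replaced by the condition that adding a multiple of a relation does not change the value.\<close>

lemma coord_reduction:
  fixes \<Phi> :: "('i \<Rightarrow> 'k::field) \<Rightarrow> 'y"
  assumes fin: "finite S"
    and \<Phi>: "\<And>x y z c. x \<in> coord S \<Longrightarrow> y \<in> coord S \<Longrightarrow> z \<in> coord S \<Longrightarrow> \<Phi> x = \<Phi> y \<Longrightarrow> \<Phi> (z + sc c (x - y)) = \<Phi> z"
  obtains I where "I \<subseteq> S" "bij_betw \<Phi> (coord I) (\<Phi> ` coord S)"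
proof -
  have sub: "coord I \<subseteq> coord J" if "I \<subseteq> J" for I J :: "'i set" using that by (auto simp: coord_def)
  define Q where "Q = (\<lambda>I. I \<subseteq> S \<and> \<Phi> ` coord I = \<Phi> ` coord S)"
  have "Q S" by (simp add: Q_def)
  then obtain I where I: "Q I" and min: "\<And>J. Q J \<Longrightarrow> card I \<le> card J"
    using ex_has_least_nat[of Q S card] by blast
  have IS: "I \<subseteq> S" "\<Phi> ` coord I = \<Phi> ` coord S" using I by (auto simp: Q_def)
  have "inj_on \<Phi> (coord I)"
  proof (rule inj_onI, rule ccontr)
    fix x y assume xy: "x \<in> coord I" "y \<in> coord I" "\<Phi> x = \<Phi> y" "x \<noteq> y"
    then obtain i where i: "x i \<noteq> y i" by (auto simp: fun_eq_iff)
    then have iI: "i \<in> I" using xy by (auto simp: coord_def)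
    have "\<Phi> ` coord (I - {i}) = \<Phi> ` coord S"
    proof (intro equalityI)
      show "\<Phi> ` coord (I - {i}) \<subseteq> \<Phi> ` coord S" using sub[of "I - {i}" S] IS by blast
      have "\<Phi> ` coord I \<subseteq> \<Phi> ` coord (I - {i})"
      proof
        fix u assume "u \<in> \<Phi> ` coord I"
        then obtain z where z: "u = \<Phi> z" "z \<in> coord I" by blast
        \<comment> \<open>The multiple of the relation that cancels the coordinate of
          \<open>z\<close> at \<open>i\<close>.\<close>
        let ?c = "- (z i / (x i - y i))"
        let ?z = "z + sc ?c (x - y)"
        have "?z i = 0" using i by (simp add: fun_pw)
        then have "?z \<in> coord (I - {i})" using xy z by (auto simp: coord_def fun_pw)
        moreover have "\<Phi> ?z = u"
          unfolding z(1) by (rule \<Phi>) (use xy z sub[OF IS(1)] in auto)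
        ultimately show "u \<in> \<Phi> ` coord (I - {i})" by blast
      qed
      then show "\<Phi> ` coord S \<subseteq> \<Phi> ` coord (I - {i})" using IS by simp
    qed
    then have "Q (I - {i})" using IS by (auto simp: Q_def)
    then have "card I \<le> card (I - {i})" by (rule min)
    moreover have "finite I" using IS(1) fin by (rule finite_subset)
    ultimately show False using iI by (metis card_Diff1_less not_less)
  qed
  then show thesis using that[of I] IS by (simp add: bij_betw_def)
qed

text \<open>Indices are taken in \<open>nat\<close> so that finite-dimensional spaces of any origin
  share one type and can be put into a common \<open>dsum\<close>.\<close>

lemma finite_dim_coord:
  fixes V :: "('i \<Rightarrow> 'k::field) set"
  assumes V: "fs.subspace V" and S: "finite S" "V \<subseteq> fs.span S"
  obtains I :: "nat set" and E where "finite I" "lin_on (coord I) V E" "bij_betw E (coord I) V"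
proof -
  obtain D where D: "D \<subseteq> V" "fs.independent D" "V \<subseteq> fs.span D" by (rule fs.maximal_independent_subset)
  have "finite D" using fs.independent_span_bound[OF S(1) D(2)] D(1) S(2) by blast
  then obtain d and m :: nat where d: "D = d ` {..<m}"
    by (metis finite_imp_nat_seg_image_inj_on lessThan_def)
  define E where "E = (\<lambda>c. \<Sum>i<m. sc (c i) (d i))"
  have dV: "d i \<in> V" if "i < m" for i using D(1) d that by auto
  have EV: "E c \<in> V" for c
    unfolding E_def by (intro fs.subspace_sum[OF V] fs.subspace_scale[OF V] dV) auto
  have Eadd: "E (x + y) = E x + E y" for x y
    by (simp add: E_def fun_pw fs.scale_left_distrib sum.distrib)
  have Esc: "E (sc c x) = sc c (E x)" for c x
    by (simp add: E_def fun_pw fs.scale_sum_right)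
  have lin: "lin_on (coord {..<m}) V E" by (rule lin_onI) (simp_all add: EV Eadd Esc)
  have surj: "E ` coord {..<m} = V"
  proof (intro equalityI subsetI)
    fix v assume "v \<in> V"
    then have "v \<in> fs.span (d ` {..<m})" using D(3) d by blast
    then obtain c where c: "v = (\<Sum>i<m. sc (c i) (d i))" using span_family by blast
    have "v = E (\<lambda>i. if i < m then c i else 0)" unfolding c E_def by (intro sum.cong refl) simp
    moreover have "(\<lambda>i. if i < m then c i else 0) \<in> coord {..<m}" by (simp add: coord_def)
    ultimately show "v \<in> E ` coord {..<m}" by blast
  qed (use EV in auto)
  obtain I where I: "I \<subseteq> {..<m}" "bij_betw E (coord I) (E ` coord {..<m})"
  proof (rule coord_reduction[of "{..<m}" E])
    fix x y z :: "nat \<Rightarrow> 'k" and c assume *: "x \<in> coord {..<m}" "y \<in> coord {..<m}" "z \<in> coord {..<m}" "E x = E y"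
    then have "E (x - y) = 0" using lin_on_diff[OF lin subspace_coord] by simp
    then show "E (z + sc c (x - y)) = E z" by (simp add: Eadd Esc)
  qed auto
  have "coord I \<subseteq> coord {..<m}" using I(1) by (auto simp: coord_def)
  then show thesis
    using that[of I E] I surj lin_on_subset[OF lin] finite_subset[OF I(1)] by auto
qed

text \<open>Coordinates are peeled off one at a time through an injection of pairs into
  \<open>'u\<close>. Here the copy of \<open>k\<close> in the universe is used.\<close>

lemma coord_inj_exists:
  fixes \<iota> :: "'k::field \<Rightarrow> 'u"
  assumes inf: "infinite (UNIV :: 'u set)" and \<iota>: "inj \<iota>" and "finite I"
  shows "\<exists>j :: ('i \<Rightarrow> 'k) \<Rightarrow> 'u. inj_on j (coord I)"
  using \<open>finite I\<close>
proof induction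
  case empty
  have "coord {} = {0 :: 'i \<Rightarrow> 'k}" by (auto simp: coord_def fun_eq_iff fun_pw)
  then show ?case by (intro exI[of _ "\<lambda>_. undefined"]) simp
next
  case (insert a I)
  then obtain j :: "('i \<Rightarrow> 'k) \<Rightarrow> 'u" where j: "inj_on j (coord I)" by blast
  obtain \<pi> :: "'u \<times> 'u \<Rightarrow> 'u" where \<pi>: "inj \<pi>" using inj_prod_exists[OF inf] by blast
  have "inj_on (\<lambda>f. \<pi> (\<iota> (f a), j (f(a := 0)))) (coord (insert a I))"
  proof (rule inj_onI)
    fix f g assume f: "f \<in> coord (insert a I)" and g: "g \<in> coord (insert a I)"
      and e: "\<pi> (\<iota> (f a), j (f(a := 0))) = \<pi> (\<iota> (g a), j (g(a := 0)))"
    have 1: "f a = g a" "j (f(a := 0)) = j (g(a := 0))" using e \<pi> \<iota> by (auto simp: inj_eq)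
    have "f(a := 0) \<in> coord I" "g(a := 0) \<in> coord I" using f g by (auto simp: coord_def)
    then have "f(a := 0) = g(a := 0)" using j 1(2) unfolding inj_on_def by blast
    then show "f = g" using 1(1) by (metis fun_upd_triv fun_upd_upd)
  qed
  then show ?case by blast
qed

definition aact :: "('g, 'x) monoid_scheme \<Rightarrow> ('g \<Rightarrow> ('i \<Rightarrow> 'k::field) \<Rightarrow> ('i \<Rightarrow> 'k)) \<Rightarrow> ('g \<Rightarrow> 'k) \<Rightarrow> ('i \<Rightarrow> 'k) \<Rightarrow> 'i \<Rightarrow> 'k"
  where "aact G \<rho> a x = (\<Sum>g\<in>carrier G. sc (a g) (\<rho> g x))"

text \<open>A group element inside the group algebra, and also a coordinate vector of
  \<open>coord I\<close>.\<close>

definition kdelta :: "'g \<Rightarrow> 'g \<Rightarrow> 'k::field" where "kdelta g = (\<lambda>h. if h = g then 1 else 0)"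

text \<open>The module of a representation, its elements encoded in \<open>'u\<close> by \<open>j\<close> and decoded by \<open>i\<close>.\<close>

definition enc :: "('g, 'x) monoid_scheme \<Rightarrow> ('i \<Rightarrow> 'k::field) set \<Rightarrow> ('g \<Rightarrow> ('i \<Rightarrow> 'k) \<Rightarrow> ('i \<Rightarrow> 'k)) \<Rightarrow>
    (('i \<Rightarrow> 'k) \<Rightarrow> 'u) \<Rightarrow> ('u \<Rightarrow> 'i \<Rightarrow> 'k) \<Rightarrow> ('g \<Rightarrow> 'k, 'u) module" where
  "enc G V \<rho> j i = \<lparr>carrier = j ` V, monoid.mult = (\<lambda>x y. x), one = j 0, zero = j 0,
     add = (\<lambda>x y. j (i x + i y)), smult = (\<lambda>a x. j (aact G \<rho> a (i x)))\<rparr>"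

text \<open>The dictionary between modules in the universe and representations on function spaces:
  \<open>\<Phi>\<close> is an isomorphism onto \<open>M\<close> from \<open>V\<close> with the
  linearly extended action.\<close>

definition presents :: "('g, 'x) monoid_scheme \<Rightarrow> ('g \<Rightarrow> 'k, 'u) module \<Rightarrow> ('i \<Rightarrow> 'k::field) set \<Rightarrow>
    ('g \<Rightarrow> ('i \<Rightarrow> 'k) \<Rightarrow> ('i \<Rightarrow> 'k)) \<Rightarrow> (('i \<Rightarrow> 'k) \<Rightarrow> 'u) \<Rightarrow> bool" where
  "presents G M V \<rho> \<Phi> \<longleftrightarrow> left_module (group_algebra G) M \<and> rep G V \<rho> \<and> bij_betw \<Phi> V (carrier M) \<and>
     (\<forall>x\<in>V. \<forall>y\<in>V. \<Phi> (x + y) = \<Phi> x \<oplus>\<^bsub>M\<^esub> \<Phi> y) \<and>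
     (\<forall>a\<in>carrier (group_algebra G). \<forall>x\<in>V. \<Phi> (aact G \<rho> a x) = a \<odot>\<^bsub>M\<^esub> \<Phi> x)"

definition hom_via where
  "hom_via V \<Phi> \<Psi> f = (\<lambda>u. \<Psi> (f (inv_into V \<Phi> u)))"

context finite_group
begin

abbreviation KG :: "('a \<Rightarrow> 'k::field) ring" where "KG \<equiv> group_algebra G"

lemma KG_carrier: "a \<in> carrier KG \<longleftrightarrow> (\<forall>g. g \<notin> carrier G \<longrightarrow> a g = 0)"
proof -
  have "finite {g. a g \<noteq> 0}" if "{g. a g \<noteq> 0} \<subseteq> carrier G" using that fin by (rule finite_subset)
  then show ?thesis by (auto simp: group_algebra_def)
qed

lemma KG_simps: "\<zero>\<^bsub>KG\<^esub> = 0" "a \<oplus>\<^bsub>KG\<^esub> b = a + b" "\<one>\<^bsub>KG\<^esub> = kdelta \<one>"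
  by (simp_all add: group_algebra_def fun_eq_iff fun_pw kdelta_def)

lemma KG_mult:
  assumes "a \<in> carrier KG"
  shows "(a \<otimes>\<^bsub>KG\<^esub> b) g = (if g \<in> carrier G then \<Sum>h\<in>carrier G. a h * b (inv h \<otimes> g) else 0)"
proof -
  have "{h. a h \<noteq> 0} \<subseteq> carrier G" using assms by (auto simp: KG_carrier)
  then have "(\<Sum>h | a h \<noteq> 0. a h * b (inv h \<otimes> g)) = (\<Sum>h\<in>carrier G. a h * b (inv h \<otimes> g))"
    by (intro sum.mono_neutral_left) auto
  then show ?thesis by (simp add: group_algebra_def)
qed

lemma kdelta_carrier: "g \<in> carrier G \<Longrightarrow> kdelta g \<in> carrier KG"
  by (auto simp: KG_carrier kdelta_def)

lemma sc_carrier: "a \<in> carrier KG \<Longrightarrow> sc c a \<in> carrier KG"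
  by (simp add: KG_carrier fun_pw)

lemma sc_one_mult:
  assumes a: "a \<in> carrier KG"
  shows "sc c (kdelta \<one>) \<otimes>\<^bsub>KG\<^esub> a = sc c a"
proof
  fix g
  show "(sc c (kdelta \<one>) \<otimes>\<^bsub>KG\<^esub> a) g = sc c a g"
  proof (cases "g \<in> carrier G")
    case True
    have "(\<Sum>h\<in>carrier G. sc c (kdelta \<one>) h * a (inv h \<otimes> g)) = (\<Sum>h\<in>carrier G. if h = \<one> then c * a g else 0)"
      using True by (intro sum.cong refl) (auto simp: fun_pw kdelta_def)
    then show ?thesis using True by (simp add: KG_mult[OF sc_carrier[OF kdelta_carrier[OF one_closed]]] fun_pw)
  next
    case False
    then show ?thesis using a by (simp add: KG_mult[OF sc_carrier[OF kdelta_carrier[OF one_closed]]] KG_carrier fun_pw)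
  qed
qed

lemma aact_closed:
  assumes V: "rep G V \<rho>" and x: "x \<in> V"
  shows "aact G \<rho> a x \<in> V"
  unfolding aact_def
  by (intro fs.subspace_sum[OF repD(1)[OF V]] fs.subspace_scale[OF repD(1)[OF V]] repD(5)[OF V _ x])

lemma aact_add_right:
  assumes V: "rep G V \<rho>" and "x \<in> V" "y \<in> V"
  shows "aact G \<rho> a (x + y) = aact G \<rho> a x + aact G \<rho> a y"
  unfolding aact_def sum.distrib[symmetric]
  by (intro sum.cong refl) (simp add: lin_onD(2)[OF repD(2)[OF V] assms(2,3)] fs.scale_right_distrib)

lemma aact_add_left: "aact G \<rho> (a + b) x = aact G \<rho> a x + aact G \<rho> b x"
  by (simp add: aact_def fun_pw fs.scale_left_distrib sum.distrib)

lemma aact_kdelta: "g \<in> carrier G \<Longrightarrow> aact G \<rho> (sc c (kdelta g)) x = sc c (\<rho> g x)"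
proof -
  assume g: "g \<in> carrier G"
  have "aact G \<rho> (sc c (kdelta g)) x = (\<Sum>h\<in>carrier G. if h = g then sc c (\<rho> g x) else 0)"
    unfolding aact_def by (intro sum.cong refl) (auto simp: fun_pw kdelta_def)
  then show ?thesis using g by simp
qed

lemma aact_mult:
  assumes V: "rep G V \<rho>" and a: "a \<in> carrier KG" and x: "x \<in> V"
  shows "aact G \<rho> (a \<otimes>\<^bsub>KG\<^esub> b) x = aact G \<rho> a (aact G \<rho> b x)"
proof -
  have m: "\<rho> g x \<in> V" if "g \<in> carrier G" for g by (rule repD(5)[OF V that x])
  have "aact G \<rho> (a \<otimes>\<^bsub>KG\<^esub> b) x = (\<Sum>g\<in>carrier G. \<Sum>h\<in>carrier G. sc (a h) (sc (b (inv h \<otimes> g)) (\<rho> g x)))"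
    unfolding aact_def by (intro sum.cong refl) (simp add: KG_mult[OF a] fs.scale_sum_left)
  also have "\<dots> = (\<Sum>h\<in>carrier G. \<Sum>g\<in>carrier G. sc (a h) (sc (b (inv h \<otimes> g)) (\<rho> g x)))"
    by (rule sum.swap)
  also have "\<dots> = (\<Sum>h\<in>carrier G. \<Sum>g\<in>carrier G. sc (a h) (sc (b (inv h \<otimes> (h \<otimes> g))) (\<rho> (h \<otimes> g) x)))"
    by (intro sum.cong refl sum_left_translate[symmetric])
  also have "\<dots> = (\<Sum>h\<in>carrier G. sc (a h) (\<rho> h (aact G \<rho> b x)))"
  proof (intro sum.cong refl)
    fix h assume h: "h \<in> carrier G"
    have "(\<Sum>g\<in>carrier G. sc (a h) (sc (b (inv h \<otimes> (h \<otimes> g))) (\<rho> (h \<otimes> g) x))) =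
        (\<Sum>g\<in>carrier G. sc (a h) (\<rho> h (sc (b g) (\<rho> g x))))"
    proof (intro sum.cong refl arg_cong[where f="sc (a h)"])
      fix g assume g: "g \<in> carrier G"
      have e: "inv h \<otimes> (h \<otimes> g) = g" using g h by (simp add: m_assoc[symmetric])
      show "sc (b (inv h \<otimes> (h \<otimes> g))) (\<rho> (h \<otimes> g) x) = \<rho> h (sc (b g) (\<rho> g x))"
        unfolding e using repD(4)[OF V h g x] lin_onD(3)[OF repD(2)[OF V h] m[OF g]] by simp
    qed
    also have "\<dots> = sc (a h) (\<rho> h (aact G \<rho> b x))"
      unfolding aact_def fs.scale_sum_right[symmetric]
      by (intro arg_cong[where f="sc (a h)"] lin_on_sum[OF repD(2)[OF V h] repD(1)[OF V], symmetric]
        fs.subspace_scale[OF repD(1)[OF V]] m)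
    finally show "(\<Sum>g\<in>carrier G. sc (a h) (sc (b (inv h \<otimes> (h \<otimes> g))) (\<rho> (h \<otimes> g) x))) = sc (a h) (\<rho> h (aact G \<rho> b x))" .
  qed
  finally show ?thesis by (simp add: aact_def)
qed

lemma ghom_aact:
  assumes V: "rep G V \<rho>" and f: "ghom G V \<rho> W \<sigma> f" and x: "x \<in> V"
  shows "f (aact G \<rho> a x) = aact G \<sigma> a (f x)"
proof -
  have m: "\<rho> g x \<in> V" if "g \<in> carrier G" for g by (rule repD(5)[OF V that x])
  have "f (aact G \<rho> a x) = (\<Sum>g\<in>carrier G. f (sc (a g) (\<rho> g x)))"
    unfolding aact_def by (intro lin_on_sum[OF ghomD(1)[OF f] repD(1)[OF V]] fs.subspace_scale[OF repD(1)[OF V]] m)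
  also have "\<dots> = aact G \<sigma> a (f x)"
    unfolding aact_def by (intro sum.cong refl) (simp add: lin_onD(3)[OF ghomD(1)[OF f] m] ghomD(3)[OF f _ x])
  finally show ?thesis .
qed

lemma presents_enc:
  fixes V :: "('i \<Rightarrow> 'k::field) set" and j :: "('i \<Rightarrow> 'k) \<Rightarrow> 'u"
  assumes R: "ring (KG :: ('a \<Rightarrow> 'k) ring)" and V: "rep G V \<rho>" and ij: "\<And>x. x \<in> V \<Longrightarrow> i (j x) = x"
  shows "presents G (enc G V \<rho> j i) V \<rho> j"
proof -
  note sV = repD(1)[OF V]
  have [simp]: "x \<in> V \<Longrightarrow> y \<in> V \<Longrightarrow> x + y \<in> V" "0 \<in> V" for x y
    using fs.subspace_add[OF sV] fs.subspace_0[OF sV] by auto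
  note [simp] = enc_def ij aact_closed[OF V]
  have ag: "abelian_group (enc G V \<rho> j i)"
  proof (rule abelian_groupI)
    fix x assume "x \<in> carrier (enc G V \<rho> j i)"
    then obtain v where "x = j v" "v \<in> V" by auto
    then show "\<exists>y\<in>carrier (enc G V \<rho> j i). y \<oplus>\<^bsub>enc G V \<rho> j i\<^esub> x = \<zero>\<^bsub>enc G V \<rho> j i\<^esub>"
      using fs.subspace_neg[OF sV] by (intro bexI[of _ "j (- v)"]) auto
  qed (auto simp: add_ac)
  have one: "aact G \<rho> (kdelta \<one>) x = x" if "x \<in> V" for x
    using aact_kdelta[OF one_closed, of \<rho> 1 x] repD(3)[OF V that] by simp
  have "left_module KG (enc G V \<rho> j i)"
    by (intro left_module.intro left_module_axioms.intro R ag)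
      (auto simp: KG_simps aact_add_left aact_add_right[OF V] aact_mult[OF V] one)
  moreover have "bij_betw j V (carrier (enc G V \<rho> j i))"
    by (auto simp: bij_betw_def intro: inj_on_inverseI[of V i])
  ultimately show ?thesis using V unfolding presents_def by simp
qed

lemma presentsD:
  assumes "presents G M V \<rho> \<Phi>"
  shows "left_module KG M" "rep G V \<rho>" "bij_betw \<Phi> V (carrier M)"
    "x \<in> V \<Longrightarrow> y \<in> V \<Longrightarrow> \<Phi> (x + y) = \<Phi> x \<oplus>\<^bsub>M\<^esub> \<Phi> y"
    "a \<in> carrier KG \<Longrightarrow> x \<in> V \<Longrightarrow> \<Phi> (aact G \<rho> a x) = a \<odot>\<^bsub>M\<^esub> \<Phi> x"
    "x \<in> V \<Longrightarrow> \<Phi> x \<in> carrier M"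
    "u \<in> carrier M \<Longrightarrow> inv_into V \<Phi> u \<in> V" "u \<in> carrier M \<Longrightarrow> \<Phi> (inv_into V \<Phi> u) = u"
    "x \<in> V \<Longrightarrow> inv_into V \<Phi> (\<Phi> x) = x"
proof -
  show b: "bij_betw \<Phi> V (carrier M)" using assms by (simp add: presents_def)
  show "x \<in> V \<Longrightarrow> \<Phi> x \<in> carrier M" using b by (auto simp: bij_betw_def)
  show "u \<in> carrier M \<Longrightarrow> inv_into V \<Phi> u \<in> V" using b by (auto simp: bij_betw_def inv_into_into)
  show "u \<in> carrier M \<Longrightarrow> \<Phi> (inv_into V \<Phi> u) = u" by (rule bij_betw_inv_into_right[OF b])
  show "x \<in> V \<Longrightarrow> inv_into V \<Phi> (\<Phi> x) = x" by (rule bij_betw_inv_into_left[OF b])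
qed (use assms in \<open>auto simp: presents_def\<close>)

lemma presents_group:
  assumes "presents G M V \<rho> \<Phi>" "g \<in> carrier G" "x \<in> V"
  shows "\<Phi> (\<rho> g x) = kdelta g \<odot>\<^bsub>M\<^esub> \<Phi> x"
  using presentsD(5)[OF assms(1) kdelta_carrier[OF assms(2)] assms(3)] aact_kdelta[OF assms(2), of \<rho> 1 x] by simp

lemma presents_scale:
  assumes "presents G M V \<rho> \<Phi>" "x \<in> V"
  shows "\<Phi> (sc c x) = sc c (kdelta \<one>) \<odot>\<^bsub>M\<^esub> \<Phi> x"
  using presentsD(5)[OF assms(1) sc_carrier[OF kdelta_carrier[OF one_closed]] assms(2), of c]
    aact_kdelta[OF one_closed, of \<rho> c x] repD(3)[OF presentsD(2)[OF assms(1)] assms(2)] by simp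

lemma presents_zero:
  assumes "presents G M V \<rho> \<Phi>"
  shows "\<Phi> 0 = \<zero>\<^bsub>M\<^esub>"
proof -
  interpret M: left_module KG M by (rule presentsD(1)[OF assms])
  have 0: "0 \<in> V" by (rule fs.subspace_0[OF repD(1)[OF presentsD(2)[OF assms]]])
  have "\<Phi> 0 \<oplus>\<^bsub>M\<^esub> \<Phi> 0 = \<Phi> 0" using presentsD(4)[OF assms 0 0] by simp
  then show ?thesis using M.M.add.l_cancel_one presentsD(6)[OF assms 0] by blast
qed

lemma presents_diff:
  assumes "presents G M V \<rho> \<Phi>" "x \<in> V" "y \<in> V"
  shows "\<Phi> (x - y) = \<Phi> x \<ominus>\<^bsub>M\<^esub> \<Phi> y"
proof -
  interpret M: left_module KG M by (rule presentsD(1)[OF assms(1)])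
  have d: "x - y \<in> V" using assms by (intro fs.subspace_diff repD(1)[OF presentsD(2)[OF assms(1)]])
  have "\<Phi> x = \<Phi> (x - y) \<oplus>\<^bsub>M\<^esub> \<Phi> y" using presentsD(4)[OF assms(1) d assms(3)] by simp
  then show ?thesis using presentsD(6)[OF assms(1)] assms(2,3) d
    by (simp add: a_minus_def M.M.a_assoc M.M.r_neg)
qed

lemma presents_sum:
  assumes P: "presents G M V \<rho> \<Phi>" and "finite I" "\<And>i. i \<in> I \<Longrightarrow> x i \<in> V"
  shows "\<Phi> (\<Sum>i\<in>I. x i) = (\<Oplus>\<^bsub>M\<^esub>i\<in>I. \<Phi> (x i))"
proof -
  interpret M: left_module KG M by (rule presentsD(1)[OF P])
  show ?thesis using assms(2,3)
  proof (induction I)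
    case empty
    then show ?case using presents_zero[OF P] by simp
  next
    case (insert i I)
    have "(\<Sum>i\<in>I. x i) \<in> V"
      using insert by (intro fs.subspace_sum[OF repD(1)[OF presentsD(2)[OF P]]]) auto
    then show ?case using insert presentsD(6)[OF P]
      by (simp add: M.M.finsum_insert presentsD(4)[OF P] Pi_def)
  qed
qed

lemma hom_via_mhom:
  fixes V :: "('i \<Rightarrow> 'k::field) set"
  assumes M: "presents G M V \<rho> \<Phi>" and N: "presents G N W \<sigma> \<Psi>" and f: "ghom G V \<rho> W \<sigma> f"
  shows "hom_via V \<Phi> \<Psi> f \<in> module_hom KG M N"
proof (rule mhomI)
  interpret M: left_module KG M by (rule presentsD(1)[OF M])
  let ?i = "inv_into V \<Phi>"
  fix u assume u: "u \<in> carrier M"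
  note iu = presentsD(7)[OF M u]
  show "hom_via V \<Phi> \<Psi> f u \<in> carrier N"
    unfolding hom_via_def by (rule presentsD(6)[OF N ghomD(2)[OF f iu]])
  fix v assume v: "v \<in> carrier M"
  note iv = presentsD(7)[OF M v]
  have s: "?i u + ?i v \<in> V" by (rule fs.subspace_add[OF repD(1)[OF presentsD(2)[OF M]] iu iv])
  have "?i (u \<oplus>\<^bsub>M\<^esub> v) = ?i u + ?i v"
    using presentsD(9)[OF M s] presentsD(4)[OF M iu iv] presentsD(8)[OF M u] presentsD(8)[OF M v] by simp
  then show "hom_via V \<Phi> \<Psi> f (u \<oplus>\<^bsub>M\<^esub> v) = hom_via V \<Phi> \<Psi> f u \<oplus>\<^bsub>N\<^esub> hom_via V \<Phi> \<Psi> f v"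
    unfolding hom_via_def
    using lin_onD(2)[OF ghomD(1)[OF f] iu iv] presentsD(4)[OF N ghomD(2)[OF f iu] ghomD(2)[OF f iv]] by simp
next
  let ?i = "inv_into V \<Phi>"
  fix a :: "'a \<Rightarrow> 'k" and u assume a: "a \<in> carrier KG" and u: "u \<in> carrier M"
  note iu = presentsD(7)[OF M u]
  have "?i (a \<odot>\<^bsub>M\<^esub> u) = aact G \<rho> a (?i u)"
    using presentsD(9)[OF M aact_closed[OF presentsD(2)[OF M] iu, of a]] presentsD(5)[OF M a iu] presentsD(8)[OF M u] by simp
  then show "hom_via V \<Phi> \<Psi> f (a \<odot>\<^bsub>M\<^esub> u) = a \<odot>\<^bsub>N\<^esub> hom_via V \<Phi> \<Psi> f u"
    unfolding hom_via_def
    using ghom_aact[OF presentsD(2)[OF M] f iu, of a] presentsD(5)[OF N a ghomD(2)[OF f iu]] by simp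
qed

lemma presents_unique:
  assumes M: "presents G M V \<rho> \<Phi>" and N: "presents G M W \<sigma> \<Psi>"
  shows "steq G V \<rho> W \<sigma>"
proof -
  let ?E = "\<lambda>x. inv_into W \<Psi> (\<Phi> x)"
  note m = presentsD(6)[OF M] and i = presentsD(7)[OF N] and pi = presentsD(8)[OF N] and ip = presentsD(9)[OF N]
  note sW = repD(1)[OF presentsD(2)[OF N]]
  show ?thesis
  proof (rule steq_iso[OF presentsD(2)[OF M] presentsD(2)[OF N]])
    show "bij_betw ?E V W"
      using bij_betw_trans[OF presentsD(3)[OF M] bij_betw_inv_into[OF presentsD(3)[OF N]]] by (simp add: comp_def)
    show "ghom G V \<rho> W \<sigma> ?E"
      unfolding ghom_def
    proof (intro conjI ballI lin_onI)
      fix x assume x: "x \<in> V"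
      show "?E x \<in> W" by (rule i[OF m[OF x]])
      fix y assume y: "y \<in> V"
      have "\<Psi> (?E x + ?E y) = \<Phi> (x + y)"
        by (simp add: presentsD(4)[OF N i[OF m[OF x]] i[OF m[OF y]]] pi m x y presentsD(4)[OF M])
      then show "?E (x + y) = ?E x + ?E y"
        using ip[OF fs.subspace_add[OF sW i[OF m[OF x]] i[OF m[OF y]]]] by simp
    next
      fix c x assume x: "x \<in> V"
      have "\<Psi> (sc c (?E x)) = \<Phi> (sc c x)"
        by (simp add: presents_scale[OF N i[OF m[OF x]]] pi m x presents_scale[OF M])
      then show "?E (sc c x) = sc c (?E x)" using ip[OF fs.subspace_scale[OF sW i[OF m[OF x]]], of c] by simp
    next
      fix g x assume g: "g \<in> carrier G" and x: "x \<in> V"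
      have "\<Psi> (\<sigma> g (?E x)) = \<Phi> (\<rho> g x)"
        by (simp add: presents_group[OF N g i[OF m[OF x]]] pi m x presents_group[OF M g])
      then show "?E (\<rho> g x) = \<sigma> g (?E x)" using ip[OF repD(5)[OF presentsD(2)[OF N] g i[OF m[OF x]]]] by simp
    qed
  qed
qed

text \<open>A module over the group algebra has no scalar action of its own; the scalar
  \<open>c\<close> appears as the multiple \<open>sc c (kdelta \<one>)\<close> of the unit.\<close>

lemma smult_expand:
  fixes M :: "('a \<Rightarrow> 'k::field, 'u) module"
  assumes M: "left_module KG M" and a: "a \<in> carrier KG" and u: "u \<in> carrier M"
  shows "a \<odot>\<^bsub>M\<^esub> u = (\<Oplus>\<^bsub>M\<^esub>g\<in>carrier G. sc (a g) (kdelta \<one>) \<odot>\<^bsub>M\<^esub> (kdelta g \<odot>\<^bsub>M\<^esub> u))"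
proof -
  interpret M: left_module KG M by fact
  have dc: "sc (a g) (kdelta g) \<in> carrier KG" if "g \<in> carrier G" for g
    by (rule sc_carrier[OF kdelta_carrier[OF that]])
  have ae: "(\<Sum>g\<in>carrier G. sc (a g) (kdelta g)) = a"
  proof
    fix h
    have "(\<Sum>g\<in>carrier G. sc (a g) (kdelta g)) h = (\<Sum>g\<in>carrier G. if h = g then a h else 0)"
      unfolding fun_sum_apply by (intro sum.cong refl) (simp add: fun_pw kdelta_def)
    then show "(\<Sum>g\<in>carrier G. sc (a g) (kdelta g)) h = a h" using a by (auto simp: KG_carrier)
  qed
  have s: "(\<Sum>g\<in>J. sc (a g) (kdelta g)) \<odot>\<^bsub>M\<^esub> u = (\<Oplus>\<^bsub>M\<^esub>g\<in>J. sc (a g) (kdelta g) \<odot>\<^bsub>M\<^esub> u)"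
    if "finite J" "J \<subseteq> carrier G" for J
    using that
  proof (induction J)
    case empty
    have "\<zero>\<^bsub>KG\<^esub> \<odot>\<^bsub>M\<^esub> u \<oplus>\<^bsub>M\<^esub> \<zero>\<^bsub>KG\<^esub> \<odot>\<^bsub>M\<^esub> u = \<zero>\<^bsub>KG\<^esub> \<odot>\<^bsub>M\<^esub> u"
      using M.smult_l_distr[OF M.R.zero_closed M.R.zero_closed u] by simp
    then have "\<zero>\<^bsub>KG\<^esub> \<odot>\<^bsub>M\<^esub> u = \<zero>\<^bsub>M\<^esub>"
      using M.M.add.l_cancel_one M.smult_closed[OF M.R.zero_closed u] by blast
    then show ?case by (simp add: KG_simps)
  next
    case (insert g J)
    have "(\<Sum>g\<in>J. sc (a g) (kdelta g)) \<in> carrier KG"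
      using insert dc by (auto simp: KG_carrier fun_sum_apply intro!: sum.neutral)
    then show ?case
      using insert dc u M.smult_l_distr[of "sc (a g) (kdelta g)" "\<Sum>g\<in>J. sc (a g) (kdelta g)" u]
      by (simp add: KG_simps M.M.finsum_insert Pi_def M.smult_closed subset_iff)
  qed
  have "a \<odot>\<^bsub>M\<^esub> u = (\<Oplus>\<^bsub>M\<^esub>g\<in>carrier G. sc (a g) (kdelta g) \<odot>\<^bsub>M\<^esub> u)"
    using s[OF fin subset_refl] unfolding ae .
  also have "\<dots> = (\<Oplus>\<^bsub>M\<^esub>g\<in>carrier G. sc (a g) (kdelta \<one>) \<odot>\<^bsub>M\<^esub> (kdelta g \<odot>\<^bsub>M\<^esub> u))"
  proof (intro M.M.finsum_cong' refl)
    fix g assume g: "g \<in> carrier G"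
    have 1: "sc (a g) (kdelta \<one>) \<in> carrier KG" by (rule sc_carrier[OF kdelta_carrier[OF one_closed]])
    show "sc (a g) (kdelta g) \<odot>\<^bsub>M\<^esub> u = sc (a g) (kdelta \<one>) \<odot>\<^bsub>M\<^esub> (kdelta g \<odot>\<^bsub>M\<^esub> u)"
      using M.smult_assoc1[OF 1 kdelta_carrier[OF g] u] by (simp add: sc_one_mult[OF kdelta_carrier[OF g]])
  qed (auto intro!: M.smult_closed sc_carrier kdelta_carrier u)
  finally show ?thesis .
qed

text \<open>The group action is transported along \<open>\<Phi>\<close>; compatibility with the
  whole algebra then follows from \<open>smult_expand\<close>.\<close>

lemma presentsI:
  fixes M :: "('a \<Rightarrow> 'k::field, 'u) module" and V :: "('i \<Rightarrow> 'k) set"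
  assumes M: "left_module KG M" and V: "fs.subspace V" and bij: "bij_betw \<Phi> V (carrier M)"
    and add: "\<And>x y. x \<in> V \<Longrightarrow> y \<in> V \<Longrightarrow> \<Phi> (x + y) = \<Phi> x \<oplus>\<^bsub>M\<^esub> \<Phi> y"
    and scale: "\<And>(c::'k) x. x \<in> V \<Longrightarrow> \<Phi> (sc c x) = sc c (kdelta \<one>) \<odot>\<^bsub>M\<^esub> \<Phi> x"
  shows "\<exists>\<rho>. presents G M V \<rho> \<Phi>"
proof -
  interpret M: left_module KG M by fact
  define i where "i = inv_into V \<Phi>"
  have \<Phi>c: "\<Phi> x \<in> carrier M" if "x \<in> V" for x using bij that by (auto simp: bij_betw_def)
  have iV: "i u \<in> V" if "u \<in> carrier M" for u
    using bij that unfolding i_def by (auto simp: bij_betw_def inv_into_into)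
  have \<Phi>i: "\<Phi> (i u) = u" if "u \<in> carrier M" for u
    unfolding i_def by (rule bij_betw_inv_into_right[OF bij that])
  have inj: "x = y" if "x \<in> V" "y \<in> V" "\<Phi> x = \<Phi> y" for x y
    using bij that by (auto simp: bij_betw_def inj_on_def)
  define \<rho> where "\<rho> = (\<lambda>g x. i (kdelta g \<odot>\<^bsub>M\<^esub> \<Phi> x))"
  have gc: "kdelta g \<odot>\<^bsub>M\<^esub> \<Phi> x \<in> carrier M" if "g \<in> carrier G" "x \<in> V" for g x
    by (rule M.smult_closed[OF kdelta_carrier[OF that(1)] \<Phi>c[OF that(2)]])
  have \<rho>V: "\<rho> g x \<in> V" if "g \<in> carrier G" "x \<in> V" for g x
    unfolding \<rho>_def by (rule iV[OF gc[OF that]])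
  have \<Phi>\<rho>: "\<Phi> (\<rho> g x) = kdelta g \<odot>\<^bsub>M\<^esub> \<Phi> x" if "g \<in> carrier G" "x \<in> V" for g x
    unfolding \<rho>_def by (rule \<Phi>i[OF gc[OF that]])
  \<comment> \<open>Scalars are central in the group algebra, which makes the transported action
    linear.\<close>
  have comm: "kdelta g \<otimes>\<^bsub>KG\<^esub> sc c (kdelta \<one>) = sc c (kdelta g)" if g: "g \<in> carrier G" for g and c :: 'k
  proof
    fix h
    have S: "(\<Sum>k\<in>carrier G. kdelta g k * sc c (kdelta \<one>) (inv k \<otimes> h)) = (\<Sum>k\<in>carrier G. if k = g then (if h = g then c else 0) else 0)"
      if h: "h \<in> carrier G"
    proof (intro sum.cong refl)
      fix k assume k: "k \<in> carrier G"
      have "inv k \<otimes> h = \<one> \<longleftrightarrow> h = k" using h k by (metis inv_equality inv_inv inv_closed l_inv)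
      then show "kdelta g k * sc c (kdelta \<one>) (inv k \<otimes> h) = (if k = g then (if h = g then c else 0) else 0)"
        by (auto simp: kdelta_def fun_pw)
    qed
    show "(kdelta g \<otimes>\<^bsub>KG\<^esub> sc c (kdelta \<one>)) h = sc c (kdelta g) h"
    proof (cases "h \<in> carrier G")
      case True
      show ?thesis
        unfolding KG_mult[OF kdelta_carrier[OF g]] S[OF True] using True g by (simp add: fun_pw kdelta_def)
    next
      case False
      then show ?thesis
        unfolding KG_mult[OF kdelta_carrier[OF g]] using g by (auto simp: fun_pw kdelta_def)
    qed
  qed
  have mult: "kdelta (g \<otimes> h) = kdelta g \<otimes>\<^bsub>KG\<^esub> (kdelta h :: 'a \<Rightarrow> 'k)" if g: "g \<in> carrier G" and h: "h \<in> carrier G" for g h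
  proof
    fix x
    have S: "(\<Sum>k\<in>carrier G. kdelta g k * kdelta h (inv k \<otimes> x)) = (\<Sum>k\<in>carrier G. if k = g then (if x = g \<otimes> h then 1 else 0) else (0::'k))"
      if x: "x \<in> carrier G"
    proof (intro sum.cong refl)
      fix k assume k: "k \<in> carrier G"
      have "inv g \<otimes> x = h \<longleftrightarrow> x = g \<otimes> h" using g h x by (metis inv_solve_left)
      then show "kdelta g k * kdelta h (inv k \<otimes> x) = (if k = g then (if x = g \<otimes> h then 1 else 0) else (0::'k))"
        by (auto simp: kdelta_def)
    qed
    show "kdelta (g \<otimes> h) x = (kdelta g \<otimes>\<^bsub>KG\<^esub> (kdelta h :: 'a \<Rightarrow> 'k)) x"
    proof (cases "x \<in> carrier G")
      case True
      show ?thesis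
        unfolding KG_mult[OF kdelta_carrier[OF g]] S[OF True] using True g by (simp add: kdelta_def)
    next
      case False
      then show ?thesis
        unfolding KG_mult[OF kdelta_carrier[OF g]] using g h by (auto simp: kdelta_def)
    qed
  qed
  have V': "rep G V \<rho>"
    unfolding rep_def
  proof (intro conjI ballI V lin_onI \<rho>V)
    fix g x y assume *: "g \<in> carrier G" "x \<in> V" "y \<in> V"
    show "\<rho> g (x + y) = \<rho> g x + \<rho> g y"
      by (rule inj)
        (use * V in \<open>simp_all add: \<rho>V fs.subspace_add \<Phi>\<rho> add M.smult_r_distr kdelta_carrier \<Phi>c\<close>)
  next
    fix g x and c :: 'k assume *: "g \<in> carrier G" "x \<in> V"
    have 1: "sc c (kdelta \<one>) \<in> carrier (KG :: ('a \<Rightarrow> 'k) ring)" by (rule sc_carrier[OF kdelta_carrier[OF one_closed]])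
    have "kdelta g \<odot>\<^bsub>M\<^esub> (sc c (kdelta \<one>) \<odot>\<^bsub>M\<^esub> \<Phi> x) = sc c (kdelta \<one>) \<odot>\<^bsub>M\<^esub> (kdelta g \<odot>\<^bsub>M\<^esub> \<Phi> x)"
      using M.smult_assoc1[OF kdelta_carrier[OF *(1)] 1 \<Phi>c[OF *(2)]]
        M.smult_assoc1[OF 1 kdelta_carrier[OF *(1)] \<Phi>c[OF *(2)]]
      by (simp add: comm[OF *(1)] sc_one_mult[OF kdelta_carrier[OF *(1)]])
    then show "\<rho> g (sc c x) = sc c (\<rho> g x)"
      by (intro inj) (use * V in \<open>simp_all add: \<rho>V fs.subspace_scale \<Phi>\<rho> scale\<close>)
  next
    fix x assume x: "x \<in> V"
    show "\<rho> \<one> x = x"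
      by (rule inj) (use x M.smult_one[OF \<Phi>c[OF x]] in \<open>simp_all add: \<rho>V \<Phi>\<rho> KG_simps\<close>)
  next
    fix g h x assume *: "g \<in> carrier G" "h \<in> carrier G" "x \<in> V"
    show "\<rho> (g \<otimes> h) x = \<rho> g (\<rho> h x)"
      by (rule inj)
        (use * in \<open>simp_all add: \<rho>V \<Phi>\<rho> mult M.smult_assoc1 kdelta_carrier \<Phi>c\<close>)
  qed
  have sum: "\<Phi> (\<Sum>g\<in>J. f g) = (\<Oplus>\<^bsub>M\<^esub>g\<in>J. \<Phi> (f g))" if "finite J" "\<And>g. g \<in> J \<Longrightarrow> f g \<in> V" for J :: "'a set" and f
    using that
  proof (induction J)
    case empty
    have "\<Phi> 0 \<oplus>\<^bsub>M\<^esub> \<Phi> 0 = \<Phi> 0" using add[OF fs.subspace_0[OF V] fs.subspace_0[OF V]] by simp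
    then show ?case using M.M.add.l_cancel_one \<Phi>c[OF fs.subspace_0[OF V]] by simp
  next
    case (insert g J)
    have "(\<Sum>g\<in>J. f g) \<in> V" using insert by (intro fs.subspace_sum[OF V]) auto
    then show ?case using insert by (simp add: M.M.finsum_insert add \<Phi>c Pi_def)
  qed
  have "\<Phi> (aact G \<rho> a x) = a \<odot>\<^bsub>M\<^esub> \<Phi> x" if a: "a \<in> carrier KG" and x: "x \<in> V" for a x
  proof -
    have "\<Phi> (aact G \<rho> a x) = (\<Oplus>\<^bsub>M\<^esub>g\<in>carrier G. \<Phi> (sc (a g) (\<rho> g x)))"
      unfolding aact_def using x by (intro sum fin fs.subspace_scale[OF V] \<rho>V)
    also have "\<dots> = (\<Oplus>\<^bsub>M\<^esub>g\<in>carrier G. sc (a g) (kdelta \<one>) \<odot>\<^bsub>M\<^esub> (kdelta g \<odot>\<^bsub>M\<^esub> \<Phi> x))"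
      using x by (intro M.M.finsum_cong' refl)
        (auto simp: scale \<rho>V \<Phi>\<rho> intro!: M.smult_closed sc_carrier kdelta_carrier \<Phi>c)
    also have "\<dots> = a \<odot>\<^bsub>M\<^esub> \<Phi> x" by (rule smult_expand[OF M a \<Phi>c[OF x], symmetric])
    finally show ?thesis .
  qed
  then have "presents G M V \<rho> \<Phi>" unfolding presents_def using M V' bij add by blast
  then show ?thesis by (rule exI[of _ \<rho>])
qed

end

lemma coord_span:
  assumes I: "finite I"
  shows "(coord I :: ('i \<Rightarrow> 'k::field) set) \<subseteq> fs.span (kdelta ` I)"
proof
  fix x :: "'i \<Rightarrow> 'k" assume x: "x \<in> coord I"
  have "x = (\<Sum>a\<in>I. sc (x a) (kdelta a))"
  proof
    fix b
    have "(\<Sum>a\<in>I. sc (x a) (kdelta a)) b = (\<Sum>a\<in>I. if b = a then x a else 0)"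
      unfolding fun_sum_apply by (intro sum.cong refl) (simp add: fun_pw kdelta_def)
    then show "x b = (\<Sum>a\<in>I. sc (x a) (kdelta a)) b" using I x by (auto simp: coord_def)
  qed
  moreover have "(\<Sum>a\<in>I. sc (x a) (kdelta a)) \<in> fs.span (kdelta ` I)"
    by (intro fs.span_sum fs.span_scale fs.span_base imageI)
  ultimately show "x \<in> fs.span (kdelta ` I)" by simp
qed

lemma coord_Times: "free G (coord I) = coord (carrier G \<times> I)"
  by (auto simp: free_def coord_def slice_def fun_eq_iff fun_pw)

lemma coord_Sigma: "dsum N (\<lambda>j. coord (I j)) = coord (SIGMA j:{..<N}. I j)"
  by (auto simp: dsum_def coord_def)

lemma enc_restrict: "K \<subseteq> V \<Longrightarrow> (enc G V \<rho> j i)\<lparr>carrier := j ` K\<rparr> = enc G K \<rho> j i"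
  by (simp add: enc_def)

section \<open>Free modules and factorisation of traces\<close>

text \<open>The transpose of \<open>slice\<close>: an element of \<open>free G (coord I)\<close> is
  read as a family of group algebra elements indexed by \<open>I\<close>, which shows the module to
  be free.\<close>

definition comp_at :: "'i \<Rightarrow> ('a \<times> 'i \<Rightarrow> 'k::field) \<Rightarrow> 'a \<Rightarrow> 'k" where
  "comp_at x F = (\<lambda>g. F (g, x))"

lemma comp_at_add: "comp_at x (F + F') = comp_at x F + comp_at x F'"
  by (simp add: comp_at_def fun_eq_iff fun_pw)

lemma comp_at_sc: "comp_at x (sc c F) = sc c (comp_at x F)"
  by (simp add: comp_at_def fun_eq_iff fun_pw)

context finite_group
begin

lemma comp_at_carrier: "F \<in> free G V \<Longrightarrow> comp_at x F \<in> carrier KG"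
  by (auto simp: free_def comp_at_def KG_carrier slice_def fun_eq_iff fun_pw)

lemma comp_at_aact:
  assumes a: "a \<in> carrier KG"
  shows "comp_at x (aact G (free_act G) a F) = a \<otimes>\<^bsub>KG\<^esub> comp_at x F"
proof
  fix g
  show "comp_at x (aact G (free_act G) a F) g = (a \<otimes>\<^bsub>KG\<^esub> comp_at x F) g"
    unfolding KG_mult[OF a] by (simp add: comp_at_def aact_def fun_sum_apply free_act_def fun_pw)
qed

lemma aact_single:
  assumes a: "a \<in> carrier KG"
  shows "aact G (free_act G) a (single \<one> v) (g, x) = a g * v x"
proof (cases "g \<in> carrier G")
  case True
  have "aact G (free_act G) a (single \<one> v) (g, x) = (\<Sum>h\<in>carrier G. if h = g then a g * v x else 0)"
    unfolding aact_def fun_sum_apply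
  proof (intro sum.cong refl)
    fix h assume h: "h \<in> carrier G"
    have "inv h \<otimes> g = \<one> \<longleftrightarrow> h = g"
      using h True by (metis inv_equality inv_inv inv_closed l_inv)
    then show "sc (a h) (free_act G h (single \<one> v)) (g, x) = (if h = g then a g * v x else 0)"
      using True by (simp add: fun_pw free_act_def single_def)
  qed
  then show ?thesis using True by simp
next
  case False
  then show ?thesis using a by (simp add: aact_def fun_sum_apply fun_pw free_act_def KG_carrier)
qed

lemma free_expand:
  fixes F :: "'a \<times> 'i \<Rightarrow> 'k::field"
  assumes I: "finite I" and F: "F \<in> free G (coord I)"
  shows "F = (\<Sum>x\<in>I. aact G (free_act G) (comp_at x F) (single \<one> (kdelta x)))"
proof
  fix z :: "'a \<times> 'i"
  obtain g y where z: "z = (g, y)" by (cases z)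
  have "(\<Sum>x\<in>I. aact G (free_act G) (comp_at x F) (single \<one> (kdelta x))) z = (\<Sum>x\<in>I. if y = x then F (g, x) else 0)"
    unfolding fun_sum_apply z
    by (intro sum.cong refl, subst aact_single[OF comp_at_carrier[OF F]]) (simp add: kdelta_def comp_at_def)
  moreover have "F (g, y) = 0" if "y \<notin> I" using F that unfolding coord_Times by (simp add: coord_def)
  ultimately show "F z = (\<Sum>x\<in>I. aact G (free_act G) (comp_at x F) (single \<one> (kdelta x))) z"
    using I z by auto
qed

text \<open>The vectors \<open>single \<one> (kdelta x)\<close> form a basis over the group algebra;
  preimages of their images are chosen and extended by \<open>comp_at\<close>.\<close>

lemma projective_free:
  fixes j :: "('a \<times> 'i \<Rightarrow> 'k::field) \<Rightarrow> 'u"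
  assumes R: "ring (KG :: ('a \<Rightarrow> 'k) ring)" and I: "finite I"
    and ij: "\<And>F. F \<in> free G (coord I) \<Longrightarrow> i (j F) = F"
  shows "projective KG (enc G (free G (coord I)) (free_act G) j i)"
proof -
  let ?P = "enc G (free G (coord I)) (free_act G) j i"
  let ?u = "\<lambda>x. single \<one> (kdelta x :: 'i \<Rightarrow> 'k)"
  have V: "rep G (free G (coord I)) (free_act G :: 'a \<Rightarrow> ('a \<times> 'i \<Rightarrow> 'k) \<Rightarrow> _)"
    by (rule rep_free[OF subspace_coord])
  note P = presents_enc[OF R V ij]
  have u: "?u x \<in> free G (coord I)" if "x \<in> I" for x
    using that by (intro lin_onD(1)[OF single_lin[OF subspace_coord one_closed]]) (simp add: coord_def kdelta_def)
  interpret P: left_module KG ?P by (rule presentsD(1)[OF P])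
  show ?thesis
    unfolding projective_def
  proof (intro conjI allI impI)
    show "left_module KG ?P" by (rule presentsD(1)[OF P])
    fix A B :: "('a \<Rightarrow> 'k, 'u) module" and e f
    assume a: "left_module KG A \<and> left_module KG B \<and> e \<in> module_hom KG A B \<and>
      e ` carrier A = carrier B \<and> f \<in> module_hom KG ?P B"
    then have e: "e \<in> module_hom KG A B" and f: "f \<in> module_hom KG ?P B" by auto
    interpret A: left_module KG A using a by simp
    interpret B: left_module KG B using a by simp
    have "\<exists>y. y \<in> carrier A \<and> e y = f (j (?u x))" if "x \<in> I" for x
    proof -
      have "f (j (?u x)) \<in> e ` carrier A" using a mhomD(1)[OF f presentsD(6)[OF P u[OF that]]] by simp
      then show ?thesis by auto
    qed
    then have "\<forall>x. \<exists>y. x \<in> I \<longrightarrow> y \<in> carrier A \<and> e y = f (j (?u x))" by blast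
    from choice[OF this] obtain y where y: "\<And>x. x \<in> I \<Longrightarrow> y x \<in> carrier A" "\<And>x. x \<in> I \<Longrightarrow> e (y x) = f (j (?u x))"
      by blast
    define h where "h = (\<lambda>z. \<Oplus>\<^bsub>A\<^esub>x\<in>I. comp_at x (i z) \<odot>\<^bsub>A\<^esub> y x)"
    have hj: "h (j F) = (\<Oplus>\<^bsub>A\<^esub>x\<in>I. comp_at x F \<odot>\<^bsub>A\<^esub> y x)" if "F \<in> free G (coord I)" for F
      by (simp add: h_def ij[OF that])
    have c: "comp_at x F \<odot>\<^bsub>A\<^esub> y x \<in> carrier A" if "F \<in> free G (coord I)" "x \<in> I" for F x
      by (rule A.smult_closed[OF comp_at_carrier[OF that(1)] y(1)[OF that(2)]])
    have cP: "\<exists>F\<in>free G (coord I). z = j F" if "z \<in> carrier ?P" for z using that by (auto simp: enc_def)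
    have "h \<in> module_hom KG ?P A"
    proof (rule mhomI)
      fix z assume "z \<in> carrier ?P"
      then obtain F where F: "F \<in> free G (coord I)" "z = j F" using cP by blast
      show "h z \<in> carrier A" unfolding F(2) hj[OF F(1)] using c[OF F(1)] by (intro A.M.finsum_closed) auto
      fix z' assume "z' \<in> carrier ?P"
      then obtain F' where F': "F' \<in> free G (coord I)" "z' = j F'" using cP by blast
      have s: "F + F' \<in> free G (coord I)" by (rule fs.subspace_add[OF repD(1)[OF V] F(1) F'(1)])
      have "h (j (F + F')) = (\<Oplus>\<^bsub>A\<^esub>x\<in>I. comp_at x F \<odot>\<^bsub>A\<^esub> y x \<oplus>\<^bsub>A\<^esub> comp_at x F' \<odot>\<^bsub>A\<^esub> y x)"
        unfolding hj[OF s] using c[OF F(1)] c[OF F'(1)]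
          A.smult_l_distr[OF comp_at_carrier[OF F(1)] comp_at_carrier[OF F'(1)] y(1)]
        by (intro A.M.finsum_cong' refl) (auto simp: comp_at_add KG_simps)
      also have "\<dots> = h (j F) \<oplus>\<^bsub>A\<^esub> h (j F')"
        unfolding hj[OF F(1)] hj[OF F'(1)] using c[OF F(1)] c[OF F'(1)] by (intro A.M.finsum_addf) auto
      finally show "h (z \<oplus>\<^bsub>?P\<^esub> z') = h z \<oplus>\<^bsub>A\<^esub> h z'"
        unfolding F(2) F'(2) by (simp add: presentsD(4)[OF P F(1) F'(1)])
    next
      fix b :: "'a \<Rightarrow> 'k" and z assume b: "b \<in> carrier KG" and "z \<in> carrier ?P"
      then obtain F where F: "F \<in> free G (coord I)" "z = j F" using cP by blast
      have s: "aact G (free_act G) b F \<in> free G (coord I)" by (rule aact_closed[OF V F(1)])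
      have "h (j (aact G (free_act G) b F)) = (\<Oplus>\<^bsub>A\<^esub>x\<in>I. b \<odot>\<^bsub>A\<^esub> (comp_at x F \<odot>\<^bsub>A\<^esub> y x))"
        unfolding hj[OF s] using c[OF F(1)] b A.smult_assoc1[OF b comp_at_carrier[OF F(1)] y(1)]
        by (intro A.M.finsum_cong' refl) (auto simp: comp_at_aact[OF b] intro!: A.smult_closed comp_at_carrier[OF F(1)] y(1))
      also have "\<dots> = b \<odot>\<^bsub>A\<^esub> h (j F)"
        unfolding hj[OF F(1)] by (rule A.smult_finsum[OF I b c[OF F(1)], symmetric])
      finally show "h (b \<odot>\<^bsub>?P\<^esub> z) = b \<odot>\<^bsub>A\<^esub> h z"
        unfolding F(2) by (simp add: presentsD(5)[OF P b F(1)])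
    qed
    moreover have "e (h z) = f z" if "z \<in> carrier ?P" for z
    proof -
      obtain F where F: "F \<in> free G (coord I)" "z = j F" using cP[OF \<open>z \<in> carrier ?P\<close>] by auto
      have k: "comp_at x F \<in> carrier KG" for x by (rule comp_at_carrier[OF F(1)])
      have "e (h z) = (\<Oplus>\<^bsub>B\<^esub>x\<in>I. e (comp_at x F \<odot>\<^bsub>A\<^esub> y x))"
        unfolding F(2) hj[OF F(1)] by (rule mhom_finsum[OF A.left_module_axioms B.left_module_axioms e I c[OF F(1)]])
      also have "\<dots> = (\<Oplus>\<^bsub>B\<^esub>x\<in>I. f (j (aact G (free_act G) (comp_at x F) (?u x))))"
      proof (intro B.M.finsum_cong' refl Pi_I)
        fix x assume x: "x \<in> I"
        show "f (j (aact G (free_act G) (comp_at x F) (?u x))) \<in> carrier B"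
          by (rule mhomD(1)[OF f presentsD(6)[OF P aact_closed[OF V u[OF x]]]])
        show "e (comp_at x F \<odot>\<^bsub>A\<^esub> y x) = f (j (aact G (free_act G) (comp_at x F) (?u x)))"
          using mhomD(3)[OF e k y(1)[OF x]] mhomD(3)[OF f k presentsD(6)[OF P u[OF x]]]
          by (simp add: y(2)[OF x] presentsD(5)[OF P k u[OF x]])
      qed
      also have "\<dots> = f (\<Oplus>\<^bsub>?P\<^esub>x\<in>I. j (aact G (free_act G) (comp_at x F) (?u x)))"
        by (rule mhom_finsum[OF P.left_module_axioms B.left_module_axioms f I, symmetric])
          (rule presentsD(6)[OF P aact_closed[OF V u]])
      also have "(\<Oplus>\<^bsub>?P\<^esub>x\<in>I. j (aact G (free_act G) (comp_at x F) (?u x))) =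
          j (\<Sum>x\<in>I. aact G (free_act G) (comp_at x F) (?u x))"
        by (rule presents_sum[OF P I aact_closed[OF V u], symmetric])
      also have "\<dots> = z" using free_expand[OF I F(1)] F(2) by simp
      finally show ?thesis .
    qed
    ultimately show "\<exists>h\<in>module_hom KG ?P A. \<forall>x\<in>carrier ?P. e (h x) = f x" by blast
  qed
qed

text \<open>One half of Higman's criterion: a trace is the composite of the map sending
  \<open>x\<close> to the family of all \<open>\<rho> (inv g) x\<close>, the application of
  \<open>\<phi>\<close> in every slice, and \<open>cover\<close>. All three are equivariant,
  although \<open>\<phi>\<close> is only linear.\<close>

lemma null_factor:
  assumes V: "rep G V \<rho>" and W: "rep G W \<sigma>" and n: "null G V \<rho> W \<sigma> f"
  obtains a b where "ghom G V \<rho> (free G V) (free_act G) a" "ghom G (free G V) (free_act G) W \<sigma> b"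
    "\<And>x. x \<in> V \<Longrightarrow> f x = b (a x)"
proof -
  obtain \<phi> where \<phi>: "lin_on V W \<phi>" "\<And>x. x \<in> V \<Longrightarrow> f x = tr G \<rho> \<sigma> \<phi> x" using n unfolding null_def by blast
  define a where "a x = (\<lambda>(g :: 'a, i). if g \<in> carrier G then \<rho> (inv g) x i else 0)" for x
  define m where "m F = (\<lambda>(g :: 'a, i). \<phi> (slice F g) i)" for F
  have sa: "slice (a x) g = (if g \<in> carrier G then \<rho> (inv g) x else 0)" for x g
    by (auto simp: slice_def a_def fun_eq_iff fun_pw)
  have sm: "slice (m F) g = \<phi> (slice F g)" for F g by (simp add: slice_def m_def)
  note r = repD(2,4,5)[OF V]
  have a1: "a x \<in> free G V" if "x \<in> V" for x using that r(3) by (auto simp: free_def sa)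
  have ga: "ghom G V \<rho> (free G V) (free_act G) a"
    unfolding ghom_def
  proof (intro conjI ballI lin_onI a1)
    fix x y assume "x \<in> V" "y \<in> V"
    then show "a (x + y) = a x + a y" by (intro slice_ext) (simp add: sa lin_onD(2)[OF r(1)])
  next
    fix c x assume "x \<in> V"
    then show "a (sc c x) = sc c (a x)" by (intro slice_ext) (simp add: sa lin_onD(3)[OF r(1)])
  next
    fix g x assume *: "g \<in> carrier G" "x \<in> V"
    show "a (\<rho> g x) = free_act G g (a x)"
    proof (rule slice_ext)
      fix h
      have "\<rho> (inv h) (\<rho> g x) = \<rho> (inv (inv g \<otimes> h)) x" if "h \<in> carrier G"
        using * that r(2)[of "inv h" g x] by (simp add: inv_mult_group)
      then show "slice (a (\<rho> g x)) h = slice (free_act G g (a x)) h"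
        using *(1) by (simp add: sa slice_free_act)
    qed
  qed
  have m0: "\<phi> 0 = 0" by (rule lin_on_0[OF \<phi>(1) repD(1)[OF V]])
  have m1: "m F \<in> free G W" if "F \<in> free G V" for F
    using that lin_onD(1)[OF \<phi>(1)] by (auto simp: free_def sm m0)
  have fV: "slice F g \<in> V" if "F \<in> free G V" for F g
    using that fs.subspace_0[OF repD(1)[OF V]] by (cases "g \<in> carrier G") (auto simp: free_def)
  have gm: "ghom G (free G V) (free_act G) (free G W) (free_act G) m"
    unfolding ghom_def
  proof (intro conjI ballI lin_onI m1)
    fix F F' assume "F \<in> free G V" "F' \<in> free G V"
    then show "m (F + F') = m F + m F'" by (intro slice_ext) (simp add: sm lin_onD(2)[OF \<phi>(1)] fV)
  next
    fix c F assume "F \<in> free G V"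
    then show "m (sc c F) = sc c (m F)" by (intro slice_ext) (simp add: sm lin_onD(3)[OF \<phi>(1)] fV)
  next
    fix g F assume "g \<in> carrier G" "F \<in> free G V"
    then show "m (free_act G g F) = free_act G g (m F)" by (intro slice_ext) (simp add: sm slice_free_act m0)
  qed
  have "f x = cover G \<sigma> (m (a x))" if "x \<in> V" for x
    unfolding \<phi>(2)[OF that] tr_def cover_def by (intro sum.cong refl) (simp add: sm sa)
  then show thesis using that[OF ga ghom_comp[OF gm ghom_cover[OF W]]] by blast
qed

end

context finite_group
begin

text \<open>The free module through which the null map factors has finitely many coordinates and can
  thus be encoded in \<open>'u\<close>, as \<open>stably_zero\<close> demands.\<close>

lemma stably_zero_of_null:
  fixes \<Phi> :: "('i \<Rightarrow> 'k::field) \<Rightarrow> 'u" and \<iota> :: "'k \<Rightarrow> 'u"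
  assumes inf: "infinite (UNIV :: 'u set)" and \<iota>: "inj \<iota>" and I: "finite I"
    and M: "presents G M (coord I) \<rho> \<Phi>" and N: "presents G N W \<sigma> \<Psi>" and n: "null G (coord I) \<rho> W \<sigma> f"
  shows "stably_zero KG M N (hom_via (coord I) \<Phi> \<Psi> f)"
proof -
  let ?V = "coord I :: ('i \<Rightarrow> 'k) set"
  let ?F = "free G ?V"
  obtain a b where ab: "ghom G ?V \<rho> ?F (free_act G) a" "ghom G ?F (free_act G) W \<sigma> b"
      and f: "\<And>x. x \<in> ?V \<Longrightarrow> f x = b (a x)"
    using null_factor[OF presentsD(2)[OF M] presentsD(2)[OF N] n] by blast
  obtain j :: "('a \<times> 'i \<Rightarrow> 'k) \<Rightarrow> 'u" where j: "inj_on j ?F"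
    using coord_inj_exists[OF inf \<iota>, of "carrier G \<times> I"] I unfolding coord_Times by auto
  have ij: "inv_into ?F j (j x) = x" if "x \<in> ?F" for x using j that by simp
  have R: "ring (KG :: ('a \<Rightarrow> 'k) ring)" by (rule left_module.axioms(1)[OF presentsD(1)[OF M]])
  let ?P = "enc G ?F (free_act G) j (inv_into ?F j)"
  have P: "presents G ?P ?F (free_act G) j"
    by (rule presents_enc[OF R rep_free[OF subspace_coord] ij])
  have 1: "hom_via ?V \<Phi> j a \<in> module_hom KG M ?P" by (rule hom_via_mhom[OF M P ab(1)])
  have 2: "hom_via ?F j \<Psi> b \<in> module_hom KG ?P N" by (rule hom_via_mhom[OF P N ab(2)])
  have e: "hom_via ?V \<Phi> \<Psi> f u = hom_via ?F j \<Psi> b (hom_via ?V \<Phi> j a u)" if "u \<in> carrier M" for u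
    using presentsD(7)[OF M that] by (simp add: hom_via_def f presentsD(9)[OF P ghomD(2)[OF ab(1)]])
  show ?thesis
    by (rule stably_zeroI[OF mhom_cong[OF mhom_comp[OF 1 2] presentsD(1)[OF M] e]
      projective_free[OF R I ij] 1 2 e])
qed

lemma stably_isomorphic_of_steq:
  fixes \<Phi> :: "('i \<Rightarrow> 'k::field) \<Rightarrow> 'u" and \<Psi> :: "('j \<Rightarrow> 'k) \<Rightarrow> 'u" and \<iota> :: "'k \<Rightarrow> 'u"
  assumes inf: "infinite (UNIV :: 'u set)" and \<iota>: "inj \<iota>" and I: "finite I" and J: "finite J"
    and M: "presents G M (coord I) \<rho> \<Phi>" and N: "presents G N (coord J) \<sigma> \<Psi>"
    and st: "steq G (coord I) \<rho> (coord J) \<sigma>"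
  shows "stably_isomorphic KG M N"
proof -
  have half: "stably_zero KG M M (\<lambda>u. hom_via W \<Psi> \<Phi> b (hom_via (coord I) \<Phi> \<Psi> a u) \<ominus>\<^bsub>M\<^esub> u)"
    if I: "finite I" and M: "presents G M (coord I) \<rho> \<Phi>" and N: "presents G N W \<sigma> \<Psi>"
      and a: "ghom G (coord I) \<rho> W \<sigma> a" and b: "ghom G W \<sigma> (coord I) \<rho> b"
      and n: "null G (coord I) \<rho> (coord I) \<rho> (\<lambda>x. b (a x) - x)"
    for I and \<Phi> :: "('l \<Rightarrow> 'k) \<Rightarrow> 'u" and \<Psi> :: "('m \<Rightarrow> 'k) \<Rightarrow> 'u" and M N \<rho> \<sigma> W a b
  proof (rule stably_zero_cong[OF stably_zero_of_null[OF inf \<iota> I M M n] presentsD(1)[OF M]])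
    fix u assume u: "u \<in> carrier M"
    note iu = presentsD(7)[OF M u]
    show "hom_via W \<Psi> \<Phi> b (hom_via (coord I) \<Phi> \<Psi> a u) \<ominus>\<^bsub>M\<^esub> u = hom_via (coord I) \<Phi> \<Phi> (\<lambda>x. b (a x) - x) u"
      using presents_diff[OF M ghomD(2)[OF b ghomD(2)[OF a iu]] iu] presentsD(8)[OF M u]
      by (simp add: hom_via_def presentsD(9)[OF N ghomD(2)[OF a iu]])
  qed
  obtain a b where ab: "ghom G (coord I) \<rho> (coord J) \<sigma> a" "ghom G (coord J) \<sigma> (coord I) \<rho> b"
    "null G (coord I) \<rho> (coord I) \<rho> (\<lambda>x. b (a x) - x)" "null G (coord J) \<sigma> (coord J) \<sigma> (\<lambda>x. a (b x) - x)"
    using st unfolding steq_def by blast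
  show ?thesis
    by (rule stably_isomorphicI[OF presentsD(1)[OF M] presentsD(1)[OF N]
      hom_via_mhom[OF M N ab(1)] hom_via_mhom[OF N M ab(2)] half[OF I M N ab(1-3)] half[OF J N M ab(2,1,4)]])
qed

lemma presents_transport:
  assumes M: "presents G M V \<rho> \<Phi>" and W: "fs.subspace W" and E: "lin_on W V E" "bij_betw E W V"
  shows "\<exists>\<rho>'. presents G M W \<rho>' (\<lambda>x. \<Phi> (E x))"
proof (rule presentsI[OF presentsD(1)[OF M] W])
  show "bij_betw (\<lambda>x. \<Phi> (E x)) W (carrier M)"
    using bij_betw_trans[OF E(2) presentsD(3)[OF M]] by (simp add: comp_def)
qed (simp_all add: lin_onD[OF E(1)] presentsD(4)[OF M] presents_scale[OF M])

lemma presents_coord: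
  fixes V :: "('i \<Rightarrow> 'k::field) set"
  assumes M: "presents G M V \<rho> \<Phi>" and S: "finite S" "V \<subseteq> fs.span S"
  obtains I :: "nat set" and \<rho>' \<Phi>' where "finite I" "presents G M (coord I) \<rho>' \<Phi>'" "steq G (coord I) \<rho>' V \<rho>"
proof -
  obtain I :: "nat set" and E where I: "finite I" "lin_on (coord I) V E" "bij_betw E (coord I) V"
    using finite_dim_coord[OF repD(1)[OF presentsD(2)[OF M]] S] by blast
  obtain \<rho>' where P: "presents G M (coord I) \<rho>' (\<lambda>x. \<Phi> (E x))"
    using presents_transport[OF M subspace_coord I(2,3)] by blast
  show thesis by (rule that[OF I(1) P presents_unique[OF P M]])
qed

text \<open>The generators define a map from the free module on \<open>A\<close>, whose image is a
  submodule containing \<open>A\<close> and so is everything. Discarding coordinates by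
  \<open>coord_reduction\<close> makes it bijective without passing to a quotient.\<close>

lemma finitely_generated_presents:
  fixes M :: "('a \<Rightarrow> 'k::field, 'u) module"
  assumes M: "finitely_generated KG M"
  shows "\<exists>(I :: ('a \<times> 'u) set) \<rho> \<Phi>. finite I \<and> presents G M (coord I) \<rho> \<Phi>"
proof -
  interpret M: left_module KG M using M by (simp add: finitely_generated_def)
  obtain A where A: "finite A" "A \<subseteq> carrier M" "\<And>H. submodule H KG M \<Longrightarrow> A \<subseteq> H \<Longrightarrow> H = carrier M"
    using M unfolding finitely_generated_def by blast
  have xc: "x \<in> carrier M" if "x \<in> A" for x using A(2) that by blast
  define S where "S = carrier G \<times> A"
  have S: "finite S" using A(1) by (simp add: S_def)
  have F: "coord S = (free G (coord A) :: ('a \<times> 'u \<Rightarrow> 'k) set)" by (simp add: S_def coord_Times)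
  have r: "rep G (coord S) (free_act G :: 'a \<Rightarrow> ('a \<times> 'u \<Rightarrow> 'k) \<Rightarrow> _)"
    unfolding F by (rule rep_free[OF subspace_coord])
  define \<Phi> where "\<Phi> F = (\<Oplus>\<^bsub>M\<^esub>x\<in>A. comp_at x F \<odot>\<^bsub>M\<^esub> x)" for F :: "'a \<times> 'u \<Rightarrow> 'k"
  have k: "comp_at x F \<in> carrier KG" if "F \<in> coord S" for x and F :: "'a \<times> 'u \<Rightarrow> 'k"
    by (rule comp_at_carrier) (use that F in blast)
  have c: "comp_at x F \<odot>\<^bsub>M\<^esub> x \<in> carrier M" if "F \<in> coord S" "x \<in> A" for x F
    by (rule M.smult_closed[OF k[OF that(1)] xc[OF that(2)]])
  have \<Phi>c: "\<Phi> F \<in> carrier M" if "F \<in> coord S" for F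
    unfolding \<Phi>_def using c[OF that] by (intro M.M.finsum_closed) auto
  have add: "\<Phi> (F + F') = \<Phi> F \<oplus>\<^bsub>M\<^esub> \<Phi> F'" if F: "F \<in> coord S" and F': "F' \<in> coord S" for F F'
  proof -
    have "\<Phi> (F + F') = (\<Oplus>\<^bsub>M\<^esub>x\<in>A. comp_at x F \<odot>\<^bsub>M\<^esub> x \<oplus>\<^bsub>M\<^esub> comp_at x F' \<odot>\<^bsub>M\<^esub> x)"
      unfolding \<Phi>_def using c[OF F] c[OF F'] M.smult_l_distr[OF k[OF F] k[OF F'] xc]
      by (intro M.M.finsum_cong' refl) (auto simp: comp_at_add KG_simps)
    also have "\<dots> = \<Phi> F \<oplus>\<^bsub>M\<^esub> \<Phi> F'"
      unfolding \<Phi>_def using c[OF F] c[OF F'] by (intro M.M.finsum_addf) auto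
    finally show ?thesis .
  qed
  have act: "(\<Oplus>\<^bsub>M\<^esub>x\<in>A. (a \<otimes>\<^bsub>KG\<^esub> comp_at x F) \<odot>\<^bsub>M\<^esub> x) = a \<odot>\<^bsub>M\<^esub> \<Phi> F"
    if a: "a \<in> carrier KG" and F: "F \<in> coord S" for a F
  proof -
    have "(\<Oplus>\<^bsub>M\<^esub>x\<in>A. (a \<otimes>\<^bsub>KG\<^esub> comp_at x F) \<odot>\<^bsub>M\<^esub> x) = (\<Oplus>\<^bsub>M\<^esub>x\<in>A. a \<odot>\<^bsub>M\<^esub> (comp_at x F \<odot>\<^bsub>M\<^esub> x))"
      using c[OF F] M.smult_assoc1[OF a k[OF F] xc]
      by (intro M.M.finsum_cong' refl) (auto intro!: M.smult_closed[OF a])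
    also have "\<dots> = a \<odot>\<^bsub>M\<^esub> \<Phi> F" unfolding \<Phi>_def by (rule M.smult_finsum[OF A(1) a c[OF F], symmetric])
    finally show ?thesis .
  qed
  have smult: "\<Phi> (aact G (free_act G) a F) = a \<odot>\<^bsub>M\<^esub> \<Phi> F" if "a \<in> carrier KG" "F \<in> coord S" for a F
    using act[OF that] by (simp add: \<Phi>_def comp_at_aact[OF that(1)])
  have scale: "\<Phi> (sc c F) = sc c (kdelta \<one>) \<odot>\<^bsub>M\<^esub> \<Phi> F" if F: "F \<in> coord S" for c F
    using act[OF sc_carrier[OF kdelta_carrier[OF one_closed]] F, of c]
    by (simp add: \<Phi>_def comp_at_sc sc_one_mult[OF k[OF F]])
  note sS = subspace_coord[of S]
  have zero: "\<Phi> 0 = \<zero>\<^bsub>M\<^esub>"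
    using add[OF fs.subspace_0[OF sS] fs.subspace_0[OF sS]]
      M.M.add.l_cancel_one[OF \<Phi>c[OF fs.subspace_0[OF sS]] \<Phi>c[OF fs.subspace_0[OF sS]]] by simp
  have "submodule (\<Phi> ` coord S) KG M"
  proof (intro submodule.intro submodule_axioms.intro subgroup.intro)
    show "\<Phi> ` coord S \<subseteq> carrier (add_monoid M)" using \<Phi>c by auto
    show "\<one>\<^bsub>add_monoid M\<^esub> \<in> \<Phi> ` coord S" using zero fs.subspace_0[OF sS] by force
    fix u assume "u \<in> \<Phi> ` coord S"
    then obtain F where F: "F \<in> coord S" "u = \<Phi> F" by blast
    have m: "- F \<in> coord S" by (rule fs.subspace_neg[OF sS F(1)])
    have "\<Phi> (- F) \<oplus>\<^bsub>M\<^esub> \<Phi> F = \<zero>\<^bsub>M\<^esub>" using add[OF m F(1)] zero by simp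
    then have "\<Phi> (- F) = \<ominus>\<^bsub>M\<^esub> \<Phi> F" using M.M.minus_equality \<Phi>c[OF m] \<Phi>c[OF F(1)] by simp
    then show "inv\<^bsub>add_monoid M\<^esub> u \<in> \<Phi> ` coord S"
      using m F(2) by (metis a_inv_def image_eqI)
    fix v assume "v \<in> \<Phi> ` coord S"
    then obtain F' where F': "F' \<in> coord S" "v = \<Phi> F'" by blast
    show "u \<otimes>\<^bsub>add_monoid M\<^esub> v \<in> \<Phi> ` coord S"
      using add[OF F(1) F'(1)] fs.subspace_add[OF sS F(1) F'(1)] F(2) F'(2) by (metis image_eqI monoid.simps(1))
  next
    fix a :: "'a \<Rightarrow> 'k" and u assume a: "a \<in> carrier KG" and "u \<in> \<Phi> ` coord S"
    then obtain F where F: "F \<in> coord S" "u = \<Phi> F" by blast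
    show "a \<odot>\<^bsub>M\<^esub> u \<in> \<Phi> ` coord S"
      using smult[OF a F(1)] aact_closed[OF r F(1), of a] F(2) by (metis image_eqI)
  qed
  moreover have "A \<subseteq> \<Phi> ` coord S"
  proof
    fix y assume y: "y \<in> A"
    let ?F = "single \<one> (kdelta y) :: 'a \<times> 'u \<Rightarrow> 'k"
    have F: "?F \<in> coord S" using y by (auto simp: S_def coord_def single_def kdelta_def)
    have e: "comp_at x ?F = (if x = y then kdelta \<one> else 0)" for x
      by (auto simp: comp_at_def single_def kdelta_def fun_eq_iff fun_pw)
    have z: "\<zero>\<^bsub>KG\<^esub> \<odot>\<^bsub>M\<^esub> x = \<zero>\<^bsub>M\<^esub>" if "x \<in> carrier M" for x
      using M.smult_l_distr[OF M.R.zero_closed M.R.zero_closed that] M.M.add.l_cancel_one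
        M.smult_closed[OF M.R.zero_closed that] by simp
    have "\<Phi> ?F = (\<Oplus>\<^bsub>M\<^esub>x\<in>A. if y = x then x else \<zero>\<^bsub>M\<^esub>)"
      unfolding \<Phi>_def
      using c[OF F] xc z M.smult_one by (intro M.M.finsum_cong' refl) (auto simp: e KG_simps)
    also have "\<dots> = y" using M.M.finsum_singleton[OF y A(1), of "\<lambda>x. x"] xc by auto
    finally show "y \<in> \<Phi> ` coord S" using F by force
  qed
  ultimately have surj: "\<Phi> ` coord S = carrier M" by (rule A(3))
  obtain I where I: "I \<subseteq> S" "bij_betw \<Phi> (coord I) (\<Phi> ` coord S)"
  proof (rule coord_reduction[OF S])
    fix x y z :: "'a \<times> 'u \<Rightarrow> 'k" and c assume *: "x \<in> coord S" "y \<in> coord S" "z \<in> coord S" "\<Phi> x = \<Phi> y"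
    have d: "x - y \<in> coord S" by (rule fs.subspace_diff[OF sS *(1,2)])
    have "\<Phi> x = \<Phi> (x - y) \<oplus>\<^bsub>M\<^esub> \<Phi> y" using add[OF d *(2)] by simp
    then have 0: "\<Phi> (x - y) = \<zero>\<^bsub>M\<^esub>" using *(4) M.M.add.r_cancel_one[OF \<Phi>c[OF *(2)] \<Phi>c[OF d]] by simp
    show "\<Phi> (z + sc c (x - y)) = \<Phi> z"
      using add[OF *(3) fs.subspace_scale[OF sS d], of c] scale[OF d, of c] 0 \<Phi>c[OF *(3)]
        M.smult_zero[OF sc_carrier[OF kdelta_carrier[OF one_closed]], of c] by simp
  qed auto
  have sub: "x \<in> coord S" if "x \<in> coord I" for x :: "'a \<times> 'u \<Rightarrow> 'k" using that I(1) by (auto simp: coord_def)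
  have "\<exists>\<rho>. presents G M (coord I) \<rho> \<Phi>"
  proof (rule presentsI[OF M.left_module_axioms subspace_coord])
    show "bij_betw \<Phi> (coord I) (carrier M)" using I(2) surj by simp
  qed (simp_all add: add scale sub)
  then show ?thesis using finite_subset[OF I(1) S] by blast
qed

lemma direct_sum_enc:
  fixes X :: "nat \<Rightarrow> ('a \<Rightarrow> 'k::field, 'u) module"
  assumes R: "ring (KG :: ('a \<Rightarrow> 'k) ring)"
    and X: "\<And>n. n < N \<Longrightarrow> presents G (X n) (V n) (\<tau> n) (\<Phi> n)"
    and ij: "\<And>F. F \<in> dsum N V \<Longrightarrow> i (j F) = F"
  shows "direct_sum KG {..<N} X (enc G (dsum N V) (dact N \<tau>) j i)"
proof -
  let ?D = "enc G (dsum N V) (dact N \<tau>) j i"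
  note rX = presentsD(2)[OF X]
  note sX = repD(1)[OF rX]
  have D: "presents G ?D (dsum N V) (dact N \<tau>) j"
    by (rule presents_enc[OF R rep_dsum[OF rX is_group] ij])
  interpret D: left_module KG ?D by (rule presentsD(1)[OF D])
  define \<kappa> where "\<kappa> n = hom_via (V n) (\<Phi> n) j (inc n)" for n
  have \<kappa>: "\<kappa> n \<in> module_hom KG (X n) ?D" if "n < N" for n
    unfolding \<kappa>_def by (rule hom_via_mhom[OF X[OF that] D ghom_inc[OF rX that]])
  have ic: "inc n (inv_into (V n) (\<Phi> n) (x n)) \<in> dsum N V" if "x \<in> (\<Pi>\<^sub>E n\<in>{..<N}. carrier (X n))" "n < N" for x n
    using that by (intro inc_dsum[OF sX]) (auto intro!: presentsD(7)[OF X])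
  have sum: "(\<Oplus>\<^bsub>?D\<^esub>n\<in>{..<N}. \<kappa> n (x n)) = j (\<Sum>n<N. inc n (inv_into (V n) (\<Phi> n) (x n)))"
    if x: "x \<in> (\<Pi>\<^sub>E n\<in>{..<N}. carrier (X n))" for x
    using presents_sum[OF D finite_lessThan, of N "\<lambda>n. inc n (inv_into (V n) (\<Phi> n) (x n))"] ic[OF x]
    by (simp add: \<kappa>_def hom_via_def)
  have sumV: "(\<Sum>n<N. inc n (inv_into (V n) (\<Phi> n) (x n))) \<in> dsum N V"
    if x: "x \<in> (\<Pi>\<^sub>E n\<in>{..<N}. carrier (X n))" for x
    by (rule fs.subspace_sum[OF subspace_dsum[OF sX]]) (use ic[OF x] in auto)
  have comps: "(\<lambda>n\<in>{..<N}. \<Phi> n (pr n F)) \<in> (\<Pi>\<^sub>E n\<in>{..<N}. carrier (X n))" if "F \<in> dsum N V" for F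
    unfolding restrict_PiE_iff by (auto intro!: presentsD(6)[OF X] dsum_pr[OF that])
  have "bij_betw (\<lambda>x. \<Oplus>\<^bsub>?D\<^esub>n\<in>{..<N}. \<kappa> n (x n)) (\<Pi>\<^sub>E n\<in>{..<N}. carrier (X n)) (carrier ?D)"
  proof (rule bij_betwI[where g="\<lambda>u. \<lambda>n\<in>{..<N}. \<Phi> n (pr n (i u))"])
    show "(\<lambda>x. \<Oplus>\<^bsub>?D\<^esub>n\<in>{..<N}. \<kappa> n (x n)) \<in> (\<Pi>\<^sub>E n\<in>{..<N}. carrier (X n)) \<rightarrow> carrier ?D"
      using presentsD(6)[OF D sumV] sum by auto
    show "(\<lambda>u. \<lambda>n\<in>{..<N}. \<Phi> n (pr n (i u))) \<in> carrier ?D \<rightarrow> (\<Pi>\<^sub>E n\<in>{..<N}. carrier (X n))"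
    proof
      fix u assume "u \<in> carrier ?D"
      then obtain F where F: "F \<in> dsum N V" "u = j F" by (auto simp: enc_def)
      show "(\<lambda>n\<in>{..<N}. \<Phi> n (pr n (i u))) \<in> (\<Pi>\<^sub>E n\<in>{..<N}. carrier (X n))"
        unfolding F(2) ij[OF F(1)] by (rule comps[OF F(1)])
    qed
    show "(\<lambda>n\<in>{..<N}. \<Phi> n (pr n (i (\<Oplus>\<^bsub>?D\<^esub>n\<in>{..<N}. \<kappa> n (x n))))) = x"
      if x: "x \<in> (\<Pi>\<^sub>E n\<in>{..<N}. carrier (X n))" for x
    proof
      fix n
      show "(\<lambda>n\<in>{..<N}. \<Phi> n (pr n (i (\<Oplus>\<^bsub>?D\<^esub>n\<in>{..<N}. \<kappa> n (x n))))) n = x n"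
      proof (cases "n < N")
        case True
        then have "x n \<in> carrier (X n)" using x by auto
        then show ?thesis
          using True unfolding sum[OF x] ij[OF sumV[OF x]]
          by (simp add: pr_sum pr_inc presentsD(8)[OF X])
      next
        case False
        then show ?thesis using x by (auto simp: PiE_def extensional_def)
      qed
    qed
    show "(\<Oplus>\<^bsub>?D\<^esub>n\<in>{..<N}. \<kappa> n ((\<lambda>n\<in>{..<N}. \<Phi> n (pr n (i u))) n)) = u" if u: "u \<in> carrier ?D" for u
    proof -
      obtain F where F: "F \<in> dsum N V" "u = j F" using u by (auto simp: enc_def)
      note x = comps[OF F(1)]
      have "(\<Sum>n<N. inc n (inv_into (V n) (\<Phi> n) ((\<lambda>n\<in>{..<N}. \<Phi> n (pr n F)) n))) = F"
        using presentsD(9)[OF X dsum_pr[OF F(1)]] dsum_expand[OF sX F(1)] by simp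
      then show ?thesis using sum[OF x] by (simp add: F(2) ij[OF F(1)])
    qed
  qed
  then show ?thesis
    unfolding direct_sum_def using \<kappa> presentsD(1)[OF D] presentsD(1)[OF X]
    by (intro conjI exI[of _ \<kappa>]) auto
qed

end

section \<open>Suspensions of the simple modules\<close>

context char_p
begin

abbreviation KS :: "(int^2^2 \<Rightarrow> 'k) ring" where "KS \<equiv> group_algebra SL"

text \<open>Finite dimension together with the stable type over the Borel subgroup: the restriction
  of \<open>M\<close> is stably \<open>pol l\<close> of weight \<open>w\<close>. This is the only
  datum followed through iterated syzygies.\<close>

definition modelled :: "(int^2^2 \<Rightarrow> 'k, 'u) module \<Rightarrow> nat \<Rightarrow> nat \<Rightarrow> bool" where
  "modelled M l w \<longleftrightarrow> (\<exists>(I :: nat set) \<rho> \<Phi>. finite I \<and> presents SL M (coord I) \<rho> \<Phi> \<and>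
     steq BB (coord I) \<rho> (pol l) (pact w))"

lemma modelledI:
  fixes V :: "('i \<Rightarrow> 'k) set"
  assumes M: "presents SL M V \<rho> \<Phi>" and S: "finite S" "V \<subseteq> fs.span S" and st: "steq BB V \<rho> (pol l) (pact w)"
  shows "modelled M l w"
proof -
  obtain I :: "nat set" and \<rho>' \<Phi>' where I: "finite I" "presents SL M (coord I) \<rho>' \<Phi>'" "steq SL (coord I) \<rho>' V \<rho>"
    using SL.presents_coord[OF M S] by blast
  note r = SL.presentsD(2)[OF M] SL.presentsD(2)[OF I(2)]
  have "steq BB (coord I) \<rho>' (pol l) (pact w)"
    by (rule B.GH.steq_trans[OF B.rep_restrict[OF r(2)] B.rep_restrict[OF r(1)] rep_pol
      B.steq_restrict[OF r(2,1) I(3)] st])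
  then show ?thesis using I unfolding modelled_def by blast
qed

lemma modelled_cong:
  assumes M: "modelled M l w" and w: "[w = w'] (mod (p - 1))"
  shows "modelled M l w'"
proof -
  obtain I :: "nat set" and \<rho> \<Phi> where I: "finite I" "presents SL M (coord I) \<rho> \<Phi>" "steq BB (coord I) \<rho> (pol l) (pact w)"
    using M unfolding modelled_def by blast
  have "steq BB (pol l) (pact w) (pol l) (pact w')"
  proof (rule B.GH.steq_iso[OF rep_pol rep_pol])
    show "ghom BB (pol l) (pact w) (pol l) (pact w') (\<lambda>f. f)"
      using pact_weight_cong[OF w] by (simp add: ghom_def lin_on_id)
    show "bij_betw (\<lambda>f. f) (pol l) (pol l)" by (simp add: bij_betw_def inj_on_def)
  qed
  then have "steq BB (coord I) \<rho> (pol l) (pact w')"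
    by (rule B.GH.steq_trans[OF B.rep_restrict[OF SL.presentsD(2)[OF I(2)]] rep_pol rep_pol I(3)])
  then show ?thesis using I unfolding modelled_def by blast
qed

text \<open>The free cover is encoded in the universe with all its elements, so its kernel is
  obtained by shrinking the carrier, exactly as in the definition of \<open>syzygy\<close>.\<close>

lemma modelled_syzygy:
  fixes M :: "(int^2^2 \<Rightarrow> 'k, 'u) module" and \<iota> :: "'k \<Rightarrow> 'u"
  assumes inf: "infinite (UNIV :: 'u set)" and \<iota>: "inj \<iota>" and M: "modelled M l w" and l: "1 \<le> l" "l < p"
  shows "\<exists>L. syzygy KS M L \<and> modelled L (p - l) (w + 2 * (l - 1))"
proof -
  obtain I :: "nat set" and \<rho> \<Phi> where I: "finite I" and P: "presents SL M (coord I) \<rho> \<Phi>"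
      and st: "steq BB (coord I) \<rho> (pol l) (pact w)"
    using M unfolding modelled_def by blast
  let ?V = "coord I :: (nat \<Rightarrow> 'k) set"
  let ?F = "free SL ?V"
  let ?K = "{F \<in> ?F. cover SL \<rho> F = 0}"
  note V = SL.presentsD(2)[OF P]
  have R: "ring KS" by (rule left_module.axioms(1)[OF SL.presentsD(1)[OF P]])
  have fI: "finite (carrier SL \<times> I)" using I by simp
  obtain j :: "((int^2^2) \<times> nat \<Rightarrow> 'k) \<Rightarrow> 'u" where j: "inj_on j ?F"
    using coord_inj_exists[OF inf \<iota> fI] unfolding coord_Times by blast
  let ?i = "inv_into ?F j"
  have ij: "?i (j x) = x" if "x \<in> ?F" for x using j that by simp
  have rF: "rep SL ?F (free_act SL)" by (rule SL.rep_free[OF subspace_coord])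
  let ?P = "enc SL ?F (free_act SL) j ?i"
  have PF: "presents SL ?P ?F (free_act SL) j" by (rule SL.presents_enc[OF R rF ij])
  have gc: "ghom SL ?F (free_act SL) ?V \<rho> (cover SL \<rho>)" by (rule SL.ghom_cover[OF V])
  let ?f = "hom_via ?F j \<Phi> (cover SL \<rho>)"
  have f: "?f \<in> module_hom KS ?P M" by (rule SL.hom_via_mhom[OF PF P gc])
  have fj: "?f (j F) = \<Phi> (cover SL \<rho> F)" if "F \<in> ?F" for F by (simp add: hom_via_def ij[OF that])
  have "carrier M \<subseteq> ?f ` carrier ?P"
  proof
    fix u assume u: "u \<in> carrier M"
    note x = SL.presentsD(7)[OF P u]
    have s: "single \<one>\<^bsub>SL\<^esub> (inv_into ?V \<Phi> u) \<in> ?F" by (rule lin_onD(1)[OF SL.single_lin[OF subspace_coord SL.one_closed] x])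
    have "?f (j (single \<one>\<^bsub>SL\<^esub> (inv_into ?V \<Phi> u))) = u"
      unfolding fj[OF s] by (simp add: SL.cover_single[OF V x] SL.presentsD(8)[OF P u])
    then show "u \<in> ?f ` carrier ?P" using SL.presentsD(6)[OF PF s] by (metis image_eqI)
  qed
  then have surj: "?f ` carrier ?P = carrier M" using mhomD(1)[OF f] by blast
  have "\<Phi> x = \<zero>\<^bsub>M\<^esub> \<longleftrightarrow> x = 0" if "x \<in> ?V" for x
    using SL.presentsD(9)[OF P that] SL.presentsD(9)[OF P fs.subspace_0[OF subspace_coord]] SL.presents_zero[OF P]
    by metis
  then have ker: "{u \<in> carrier ?P. ?f u = \<zero>\<^bsub>M\<^esub>} = j ` ?K"
    using fj ghomD(2)[OF gc] SL.presents_zero[OF P] by (auto simp: enc_def)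
  have L: "?P\<lparr>carrier := {u \<in> carrier ?P. ?f u = \<zero>\<^bsub>M\<^esub>}\<rparr> = enc SL ?K (free_act SL) j ?i"
    unfolding ker by (rule enc_restrict) blast
  have "syzygy KS M (enc SL ?K (free_act SL) j ?i)"
    unfolding syzygy_def L[symmetric]
    using SL.presentsD(1)[OF P] SL.projective_free[where i="?i" and j=j, OF R I ij] f surj by blast
  moreover have "presents SL (enc SL ?K (free_act SL) j ?i) ?K (free_act SL) j"
    by (rule SL.presents_enc[OF R SL.rep_kernel[OF rF V gc] ij]) simp
  then have "modelled (enc SL ?K (free_act SL) j ?i) (p - l) (w + 2 * (l - 1))"
  proof (rule modelledI)
    show "finite (kdelta ` (carrier SL \<times> I))" using fI by (rule finite_imageI)
    show "?K \<subseteq> fs.span (kdelta ` (carrier SL \<times> I))" using coord_span[OF fI] unfolding coord_Times by blast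
    show "steq BB ?K (free_act SL) (pol (p - l)) (pact (w + 2 * (l - 1)))" by (rule steq_syzygy[OF V st l])
  qed
  ultimately show ?thesis by blast
qed

text \<open>Scalars and group elements both lie in the group algebra, so a submodule of the encoded
  module is an invariant subspace of \<open>homog n\<close>, to which \<open>homog_simple\<close>
  applies.\<close>

lemma modelled_simple:
  fixes \<iota> :: "'k \<Rightarrow> 'u"
  assumes inf: "infinite (UNIV :: 'u set)" and \<iota>: "inj \<iota>" and R: "ring KS" and n: "n < p"
  shows "\<exists>S :: (int^2^2 \<Rightarrow> 'k, 'u) module. simple_module KS S \<and> modelled S (Suc n) ((p - 2) * n)"
proof -
  let ?B = "(\<lambda>i. mono (n - i) i) ` {..<Suc n}"
  have sp: "homog n \<subseteq> fs.span ?B" by (simp add: homog_def)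
  have fB: "finite ?B" by simp
  obtain I :: "nat set" and E :: "(nat \<Rightarrow> 'k) \<Rightarrow> int \<times> int \<Rightarrow> 'k" where I: "finite I" "bij_betw E (coord I) (homog n)"
    using finite_dim_coord[OF subspace_homog fB sp] by blast
  obtain e :: "(nat \<Rightarrow> 'k) \<Rightarrow> 'u" where e: "inj_on e (coord I)" using coord_inj_exists[OF inf \<iota> I(1)] by blast
  \<comment> \<open>\<open>homog n\<close> consists of functions on an infinite set, so it is
    encoded through finitely many coordinates.\<close>
  define j where "j = e \<circ> inv_into (coord I) E"
  have "inj_on j (homog n)"
    unfolding j_def using bij_betw_inv_into[OF I(2)] e by (intro comp_inj_on) (auto simp: bij_betw_def)
  then have ij: "inv_into (homog n) j (j F) = F" if "F \<in> homog n" for F using that by simp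
  let ?S = "enc SL (homog n) lact j (inv_into (homog n) j)"
  have P: "presents SL ?S (homog n) lact j" by (rule SL.presents_enc[OF R rep_homog ij])
  interpret S: left_module KS ?S by (rule SL.presentsD(1)[OF P])
  have jc: "j F \<in> carrier ?S" if "F \<in> homog n" for F by (rule SL.presentsD(6)[OF P that])
  have j0: "j 0 = \<zero>\<^bsub>?S\<^esub>" by (rule SL.presents_zero[OF P])
  have j0_iff: "j F = \<zero>\<^bsub>?S\<^esub> \<longleftrightarrow> F = 0" if "F \<in> homog n" for F
    using ij[OF that] ij[OF fs.subspace_0[OF subspace_homog]] j0 by metis
  have "simple_module KS ?S"
    unfolding simple_module_def
  proof (intro conjI allI impI S.left_module_axioms)
    have "mono 0 n (0, 1) = 1" by (simp add: mono_apply)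
    then have "mono 0 n \<noteq> 0" by (auto simp: fun_pw)
    then show "carrier ?S \<noteq> {\<zero>\<^bsub>?S\<^esub>}" using jc[OF mono0_homog] j0_iff[OF mono0_homog] by auto
    fix H assume H: "submodule H KS ?S"
    then interpret H: submodule H KS ?S .
    have Hc: "H \<subseteq> carrier ?S" using H.subset by simp
    let ?H = "{F \<in> homog n. j F \<in> H}"
    have HH: "H = j ` ?H" using Hc by (auto simp: enc_def)
    have sH: "fs.subspace ?H"
      unfolding fs.subspace_def
    proof (intro conjI ballI allI)
      show "0 \<in> ?H" using H.one_closed j0 fs.subspace_0[OF subspace_homog] by simp
      fix F F' assume F: "F \<in> ?H" "F' \<in> ?H"
      then show "F + F' \<in> ?H"
        using H.m_closed[of "j F" "j F'"] SL.presentsD(4)[OF P, of F F'] fs.subspace_add[OF subspace_homog] by simp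
    next
      fix c F assume F: "F \<in> ?H"
      then show "sc c F \<in> ?H"
        using H.smult_closed[OF SL.sc_carrier[OF SL.kdelta_carrier[OF SL.one_closed]], of "j F" c]
          SL.presents_scale[OF P, of F c] fs.subspace_scale[OF subspace_homog] by simp
    qed
    have lH: "lact A F \<in> ?H" if "A \<in> carrier SL" "F \<in> ?H" for A F
      using H.smult_closed[OF SL.kdelta_carrier[OF that(1)], of "j F"] SL.presents_group[OF P that(1), of F]
        repD(5)[OF rep_homog that(1), of F] that(2) by simp
    show "H = {\<zero>\<^bsub>?S\<^esub>} \<or> H = carrier ?S"
    proof (cases "?H = {0}")
      case True
      then show ?thesis using HH j0 by auto
    next
      case False
      then obtain F where "F \<in> ?H" "F \<noteq> 0" using fs.subspace_0[OF sH] by blast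
      then have "?H = homog n" using homog_simple[OF sH _ lH n] by blast
      then show ?thesis using HH by (simp add: enc_def)
    qed
  qed
  moreover have "modelled ?S (Suc n) ((p - 2) * n)" by (rule modelledI[OF P fB sp steq_homog[OF n]])
  ultimately show ?thesis by blast
qed

text \<open>Two syzygies restore the length and add
  \<open>2 * (l - 1) + 2 * (p - l - 1) = 2 * (p - 2)\<close> to the weight, which is -2 modulo
  \<open>p - 1\<close>.\<close>

lemma modelled_omega_even:
  fixes M :: "(int^2^2 \<Rightarrow> 'k, 'u) module" and \<iota> :: "'k \<Rightarrow> 'u"
  assumes inf: "infinite (UNIV :: 'u set)" and \<iota>: "inj \<iota>" and l: "1 \<le> l" "l < p" and M: "modelled M l w"
  shows "\<exists>X. Omega_nat KS (2 * n) M X \<and> modelled X l (w + n * (2 * (p - 2)))"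
  using M
proof (induction n arbitrary: M w)
  case 0
  then have "left_module KS M" unfolding modelled_def using SL.presentsD(1) by blast
  then show ?case using 0 stably_isomorphic_refl by auto
next
  case (Suc n)
  obtain L where L: "syzygy KS M L" "modelled L (p - l) (w + 2 * (l - 1))"
    using modelled_syzygy[OF inf \<iota> Suc.prems l] by blast
  have l': "1 \<le> p - l" "p - l < p" using l by auto
  obtain L' where L': "syzygy KS L L'" "modelled L' (p - (p - l)) (w + 2 * (l - 1) + 2 * (p - l - 1))"
    using modelled_syzygy[OF inf \<iota> L(2) l'] by blast
  have e: "w + 2 * (l - 1) + 2 * (p - l - 1) = w + 2 * (p - 2)" "p - (p - l) = l" using l by auto
  then have "modelled L' l (w + 2 * (p - 2))" using L'(2) by (simp only: e)
  from Suc.IH[OF this] obtain X where X: "Omega_nat KS (2 * n) L' X"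
    "modelled X l (w + 2 * (p - 2) + n * (2 * (p - 2)))" by blast
  have "Omega_nat KS (2 * Suc n) M X" using L(1) L'(1) X(1) by auto
  moreover have "modelled X l (w + Suc n * (2 * (p - 2)))" using X(2) by (simp only: mult_Suc add.assoc)
  ultimately show ?case by blast
qed

text \<open>Modulo \<open>p - 1\<close> the factor \<open>p - 2\<close> is -1. The assumption thus
  says \<open>2 * n = v - w\<close> and the conclusion \<open>v - 2 * n = w\<close>, both without
  subtraction of natural numbers.\<close>

lemma weight_shift:
  assumes "2 * n = v + w * (p - 2)"
  shows "[v + n * (2 * (p - 2)) = w] (mod (p - 1))"
proof -
  define q where "q = p - 2"
  have p: "p - 2 = q" "p - 1 = q + 1" using p_ge_2 by (auto simp: q_def)
  have "v + n * (2 * q) = v + (2 * n) * q" by simp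
  also have "\<dots> = v * (q + 1) + w * (q * q)" using assms by (simp add: p algebra_simps)
  finally have e: "v + n * (2 * q) + w * q = v * (q + 1) + w * q * (q + 1)" by (simp add: algebra_simps)
  have "[v * (q + 1) + w * q * (q + 1) = 0] (mod (q + 1))"
    by (intro cong_0_iff[THEN iffD2] dvd_add dvd_triv_right)
  moreover have "[w + w * q = 0] (mod (q + 1))"
    by (intro cong_0_iff[THEN iffD2] dvdI[of _ _ w]) simp
  ultimately have "[v + n * (2 * q) + w * q = w + w * q] (mod (q + 1))"
    unfolding e using cong_trans cong_sym by blast
  then show ?thesis unfolding p by (simp only: cong_add_rcancel_nat)
qed

text \<open>Every weight is reached by \<open>\<Omega>\<^sup>2\<close>, which lowers weights by 2, from \<open>homog (l - 1)\<close> or from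
  the first syzygy of \<open>homog (p - l - 1)\<close>, whose weights have opposite parities for odd \<open>p\<close>.\<close>

lemma suspension_exists:
  fixes \<iota> :: "'k \<Rightarrow> 'u"
  assumes inf: "infinite (UNIV :: 'u set)" and \<iota>: "inj \<iota>" and R: "ring KS" and l: "1 \<le> l" "l < p"
  shows "\<exists>(S :: (int^2^2 \<Rightarrow> 'k, 'u) module) d X. simple_module KS S \<and> Omega KS d S X \<and> modelled X l w"
\<comment> \<open>The weight of \<open>homog (l - 1)\<close> minus \<open>w\<close>, with
  \<open>p - 2\<close> in place of -1. For \<open>p = 2\<close> the expression is zero, so the
  second case concerns odd \<open>p\<close>.\<close>
proof (cases "even ((p - 2) * (l - 1) + w * (p - 2))")
  case True
  then obtain n where n: "2 * n = (p - 2) * (l - 1) + w * (p - 2)" by (metis evenE)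
  have "l - 1 < p" "Suc (l - 1) = l" using l by auto
  then obtain S :: "(int^2^2 \<Rightarrow> 'k, 'u) module" where S: "simple_module KS S" "modelled S l ((p - 2) * (l - 1))"
    using modelled_simple[OF inf \<iota> R, of "l - 1"] by auto
  obtain X where X: "Omega_nat KS (2 * n) S X" "modelled X l ((p - 2) * (l - 1) + n * (2 * (p - 2)))"
    using modelled_omega_even[OF inf \<iota> l S(2)] by blast
  have "Omega KS (int (2 * n)) S X" using X(1) by (simp only: Omega_def nat_int) simp
  moreover have "modelled X l w" by (rule modelled_cong[OF X(2) weight_shift[OF n]])
  ultimately show ?thesis using S(1) by blast
next
  case False
  \<comment> \<open>The weight of the first syzygy of \<open>homog (p - l - 1)\<close>: its own
    weight plus the shift \<open>2 * (p - l - 1)\<close>.\<close>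
  let ?v = "(p - 2) * (p - l - 1) + 2 * (p - l - 1)"
  have l': "1 \<le> p - l" "p - l < p" "p - l - 1 < p" "Suc (p - l - 1) = p - l" "p - (p - l) = l" using l by auto
  have "odd (p - 2)" using False by auto
  \<comment> \<open>An odd sum, so \<open>l - 1\<close> and \<open>p - l - 1\<close> have opposite
    parity and the second starting weight has the parity that the first one misses.\<close>
  moreover have "(l - 1) + (p - l - 1) = p - 2" using l by simp
  ultimately have "even (?v + w * (p - 2))" using False by (metis even_add even_mult_iff even_numeral)
  then obtain n where n: "2 * n = ?v + w * (p - 2)" by (metis evenE)
  obtain S :: "(int^2^2 \<Rightarrow> 'k, 'u) module" where S: "simple_module KS S" "modelled S (p - l) ((p - 2) * (p - l - 1))"
    using modelled_simple[OF inf \<iota> R l'(3)] l'(4) by auto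
  obtain L where L: "syzygy KS S L" "modelled L l ?v"
    using modelled_syzygy[OF inf \<iota> S(2) l'(1,2)] l'(5) by auto
  obtain X where X: "Omega_nat KS (2 * n) L X" "modelled X l (?v + n * (2 * (p - 2)))"
    using modelled_omega_even[OF inf \<iota> l L(2)] by blast
  have "Omega_nat KS (Suc (2 * n)) S X" using L(1) X(1) by auto
  then have "Omega KS (int (Suc (2 * n))) S X" by (simp only: Omega_def nat_int) simp
  moreover have "modelled X l w" by (rule modelled_cong[OF X(2) weight_shift[OF n]])
  ultimately show ?thesis using S(1) by blast
qed

lemma stmod_sum:
  fixes M :: "(int^2^2 \<Rightarrow> 'k, 'u) module" and \<iota> :: "'k \<Rightarrow> 'u"
  assumes inf: "infinite (UNIV :: 'u set)" and \<iota>: "inj \<iota>" and M: "in_stmod KS M"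
  shows "sum_of_suspensions_of_simples KS M"
proof -
  obtain M' :: "(int^2^2 \<Rightarrow> 'k, 'u) module" where M': "finitely_generated KS M'" "stably_isomorphic KS M M'"
    using M unfolding in_stmod_def by blast
  obtain I :: "((int^2^2) \<times> 'u) set" and \<rho> \<Phi> where I: "finite I" and P: "presents SL M' (coord I) \<rho> \<Phi>"
    using SL.finitely_generated_presents[OF M'(1)] by blast
  note V = SL.presentsD(2)[OF P]
  note VB = B.rep_restrict[OF V]
  have R: "ring KS" by (rule left_module.axioms(1)[OF SL.presentsD(1)[OF P]])
  obtain N l w \<alpha> \<beta> where dec: "borel_decomp (coord I) \<rho> N l w \<alpha> \<beta>"
    using borel_decomposition[OF VB finite_imageI[OF I] coord_span[OF I]] by blast
  \<comment> \<open>All data belonging to one summand are bundled so that they can be chosen for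
    every summand at once; beyond \<open>N\<close> the condition is void, which makes the choice
    functions total.\<close>
  let ?Q = "\<lambda>n (S :: (int^2^2 \<Rightarrow> 'k, 'u) module) d X J \<tau> \<Theta>. n < N \<longrightarrow> simple_module KS S \<and> Omega KS d S X \<and>
    finite (J :: nat set) \<and> presents SL X (coord J) \<tau> \<Theta> \<and> steq BB (coord J) \<tau> (pol (l n)) (pact (w n))"
  have "\<exists>S d X J \<tau> \<Theta>. ?Q n S d X J \<tau> \<Theta>" for n
  proof (cases "n < N")
    case True
    then have "1 \<le> l n" "l n < p" using dec by (auto simp: borel_decomp_def)
    then show ?thesis using suspension_exists[OF inf \<iota> R, of "l n" "w n"] unfolding modelled_def by blast
  qed simp
  then have "\<forall>n. \<exists>S d X J \<tau> \<Theta>. ?Q n S d X J \<tau> \<Theta>" by blast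
  then obtain S where "\<forall>n. \<exists>d X J \<tau> \<Theta>. ?Q n (S n) d X J \<tau> \<Theta>" by (rule exE[OF choice])
  then obtain d where "\<forall>n. \<exists>X J \<tau> \<Theta>. ?Q n (S n) (d n) X J \<tau> \<Theta>" by (rule exE[OF choice])
  then obtain X where "\<forall>n. \<exists>J \<tau> \<Theta>. ?Q n (S n) (d n) (X n) J \<tau> \<Theta>" by (rule exE[OF choice])
  then obtain J where "\<forall>n. \<exists>\<tau> \<Theta>. ?Q n (S n) (d n) (X n) (J n) \<tau> \<Theta>" by (rule exE[OF choice])
  then obtain \<tau> where "\<forall>n. \<exists>\<Theta>. ?Q n (S n) (d n) (X n) (J n) (\<tau> n) \<Theta>" by (rule exE[OF choice])
  then obtain \<Theta> where "\<forall>n. ?Q n (S n) (d n) (X n) (J n) (\<tau> n) (\<Theta> n)" by (rule exE[OF choice])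
  then have X: "simple_module KS (S n)" "Omega KS (d n) (S n) (X n)" "finite (J n)"
      "presents SL (X n) (coord (J n)) (\<tau> n) (\<Theta> n)" "steq BB (coord (J n)) (\<tau> n) (pol (l n)) (pact (w n))"
    if "n < N" for n using that by simp_all
  let ?U = "dsum N (\<lambda>n. coord (J n)) :: (nat \<times> nat \<Rightarrow> 'k) set"
  have rU: "rep SL ?U (dact N \<tau>)" by (rule rep_dsum[OF SL.presentsD(2)[OF X(4)] SL.is_group])
  \<comment> \<open>\<open>borel_decomp\<close> provides the orthogonality and the null complement
    that \<open>steq_dsum\<close> asks for, with \<open>pol (l n)\<close> as the summands to be
    replaced by the suspensions.\<close>
  have "steq BB (coord I) \<rho> ?U (dact N \<tau>)"
    using dec unfolding borel_decomp_def
    by (intro B.GH.steq_dsum[OF VB B.rep_restrict[OF SL.presentsD(2)[OF X(4)]] rep_pol X(5)]) auto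
  then have st: "steq SL (coord I) \<rho> ?U (dact N \<tau>)" by (rule steq_SL_of_borel[OF V rU])
  have fJ: "finite (SIGMA n:{..<N}. J n)" using X(3) by (intro finite_SigmaI) auto
  obtain j :: "(nat \<times> nat \<Rightarrow> 'k) \<Rightarrow> 'u" where j: "inj_on j ?U"
    using coord_inj_exists[OF inf \<iota> fJ] unfolding coord_Sigma by blast
  have ij: "inv_into ?U j (j F) = F" if "F \<in> ?U" for F using j that by simp
  let ?D = "enc SL ?U (dact N \<tau>) j (inv_into ?U j)"
  have D: "presents SL ?D ?U (dact N \<tau>) j" by (rule SL.presents_enc[OF R rU ij])
  have "stably_isomorphic KS M' ?D"
    using SL.stably_isomorphic_of_steq[OF inf \<iota> I fJ P] D st unfolding coord_Sigma by blast
  then have "stably_isomorphic KS M ?D" by (rule stably_isomorphic_trans[OF inf M'(2)])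
  moreover have "direct_sum KS {..<N} X ?D" by (rule SL.direct_sum_enc[OF R X(4) ij])
  ultimately show ?thesis
    unfolding sum_of_suspensions_of_simples_def using X(1,2) by blast
qed

end

theorem theorem5p9:
  fixes p :: nat and \<iota> :: "'k :: field \<Rightarrow> 'u"
  assumes "prime p" and "CHAR('k) = p"
    and "infinite (UNIV :: 'u set)" and "inj \<iota>"
  shows "(\<forall>M :: ((int^2^2) \<Rightarrow> 'k, 'u) module.
            in_stmod (group_algebra (SL2 p)) M \<longrightarrow>
            sum_of_suspensions_of_simples (group_algebra (SL2 p)) M) \<and>
         simple_generating_hypothesis
           (group_algebra (SL2 p) :: ((int^2^2) \<Rightarrow> 'k) ring) TYPE('u)"
proof -
  interpret char_p p "TYPE('k)" by (rule char_p.intro) (use assms in auto)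
  have "sum_of_suspensions_of_simples KS M" if "in_stmod KS M" for M :: "((int^2^2) \<Rightarrow> 'k, 'u) module"
    by (rule stmod_sum[OF assms(3,4) that])
  then show ?thesis using simple_generating_hypothesis_if_sums[OF assms(3)] by blast
qed

end
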